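(* Let $R=\mathbb Z_{(2)}$. Let $\Psi$ be the quiver with three vertices $\tilde{\mathrm e}_3,\tilde{\mathrm e}_4,\tilde{\mathrm e}_5$ and five arrows $$\tilde\tau_1:\tilde{\mathrm e}_5\to\tilde{\mathrm e}_3,\quad\tilde\tau_2:\tilde{\mathrm e}_3\to\tilde{\mathrm e}_5,\quad\tilde\tau_3:\tilde{\mathrm e}_5\to\tilde{\mathrm e}_4,\quad\tilde\tau_4:\tilde{\mathrm e}_4\to\tilde{\mathrm e}_5,\quad\tilde\tau_7:\tilde{\mathrm e}_5\to\tilde{\mathrm e}_5,$$ and let $I$ be the ideal of the path algebra $R\Psi$ generated by $$\tilde\tau_2\tilde\tau_1,\ \tilde\tau_2\tilde\tau_3,\ \tilde\tau_2\tilde\tau_7-2\tilde\tau_2,\ \tilde\tau_4\tilde\tau_1,\ \tilde\tau_4\tilde\tau_3,\ \tilde\tau_4\tilde\tau_7-2\tilde\tau_4,\ \tilde\tau_7\tilde\tau_1-2\tilde\tau_1,\ \tilde\tau_7\tilde\tau_3-2\tilde\tau_3,\ \tilde\tau_7^2-2\tilde\tau_7-\tilde\tau_1\tilde\tau_2.$$ There is an isomorphism of $\mathbb Z_{(2)}$-algebras $\Lambda'_{(2)}\to R\Psi/I$ with $\mathrm e_i\mapsto\tilde{\mathrm e}_i+I$ for $i\in\{3,4,5\}$ and $\tau_j\mapsto\tilde\tau_j+I$ for $j\in\{1,2,3,4,7\}$. Moreover, $\mathrm{B}_{\mathbb Z_{(2)}}(S_3,S_3)$ is Morita equivalent to $\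Lambda'_{(2)}$.
   Context: **Double Burnside algebra.** For a finite group $G$ and a commutative ring $R$, $\mathrm{B}_R(G,G)$ is the $R$-module generated by the isomorphism classes $[M]$ of finite $(G,G)$-bisets (finite sets with commuting left and right $G$-actions) modulo $[M\sqcup N]=[M]+[N]$, with multiplication induced by $[M]\cdot[N]=[M\times_G N]$, where $M\times_G N$ is the set of $G$-orbits on $M\times N$ under $g(m,n)=(mg^{-1},gn)$, with biset structure induced by $h(m,n)p=(hm,np)$. **The algebra $A$.** Let $\mathbb Q[\bar\eta,\bar\xi]=\mathbb Q[\eta,\xi]/(\eta^2,\eta\xi,\xi^2)$, with $\mathbb Q$-basis $1,\bar\eta,\bar\xi$. $A$ consists of arrays $[a_{i,j}]_{i,j\in\{1,2,3,4\}}$ with $a_{i,j}\in A_{i,j}$, where $A_{1,1}=\mathbb Q^{3\times3}$, $A_{1,4}=\mathbb Q^{3\times1}$, $A_{4,1}=\mathbb Q^{1\times3}$, $A_{2,2}=A_{2,4}=A_{3,3}=A_{4,2}=\mathbb Q$, $A_{4,4}=\mathbb Q[\bar\eta,\bar\xi]$, and all other $A_{i,j}=0$. Addition is entrywise; the product of $[a_{i,j}]$ and $[a'_{i,j}]$ has $(i,j)$ entry $\sum_r\alpha_{i,r,j}(a_{i,r},a'_{r,j})$, where the bilinear maps $\alpha_{i,j,k}:A_{i,j}\times A_{j,k}\to A_{i,k}$ are: zero whenever one of $A_{i,j},A_{j,k},A_{i,k}$ is zero; $\alpha_{1,4,1}=0$, $\alpha_{2,4,2}=0$; $\alpha_{4,1,4}(x,y)=(xy)\bar\eta$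 (row times column); $\alpha_{4,2,4}(x,y)=xy(\bar\xi-12\bar\eta)$; $\alpha_{4,4,4}$ is multiplication in $\mathbb Q[\bar\eta,\bar\xi]$; in $\alpha_{1,4,4},\alpha_{2,4,4},\alpha_{4,4,1},\alpha_{4,4,2}$ an element $a+b\bar\eta+c\bar\xi\in A_{4,4}$ acts as multiplication by its constant term $a$; and $\alpha_{1,1,1},\alpha_{1,1,4},\alpha_{4,1,1},\alpha_{2,2,2},\alpha_{2,2,4},\alpha_{4,2,2},\alpha_{3,3,3}$ are the usual (matrix) products. Elements of $A$ are written as $6\times6$ arrays with block sizes $3,1,1,1$. **The order $\Lambda_{(2)}$.** With $R=\mathbb Z_{(2)}$, $\Lambda_{(2)}$ is the $R$-subalgebra of $A$ consisting of all $$\begin{bmatrix} s_{1,1}&s_{1,2}&s_{1,3}&0&0&t_1\\ s_{2,1}&s_{2,2}&s_{2,3}&0&0&t_2\\ s_{3,1}&s_{3,2}&s_{3,3}&0&0&t_3\\ 0&0&0&u&0&v\\ 0&0&0&0&w&0\\ x_1&x_2&x_3&y&0&z_1+z_2\bar\eta+z_3\bar\xi\end{bmatrix}$$ with $s_{i,j},t_i,u,v,w,x_i,y,z_i\in R$ satisfying $2w-2z_1\equiv z_2\pmod 8$, $z_2\equiv z_3\pmod4$, $z_3\equiv0\pmod 4$; $x_1\equiv x_2\equiv x_3\equiv0\pmod 4$; $y\equiv t_1\equiv t_2\equiv t_3\equiv v\equiv0\pmod2$. **Elements.** For $6\times6$ array positions: $\mathrm e_3$ has entry $1$ at $(3,3)$;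 $\mathrm e_4$ has entry $1$ at $(4,4)$; $\mathrm e_5$ has entries $1$ at $(5,5)$ and at $(6,6)$; $\tau_1$ has entry $4$ at $(6,3)$; $\tau_2$ has entry $2$ at $(3,6)$; $\tau_3$ has entry $2$ at $(6,4)$; $\tau_4$ has entry $2$ at $(4,6)$; $\tau_7$ has entry $2+4\bar\eta$ at $(6,6)$; all other entries are zero. Put $\Lambda'_{(2)}=(\mathrm e_3+\mathrm e_4+\mathrm e_5)\Lambda_{(2)}(\mathrm e_3+\mathrm e_4+\mathrm e_5)$. **Path algebra convention.** Paths are composed from left to right: $\alpha\beta$ means first the arrow $\alpha$, then $\beta$; an arrow $\alpha:x\to y$ satisfies $x\alpha y=\alpha$, where the vertices also denote the corresponding idempotents (trivial paths). Ideals are two-sided. *)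

theory Defs
  imports
    "HOL-Analysis.Finite_Cartesian_Product"
    "HOL-Library.Infinite_Typeclass"
    "Graph_Theory.Arc_Walk"
    "HOL-Algebra.Algebra"
begin

section \<open>Associative algebras over a commutative ring\<close>

text \<open>The library locale \<^locale>\<open>algebra\<close> requires a commutative multiplication, so the
  noncommutative notion is introduced here, on the same record type.\<close>

locale assoc_algebra = Module.module R A + ring A
  for R :: "('r, 'c) ring_scheme" (structure) and A :: "('r, 'a, 'd) module_scheme" (structure) +
  assumes smult_mult_left:
      "\<lbrakk>r \<in> carrier R; x \<in> carrier A; y \<in> carrier A\<rbrakk>
        \<Longrightarrow> (r \<odot>\<^bsub>A\<^esub> x) \<otimes>\<^bsub>A\<^esub> y = r \<odot>\<^bsub>A\<^esub> (x \<otimes>\<^bsub>A\<^esub> y)"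
    and smult_mult_right:
      "\<lbrakk>r \<in> carrier R; x \<in> carrier A; y \<in> carrier A\<rbrakk>
        \<Longrightarrow> x \<otimes>\<^bsub>A\<^esub> (r \<odot>\<^bsub>A\<^esub> y) = r \<odot>\<^bsub>A\<^esub> (x \<otimes>\<^bsub>A\<^esub> y)"

definition algebra_iso ::
  "('r, 'c) ring_scheme \<Rightarrow> ('r, 'a, 'd) module_scheme \<Rightarrow> ('r, 'b, 'e) module_scheme \<Rightarrow> ('a \<Rightarrow> 'b) \<Rightarrow> bool"
where
  "algebra_iso R A B h \<longleftrightarrow>
     assoc_algebra R A \<and> assoc_algebra R B \<and> h \<in> ring_iso A B \<and>
     (\<forall>r\<in>carrier R. \<forall>x\<in>carrier A. h (r \<odot>\<^bsub>A\<^esub> x) = r \<odot>\<^bsub>B\<^esub> h x)"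

text \<open>The quotient ring \<^term>\<open>A Quot I\<close> together with the induced scalar multiplication.\<close>

definition quot_algebra :: "('r, 'a, 'd) module_scheme \<Rightarrow> 'a set \<Rightarrow> ('r, 'a set) module" where
  "quot_algebra A I =
     \<lparr>carrier = carrier (A Quot I), monoid.mult = monoid.mult (A Quot I), one = one (A Quot I),
      ring.zero = ring.zero (A Quot I), ring.add = ring.add (A Quot I),
      smult = (\<lambda>r C. \<Union>x\<in>C. I +>\<^bsub>A\<^esub> (r \<odot>\<^bsub>A\<^esub> x))\<rparr>"

text \<open>The free \<open>R\<close>-module on the set \<open>B\<close> (functions of finite support contained in \<open>B\<close>), with the
  bilinear multiplication for which the product of the basis elements \<open>x\<close>, \<open>y\<close> is the basis element
  \<open>z\<close> if \<open>m x y = Some z\<close>, and zero if \<open>m x y = None\<close>. The unit is the sum of the basis elements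
  in \<open>E\<close>.\<close>

definition basis_algebra ::
  "('r, 'c) ring_scheme \<Rightarrow> 'b set \<Rightarrow> ('b \<Rightarrow> 'b \<Rightarrow> 'b option) \<Rightarrow> 'b set \<Rightarrow> ('r, 'b \<Rightarrow> 'r) module"
where
  "basis_algebra R B m E =
     \<lparr>carrier = {f. (\<forall>b. f b \<in> carrier R) \<and> finite {b. f b \<noteq> \<zero>\<^bsub>R\<^esub>} \<and> {b. f b \<noteq> \<zero>\<^bsub>R\<^esub>} \<subseteq> B},
      monoid.mult = (\<lambda>f g b.
        \<Oplus>\<^bsub>R\<^esub>p \<in> {(x, y). f x \<noteq> \<zero>\<^bsub>R\<^esub> \<and> g y \<noteq> \<zero>\<^bsub>R\<^esub> \<and> m x y = Some b}.
          f (fst p) \<otimes>\<^bsub>R\<^esub> g (snd p)),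
      one = (\<lambda>b. if b \<in> E then \<one>\<^bsub>R\<^esub> else \<zero>\<^bsub>R\<^esub>),
      ring.zero = (\<lambda>b. \<zero>\<^bsub>R\<^esub>),
      ring.add = (\<lambda>f g b. f b \<oplus>\<^bsub>R\<^esub> g b),
      smult = (\<lambda>r f b. r \<otimes>\<^bsub>R\<^esub> f b)\<rparr>"

definition basis_elt :: "('r, 'c) ring_scheme \<Rightarrow> 'b \<Rightarrow> 'b \<Rightarrow> 'r" where
  "basis_elt R x = (\<lambda>b. if b = x then \<one>\<^bsub>R\<^esub> else \<zero>\<^bsub>R\<^esub>)"


section \<open>Morita equivalence\<close>

text \<open>Left modules over a not necessarily commutative ring. As for the library locale
  \<^locale>\<open>Module.module\<close>, the multiplicative fields of the record \<open>M\<close> are irrelevant.\<close>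

locale left_module = A?: ring A + M?: abelian_group M
  for A :: "('a, 'c) ring_scheme" (structure) and M :: "('a, 'm, 'd) module_scheme" (structure) +
  assumes act_closed: "\<lbrakk>a \<in> carrier A; x \<in> carrier M\<rbrakk> \<Longrightarrow> a \<odot>\<^bsub>M\<^esub> x \<in> carrier M"
    and act_add_left: "\<lbrakk>a \<in> carrier A; b \<in> carrier A; x \<in> carrier M\<rbrakk>
        \<Longrightarrow> (a \<oplus>\<^bsub>A\<^esub> b) \<odot>\<^bsub>M\<^esub> x = a \<odot>\<^bsub>M\<^esub> x \<oplus>\<^bsub>M\<^esub> b \<odot>\<^bsub>M\<^esub> x"
    and act_add_right: "\<lbrakk>a \<in> carrier A; x \<in> carrier M; y \<in> carrier M\<rbrakk>
        \<Longrightarrow> a \<odot>\<^bsub>M\<^esub> (x \<oplus>\<^bsub>M\<^esub> y) = a \<odot>\<^bsub>M\<^esub> x \<oplus>\<^bsub>M\<^esub> a \<odot>\<^bsub>M\<^esub> y"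
    and act_mult: "\<lbrakk>a \<in> carrier A; b \<in> carrier A; x \<in> carrier M\<rbrakk>
        \<Longrightarrow> (a \<otimes>\<^bsub>A\<^esub> b) \<odot>\<^bsub>M\<^esub> x = a \<odot>\<^bsub>M\<^esub> (b \<odot>\<^bsub>M\<^esub> x)"
    and act_one: "x \<in> carrier M \<Longrightarrow> \<one>\<^bsub>A\<^esub> \<odot>\<^bsub>M\<^esub> x = x"

text \<open>Homomorphisms are extensional functions, so that equality in the hom-sets is equality on the
  carrier.\<close>

definition module_hom ::
  "('a, 'c) ring_scheme \<Rightarrow> ('a, 'm) module \<Rightarrow> ('a, 'n) module \<Rightarrow> ('m \<Rightarrow> 'n) set"
where
  "module_hom A M N =
     {f \<in> carrier M \<rightarrow>\<^sub>E carrier N.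
        (\<forall>x\<in>carrier M. \<forall>y\<in>carrier M. f (x \<oplus>\<^bsub>M\<^esub> y) = f x \<oplus>\<^bsub>N\<^esub> f y) \<and>
        (\<forall>a\<in>carrier A. \<forall>x\<in>carrier M. f (a \<odot>\<^bsub>M\<^esub> x) = a \<odot>\<^bsub>N\<^esub> f x)}"

text \<open>The linear combination \<open>r f + g\<close> of two homomorphisms into \<open>N\<close>, where \<open>r\<close> acts on \<open>N\<close>
  through its image \<open>r 1\<close> in the \<open>R\<close>-algebra \<open>A\<close>.\<close>

definition hom_axpy ::
  "('r, 'a, 'c) module_scheme \<Rightarrow> ('a, 'm) module \<Rightarrow> ('a, 'n) module \<Rightarrow> 'r \<Rightarrow> ('m \<Rightarrow> 'n) \<Rightarrow> ('m \<Rightarrow> 'n) \<Rightarrow> 'm \<Rightarrow> 'n"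
where
  "hom_axpy A M N r f g = (\<lambda>x\<in>carrier M. ((r \<odot>\<^bsub>A\<^esub> \<one>\<^bsub>A\<^esub>) \<odot>\<^bsub>N\<^esub> f x) \<oplus>\<^bsub>N\<^esub> g x)"

text \<open>\<open>R\<close>-linear functors from the category of left \<open>A\<close>-modules to the category of left \<open>B\<close>-modules,
  given by an object map and by maps on the hom-sets, which are indexed by source and target.
  The type variables \<open>'u\<close> and \<open>'v\<close> are the universes: the objects are the modules whose carriers are
  subsets of these types.\<close>

locale linear_functor =
  fixes R :: "('r, 'c) ring_scheme"
    and A :: "('r, 'a, 'd) module_scheme"
    and B :: "('r, 'b, 'e) module_scheme"
    and Fo :: "('a, 'u) module \<Rightarrow> ('b, 'v) module"
    and Fm :: "('a, 'u) module \<Rightarrow> ('a, 'u) module \<Rightarrow> ('u \<Rightarrow> 'u) \<Rightarrow> 'v \<Rightarrow> 'v"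
  assumes obj: "left_module A M \<Longrightarrow> left_module B (Fo M)"
    and hom: "\<lbrakk>left_module A M; left_module A N; f \<in> module_hom A M N\<rbrakk>
        \<Longrightarrow> Fm M N f \<in> module_hom B (Fo M) (Fo N)"
    and ident: "left_module A M \<Longrightarrow> Fm M M (\<lambda>x\<in>carrier M. x) = (\<lambda>x\<in>carrier (Fo M). x)"
    and comp: "\<lbrakk>left_module A M; left_module A N; left_module A P;
          f \<in> module_hom A M N; g \<in> module_hom A N P\<rbrakk>
        \<Longrightarrow> Fm M P (compose (carrier M) g f) = compose (carrier (Fo M)) (Fm N P g) (Fm M N f)"
    and linear: "\<lbrakk>left_module A M; left_module A N; f \<in> module_hom A M N; g \<in> module_hom A M N;
          r \<in> carrier R\<rbrakk>
        \<Longrightarrow> Fm M N (hom_axpy A M N r f g) = hom_axpy B (Fo M) (Fo N) r (Fm M N f) (Fm M N g)"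

text \<open>A natural isomorphism from the identity functor to the endofunctor \<open>(To, Tm)\<close>.\<close>

definition natural_iso_id ::
  "('r, 'a, 'c) module_scheme \<Rightarrow> (('a, 'u) module \<Rightarrow> ('a, 'u) module)
    \<Rightarrow> (('a, 'u) module \<Rightarrow> ('a, 'u) module \<Rightarrow> ('u \<Rightarrow> 'u) \<Rightarrow> 'u \<Rightarrow> 'u)
    \<Rightarrow> (('a, 'u) module \<Rightarrow> 'u \<Rightarrow> 'u) \<Rightarrow> bool"
where
  "natural_iso_id A To Tm \<eta> \<longleftrightarrow>
     (\<forall>M. left_module A M \<longrightarrow>
        \<eta> M \<in> module_hom A M (To M) \<and> bij_betw (\<eta> M) (carrier M) (carrier (To M))) \<and>
     (\<forall>M N f. left_module A M \<and> left_module A N \<and> f \<in> module_hom A M N \<longrightarrow>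
        compose (carrier M) (\<eta> N) f = compose (carrier M) (Tm M N f) (\<eta> M))"

text \<open>Morita equivalence of two \<open>R\<close>-algebras: the categories of left modules are equivalent, by
  \<open>R\<close>-linear functors \<open>F\<close> and \<open>G\<close>. HOL has no category of all modules, so the notion is relative to
  a universe \<open>'u\<close>; it is meant to be used with a type variable \<open>'u\<close> ranging over all infinite
  types.\<close>

definition morita_equivalent ::
  "'u::infinite itself \<Rightarrow> ('r, 'c) ring_scheme \<Rightarrow> ('r, 'a, 'd) module_scheme \<Rightarrow> ('r, 'b, 'e) module_scheme \<Rightarrow> bool"
where
  "morita_equivalent (_ :: 'u itself) R A B \<longleftrightarrow>
     assoc_algebra R A \<and> assoc_algebra R B \<and>
     (\<exists>(Fo :: ('a, 'u) module \<Rightarrow> ('b, 'u) module) Fm (Go :: ('b, 'u) module \<Rightarrow> ('a, 'u) module) Gm \<eta> \<epsilon>.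
        linear_functor R A B Fo Fm \<and> linear_functor R B A Go Gm \<and>
        natural_iso_id A (\<lambda>M. Go (Fo M)) (\<lambda>M N f. Gm (Fo M) (Fo N) (Fm M N f)) \<eta> \<and>
        natural_iso_id B (\<lambda>M. Fo (Go M)) (\<lambda>M N f. Fm (Go M) (Go N) (Gm M N f)) \<epsilon>)"


section \<open>The double Burnside algebra\<close>

record ('g, 'm) biset =
  pts :: "'m set"
  lact :: "'g \<Rightarrow> 'm \<Rightarrow> 'm"
  ract :: "'m \<Rightarrow> 'g \<Rightarrow> 'm"

locale finite_biset = group G
  for G :: "('g, 'c) monoid_scheme" (structure) and M :: "('g, 'm) biset" +
  assumes finite_pts: "finite (pts M)"
    and lact_closed: "\<lbrakk>g \<in> carrier G; x \<in> pts M\<rbrakk> \<Longrightarrow> lact M g x \<in> pts M"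
    and lact_one: "x \<in> pts M \<Longrightarrow> lact M \<one> x = x"
    and lact_mult: "\<lbrakk>g \<in> carrier G; h \<in> carrier G; x \<in> pts M\<rbrakk>
        \<Longrightarrow> lact M (g \<otimes> h) x = lact M g (lact M h x)"
    and ract_closed: "\<lbrakk>g \<in> carrier G; x \<in> pts M\<rbrakk> \<Longrightarrow> ract M x g \<in> pts M"
    and ract_one: "x \<in> pts M \<Longrightarrow> ract M x \<one> = x"
    and ract_mult: "\<lbrakk>g \<in> carrier G; h \<in> carrier G; x \<in> pts M\<rbrakk>
        \<Longrightarrow> ract M x (g \<otimes> h) = ract M (ract M x g) h"
    and actions_commute: "\<lbrakk>g \<in> carrier G; h \<in> carrier G; x \<in> pts M\<rbrakk>
        \<Longrightarrow> ract M (lact M g x) h = lact M g (ract M x h)"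

definition biset_isomorphic ::
  "('g, 'c) monoid_scheme \<Rightarrow> ('g, 'm) biset \<Rightarrow> ('g, 'n) biset \<Rightarrow> bool"
where
  "biset_isomorphic G M N \<longleftrightarrow>
     (\<exists>f. bij_betw f (pts M) (pts N) \<and>
        (\<forall>g\<in>carrier G. \<forall>x\<in>pts M. f (lact M g x) = lact N g (f x) \<and> f (ract M x g) = ract N (f x) g))"

text \<open>Every finite biset is isomorphic to one whose points are natural numbers; so the isomorphism
  class \<open>[M]\<close> of a finite biset \<open>M\<close> with points of an arbitrary type is represented by the set of the
  bisets on natural numbers that are isomorphic to \<open>M\<close>.\<close>

definition biset_class :: "('g, 'c) monoid_scheme \<Rightarrow> ('g, 'm) biset \<Rightarrow> ('g, nat) biset set" where
  "biset_class G M = {N. finite_biset G N \<and> biset_isomorphic G M N}"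

definition biset_classes :: "('g, 'c) monoid_scheme \<Rightarrow> ('g, nat) biset set set" where
  "biset_classes G = {biset_class G M | M :: ('g, nat) biset. finite_biset G M}"

definition regular_biset :: "('g, 'c) monoid_scheme \<Rightarrow> ('g, 'g) biset" where
  "regular_biset G = \<lparr>pts = carrier G, lact = monoid.mult G, ract = monoid.mult G\<rparr>"

definition disjoint_union :: "('g, 'm) biset \<Rightarrow> ('g, 'n) biset \<Rightarrow> ('g, 'm + 'n) biset" where
  "disjoint_union M N =
     \<lparr>pts = pts M <+> pts N,
      lact = (\<lambda>g. map_sum (lact M g) (lact N g)),
      ract = (\<lambda>x g. map_sum (\<lambda>m. ract M m g) (\<lambda>n. ract N n g) x)\<rparr>"

definition tensor_biset ::
  "('g, 'c) monoid_scheme \<Rightarrow> ('g, 'm) biset \<Rightarrow> ('g, 'n) biset \<Rightarrow> ('g, ('m \<times> 'n) set) biset"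
where
  "tensor_biset G M N =
     \<lparr>pts = orbits G (pts M \<times> pts N) (\<lambda>g (m, n). (ract M m (inv\<^bsub>G\<^esub> g), lact N g n)),
      lact = (\<lambda>h C. (\<lambda>(m, n). (lact M h m, n)) ` C),
      ract = (\<lambda>C p. (\<lambda>(m, n). (m, ract N n p)) ` C)\<rparr>"

definition tensor_class ::
  "('g, 'c) monoid_scheme \<Rightarrow> ('g, nat) biset set \<Rightarrow> ('g, nat) biset set \<Rightarrow> ('g, nat) biset set"
where
  "tensor_class G C D = (\<Union>M\<in>C. \<Union>N\<in>D. biset_class G (tensor_biset G M N))"

text \<open>The free \<open>R\<close>-module on the isomorphism classes, with the multiplication
  \<open>[M] [N] = [M \<times>\<^sub>G N]\<close>, whose unit is the class of the regular biset.\<close>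

definition biset_algebra ::
  "('r, 'c) ring_scheme \<Rightarrow> ('g, 'd) monoid_scheme \<Rightarrow> ('r, ('g, nat) biset set \<Rightarrow> 'r) module"
where
  "biset_algebra R G =
     basis_algebra R (biset_classes G) (\<lambda>C D. Some (tensor_class G C D)) {biset_class G (regular_biset G)}"

definition burnside_relators ::
  "('r, 'c) ring_scheme \<Rightarrow> ('g, 'd) monoid_scheme \<Rightarrow> (('g, nat) biset set \<Rightarrow> 'r) set"
where
  "burnside_relators R G =
     {basis_elt R (biset_class G (disjoint_union M N)) \<ominus>\<^bsub>biset_algebra R G\<^esub>
        (basis_elt R (biset_class G M) \<oplus>\<^bsub>biset_algebra R G\<^esub> basis_elt R (biset_class G N))
      | (M :: ('g, nat) biset) (N :: ('g, nat) biset). finite_biset G M \<and> finite_biset G N}"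

text \<open>The relations span a submodule that happens to be a two-sided ideal, so the multiplication of
  the quotient ring is well defined.\<close>

definition double_burnside ::
  "('r, 'c) ring_scheme \<Rightarrow> ('g, 'd) monoid_scheme \<Rightarrow> ('r, (('g, nat) biset set \<Rightarrow> 'r) set) module"
where
  "double_burnside R G =
     quot_algebra (biset_algebra R G)
       ((\<lambda>H. submodule H R (biset_algebra R G)) hull burnside_relators R G)"


section \<open>The localization of the integers at 2\<close>

definition Z2 :: "rat ring" where
  "Z2 = \<lparr>carrier = {of_int a / of_int b | a b. odd b}, monoid.mult = (*), one = 1, ring.zero = 0, ring.add = (+)\<rparr>"

definition Z2_cong :: "rat \<Rightarrow> rat \<Rightarrow> rat \<Rightarrow> bool" where
  "Z2_cong n x y \<longleftrightarrow> (\<exists>r\<in>carrier Z2. x - y = n * r)"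


section \<open>The algebra \<open>A\<close> and the order\<close>

text \<open>\<open>Loc a b c\<close> stands for \<open>a + b \<eta> + c \<xi>\<close> in \<open>\<rat>[\<eta>, \<xi>] / (\<eta>\<^sup>2, \<eta>\<xi>, \<xi>\<^sup>2)\<close>.\<close>

datatype loc = Loc (cst: rat) (eta: rat) (xi: rat)

fun loc_add :: "loc \<Rightarrow> loc \<Rightarrow> loc" where
  "loc_add (Loc a b c) (Loc a' b' c') = Loc (a + a') (b + b') (c + c')"

fun loc_mult :: "loc \<Rightarrow> loc \<Rightarrow> loc" where
  "loc_mult (Loc a b c) (Loc a' b' c') = Loc (a * a') (a * b' + b * a') (a * c' + c * a')"

fun loc_smult :: "rat \<Rightarrow> loc \<Rightarrow> loc" where
  "loc_smult r (Loc a b c) = Loc (r * a) (r * b) (r * c)"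

text \<open>An array is given by its blocks in the positions \<open>(i, j)\<close> with \<open>A\<^sub>i\<^sub>,\<^sub>j \<noteq> 0\<close>.
  In the notation of the \<open>6 \<times> 6\<close> arrays, with rows and columns \<open>1, 2, 3\<close> in block \<open>1\<close>, block \<open>2\<close> is row
  and column \<open>4\<close>, block \<open>3\<close> is row and column \<open>5\<close>, and block \<open>4\<close> is row and column \<open>6\<close>.\<close>

datatype arr = Arr
  (a11: "rat^3^3") (a14: "rat^3")
  (a22: rat) (a24: rat)
  (a33: rat)
  (a41: "rat^3") (a42: rat) (a44: loc)

definition arr_add :: "arr \<Rightarrow> arr \<Rightarrow> arr" where
  "arr_add x y = Arr (a11 x + a11 y) (a14 x + a14 y) (a22 x + a22 y) (a24 x + a24 y)
     (a33 x + a33 y) (a41 x + a41 y) (a42 x + a42 y) (loc_add (a44 x) (a44 y))"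

definition arr_smult :: "rat \<Rightarrow> arr \<Rightarrow> arr" where
  "arr_smult r x = Arr (\<chi> i j. r * a11 x $ i $ j) (r *s a14 x) (r * a22 x) (r * a24 x)
     (r * a33 x) (r *s a41 x) (r * a42 x) (loc_smult r (a44 x))"

text \<open>The entries \<open>\<Sum>\<^sub>r \<alpha>\<^sub>i\<^sub>,\<^sub>r\<^sub>,\<^sub>j(x\<^sub>i\<^sub>,\<^sub>r, y\<^sub>r\<^sub>,\<^sub>j)\<close>, omitting the summands that vanish. In particular
  \<open>\<alpha>\<^sub>1\<^sub>,\<^sub>4\<^sub>,\<^sub>1 = 0\<close> and \<open>\<alpha>\<^sub>2\<^sub>,\<^sub>4\<^sub>,\<^sub>2 = 0\<close>, while \<open>\<alpha>\<^sub>4\<^sub>,\<^sub>1\<^sub>,\<^sub>4(x, y) = x y \<eta>\<close> and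
  \<open>\<alpha>\<^sub>4\<^sub>,\<^sub>2\<^sub>,\<^sub>4(x, y) = x y (\<xi> - 12 \<eta>)\<close>.\<close>

definition arr_mult :: "arr \<Rightarrow> arr \<Rightarrow> arr" where
  "arr_mult x y = Arr
     (a11 x ** a11 y)
     (a11 x *v a14 y + cst (a44 y) *s a14 x)
     (a22 x * a22 y)
     (a22 x * a24 y + a24 x * cst (a44 y))
     (a33 x * a33 y)
     (a41 x v* a11 y + cst (a44 x) *s a41 y)
     (a42 x * a22 y + cst (a44 x) * a42 y)
     (loc_add (Loc 0 (\<Sum>k\<in>UNIV. a41 x $ k * a14 y $ k) 0)
       (loc_add (loc_smult (a42 x * a24 y) (Loc 0 (- 12) 1))
         (loc_mult (a44 x) (a44 y))))"

definition zero_arr :: arr where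
  "zero_arr = Arr 0 0 0 0 0 0 0 (Loc 0 0 0)"

definition one_arr :: arr where
  "one_arr = Arr (mat 1) 0 1 0 1 0 0 (Loc 1 0 0)"

definition A_alg :: "(rat, arr) module" where
  "A_alg = \<lparr>carrier = UNIV, monoid.mult = arr_mult, one = one_arr, ring.zero = zero_arr, ring.add = arr_add,
     smult = arr_smult\<rparr>"

definition Lambda_carrier :: "arr set" where
  "Lambda_carrier = {Arr s t u v w x y (Loc z1 z2 z3) | s t u v w x y z1 z2 z3.
     (\<forall>i j. s $ i $ j \<in> carrier Z2) \<and> (\<forall>i. t $ i \<in> carrier Z2) \<and> u \<in> carrier Z2 \<and>
     v \<in> carrier Z2 \<and> w \<in> carrier Z2 \<and> (\<forall>i. x $ i \<in> carrier Z2) \<and> y \<in> carrier Z2 \<and>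
     z1 \<in> carrier Z2 \<and> z2 \<in> carrier Z2 \<and> z3 \<in> carrier Z2 \<and>
     Z2_cong 8 (2 * w - 2 * z1) z2 \<and> Z2_cong 4 z2 z3 \<and> Z2_cong 4 z3 0 \<and>
     (\<forall>i. Z2_cong 4 (x $ i) 0) \<and>
     Z2_cong 2 y 0 \<and> (\<forall>i. Z2_cong 2 (t $ i) 0) \<and> Z2_cong 2 v 0}"

definition Lambda :: "(rat, arr) module" where
  "Lambda = A_alg\<lparr>carrier := Lambda_carrier\<rparr>"

text \<open>\<^term>\<open>axis k c\<close> is the vector with entry \<open>c\<close> in position \<open>k\<close> and zeros elsewhere.\<close>

definition e3 :: arr where "e3 = Arr (axis 3 (axis 3 1)) 0 0 0 0 0 0 (Loc 0 0 0)"
definition e4 :: arr where "e4 = Arr 0 0 1 0 0 0 0 (Loc 0 0 0)"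
definition e5 :: arr where "e5 = Arr 0 0 0 0 1 0 0 (Loc 1 0 0)"
definition tau1 :: arr where "tau1 = Arr 0 0 0 0 0 (axis 3 4) 0 (Loc 0 0 0)"
definition tau2 :: arr where "tau2 = Arr 0 (axis 3 2) 0 0 0 0 0 (Loc 0 0 0)"
definition tau3 :: arr where "tau3 = Arr 0 0 0 0 0 0 2 (Loc 0 0 0)"
definition tau4 :: arr where "tau4 = Arr 0 0 0 2 0 0 0 (Loc 0 0 0)"
definition tau7 :: arr where "tau7 = Arr 0 0 0 0 0 0 0 (Loc 2 4 0)"

definition eps :: arr where
  "eps = e3 \<oplus>\<^bsub>A_alg\<^esub> e4 \<oplus>\<^bsub>A_alg\<^esub> e5"

definition Lambda' :: "(rat, arr) module" where
  "Lambda' = Lambda\<lparr>carrier := {eps \<otimes>\<^bsub>Lambda\<^esub> x \<otimes>\<^bsub>Lambda\<^esub> eps | x. x \<in> carrier Lambda}, one := eps\<rparr>"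


section \<open>Path algebras\<close>

text \<open>A quiver is a \<open>pre_digraph\<close>. A path is a triple of its start vertex, its list of arrows in the
  order of traversal, and its end vertex, so that there is one trivial path for each vertex.\<close>

type_synonym ('v, 'e) path = "'v \<times> 'e list \<times> 'v"

definition paths :: "('v, 'e) pre_digraph \<Rightarrow> ('v, 'e) path set" where
  "paths Q = {(u, p, v). pre_digraph.awalk Q u p v}"

fun path_comp :: "('v, 'e) path \<Rightarrow> ('v, 'e) path \<Rightarrow> ('v, 'e) path option" where
  "path_comp (u, p, v) (u', q, v') = (if v = u' then Some (u, p @ q, v') else None)"

definition path_algebra ::
  "('r, 'c) ring_scheme \<Rightarrow> ('v, 'e) pre_digraph \<Rightarrow> ('r, ('v, 'e) path \<Rightarrow> 'r) module"
where
  "path_algebra R Q = basis_algebra R (paths Q) path_comp {(v, [], v) | v. v \<in> verts Q}"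

definition vertex_elt :: "('r, 'c) ring_scheme \<Rightarrow> 'v \<Rightarrow> ('v, 'e) path \<Rightarrow> 'r" where
  "vertex_elt R v = basis_elt R (v, [], v)"

definition arrow_elt :: "('r, 'c) ring_scheme \<Rightarrow> ('v, 'e) pre_digraph \<Rightarrow> 'e \<Rightarrow> ('v, 'e) path \<Rightarrow> 'r" where
  "arrow_elt R Q a = basis_elt R (tail Q a, [a], head Q a)"

datatype vertex = E3 | E4 | E5

datatype arrow = T1 | T2 | T3 | T4 | T7

fun source :: "arrow \<Rightarrow> vertex" where
  "source T1 = E5" | "source T2 = E3" | "source T3 = E5" | "source T4 = E4" | "source T7 = E5"

fun target :: "arrow \<Rightarrow> vertex" where
  "target T1 = E3" | "target T2 = E5" | "target T3 = E4" | "target T4 = E5" | "target T7 = E5"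

definition Psi :: "(vertex, arrow) pre_digraph" where
  "Psi = \<lparr>verts = UNIV, arcs = UNIV, tail = source, head = target\<rparr>"

abbreviation RPsi :: "(rat, (vertex, arrow) path \<Rightarrow> rat) module" where
  "RPsi \<equiv> path_algebra Z2 Psi"

abbreviation vert :: "vertex \<Rightarrow> (vertex, arrow) path \<Rightarrow> rat" where
  "vert \<equiv> vertex_elt Z2"

abbreviation arrw :: "arrow \<Rightarrow> (vertex, arrow) path \<Rightarrow> rat" where
  "arrw \<equiv> arrow_elt Z2 Psi"

definition Psi_relations :: "((vertex, arrow) path \<Rightarrow> rat) set" where
  "Psi_relations =
    {arrw T2 \<otimes>\<^bsub>RPsi\<^esub> arrw T1,
     arrw T2 \<otimes>\<^bsub>RPsi\<^esub> arrw T3,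
     arrw T2 \<otimes>\<^bsub>RPsi\<^esub> arrw T7 \<ominus>\<^bsub>RPsi\<^esub> 2 \<odot>\<^bsub>RPsi\<^esub> arrw T2,
     arrw T4 \<otimes>\<^bsub>RPsi\<^esub> arrw T1,
     arrw T4 \<otimes>\<^bsub>RPsi\<^esub> arrw T3,
     arrw T4 \<otimes>\<^bsub>RPsi\<^esub> arrw T7 \<ominus>\<^bsub>RPsi\<^esub> 2 \<odot>\<^bsub>RPsi\<^esub> arrw T4,
     arrw T7 \<otimes>\<^bsub>RPsi\<^esub> arrw T1 \<ominus>\<^bsub>RPsi\<^esub> 2 \<odot>\<^bsub>RPsi\<^esub> arrw T1,
     arrw T7 \<otimes>\<^bsub>RPsi\<^esub> arrw T3 \<ominus>\<^bsub>RPsi\<^esub> 2 \<odot>\<^bsub>RPsi\<^esub> arrw T3,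
     arrw T7 \<otimes>\<^bsub>RPsi\<^esub> arrw T7 \<ominus>\<^bsub>RPsi\<^esub> 2 \<odot>\<^bsub>RPsi\<^esub> arrw T7 \<ominus>\<^bsub>RPsi\<^esub> arrw T1 \<otimes>\<^bsub>RPsi\<^esub> arrw T2}"

definition Psi_ideal :: "((vertex, arrow) path \<Rightarrow> rat) set" where
  "Psi_ideal = genideal RPsi Psi_relations"

end

theory Submission
  imports Defs "HOL-Analysis.Cartesian_Space"
begin

text \<open>The double Burnside algebra is mapped to \<open>A\<close> by \<open>[M] \<mapsto> \<Sum>\<^sub>x \<phi>(Stab x)\<close>, where \<open>Stab x = {(a, b). a x = x b}\<close> and
  \<open>\<phi>\<close> is a class function on the subgroups of \<open>S\<^sub>3 \<times> S\<^sub>3\<close>. The stabilizer of \<open>[x, y]\<close> in a tensor product is the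
  relational composite of the stabilizers of \<open>x\<close> and \<open>y\<close>, so multiplicativity reduces to an identity for each
  pair of the 22 conjugacy classes of subgroups, and the images of the 22 transitive bisets form a basis of the
  order. The idempotent \<open>e\<^sub>3 + e\<^sub>4 + e\<^sub>5\<close> is full, which gives the Morita equivalence, with the inverse functor
  \<open>N \<mapsto> Hom(e A, N)\<close>. In the path algebra the relations reduce every path to a combination of ten, whose images
  in the corner form a basis.\<close>

section \<open>The algebra of arrays\<close>

text \<open>The path algebra and the Burnside algebra are treated by one scheme. Each is a free
  module on a multiplicative basis with a linear map to \<open>A\<close>. Its kernel is found
  without structure theory: modulo the relations every basis element reduces to finitely many normal
  forms, and the images of the normal forms are independent.

  The class function is forced by the images of the transitive bisets:
  \<open>(G \<times> G) / Q\<close> has 36 / |Q| points, all with stabilizers conjugate to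
  \<open>Q\<close>, so its value at \<open>Q\<close> must be |Q| / 36 times the image.

  A pair of points contributes to the tensor product with weight |stabilizer of the pair| / |G|, so
  that each orbit counts once. The composite of two stabilizers is not determined by their conjugacy
  classes. Replacing \<open>x\<close> by \<open>x g^-1\<close> and averaging over \<open>g\<close>
  yields an expression that is unchanged when either subgroup is conjugated; this is why one pair of
  representatives per pair of classes suffices, and why multiplicativity becomes a finite
  computation with integers.\<close>

lemma loc_sel [simp]:
  "cst (loc_add p q) = cst p + cst q"
  "eta (loc_add p q) = eta p + eta q"
  "xi (loc_add p q) = xi p + xi q"
  "cst (loc_smult r p) = r * cst p"
  "eta (loc_smult r p) = r * eta p"
  "xi (loc_smult r p) = r * xi p"
  "cst (loc_mult p q) = cst p * cst q"
  "eta (loc_mult p q) = cst p * eta q + eta p * cst q"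
  "xi (loc_mult p q) = cst p * xi q + xi p * cst q"
  by (cases p; cases q; simp)+

text \<open>With \<open>forall_3\<close> this breaks an identity of arrays into scalar identities
  between the 22 entries; most computations in \<open>A\<close> are done this way.\<close>

lemma arr_eq_iff:
  "x = y \<longleftrightarrow> (\<forall>i j. a11 x $ i $ j = a11 y $ i $ j) \<and> (\<forall>i. a14 x $ i = a14 y $ i) \<and> a22 x = a22 y \<and>
     a24 x = a24 y \<and> a33 x = a33 y \<and> (\<forall>i. a41 x $ i = a41 y $ i) \<and> a42 x = a42 y \<and>
     cst (a44 x) = cst (a44 y) \<and> eta (a44 x) = eta (a44 y) \<and> xi (a44 x) = xi (a44 y)"
  by (cases x; cases y; cases "a44 x"; cases "a44 y") (auto simp: vec_eq_iff)

text \<open>As a type class instance, \<open>A\<close> is open to ordinary ring simplification;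
  \<open>A_alg_simps\<close> identifies the record operations with those of the class.\<close>

instantiation arr :: ring_1
begin

definition "0 = zero_arr"
definition "1 = one_arr"
definition "x + y = arr_add x y" for x y :: arr
definition "- x = arr_smult (- 1) x" for x :: arr
definition "x - y = arr_add x (arr_smult (- 1) y)" for x y :: arr
definition "x * y = arr_mult x y" for x y :: arr

lemma arr_sel [simp]:
  "a11 (x + y) = a11 x + a11 y" "a14 (x + y) = a14 x + a14 y" "a22 (x + y) = a22 x + a22 y"
  "a24 (x + y) = a24 x + a24 y" "a33 (x + y) = a33 x + a33 y" "a41 (x + y) = a41 x + a41 y"
  "a42 (x + y) = a42 x + a42 y" "a44 (x + y) = loc_add (a44 x) (a44 y)"
  "a11 (arr_smult r x) $ i $ j = r * a11 x $ i $ j" "a14 (arr_smult r x) = r *s a14 x"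
  "a22 (arr_smult r x) = r * a22 x" "a24 (arr_smult r x) = r * a24 x"
  "a33 (arr_smult r x) = r * a33 x" "a41 (arr_smult r x) = r *s a41 x"
  "a42 (arr_smult r x) = r * a42 x" "a44 (arr_smult r x) = loc_smult r (a44 x)"
  "a11 (- x) = - a11 x" "a14 (- x) = - a14 x" "a22 (- x) = - a22 x" "a24 (- x) = - a24 x"
  "a33 (- x) = - a33 x" "a41 (- x) = - a41 x" "a42 (- x) = - a42 x"
  "a44 (- x) = loc_smult (- 1) (a44 x)"
  "a11 (x - y) = a11 x - a11 y" "a14 (x - y) = a14 x - a14 y" "a22 (x - y) = a22 x - a22 y"
  "a24 (x - y) = a24 x - a24 y" "a33 (x - y) = a33 x - a33 y" "a41 (x - y) = a41 x - a41 y"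
  "a42 (x - y) = a42 x - a42 y" "a44 (x - y) = loc_add (a44 x) (loc_smult (- 1) (a44 y))"
  "a11 0 = 0" "a14 0 = 0" "a22 0 = 0" "a24 0 = 0" "a33 0 = 0" "a41 0 = 0" "a42 0 = 0"
  "a44 0 = Loc 0 0 0"
  "a11 1 = mat 1" "a14 1 = 0" "a22 1 = 1" "a24 1 = 0" "a33 1 = 1" "a41 1 = 0" "a42 1 = 0"
  "a44 1 = Loc 1 0 0"
  by (simp_all add: plus_arr_def uminus_arr_def minus_arr_def zero_arr_def zero_arr_def one_arr_def
      arr_add_def arr_smult_def Defs.zero_arr_def Defs.one_arr_def vec_eq_iff)

lemma arr_mult_sel [simp]:
  "a11 (x * y) = a11 x ** a11 y"
  "a14 (x * y) = a11 x *v a14 y + cst (a44 y) *s a14 x"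
  "a22 (x * y) = a22 x * a22 y"
  "a24 (x * y) = a22 x * a24 y + a24 x * cst (a44 y)"
  "a33 (x * y) = a33 x * a33 y"
  "a41 (x * y) = a41 x v* a11 y + cst (a44 x) *s a41 y"
  "a42 (x * y) = a42 x * a22 y + cst (a44 x) * a42 y"
  "a44 (x * y) = loc_add (Loc 0 (\<Sum>k\<in>UNIV. a41 x $ k * a14 y $ k) 0)
       (loc_add (loc_smult (a42 x * a24 y) (Loc 0 (- 12) 1)) (loc_mult (a44 x) (a44 y)))"
  by (simp_all add: times_arr_def arr_mult_def)

lemmas arr_mult_entry = matrix_matrix_mult_def matrix_vector_mult_def vector_matrix_mult_def

instance
proof
  fix x y z :: arr
  \<comment> \<open>Associativity rests on one feature of the product: what comes from the first two
    blocks into position (4,4) has constant term 0. It therefore acts as zero on the vectors in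
    positions (1,4), (2,4), (4,1), (4,2), in agreement with
    \<open>\<alpha>\<^sub>1\<^sub>,\<^sub>4\<^sub>,\<^sub>1 = 0\<close> and
    \<open>\<alpha>\<^sub>2\<^sub>,\<^sub>4\<^sub>,\<^sub>2 = 0\<close>.\<close>
  show "x * y * z = x * (y * z)"
    unfolding arr_eq_iff forall_3 by (simp add: arr_mult_entry sum_3 algebra_simps)
  show "1 * x = x" "x * 1 = x"
    by (simp_all add: arr_eq_iff)
  show "(x + y) * z = x * z + y * z" "x * (y + z) = x * y + x * z"
    unfolding arr_eq_iff forall_3 by (simp_all add: arr_mult_entry sum_3 algebra_simps)
  show "0 \<noteq> (1::arr)" "x + y + z = x + (y + z)" "x + y = y + x" "0 + x = x" "- x + x = 0"
    "x - y = x + - y"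
    by (simp_all add: arr_eq_iff)
qed

end

interpretation arr: Modules.module arr_smult
  by standard (simp_all add: arr_eq_iff algebra_simps)

lemma arr_smult_mult [simp]:
  "arr_smult r x * y = arr_smult r (x * y)" "x * arr_smult r y = arr_smult r (x * y)"
  unfolding arr_eq_iff forall_3 by (simp_all add: arr_mult_entry sum_3 algebra_simps)

lemma A_alg_simps [simp]:
  "carrier A_alg = UNIV" "x \<otimes>\<^bsub>A_alg\<^esub> y = x * y" "\<one>\<^bsub>A_alg\<^esub> = 1" "\<zero>\<^bsub>A_alg\<^esub> = 0"
  "x \<oplus>\<^bsub>A_alg\<^esub> y = x + y" "r \<odot>\<^bsub>A_alg\<^esub> x = arr_smult r x"
  by (simp_all add: A_alg_def times_arr_def one_arr_def zero_arr_def plus_arr_def)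

section \<open>The integers localized at 2\<close>

lemma Z2_simps [simp]:
  "x \<otimes>\<^bsub>Z2\<^esub> y = x * y" "\<one>\<^bsub>Z2\<^esub> = 1" "\<zero>\<^bsub>Z2\<^esub> = 0" "x \<oplus>\<^bsub>Z2\<^esub> y = x + y"
  by (simp_all add: Z2_def)

lemma mem_Z2: "x \<in> carrier Z2 \<longleftrightarrow> (\<exists>a b. x = of_int a / of_int b \<and> odd b)"
  by (simp add: Z2_def)

lemma Z2_of_int [simp]: "of_int a \<in> carrier Z2"
  unfolding mem_Z2 by (rule exI[of _ a], rule exI[of _ 1]) simp

lemma Z2_numeral [simp]:
  "0 \<in> carrier Z2" "1 \<in> carrier Z2" "numeral k \<in> carrier Z2" "- 1 \<in> carrier Z2"
  "- numeral k \<in> carrier Z2"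
  using Z2_of_int[of 0] Z2_of_int[of 1] Z2_of_int[of "numeral k"] Z2_of_int[of "- 1"]
    Z2_of_int[of "- numeral k"] by simp_all

lemma Z2_closed [simp]:
  assumes "x \<in> carrier Z2" "y \<in> carrier Z2"
  shows "x + y \<in> carrier Z2" "x * y \<in> carrier Z2" "x - y \<in> carrier Z2"
proof -
  obtain a b c d where ab: "x = of_int a / of_int b" "odd b" and cd: "y = of_int c / of_int d" "odd d"
    using assms by (auto simp: mem_Z2)
  have "(of_int b :: rat) \<noteq> 0" "(of_int d :: rat) \<noteq> 0" "odd (b * d)"
    using ab cd by auto
  then have "x + y = of_int (a * d + c * b) / of_int (b * d)" "x * y = of_int (a * c) / of_int (b * d)"
    "x - y = of_int (a * d - c * b) / of_int (b * d)"
    unfolding ab(1) cd(1) by (simp_all add: field_simps)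
  then show "x + y \<in> carrier Z2" "x * y \<in> carrier Z2" "x - y \<in> carrier Z2"
    unfolding mem_Z2 using \<open>odd (b * d)\<close> by blast+
qed

lemma Z2_uminus [simp]: "- x \<in> carrier Z2 \<longleftrightarrow> x \<in> carrier Z2"
  using Z2_closed(3)[of 0 x] Z2_closed(3)[of 0 "- x"] by auto

lemma Z2_sum [simp]: "(\<And>i. i \<in> I \<Longrightarrow> f i \<in> carrier Z2) \<Longrightarrow> sum f I \<in> carrier Z2"
  by (induction I rule: infinite_finite_induct) auto

lemma Z2_cring: "cring Z2"
proof (rule cringI)
  show "abelian_group Z2"
  proof (rule abelian_groupI)
    fix x assume "x \<in> carrier Z2"
    then show "\<exists>y\<in>carrier Z2. y \<oplus>\<^bsub>Z2\<^esub> x = \<zero>\<^bsub>Z2\<^esub>"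
      by (intro bexI[of _ "- x"]) auto
  qed auto
  show "comm_monoid Z2"
    by (rule comm_monoidI) auto
qed (auto simp: algebra_simps)

lemma Z2_finsum: "(\<And>i. i \<in> I \<Longrightarrow> f i \<in> carrier Z2) \<Longrightarrow> finsum Z2 f I = sum f I"
proof (induction I rule: infinite_finite_induct)
  interpret cring Z2 by (rule Z2_cring)
  case (insert i I)
  then show ?case by (subst finsum_insert) (auto simp: Pi_def)
next
  \<comment> \<open>Over an infinite index set both sums are zero by convention.\<close>
  case (infinite I)
  then show ?case by (simp add: finsum_def finprod_def)
next
  case empty
  show ?case by (simp add: finsum_def finprod_def)
qed

section \<open>The orders\<close>

definition Z2mult :: "rat \<Rightarrow> rat set" where
  "Z2mult n = (\<lambda>r. n * r) ` carrier Z2"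

lemma Z2_cong_iff: "Z2_cong n x y \<longleftrightarrow> x - y \<in> Z2mult n"
  by (auto simp: Z2_cong_def Z2mult_def)

text \<open>The unit is a parameter because the corner has the unit \<open>eps\<close> instead of 1.
  Zero and negatives come from the scalars 0 and -1.\<close>

definition submodule_arr :: "arr set \<Rightarrow> arr \<Rightarrow> bool" where
  "submodule_arr S u \<longleftrightarrow> u \<in> S \<and> (\<forall>x\<in>S. \<forall>y\<in>S. x + y \<in> S \<and> x * y \<in> S) \<and>
     (\<forall>r\<in>carrier Z2. \<forall>x\<in>S. arr_smult r x \<in> S) \<and> (\<forall>x\<in>S. u * x = x \<and> x * u = x)"

lemma assoc_algebra_arr:
  assumes S: "submodule_arr S u"
  shows "assoc_algebra Z2 (A_alg\<lparr>carrier := S, one := u\<rparr>)" (is "assoc_algebra Z2 ?A")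
proof -
  have simps: "carrier ?A = S" "\<And>x y. x \<otimes>\<^bsub>?A\<^esub> y = x * y" "\<one>\<^bsub>?A\<^esub> = u" "\<zero>\<^bsub>?A\<^esub> = 0"
    "\<And>x y. x \<oplus>\<^bsub>?A\<^esub> y = x + y" "\<And>r x. r \<odot>\<^bsub>?A\<^esub> x = arr_smult r x"
    using A_alg_simps by simp_all
  have zero: "0 \<in> S"
    using S arr.scale_zero_left[of u] unfolding submodule_arr_def by (metis Z2_numeral(1))
  have neg: "- x \<in> S" if "x \<in> S" for x
  proof -
    have "arr_smult (- 1) x \<in> S" using S that Z2_numeral(4) unfolding submodule_arr_def by blast
    then show ?thesis by simp
  qed
  have grp: "abelian_group ?A"
    by (rule abelian_groupI; unfold simps)
       (use S zero neg in \<open>auto simp: submodule_arr_def algebra_simps intro!: bexI[of _ "- x" for x]\<close>)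
  have "ring ?A"
    by (rule ringI[OF grp monoidI]; unfold simps)
       (use S in \<open>auto simp: submodule_arr_def algebra_simps\<close>)
  moreover have "Module.module Z2 ?A"
    by (rule Module.moduleI[OF Z2_cring grp]; unfold simps)
       (use S in \<open>auto simp: submodule_arr_def arr.scale_left_distrib arr.scale_right_distrib\<close>)
  ultimately show ?thesis
    unfolding assoc_algebra_def assoc_algebra_axioms_def simps by simp
qed

lemma Z2multE: "x \<in> Z2mult n \<Longrightarrow> \<exists>r\<in>carrier Z2. x = n * r"
  by (auto simp: Z2mult_def)

lemma Z2mult_closed:
  assumes "x \<in> Z2mult n"
  shows "y \<in> Z2mult n \<Longrightarrow> x + y \<in> Z2mult n" "y \<in> Z2mult n \<Longrightarrow> x - y \<in> Z2mult n"
    "r \<in> carrier Z2 \<Longrightarrow> r * x \<in> Z2mult n" "r \<in> carrier Z2 \<Longrightarrow> x * r \<in> Z2mult n" "- x \<in> Z2mult n"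
proof -
  obtain a where a: "a \<in> carrier Z2" "x = n * a" using assms by (auto simp: Z2mult_def)
  { assume "y \<in> Z2mult n"
    then obtain b where b: "b \<in> carrier Z2" "y = n * b" by (auto simp: Z2mult_def)
    have "x + y = n * (a + b)" "x - y = n * (a - b)" using a b by (simp_all add: algebra_simps)
    then show "x + y \<in> Z2mult n" "x - y \<in> Z2mult n" using a b by (auto simp: Z2mult_def) }
  { assume "r \<in> carrier Z2"
    then show "r * x \<in> Z2mult n" "x * r \<in> Z2mult n"
      using a by (auto simp: Z2mult_def intro!: image_eqI[of _ _ "r * a"]) }
  show "- x \<in> Z2mult n" using a by (auto simp: Z2mult_def intro!: image_eqI[of _ _ "- a"])
qed

lemma zero_Z2mult [simp]: "0 \<in> Z2mult n"
  by (auto simp: Z2mult_def intro: image_eqI[of _ _ 0])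

lemma Z2mult_mult: "x \<in> Z2mult m \<Longrightarrow> y \<in> Z2mult n \<Longrightarrow> x * y \<in> Z2mult (m * n)"
proof -
  assume "x \<in> Z2mult m" "y \<in> Z2mult n"
  then obtain a b where "a \<in> carrier Z2" "x = m * a" "b \<in> carrier Z2" "y = n * b"
    by (auto simp: Z2mult_def)
  then show ?thesis by (auto simp: Z2mult_def intro!: image_eqI[of _ _ "a * b"])
qed

lemma Z2mult_Z2: "x \<in> Z2mult (numeral n) \<Longrightarrow> x \<in> carrier Z2"
  by (auto simp: Z2mult_def)

text \<open>The congruences \<open>z\<^sub>2 \<equiv> z\<^sub>3 (4)\<close>, \<open>z\<^sub>3 \<equiv> 0 (4)\<close> are recorded as \<open>z\<^sub>2, z\<^sub>3 \<in> 4R\<close>; the arrays are then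
  parametrized by free parameters in \<open>R\<close>.\<close>

lemma mem_Lambda:
  "x \<in> Lambda_carrier \<longleftrightarrow> (\<forall>i j. a11 x $ i $ j \<in> carrier Z2) \<and> (\<forall>i. a14 x $ i \<in> Z2mult 2) \<and>
     a22 x \<in> carrier Z2 \<and> a24 x \<in> Z2mult 2 \<and> a33 x \<in> carrier Z2 \<and> (\<forall>i. a41 x $ i \<in> Z2mult 4) \<and>
     a42 x \<in> Z2mult 2 \<and> cst (a44 x) \<in> carrier Z2 \<and> eta (a44 x) \<in> Z2mult 4 \<and>
     xi (a44 x) \<in> Z2mult 4 \<and> 2 * a33 x - 2 * cst (a44 x) - eta (a44 x) \<in> Z2mult 8"
proof -
  have "p - q \<in> Z2mult 4 \<and> q - 0 \<in> Z2mult 4 \<longleftrightarrow> p \<in> Z2mult 4 \<and> q \<in> Z2mult 4" for p q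
    using Z2mult_closed(1)[of "p - q" 4 q] Z2mult_closed(2)[of p 4 q] by auto
  then show ?thesis
    unfolding Lambda_carrier_def Z2_cong_iff mem_Collect_eq
    by (cases x; cases "a44 x") (auto dest: Z2mult_Z2)
qed

text \<open>The delicate point is the congruence modulo 8 for a product. To the coefficient of
  \<open>\<eta>\<close> the first block adds products of an element of \<open>4 R\<close> with one
  of \<open>2 R\<close>, and the second block \<open>- 12\<close> times an element of
  \<open>4 R\<close>. Both lie in \<open>8 R\<close>, so only the entries \<open>w\<close> and
  \<open>z\<close> remain to be compared.\<close>

lemma Lambda_closed:
  assumes x: "x \<in> Lambda_carrier" and y: "y \<in> Lambda_carrier"
  shows "x + y \<in> Lambda_carrier" "x * y \<in> Lambda_carrier"
    and "r \<in> carrier Z2 \<Longrightarrow> arr_smult r x \<in> Lambda_carrier"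
proof -
  note x = x[unfolded mem_Lambda] and y = y[unfolded mem_Lambda]
  have "2 * (a33 x + a33 y) - 2 * (cst (a44 x) + cst (a44 y)) - (eta (a44 x) + eta (a44 y)) \<in> Z2mult 8"
    using Z2mult_closed(1)[of "2 * a33 x - 2 * cst (a44 x) - eta (a44 x)" 8
        "2 * a33 y - 2 * cst (a44 y) - eta (a44 y)"] x y by (simp add: algebra_simps)
  then show "x + y \<in> Lambda_carrier"
    unfolding mem_Lambda arr_sel loc_sel using x y by (simp add: Z2mult_closed(1))
  show "arr_smult r x \<in> Lambda_carrier" if r: "r \<in> carrier Z2"
  proof -
    have "2 * (r * a33 x) - 2 * (r * cst (a44 x)) - r * eta (a44 x) \<in> Z2mult 8"
      using Z2mult_closed(3)[of "2 * a33 x - 2 * cst (a44 x) - eta (a44 x)" 8 r] x r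
      by (simp add: algebra_simps)
    then show ?thesis
      unfolding mem_Lambda arr_sel loc_sel using x r by (simp add: Z2mult_closed(3))
  qed
  have 8: "a41 x $ k * a14 y $ k \<in> Z2mult 8" for k
    using Z2mult_mult[of "a41 x $ k" 4 "a14 y $ k" 2] x y by simp
  have 4: "a42 x * a24 y \<in> Z2mult 4"
    using Z2mult_mult[of "a42 x" 2 "a24 y" 2] x y by simp
  have 48: "12 * (a42 x * a24 y) \<in> Z2mult 8"
    using Z2multE[OF 4] by (auto simp: Z2mult_def intro!: image_eqI[of _ _ "6 * r" for r])
  have half: "Z2mult 8 \<subseteq> Z2mult 4"
    by (auto simp: Z2mult_def intro!: image_eqI[of _ _ "2 * r" for r])
  let ?w = "a33 x" and ?z = "cst (a44 x)" and ?e = "eta (a44 x)"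
  let ?w' = "a33 y" and ?z' = "cst (a44 y)" and ?e' = "eta (a44 y)"
  obtain p q where pq: "?e = 4 * p" "p \<in> carrier Z2" "?e' = 4 * q" "q \<in> carrier Z2"
    using x y by (meson Z2multE)
  obtain d' where d': "2 * ?w' - 2 * ?z' - ?e' = 8 * d'" "d' \<in> carrier Z2"
    using y by (meson Z2multE)
  \<comment> \<open>The congruence for \<open>y\<close> shows that \<open>w' - z'\<close> is even,
    so its product with the multiple \<open>e\<close> of 4 lies in \<open>8 R\<close>.\<close>
  have "?w' - ?z' = 4 * d' + 2 * q"
    using pq(3) d'(1) by simp
  then have "?e * (?w' - ?z') = 8 * (2 * p * d' + p * q)"
    using pq(1) by (simp add: algebra_simps)
  moreover have "2 * p * d' + p * q \<in> carrier Z2"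
    using pq d' by simp
  ultimately have ew: "?e * (?w' - ?z') \<in> Z2mult 8"
    unfolding Z2mult_def by (rule image_eqI)
  have dx: "2 * ?w - 2 * ?z - ?e \<in> Z2mult 8" "2 * ?w' - 2 * ?z' - ?e' \<in> Z2mult 8"
    using x y by auto
  \<comment> \<open>A telescoping identity: \<open>2 w w' - 2 z z' - z e' - e z'\<close> is
    \<open>w'\<close> times the expression of the congruence for \<open>x\<close>, plus
    \<open>z\<close> times that for \<open>y\<close>, plus the correction
    \<open>e (w' - z')\<close>.\<close>
  have eq: "2 * (?w * ?w') - 2 * (?z * ?z') -
      (a41 x $ 1 * a14 y $ 1 + a41 x $ 2 * a14 y $ 2 + a41 x $ 3 * a14 y $ 3 +
        (- (12 * (a42 x * a24 y)) + (?z * ?e' + ?e * ?z'))) =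
      ?w' * (2 * ?w - 2 * ?z - ?e) + ?z * (2 * ?w' - 2 * ?z' - ?e') + ?e * (?w' - ?z') -
      (a41 x $ 1 * a14 y $ 1 + a41 x $ 2 * a14 y $ 2 + a41 x $ 3 * a14 y $ 3 - 12 * (a42 x * a24 y))"
    by (simp add: algebra_simps)
  have last: "2 * (?w * ?w') - 2 * (?z * ?z') -
      (a41 x $ 1 * a14 y $ 1 + a41 x $ 2 * a14 y $ 2 + a41 x $ 3 * a14 y $ 3 +
        (- (12 * (a42 x * a24 y)) + (?z * ?e' + ?e * ?z'))) \<in> Z2mult 8"
    unfolding eq using x y dx by (intro Z2mult_closed(1,2) ew 8 48; intro Z2mult_closed(3)) simp_all
  have e: "?z * ?e' \<in> Z2mult 4" "?e * ?z' \<in> Z2mult 4"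
    using x y by (simp_all add: Z2mult_closed(3,4))
  have eta: "a41 x $ 1 * a14 y $ 1 + a41 x $ 2 * a14 y $ 2 + a41 x $ 3 * a14 y $ 3 +
        (- (12 * (a42 x * a24 y)) + (?z * ?e' + ?e * ?z')) \<in> Z2mult 4"
    by (intro Z2mult_closed(1) e) (intro subsetD[OF half] Z2mult_closed(1,5) 8 48)+
  show "x * y \<in> Lambda_carrier"
    unfolding mem_Lambda forall_3 arr_mult_sel loc_sel loc.sel sum_3
    using x y 4 last eta
    by (simp add: arr_mult_entry sum_3 Z2mult_closed(1,3,4) mult.commute[of _ 12])
qed

lemma one_Lambda: "1 \<in> Lambda_carrier"
  by (auto simp: mem_Lambda mat_def)

lemma submodule_Lambda: "submodule_arr Lambda_carrier 1"
  using Lambda_closed one_Lambda by (simp add: submodule_arr_def)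

lemma Lambda_eq: "Lambda = A_alg\<lparr>carrier := Lambda_carrier, one := 1\<rparr>"
  by (simp add: Lambda_def A_alg_def one_arr_def)

lemma Lambda_algebra: "assoc_algebra Z2 Lambda"
  unfolding Lambda_eq by (rule assoc_algebra_arr[OF submodule_Lambda])

lemma Lambda_simps [simp]:
  "carrier Lambda = Lambda_carrier" "x \<otimes>\<^bsub>Lambda\<^esub> y = x * y" "\<one>\<^bsub>Lambda\<^esub> = 1" "\<zero>\<^bsub>Lambda\<^esub> = 0"
  "x \<oplus>\<^bsub>Lambda\<^esub> y = x + y" "r \<odot>\<^bsub>Lambda\<^esub> x = arr_smult r x"
  using A_alg_simps by (simp_all add: Lambda_def)

lemma eps_sel [simp]:
  "a11 eps = axis 3 (axis 3 1)" "a14 eps = 0" "a22 eps = 1" "a24 eps = 0" "a33 eps = 1"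
  "a41 eps = 0" "a42 eps = 0" "a44 eps = Loc 1 0 0"
  by (simp_all add: eps_def e3_def e4_def e5_def)

lemma eps_Lambda: "eps \<in> Lambda_carrier"
  by (auto simp: mem_Lambda axis_def)

lemma eps_idem: "eps * eps = eps"
  unfolding arr_eq_iff forall_3 by (simp add: arr_mult_entry sum_3 axis_def)

text \<open>Describing \<open>eps Lambda eps\<close> by fixed points makes membership a pair of
  equations; \<open>Lambda'_eq\<close> justifies it.\<close>

definition corner :: "arr set" where
  "corner = {x \<in> Lambda_carrier. eps * x = x \<and> x * eps = x}"

lemma Lambda'_eq: "Lambda' = A_alg\<lparr>carrier := corner, one := eps\<rparr>"
proof -
  have "{eps * x * eps | x. x \<in> Lambda_carrier} = corner"
  proof safe
    fix x assume "x \<in> Lambda_carrier"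
    then show "eps * x * eps \<in> corner"
      by (simp add: corner_def Lambda_closed eps_Lambda mult.assoc eps_idem)
         (simp add: mult.assoc[symmetric] eps_idem)
  next
    fix x assume "x \<in> corner"
    then show "\<exists>y. x = eps * y * eps \<and> y \<in> Lambda_carrier"
      by (intro exI[of _ x]) (simp add: corner_def)
  qed
  then show ?thesis by (simp add: Lambda'_def Lambda_def A_alg_def times_arr_def)
qed

lemma submodule_corner: "submodule_arr corner eps"
proof -
  have "eps * (x * y) = x * y" "x * y * eps = x * y" if "x \<in> corner" "y \<in> corner" for x y
    using that by (simp_all add: corner_def mult.assoc) (simp add: mult.assoc[symmetric])
  then show ?thesis
    using Lambda_closed eps_Lambda eps_idem
    unfolding submodule_arr_def by (auto simp: corner_def distrib_left distrib_right)
qed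

lemma Lambda'_algebra: "assoc_algebra Z2 Lambda'"
  unfolding Lambda'_eq by (rule assoc_algebra_arr[OF submodule_corner])

lemma Lambda'_simps [simp]:
  "carrier Lambda' = corner" "x \<otimes>\<^bsub>Lambda'\<^esub> y = x * y" "\<one>\<^bsub>Lambda'\<^esub> = eps" "\<zero>\<^bsub>Lambda'\<^esub> = 0"
  "x \<oplus>\<^bsub>Lambda'\<^esub> y = x + y" "r \<odot>\<^bsub>Lambda'\<^esub> x = arr_smult r x"
  using A_alg_simps by (simp_all add: Lambda'_eq)

section \<open>Quotient algebras\<close>

text \<open>Provides the axioms of a quotient, whose operations are operations on cosets, from those
  of an algebra in bijection with it.\<close>

lemma assoc_algebra_transport:
  fixes B :: "('r, 'a, 'd) module_scheme" and Q :: "('r, 'b, 'e) module_scheme"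
  assumes B: "assoc_algebra R B"
    and bij: "bij_betw h (carrier B) (carrier Q)"
    and add: "\<And>x y. x \<in> carrier B \<Longrightarrow> y \<in> carrier B \<Longrightarrow> h (x \<oplus>\<^bsub>B\<^esub> y) = h x \<oplus>\<^bsub>Q\<^esub> h y"
    and mult: "\<And>x y. x \<in> carrier B \<Longrightarrow> y \<in> carrier B \<Longrightarrow> h (x \<otimes>\<^bsub>B\<^esub> y) = h x \<otimes>\<^bsub>Q\<^esub> h y"
    and smult: "\<And>r x. r \<in> carrier R \<Longrightarrow> x \<in> carrier B \<Longrightarrow> h (r \<odot>\<^bsub>B\<^esub> x) = r \<odot>\<^bsub>Q\<^esub> h x"
    and one: "h \<one>\<^bsub>B\<^esub> = \<one>\<^bsub>Q\<^esub>" and zero: "h \<zero>\<^bsub>B\<^esub> = \<zero>\<^bsub>Q\<^esub>"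
  shows "assoc_algebra R Q"
proof -
  interpret B: assoc_algebra R B by (rule B)
  have car: "carrier Q = h ` carrier B" using bij by (simp add: bij_betw_def)
  note hom = add[symmetric] mult[symmetric] smult[symmetric] one[symmetric] zero[symmetric]
  have grp: "abelian_group Q"
  proof (rule abelian_groupI)
    fix x assume "x \<in> carrier Q"
    then obtain a where "a \<in> carrier B" "x = h a" by (auto simp: car)
    then show "\<exists>y\<in>carrier Q. y \<oplus>\<^bsub>Q\<^esub> x = \<zero>\<^bsub>Q\<^esub>"
      by (intro bexI[of _ "h (\<ominus>\<^bsub>B\<^esub> a)"]) (auto simp: car hom B.l_neg)
  qed (auto simp: car hom B.a_ac)
  have rng: "ring Q"
    by (rule ringI[OF grp monoidI]) (auto simp: car hom B.m_assoc B.l_distr B.r_distr)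
  have md: "Module.module R Q"
    by (rule Module.moduleI[OF B.is_cring grp])
       (auto simp: car hom B.smult_l_distr B.smult_r_distr B.smult_assoc1)
  show ?thesis
    using rng md
    by (auto simp: assoc_algebra_def assoc_algebra_axioms_def car hom B.smult_mult_left
        B.smult_mult_right)
qed

text \<open>No ring structure on the source is assumed: the quotient by the kernel of a multiplicative
  surjection inherits the ring axioms from the target. For the Burnside algebra this makes
  it unnecessary to prove that the tensor product of bisets is associative.\<close>

lemma quot_algebra_iso:
  fixes A :: "('r, 'a, 'd) module_scheme" and B :: "('r, 'b, 'e) module_scheme"
  assumes A: "abelian_group A" and B: "assoc_algebra R B"
    and mult_closed: "\<And>x y. x \<in> carrier A \<Longrightarrow> y \<in> carrier A \<Longrightarrow> x \<otimes>\<^bsub>A\<^esub> y \<in> carrier A"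
    and one_closed: "\<one>\<^bsub>A\<^esub> \<in> carrier A"
    and smult_closed: "\<And>r x. r \<in> carrier R \<Longrightarrow> x \<in> carrier A \<Longrightarrow> r \<odot>\<^bsub>A\<^esub> x \<in> carrier A"
    and closed: "\<And>x. x \<in> carrier A \<Longrightarrow> \<theta> x \<in> carrier B"
    and surj: "\<And>y. y \<in> carrier B \<Longrightarrow> \<exists>x\<in>carrier A. \<theta> x = y"
    and add: "\<And>x y. x \<in> carrier A \<Longrightarrow> y \<in> carrier A \<Longrightarrow> \<theta> (x \<oplus>\<^bsub>A\<^esub> y) = \<theta> x \<oplus>\<^bsub>B\<^esub> \<theta> y"
    and mult: "\<And>x y. x \<in> carrier A \<Longrightarrow> y \<in> carrier A \<Longrightarrow> \<theta> (x \<otimes>\<^bsub>A\<^esub> y) = \<theta> x \<otimes>\<^bsub>B\<^esub> \<theta> y"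
    and smult: "\<And>r x. r \<in> carrier R \<Longrightarrow> x \<in> carrier A \<Longrightarrow> \<theta> (r \<odot>\<^bsub>A\<^esub> x) = r \<odot>\<^bsub>B\<^esub> \<theta> x"
    and one: "\<theta> \<one>\<^bsub>A\<^esub> = \<one>\<^bsub>B\<^esub>"
    and I: "I = {x \<in> carrier A. \<theta> x = \<zero>\<^bsub>B\<^esub>}"
  obtains h where "algebra_iso R B (quot_algebra A I) h" "\<And>x. x \<in> carrier A \<Longrightarrow> h (\<theta> x) = I +>\<^bsub>A\<^esub> x"
proof -
  interpret A: abelian_group A by (rule A)
  interpret B: assoc_algebra R B by (rule B)
  \<comment> \<open>The fibre over \<open>y\<close>; for \<open>y = \<theta> x\<close> it is the
    coset of the kernel through \<open>x\<close>.\<close>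
  define h where "h y = {x \<in> carrier A. \<theta> x = y}" for y
  have zero: "\<theta> \<zero>\<^bsub>A\<^esub> = \<zero>\<^bsub>B\<^esub>"
    using add[of "\<zero>\<^bsub>A\<^esub>" "\<zero>\<^bsub>A\<^esub>"] closed[of "\<zero>\<^bsub>A\<^esub>"] by (simp add: B.add.l_cancel_one')
  have neg: "\<theta> (\<ominus>\<^bsub>A\<^esub> x) = \<ominus>\<^bsub>B\<^esub> \<theta> x" if "x \<in> carrier A" for x
    using that add[of "\<ominus>\<^bsub>A\<^esub> x" x] closed zero by (simp add: A.l_neg B.minus_equality)
  have coset: "I +>\<^bsub>A\<^esub> x = h (\<theta> x)" if x: "x \<in> carrier A" for x
  proof (rule Set.set_eqI)
    fix y
    show "y \<in> I +>\<^bsub>A\<^esub> x \<longleftrightarrow> y \<in> h (\<theta> x)"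
    proof
      assume "y \<in> I +>\<^bsub>A\<^esub> x"
      then show "y \<in> h (\<theta> x)"
        using x closed[OF x] by (auto simp: a_r_coset_def' I h_def add)
    next
      assume y: "y \<in> h (\<theta> x)"
      then have "y = (y \<oplus>\<^bsub>A\<^esub> \<ominus>\<^bsub>A\<^esub> x) \<oplus>\<^bsub>A\<^esub> x"
        using x by (simp add: h_def A.a_assoc A.l_neg)
      moreover have "y \<oplus>\<^bsub>A\<^esub> \<ominus>\<^bsub>A\<^esub> x \<in> I"
        using x y closed[OF x] by (simp add: h_def I add neg B.r_neg)
      ultimately show "y \<in> I +>\<^bsub>A\<^esub> x"
        unfolding a_r_coset_def' by blast
    qed
  qed
  let ?Q = "quot_algebra A I"
  have fibre: "x \<in> h y \<longleftrightarrow> x \<in> carrier A \<and> \<theta> x = y" for x y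
    by (simp add: h_def)
  have car: "carrier ?Q = h ` carrier B"
  proof -
    have "carrier ?Q = (\<Union>a\<in>carrier A. {I +>\<^bsub>A\<^esub> a})"
      by (simp add: quot_algebra_def FactRing_def A_RCOSETS_def')
    also have "\<dots> = (\<lambda>x. h (\<theta> x)) ` carrier A"
      using coset by auto
    also have "\<dots> = h ` carrier B"
      using surj closed by (fastforce simp: image_iff)
    finally show ?thesis .
  qed
  have inj: "inj_on h (carrier B)"
    by (rule inj_onI) (use surj fibre in blast)
  have bij: "bij_betw h (carrier B) (carrier ?Q)"
    using car inj by (simp add: bij_betw_def)
  \<comment> \<open>Addition of cosets is the setwise sum. An element of the fibre over
    \<open>b + c\<close> is split with a fixed first summand \<open>z\<close> in the fibre over
    \<open>b\<close>; the remainder then lies over \<open>c\<close>.\<close>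
  have hadd: "h (b \<oplus>\<^bsub>B\<^esub> c) = h b \<oplus>\<^bsub>?Q\<^esub> h c" if b: "b \<in> carrier B" and c: "c \<in> carrier B" for b c
  proof -
    obtain z where z: "z \<in> carrier A" "\<theta> z = b" using surj[OF b] by blast
    have "\<exists>u\<in>h b. \<exists>v\<in>h c. w = u \<oplus>\<^bsub>A\<^esub> v" if w: "w \<in> h (b \<oplus>\<^bsub>B\<^esub> c)" for w
    proof (intro bexI)
      show "w = z \<oplus>\<^bsub>A\<^esub> (\<ominus>\<^bsub>A\<^esub> z \<oplus>\<^bsub>A\<^esub> w)" "z \<in> h b"
        using w z by (simp_all add: fibre A.r_neg2)
      show "\<ominus>\<^bsub>A\<^esub> z \<oplus>\<^bsub>A\<^esub> w \<in> h c"
        using w z b c by (simp add: fibre add neg B.r_neg1)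
    qed
    then show ?thesis
      by (auto simp: quot_algebra_def FactRing_def set_add_def' fibre add)
  qed
  \<comment> \<open>The product of cosets is the union of the cosets of all products of
    representatives. All of these equal the fibre over the product; surjectivity ensures that the
    union is not empty.\<close>
  have hmult: "h (b \<otimes>\<^bsub>B\<^esub> c) = h b \<otimes>\<^bsub>?Q\<^esub> h c" if b: "b \<in> carrier B" and c: "c \<in> carrier B" for b c
  proof -
    have "I +>\<^bsub>A\<^esub> (u \<otimes>\<^bsub>A\<^esub> v) = h (b \<otimes>\<^bsub>B\<^esub> c)" if "u \<in> h b" "v \<in> h c" for u v
      using that by (simp add: fibre mult_closed coset mult)
    then show ?thesis
      using surj[OF b] surj[OF c] by (auto simp: quot_algebra_def FactRing_def rcoset_mult_def fibre)
  qed
  have hsmult: "h (r \<odot>\<^bsub>B\<^esub> b) = r \<odot>\<^bsub>?Q\<^esub> h b" if r: "r \<in> carrier R" and b: "b \<in> carrier B" for r b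
  proof -
    have "I +>\<^bsub>A\<^esub> (r \<odot>\<^bsub>A\<^esub> u) = h (r \<odot>\<^bsub>B\<^esub> b)" if "u \<in> h b" for u
      using that r by (simp add: fibre smult_closed coset smult)
    then show ?thesis
      using surj[OF b] by (auto simp: quot_algebra_def fibre)
  qed
  have hone: "h \<one>\<^bsub>B\<^esub> = \<one>\<^bsub>?Q\<^esub>"
    using coset[OF one_closed] one by (simp add: quot_algebra_def FactRing_def)
  have hzero: "h \<zero>\<^bsub>B\<^esub> = \<zero>\<^bsub>?Q\<^esub>"
    by (auto simp: quot_algebra_def FactRing_def I fibre)
  have "assoc_algebra R ?Q"
    by (rule assoc_algebra_transport[OF B bij]) (fact hadd hmult hsmult hone hzero)+
  then have "algebra_iso R B ?Q h"
    unfolding algebra_iso_def ring_iso_def ring_hom_def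
    using B bij hadd hmult hsmult hone car by auto
  then show ?thesis using that coset by metis
qed

section \<open>Algebras with a multiplicative basis\<close>

lemma basis_elt_Z2: "basis_elt Z2 x b = (if b = x then 1 else 0)"
  by (simp add: basis_elt_def)

text \<open>The linear extension of \<open>\<phi>\<close> from the basis to functions of finite
  support.\<close>

definition lin :: "(rat \<Rightarrow> 'v \<Rightarrow> 'v) \<Rightarrow> ('b \<Rightarrow> 'v) \<Rightarrow> ('b \<Rightarrow> rat) \<Rightarrow> 'v::ab_group_add" where
  "lin s \<phi> f = (\<Sum>b | f b \<noteq> 0. s (f b) (\<phi> b))"

context
  fixes s :: "rat \<Rightarrow> 'v \<Rightarrow> 'v::ab_group_add"
  assumes s: "Modules.module s"
begin

interpretation s: Modules.module s by (rule s)

lemma lin_superset: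
  assumes "finite S" "{b. f b \<noteq> 0} \<subseteq> S"
  shows "lin s \<phi> f = (\<Sum>b\<in>S. s (f b) (\<phi> b))"
  unfolding lin_def by (rule sum.mono_neutral_left) (use assms in auto)

lemma lin_add:
  assumes "finite {b. f b \<noteq> 0}" "finite {b. g b \<noteq> 0}"
  shows "lin s \<phi> (\<lambda>b. f b + g b) = lin s \<phi> f + lin s \<phi> g"
proof -
  let ?S = "{b. f b \<noteq> 0} \<union> {b. g b \<noteq> 0}"
  have "finite ?S" using assms by simp
  then show ?thesis
    by (subst (1 2 3) lin_superset[of ?S]) (auto simp: s.scale_left_distrib sum.distrib)
qed

lemma lin_smult: "finite {b. f b \<noteq> 0} \<Longrightarrow> lin s \<phi> (\<lambda>b. r * f b) = s r (lin s \<phi> f)"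
  by (subst (1 2) lin_superset[of "{b. f b \<noteq> 0}"]) (auto simp: s.scale_sum_right)

lemma lin_basis_elt [simp]: "lin s \<phi> (basis_elt Z2 b) = \<phi> b"
  by (subst lin_superset[of "{b}"]) (auto simp: basis_elt_Z2)

end

text \<open>Covers the path algebra, where products of basis elements may vanish, and the Burnside
  algebra, where they never do.\<close>

locale Z2_basis =
  fixes B :: "'b set" and m :: "'b \<Rightarrow> 'b \<Rightarrow> 'b option" and E :: "'b set"
  assumes m_closed: "\<lbrakk>x \<in> B; y \<in> B; m x y = Some z\<rbrakk> \<Longrightarrow> z \<in> B"
    and E: "finite E" "E \<subseteq> B"
begin

abbreviation A :: "(rat, 'b \<Rightarrow> rat) module" where "A \<equiv> basis_algebra Z2 B m E"

lemma mem_carrier: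
  "f \<in> carrier A \<longleftrightarrow> (\<forall>b. f b \<in> carrier Z2) \<and> finite {b. f b \<noteq> 0} \<and> {b. f b \<noteq> 0} \<subseteq> B"
  by (simp add: basis_algebra_def)

lemma A_simps:
  "\<zero>\<^bsub>A\<^esub> = (\<lambda>b. 0)" "f \<oplus>\<^bsub>A\<^esub> g = (\<lambda>b. f b + g b)" "r \<odot>\<^bsub>A\<^esub> f = (\<lambda>b. r * f b)"
  "\<one>\<^bsub>A\<^esub> = (\<lambda>b. if b \<in> E then 1 else 0)"
  by (auto simp: basis_algebra_def fun_eq_iff)

lemma add_closed:
  assumes "f \<in> carrier A" "g \<in> carrier A"
  shows "(\<lambda>b. f b + g b) \<in> carrier A"
proof -
  have "{b. f b + g b \<noteq> 0} \<subseteq> {b. f b \<noteq> 0} \<union> {b. g b \<noteq> 0}" by auto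
  moreover have "finite ({b. f b \<noteq> 0} \<union> {b. g b \<noteq> 0})" "{b. f b \<noteq> 0} \<union> {b. g b \<noteq> 0} \<subseteq> B"
    using assms by (auto simp: mem_carrier)
  ultimately have "finite {b. f b + g b \<noteq> 0}" "{b. f b + g b \<noteq> 0} \<subseteq> B"
    by (meson finite_subset, meson subset_trans)
  then show ?thesis using assms by (simp add: mem_carrier)
qed

lemma smult_closed:
  assumes "r \<in> carrier Z2" "f \<in> carrier A"
  shows "(\<lambda>b. r * f b) \<in> carrier A"
proof -
  have "{b. r * f b \<noteq> 0} \<subseteq> {b. f b \<noteq> 0}" by auto
  moreover have "finite {b. f b \<noteq> 0}" "{b. f b \<noteq> 0} \<subseteq> B"
    using assms by (auto simp: mem_carrier)
  ultimately have "finite {b. r * f b \<noteq> 0}" "{b. r * f b \<noteq> 0} \<subseteq> B"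
    by (meson finite_subset, meson subset_trans)
  then show ?thesis using assms by (simp add: mem_carrier)
qed

lemma zero_closed: "(\<lambda>b. 0) \<in> carrier A"
  by (simp add: mem_carrier)

lemma one_closed: "\<one>\<^bsub>A\<^esub> \<in> carrier A"
  using E by (simp add: A_simps mem_carrier)

lemma basis_closed: "x \<in> B \<Longrightarrow> basis_elt Z2 x \<in> carrier A"
  by (simp add: mem_carrier basis_elt_Z2)

lemma abelian_group_A: "abelian_group A"
proof (rule abelian_groupI)
  fix f assume "f \<in> carrier A"
  then have "(\<lambda>b. - 1 * f b) \<in> carrier A" by (intro smult_closed) auto
  then show "\<exists>g\<in>carrier A. g \<oplus>\<^bsub>A\<^esub> f = \<zero>\<^bsub>A\<^esub>"
    by (intro bexI[of _ "\<lambda>b. - 1 * f b"]) (simp_all add: A_simps)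
qed (auto simp: A_simps add_closed zero_closed algebra_simps)

lemma module_A: "Module.module Z2 A"
  by (rule Module.moduleI[OF Z2_cring abelian_group_A])
     (auto simp: A_simps smult_closed algebra_simps)

lemma minus_A: "f \<in> carrier A \<Longrightarrow> g \<in> carrier A \<Longrightarrow> f \<ominus>\<^bsub>A\<^esub> g = (\<lambda>b. f b - g b)"
proof -
  assume f: "f \<in> carrier A" and g: "g \<in> carrier A"
  interpret abelian_group A by (rule abelian_group_A)
  have "(\<lambda>b. - 1 * g b) \<in> carrier A" using g by (intro smult_closed) auto
  then have "\<ominus>\<^bsub>A\<^esub> g = (\<lambda>b. - 1 * g b)"
    using g by (intro minus_equality) (simp_all add: A_simps)
  then show ?thesis by (simp add: a_minus_def A_simps)
qed

text \<open>As a double sum over a rectangle, with zeros for the pairs whose product is not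
  \<open>b\<close>, the product can be treated by exchange of summations.\<close>

lemma mult_A:
  assumes f: "f \<in> carrier A" and g: "g \<in> carrier A"
  shows "(f \<otimes>\<^bsub>A\<^esub> g) b =
    (\<Sum>x | f x \<noteq> 0. \<Sum>y | g y \<noteq> 0. if m x y = Some b then f x * g y else 0)"
proof -
  let ?S = "{x. f x \<noteq> 0}" and ?T = "{y. g y \<noteq> 0}"
  let ?P = "{(x, y). f x \<noteq> 0 \<and> g y \<noteq> 0 \<and> m x y = Some b}"
  have fin: "finite ?S" "finite ?T" and Z: "\<And>x. f x \<in> carrier Z2" "\<And>x. g x \<in> carrier Z2"
    using f g by (auto simp: mem_carrier)
  have P: "?P = {p \<in> ?S \<times> ?T. m (fst p) (snd p) = Some b}" by auto
  have "(f \<otimes>\<^bsub>A\<^esub> g) b = (\<Sum>p\<in>?P. f (fst p) * g (snd p))"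
    by (simp add: basis_algebra_def Z2_finsum Z)
  also have "\<dots> = (\<Sum>p\<in>?S \<times> ?T. if m (fst p) (snd p) = Some b then f (fst p) * g (snd p) else 0)"
    unfolding P by (rule sum.inter_filter) (use fin in simp)
  also have "\<dots> = (\<Sum>x\<in>?S. \<Sum>y\<in>?T. if m x y = Some b then f x * g y else 0)"
    by (simp add: sum.cartesian_product split_beta)
  finally show ?thesis .
qed

lemma mult_nonzero:
  assumes f: "f \<in> carrier A" and g: "g \<in> carrier A" and b: "(f \<otimes>\<^bsub>A\<^esub> g) b \<noteq> 0"
  shows "\<exists>x y. f x \<noteq> 0 \<and> g y \<noteq> 0 \<and> m x y = Some b"
proof (rule ccontr)
  assume "\<not> ?thesis"
  then have "(if m x y = Some b then f x * g y else 0) = 0" for x y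
    by auto
  then have "(f \<otimes>\<^bsub>A\<^esub> g) b = 0"
    unfolding mult_A[OF f g] by simp
  with b show False by simp
qed

lemma supp_mult:
  assumes f: "f \<in> carrier A" and g: "g \<in> carrier A"
  shows "{b. (f \<otimes>\<^bsub>A\<^esub> g) b \<noteq> 0} \<subseteq> the ` (case_prod m ` ({x. f x \<noteq> 0} \<times> {y. g y \<noteq> 0}) - {None})"
proof
  fix b assume "b \<in> {b. (f \<otimes>\<^bsub>A\<^esub> g) b \<noteq> 0}"
  then obtain x y where "f x \<noteq> 0" "g y \<noteq> 0" "m x y = Some b"
    using mult_nonzero[OF f g] by blast
  then show "b \<in> the ` (case_prod m ` ({x. f x \<noteq> 0} \<times> {y. g y \<noteq> 0}) - {None})"
    by (intro image_eqI[of _ _ "Some b"] DiffI image_eqI[of _ _ "(x, y)"]) auto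
qed

lemma mult_closed:
  assumes f: "f \<in> carrier A" and g: "g \<in> carrier A"
  shows "f \<otimes>\<^bsub>A\<^esub> g \<in> carrier A"
proof -
  have "finite {b. (f \<otimes>\<^bsub>A\<^esub> g) b \<noteq> 0}"
    by (rule finite_subset[OF supp_mult[OF f g]]) (use f g in \<open>simp add: mem_carrier\<close>)
  moreover have "{b. (f \<otimes>\<^bsub>A\<^esub> g) b \<noteq> 0} \<subseteq> B"
  proof
    fix b assume "b \<in> {b. (f \<otimes>\<^bsub>A\<^esub> g) b \<noteq> 0}"
    then obtain x y where "f x \<noteq> 0" "g y \<noteq> 0" "m x y = Some b"
      using mult_nonzero[OF f g] by blast
    moreover from this have "x \<in> B" "y \<in> B"
      using f g by (auto simp: mem_carrier)
    ultimately show "b \<in> B" using m_closed by blast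
  qed
  moreover have "(f \<otimes>\<^bsub>A\<^esub> g) b \<in> carrier Z2" for b
    unfolding mult_A[OF f g] using f g by (auto simp: mem_carrier intro!: Z2_sum)
  ultimately show ?thesis by (simp add: mem_carrier)
qed

text \<open>After the exchange of summations, the sum over \<open>b\<close> for a fixed pair
  \<open>(x, y)\<close> has at most one term, that of \<open>m x y\<close>. The map
  \<open>\<phi>\<close> is arbitrary; with rational values the lemma also serves to evaluate
  iterated products at a basis element.\<close>

lemma lin_mult:
  assumes s: "Modules.module s" and f: "f \<in> carrier A" and g: "g \<in> carrier A"
  shows "lin s \<phi> (f \<otimes>\<^bsub>A\<^esub> g) = (\<Sum>x | f x \<noteq> 0. \<Sum>y | g y \<noteq> 0.
    s (f x * g y) (case m x y of None \<Rightarrow> 0 | Some z \<Rightarrow> \<phi> z))"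
proof -
  interpret s: Modules.module s by (rule s)
  let ?S = "{x. f x \<noteq> 0}" and ?T = "{y. g y \<noteq> 0}"
  let ?U = "the ` (case_prod m ` (?S \<times> ?T) - {None})"
  have fin: "finite ?S" "finite ?T" "finite ?U"
    using f g by (auto simp: mem_carrier)
  have "lin s \<phi> (f \<otimes>\<^bsub>A\<^esub> g) = (\<Sum>b\<in>?U. s ((f \<otimes>\<^bsub>A\<^esub> g) b) (\<phi> b))"
    by (rule lin_superset[OF s fin(3) supp_mult[OF f g]])
  also have "\<dots> = (\<Sum>b\<in>?U. \<Sum>x\<in>?S. \<Sum>y\<in>?T. if m x y = Some b then s (f x * g y) (\<phi> b) else 0)"
    unfolding mult_A[OF f g] s.scale_sum_left by (intro sum.cong refl) simp
  also have "\<dots> = (\<Sum>x\<in>?S. \<Sum>b\<in>?U. \<Sum>y\<in>?T. if m x y = Some b then s (f x * g y) (\<phi> b) else 0)"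
    by (rule sum.swap)
  also have "\<dots> = (\<Sum>x\<in>?S. \<Sum>y\<in>?T. \<Sum>b\<in>?U. if m x y = Some b then s (f x * g y) (\<phi> b) else 0)"
    by (intro sum.cong refl sum.swap)
  also have "\<dots> = (\<Sum>x\<in>?S. \<Sum>y\<in>?T. s (f x * g y) (case m x y of None \<Rightarrow> 0 | Some z \<Rightarrow> \<phi> z))"
  proof (intro sum.cong refl)
    fix x y assume xy: "x \<in> ?S" "y \<in> ?T"
    show "(\<Sum>b\<in>?U. if m x y = Some b then s (f x * g y) (\<phi> b) else 0) =
      s (f x * g y) (case m x y of None \<Rightarrow> 0 | Some z \<Rightarrow> \<phi> z)"
    proof (cases "m x y")
      case (Some z)
      then have "z \<in> ?U"
        using xy by (intro image_eqI[of _ _ "Some z"] DiffI image_eqI[of _ _ "(x, y)"]) auto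
      then show ?thesis using fin(3) Some by (simp add: sum.delta)
    qed simp
  qed
  finally show ?thesis .
qed

lemma lin_arr_mult:
  assumes f: "f \<in> carrier A" and g: "g \<in> carrier A"
    and \<phi>: "\<And>x y. x \<in> B \<Longrightarrow> y \<in> B \<Longrightarrow> \<phi> x * \<phi> y = (case m x y of None \<Rightarrow> 0 | Some z \<Rightarrow> \<phi> z)"
  shows "lin arr_smult \<phi> (f \<otimes>\<^bsub>A\<^esub> g) = lin arr_smult \<phi> f * lin arr_smult \<phi> g"
proof -
  have "lin arr_smult \<phi> (f \<otimes>\<^bsub>A\<^esub> g) =
      (\<Sum>x | f x \<noteq> 0. \<Sum>y | g y \<noteq> 0. arr_smult (f x) (\<phi> x) * arr_smult (g y) (\<phi> y))"
    unfolding lin_mult[OF arr.module_axioms f g]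
  proof (intro sum.cong refl)
    fix x y assume "x \<in> {x. f x \<noteq> 0}" "y \<in> {y. g y \<noteq> 0}"
    then have "x \<in> B" "y \<in> B" using f g by (auto simp: mem_carrier)
    then have "\<phi> x * \<phi> y = (case m x y of None \<Rightarrow> 0 | Some z \<Rightarrow> \<phi> z)"
      by (rule \<phi>)
    then show "arr_smult (f x * g y) (case m x y of None \<Rightarrow> 0 | Some z \<Rightarrow> \<phi> z) =
        arr_smult (f x) (\<phi> x) * arr_smult (g y) (\<phi> y)"
      by (simp only: arr_smult_mult arr.scale_scale mult.commute[of "g y"])
  qed
  also have "\<dots> = lin arr_smult \<phi> f * lin arr_smult \<phi> g"
    unfolding lin_def sum_product ..
  finally show ?thesis .
qed

lemma basis_mult:
  assumes "x \<in> B" "y \<in> B"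
  shows "basis_elt Z2 x \<otimes>\<^bsub>A\<^esub> basis_elt Z2 y = (case m x y of None \<Rightarrow> \<zero>\<^bsub>A\<^esub> | Some z \<Rightarrow> basis_elt Z2 z)"
proof -
  have "{b. basis_elt Z2 x b \<noteq> 0} = {x}" for x :: 'b by (auto simp: basis_elt_Z2)
  then show ?thesis
    by (auto simp: fun_eq_iff mult_A[OF basis_closed basis_closed] assms A_simps basis_elt_Z2
        split: option.split)
qed

text \<open>The function is built up from its restrictions to finite subsets of its support. The set
  \<open>S\<close> keeps track of which basis elements can occur.\<close>

lemma span_induct [consumes 2, case_names zero add smult]:
  assumes f: "f \<in> carrier A" and S: "{b. f b \<noteq> 0} \<subseteq> S"
    and zero: "P (\<lambda>b. 0)"
    and add: "\<And>f g. \<lbrakk>f \<in> carrier A; g \<in> carrier A; P f; P g\<rbrakk> \<Longrightarrow> P (f \<oplus>\<^bsub>A\<^esub> g)"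
    and smult: "\<And>r b. \<lbrakk>r \<in> carrier Z2; b \<in> B; b \<in> S\<rbrakk> \<Longrightarrow> P (r \<odot>\<^bsub>A\<^esub> basis_elt Z2 b)"
  shows "P f"
proof -
  have "P (\<lambda>b. if b \<in> F then f b else 0)" if "finite F" "F \<subseteq> {b. f b \<noteq> 0}" for F
    using that
  proof (induction F)
    case empty
    then show ?case using zero by simp
  next
    case (insert x F)
    let ?g = "\<lambda>b. if b \<in> F then f b else 0"
    have "{b. ?g b \<noteq> 0} \<subseteq> {b. f b \<noteq> 0}" by auto
    then have g: "?g \<in> carrier A"
      using f insert by (auto simp: mem_carrier intro: finite_subset[OF _ insert.hyps(1)])
    have x: "x \<in> B" "x \<in> S" "f x \<in> carrier Z2"
      using f S insert by (auto simp: mem_carrier)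
    have h: "f x \<odot>\<^bsub>A\<^esub> basis_elt Z2 x \<in> carrier A"
      using smult_closed[OF x(3) basis_closed[OF x(1)]] by (simp add: A_simps)
    have "(\<lambda>b. if b \<in> insert x F then f b else 0) = ?g \<oplus>\<^bsub>A\<^esub> (f x \<odot>\<^bsub>A\<^esub> basis_elt Z2 x)"
      using insert by (auto simp: A_simps basis_elt_Z2)
    moreover have "P ?g" using insert by blast
    ultimately show ?case using add[OF g h] smult[OF x(3,1,2)] by (simp only:)
  qed
  then have "P (\<lambda>b. if b \<in> {b. f b \<noteq> 0} then f b else 0)"
    using f by (simp only: mem_carrier)
  moreover have "(\<lambda>b. if b \<in> {b. f b \<noteq> 0} then f b else 0) = f" by auto
  ultimately show ?thesis by (simp only:)
qed

text \<open>Both bracketings expand to one triple sum over the supports, where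
  \<open>Option.bind\<close> lets vanishing products propagate. For the unit, exactly one element of
  \<open>E\<close> survives next to a given basis element, and it acts as the identity.\<close>

lemma assoc_algebra_A:
  assumes assoc: "\<And>x y z. \<lbrakk>x \<in> B; y \<in> B; z \<in> B\<rbrakk>
      \<Longrightarrow> Option.bind (m x y) (\<lambda>p. m p z) = Option.bind (m y z) (m x)"
    and unit: "\<And>x. x \<in> B \<Longrightarrow> \<exists>e\<in>E. \<forall>e'\<in>E. m e' x = (if e' = e then Some x else None)"
      "\<And>x. x \<in> B \<Longrightarrow> \<exists>e\<in>E. \<forall>e'\<in>E. m x e' = (if e' = e then Some x else None)"
  shows "assoc_algebra Z2 A"
proof -
  have rat: "Modules.module ((*) :: rat \<Rightarrow> rat \<Rightarrow> rat)"
    by (rule Modules.module.intro) (simp_all add: algebra_simps)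
  note lm = lin_mult[OF rat]
  have supp_one: "{b. \<one>\<^bsub>A\<^esub> b \<noteq> 0} = E" by (auto simp: A_simps)
  have "ring A"
  proof (rule ringI[OF abelian_group_A monoidI])
    fix f g h assume f: "f \<in> carrier A" and g: "g \<in> carrier A" and h: "h \<in> carrier A"
    note fg = mult_closed[OF f g] and gh = mult_closed[OF g h]
    have B: "x \<in> B" if "f x \<noteq> 0 \<or> g x \<noteq> 0 \<or> h x \<noteq> 0" for x
      using that f g h by (auto simp: mem_carrier)
    show "(f \<otimes>\<^bsub>A\<^esub> g) \<otimes>\<^bsub>A\<^esub> h = f \<otimes>\<^bsub>A\<^esub> (g \<otimes>\<^bsub>A\<^esub> h)"
    proof
      fix b
      \<comment> \<open>The value at \<open>b\<close> of a product with \<open>h\<close> is a linear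
        extension, with rational values, evaluated at \<open>f g\<close>; so \<open>lin_mult\<close>
        expands the inner product.\<close>
      let ?c = "\<lambda>x y z. if Option.bind (m x y) (\<lambda>p. m p z) = Some b then f x * g y * h z else 0"
      have "((f \<otimes>\<^bsub>A\<^esub> g) \<otimes>\<^bsub>A\<^esub> h) b =
          lin (*) (\<lambda>p. \<Sum>z | h z \<noteq> 0. if m p z = Some b then h z else 0) (f \<otimes>\<^bsub>A\<^esub> g)"
        unfolding mult_A[OF fg h] lin_def by (simp add: sum_distrib_left if_distrib cong: if_cong)
      also have "\<dots> = (\<Sum>x | f x \<noteq> 0. \<Sum>y | g y \<noteq> 0. \<Sum>z | h z \<noteq> 0. ?c x y z)"
        unfolding lm[OF f g]
        by (intro sum.cong refl) (auto simp: sum_distrib_left split: option.split intro!: sum.cong)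
      also have "\<dots> = (\<Sum>y | g y \<noteq> 0. \<Sum>x | f x \<noteq> 0. \<Sum>z | h z \<noteq> 0. ?c x y z)"
        by (rule sum.swap)
      also have "\<dots> = (\<Sum>y | g y \<noteq> 0. \<Sum>z | h z \<noteq> 0. \<Sum>x | f x \<noteq> 0. ?c x y z)"
        by (intro sum.cong refl sum.swap)
      also have "\<dots> = lin (*) (\<lambda>p. \<Sum>x | f x \<noteq> 0. if m x p = Some b then f x else 0) (g \<otimes>\<^bsub>A\<^esub> h)"
        unfolding lm[OF g h]
        by (intro sum.cong refl)
           (auto simp: sum_distrib_left assoc B split: option.split intro!: sum.cong)
      also have "\<dots> = (\<Sum>p | (g \<otimes>\<^bsub>A\<^esub> h) p \<noteq> 0. \<Sum>x | f x \<noteq> 0.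
          if m x p = Some b then f x * (g \<otimes>\<^bsub>A\<^esub> h) p else 0)"
        unfolding lin_def by (simp add: sum_distrib_left if_distrib mult.commute cong: if_cong)
      also have "\<dots> = (f \<otimes>\<^bsub>A\<^esub> (g \<otimes>\<^bsub>A\<^esub> h)) b"
        unfolding mult_A[OF f gh] by (rule sum.swap)
      finally show "((f \<otimes>\<^bsub>A\<^esub> g) \<otimes>\<^bsub>A\<^esub> h) b = (f \<otimes>\<^bsub>A\<^esub> (g \<otimes>\<^bsub>A\<^esub> h)) b" .
    qed
    have fin: "finite {x. f x \<noteq> 0}" "finite {x. g x \<noteq> 0}" "finite {x. h x \<noteq> 0}"
      using f g h by (auto simp: mem_carrier)
    have "(f \<otimes>\<^bsub>A\<^esub> g) b = (\<Sum>x\<in>S. \<Sum>y\<in>T. if m x y = Some b then f x * g y else 0)"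
      if "finite S" "{x. f x \<noteq> 0} \<subseteq> S" "finite T" "{x. g x \<noteq> 0} \<subseteq> T"
        "f \<in> carrier A" "g \<in> carrier A" for S T f g b
    proof -
      have "(f \<otimes>\<^bsub>A\<^esub> g) b = (\<Sum>x\<in>S. \<Sum>y | g y \<noteq> 0. if m x y = Some b then f x * g y else 0)"
        unfolding mult_A[OF that(5,6)]
        by (rule sum.mono_neutral_left[OF that(1,2)]) (simp cong: if_cong)
      also have "\<dots> = (\<Sum>x\<in>S. \<Sum>y\<in>T. if m x y = Some b then f x * g y else 0)"
        by (intro sum.cong refl sum.mono_neutral_left[OF that(3,4)]) (simp cong: if_cong)
      finally show ?thesis .
    qed
    note sup = this
    \<comment> \<open>The supports of \<open>f\<close>, \<open>g\<close> and their sum differ, so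
      distributivity is checked over a common finite superset.\<close>
    let ?S = "{x. f x \<noteq> 0} \<union> {x. g x \<noteq> 0}" and ?T = "{x. h x \<noteq> 0}"
    have "f x + g x = 0" if "f x = 0" "g x = 0" for x
      using that by simp
    then have S: "finite ?S" "{x. f x \<noteq> 0} \<subseteq> ?S" "{x. g x \<noteq> 0} \<subseteq> ?S"
        "{x. f x + g x \<noteq> 0} \<subseteq> ?S"
      using fin(1,2) by (simp, blast+)
    note fg = add_closed[OF f g]
    show "(f \<oplus>\<^bsub>A\<^esub> g) \<otimes>\<^bsub>A\<^esub> h = f \<otimes>\<^bsub>A\<^esub> h \<oplus>\<^bsub>A\<^esub> g \<otimes>\<^bsub>A\<^esub> h"
      unfolding A_simps
    proof
      fix b
      show "((\<lambda>b. f b + g b) \<otimes>\<^bsub>A\<^esub> h) b = (f \<otimes>\<^bsub>A\<^esub> h) b + (g \<otimes>\<^bsub>A\<^esub> h) b"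
        unfolding sup[OF S(1,4) fin(3) order_refl fg h] sup[OF S(1,2) fin(3) order_refl f h]
          sup[OF S(1,3) fin(3) order_refl g h] sum.distrib[symmetric]
        by (intro sum.cong refl) (simp add: distrib_right)
    qed
    show "h \<otimes>\<^bsub>A\<^esub> (f \<oplus>\<^bsub>A\<^esub> g) = h \<otimes>\<^bsub>A\<^esub> f \<oplus>\<^bsub>A\<^esub> h \<otimes>\<^bsub>A\<^esub> g"
      unfolding A_simps
    proof
      fix b
      show "(h \<otimes>\<^bsub>A\<^esub> (\<lambda>b. f b + g b)) b = (h \<otimes>\<^bsub>A\<^esub> f) b + (h \<otimes>\<^bsub>A\<^esub> g) b"
        unfolding sup[OF fin(3) order_refl S(1,4) h fg] sup[OF fin(3) order_refl S(1,2) h f]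
          sup[OF fin(3) order_refl S(1,3) h g] sum.distrib[symmetric]
        by (intro sum.cong refl) (simp add: distrib_left)
    qed
  next
    fix f assume f: "f \<in> carrier A"
    then have fin: "finite {x. f x \<noteq> 0}" and B: "\<And>x. f x \<noteq> 0 \<Longrightarrow> x \<in> B" by (auto simp: mem_carrier)
    have delta: "(\<Sum>x | f x \<noteq> 0. if x = b then f x else 0) = f b" for b
      using fin by (simp add: sum.delta)
    show "\<one>\<^bsub>A\<^esub> \<otimes>\<^bsub>A\<^esub> f = f"
    proof
      fix b
      have "(\<one>\<^bsub>A\<^esub> \<otimes>\<^bsub>A\<^esub> f) b = (\<Sum>x | f x \<noteq> 0. \<Sum>e\<in>E. if m e x = Some b then f x else 0)"
        unfolding mult_A[OF one_closed f] supp_one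
        by (subst sum.swap) (auto simp: A_simps intro!: sum.cong)
      also have "\<dots> = (\<Sum>x | f x \<noteq> 0. if x = b then f x else 0)"
      proof (intro sum.cong refl)
        fix x assume "x \<in> {x. f x \<noteq> 0}"
        then obtain e where e: "e \<in> E" "\<And>e'. e' \<in> E \<Longrightarrow> m e' x = (if e' = e then Some x else None)"
          using unit(1)[of x] B by blast
        have "(\<Sum>e\<in>E. if m e x = Some b then f x else 0) = (\<Sum>e'\<in>E. if e' = e then (if x = b then f x else 0) else 0)"
          by (intro sum.cong refl) (auto simp: e)
        then show "(\<Sum>e\<in>E. if m e x = Some b then f x else 0) = (if x = b then f x else 0)"
          using E e by (simp add: sum.delta)
      qed
      finally show "(\<one>\<^bsub>A\<^esub> \<otimes>\<^bsub>A\<^esub> f) b = f b" by (simp add: delta)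
    qed
    show "f \<otimes>\<^bsub>A\<^esub> \<one>\<^bsub>A\<^esub> = f"
    proof
      fix b
      have "(f \<otimes>\<^bsub>A\<^esub> \<one>\<^bsub>A\<^esub>) b = (\<Sum>x | f x \<noteq> 0. \<Sum>e\<in>E. if m x e = Some b then f x else 0)"
        unfolding mult_A[OF f one_closed] supp_one
        by (auto simp: A_simps intro!: sum.cong)
      also have "\<dots> = (\<Sum>x | f x \<noteq> 0. if x = b then f x else 0)"
      proof (intro sum.cong refl)
        fix x assume "x \<in> {x. f x \<noteq> 0}"
        then obtain e where e: "e \<in> E" "\<And>e'. e' \<in> E \<Longrightarrow> m x e' = (if e' = e then Some x else None)"
          using unit(2)[of x] B by blast
        have "(\<Sum>e\<in>E. if m x e = Some b then f x else 0) = (\<Sum>e'\<in>E. if e' = e then (if x = b then f x else 0) else 0)"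
          by (intro sum.cong refl) (auto simp: e)
        then show "(\<Sum>e\<in>E. if m x e = Some b then f x else 0) = (if x = b then f x else 0)"
          using E e by (simp add: sum.delta)
      qed
      finally show "(f \<otimes>\<^bsub>A\<^esub> \<one>\<^bsub>A\<^esub>) b = f b" by (simp add: delta)
    qed
  qed (auto simp: mult_closed one_closed)
  moreover have "assoc_algebra_axioms Z2 A"
  proof
    fix r f g assume r: "r \<in> carrier Z2" and f: "f \<in> carrier A" and g: "g \<in> carrier A"
    have rf: "(\<lambda>b. r * f b) \<in> carrier A" "(\<lambda>b. r * g b) \<in> carrier A"
      using smult_closed r f g by auto
    show "(r \<odot>\<^bsub>A\<^esub> f) \<otimes>\<^bsub>A\<^esub> g = r \<odot>\<^bsub>A\<^esub> (f \<otimes>\<^bsub>A\<^esub> g)" "f \<otimes>\<^bsub>A\<^esub> (r \<odot>\<^bsub>A\<^esub> g) = r \<odot>\<^bsub>A\<^esub> (f \<otimes>\<^bsub>A\<^esub> g)"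
      unfolding A_simps using f g rf
      by (cases "r = 0"; auto simp: mult_A sum_distrib_left if_distrib mult_ac cong: if_cong)+
  qed
  ultimately show ?thesis
    using module_A by (simp add: assoc_algebra_def)
qed

section \<open>Reduction to normal forms modulo a submodule\<close>

definition stable :: "('b \<Rightarrow> rat) set \<Rightarrow> bool" where
  "stable J \<longleftrightarrow> J \<subseteq> carrier A \<and> \<zero>\<^bsub>A\<^esub> \<in> J \<and> (\<forall>f\<in>J. \<forall>g\<in>J. f \<oplus>\<^bsub>A\<^esub> g \<in> J) \<and>
     (\<forall>r\<in>carrier Z2. \<forall>f\<in>J. r \<odot>\<^bsub>A\<^esub> f \<in> J)"

text \<open>\<open>N\<close> is the set of normal forms: modulo \<open>J\<close>, the element is a
  combination of basis elements from \<open>N\<close>.\<close>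

definition reducible :: "('b \<Rightarrow> rat) set \<Rightarrow> 'b set \<Rightarrow> ('b \<Rightarrow> rat) \<Rightarrow> bool" where
  "reducible J N f \<longleftrightarrow> f \<in> carrier A \<and>
     (\<exists>g\<in>carrier A. {p. g p \<noteq> 0} \<subseteq> N \<and> f \<ominus>\<^bsub>A\<^esub> g \<in> J)"

context
  fixes J and N :: "'b set" assumes J: "stable J"
begin

lemma reducible_mod:
  assumes f: "f \<in> carrier A" and g: "reducible J N g" and fg: "f \<ominus>\<^bsub>A\<^esub> g \<in> J"
  shows "reducible J N f"
proof -
  obtain h where h: "h \<in> carrier A" "{p. h p \<noteq> 0} \<subseteq> N" "g \<ominus>\<^bsub>A\<^esub> h \<in> J"
    and gc: "g \<in> carrier A"
    using g by (auto simp: reducible_def)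
  have "(f \<ominus>\<^bsub>A\<^esub> g) \<oplus>\<^bsub>A\<^esub> (g \<ominus>\<^bsub>A\<^esub> h) \<in> J"
    using J fg h(3) unfolding stable_def by blast
  then have "f \<ominus>\<^bsub>A\<^esub> h \<in> J"
    using f gc h by (simp add: minus_A A_simps)
  then show ?thesis using f h by (auto simp: reducible_def)
qed

lemma reducible_null: "f \<in> J \<Longrightarrow> reducible J N f"
proof -
  assume f: "f \<in> J"
  then have "f \<in> carrier A" using J by (auto simp: stable_def)
  then show ?thesis
    using f zero_closed by (auto simp: reducible_def minus_A intro!: bexI[of _ "\<lambda>b. 0"])
qed

lemma reducible_add:
  assumes "reducible J N f" "reducible J N g"
  shows "reducible J N (f \<oplus>\<^bsub>A\<^esub> g)"
proof -
  obtain h k where h: "h \<in> carrier A" "{p. h p \<noteq> 0} \<subseteq> N" "f \<ominus>\<^bsub>A\<^esub> h \<in> J"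
    and k: "k \<in> carrier A" "{p. k p \<noteq> 0} \<subseteq> N" "g \<ominus>\<^bsub>A\<^esub> k \<in> J"
    and fg: "f \<in> carrier A" "g \<in> carrier A"
    using assms by (auto simp: reducible_def)
  have "(f \<ominus>\<^bsub>A\<^esub> h) \<oplus>\<^bsub>A\<^esub> (g \<ominus>\<^bsub>A\<^esub> k) \<in> J"
    using J h(3) k(3) unfolding stable_def by blast
  then have 1: "(f \<oplus>\<^bsub>A\<^esub> g) \<ominus>\<^bsub>A\<^esub> (h \<oplus>\<^bsub>A\<^esub> k) \<in> J"
    using fg h k by (simp add: minus_A A_simps add_closed algebra_simps)
  have "h p + k p = 0" if "p \<notin> N" for p
  proof -
    have "h p = 0" "k p = 0" using that h(2) k(2) by blast+
    then show ?thesis by simp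
  qed
  then have 2: "{p. (h \<oplus>\<^bsub>A\<^esub> k) p \<noteq> 0} \<subseteq> N"
    by (auto simp: A_simps)
  have "h \<oplus>\<^bsub>A\<^esub> k \<in> carrier A" "f \<oplus>\<^bsub>A\<^esub> g \<in> carrier A"
    unfolding A_simps using add_closed fg h(1) k(1) by blast+
  then show ?thesis
    unfolding reducible_def using 1 2 by blast
qed

lemma reducible_smult:
  assumes r: "r \<in> carrier Z2" and "reducible J N f"
  shows "reducible J N (r \<odot>\<^bsub>A\<^esub> f)"
proof -
  obtain h where h: "h \<in> carrier A" "{p. h p \<noteq> 0} \<subseteq> N" "f \<ominus>\<^bsub>A\<^esub> h \<in> J"
    and f: "f \<in> carrier A"
    using assms by (auto simp: reducible_def)
  have "r \<odot>\<^bsub>A\<^esub> (f \<ominus>\<^bsub>A\<^esub> h) \<in> J" using J r h(3) unfolding stable_def by blast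
  then have 1: "(r \<odot>\<^bsub>A\<^esub> f) \<ominus>\<^bsub>A\<^esub> (r \<odot>\<^bsub>A\<^esub> h) \<in> J"
    using f h smult_closed[OF r f] smult_closed[OF r h(1)]
    by (simp add: minus_A A_simps algebra_simps)
  have 2: "{p. (r \<odot>\<^bsub>A\<^esub> h) p \<noteq> 0} \<subseteq> N"
    using h(2) by (auto simp: A_simps)
  have "r \<odot>\<^bsub>A\<^esub> h \<in> carrier A" "r \<odot>\<^bsub>A\<^esub> f \<in> carrier A"
    unfolding A_simps using smult_closed r f h(1) by blast+
  then show ?thesis
    unfolding reducible_def using 1 2 by blast
qed

lemma reducible_basis:
  assumes p: "p \<in> N" "p \<in> B"
  shows "reducible J N (basis_elt Z2 p)"
proof -
  have c: "basis_elt Z2 p \<in> carrier A" by (rule basis_closed[OF p(2)])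
  have "{q. basis_elt Z2 p q \<noteq> 0} \<subseteq> N"
    using p by (auto simp: basis_elt_Z2 split: if_splits)
  moreover have "basis_elt Z2 p \<ominus>\<^bsub>A\<^esub> basis_elt Z2 p \<in> J"
    using J unfolding minus_A[OF c c] stable_def A_simps by simp
  ultimately show ?thesis
    unfolding reducible_def using c by blast
qed

lemma reducible_all:
  assumes basis: "\<And>b. b \<in> B \<Longrightarrow> reducible J N (basis_elt Z2 b)" and f: "f \<in> carrier A"
  shows "reducible J N f"
proof (rule span_induct[OF f, of B "reducible J N"])
  show "{b. f b \<noteq> 0} \<subseteq> B" using f unfolding mem_carrier by blast
  show "reducible J N (\<lambda>b. 0)" using reducible_null J unfolding stable_def A_simps by blast
  show "reducible J N (r \<odot>\<^bsub>A\<^esub> basis_elt Z2 b)" if "r \<in> carrier Z2" "b \<in> B" for r b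
    using that by (intro reducible_smult basis)
qed (rule reducible_add)

text \<open>Let \<open>g\<close> be the normal form of an element of the kernel. As \<open>J\<close>
  is mapped to zero, \<open>g\<close> lies in the kernel too, so it vanishes by independence, and
  the element itself lies in \<open>J\<close>.\<close>

lemma kernel_eq:
  assumes basis: "\<And>b. b \<in> B \<Longrightarrow> reducible J N (basis_elt Z2 b)"
    and null: "\<And>f. f \<in> J \<Longrightarrow> lin arr_smult \<phi> f = 0"
    and inj: "\<And>g p. \<lbrakk>g \<in> carrier A; {p. g p \<noteq> 0} \<subseteq> N; lin arr_smult \<phi> g = 0; p \<in> N\<rbrakk> \<Longrightarrow> g p = 0"
  shows "{f \<in> carrier A. lin arr_smult \<phi> f = 0} = J"
proof (intro equalityI subsetI)
  fix f assume "f \<in> {f \<in> carrier A. lin arr_smult \<phi> f = 0}"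
  then have f: "f \<in> carrier A" "lin arr_smult \<phi> f = 0" by auto
  obtain g where g: "g \<in> carrier A" "{p. g p \<noteq> 0} \<subseteq> N" "f \<ominus>\<^bsub>A\<^esub> g \<in> J"
    using reducible_all[OF basis f(1)] by (auto simp: reducible_def)
  have c: "f \<ominus>\<^bsub>A\<^esub> g \<in> carrier A" using J g(3) by (auto simp: stable_def)
  have "f = (\<lambda>b. (f \<ominus>\<^bsub>A\<^esub> g) b + g b)"
    by (simp add: minus_A f g)
  then have "lin arr_smult \<phi> f = lin arr_smult \<phi> (f \<ominus>\<^bsub>A\<^esub> g) + lin arr_smult \<phi> g"
    using lin_add[OF arr.module_axioms, of "f \<ominus>\<^bsub>A\<^esub> g" g \<phi>] c g(1) by (simp add: mem_carrier)
  then have "lin arr_smult \<phi> g = 0" using null[OF g(3)] f(2) by simp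
  then have "g p = 0" if "p \<in> N" for p
    using inj[OF g(1,2)] that by simp
  moreover have "g p = 0" if "p \<notin> N" for p
    using that g(2) by blast
  ultimately have "g p = 0" for p by (cases "p \<in> N")
  then have "g = (\<lambda>b. 0)" by (rule ext)
  then show "f \<in> J" using g(3) f(1) zero_closed by (simp add: minus_A)
next
  fix f assume "f \<in> J"
  then show "f \<in> {f \<in> carrier A. lin arr_smult \<phi> f = 0}" using null J by (auto simp: stable_def)
qed

end

end

section \<open>The path algebra\<close>

text \<open>A recursive form of \<open>awalk\<close>, which the simplifier decides on concrete
  paths.\<close>

fun walk :: "vertex \<Rightarrow> arrow list \<Rightarrow> vertex \<Rightarrow> bool" where
  "walk u [] v \<longleftrightarrow> u = v"
| "walk u (a # p) v \<longleftrightarrow> source a = u \<and> walk (target a) p v"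

lemma mem_paths [simp]: "(u, p, v) \<in> paths Psi \<longleftrightarrow> walk u p v"
proof -
  have "pre_digraph.cas Psi u p v \<longleftrightarrow> walk u p v"
    by (induction p arbitrary: u) (auto simp: pre_digraph.cas.simps Psi_def)
  then show ?thesis by (simp add: paths_def pre_digraph.awalk_def Psi_def)
qed

lemma walk_append: "walk u (p @ q) w \<longleftrightarrow> (\<exists>v. walk u p v \<and> walk v q w)"
  by (induction p arbitrary: u) auto

lemma trivial_paths:
  "{(v, [] :: arrow list, v) | v. v \<in> verts Psi} = {(E3, [], E3), (E4, [], E4), (E5, [], E5)}"
proof -
  have "v \<in> {E3, E4, E5}" for v by (cases v) auto
  then show ?thesis by (auto simp: Psi_def)
qed

interpretation path: Z2_basis "paths Psi" path_comp "{(v, [], v) | v. v \<in> verts Psi}"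
proof
  fix x y z assume "x \<in> paths Psi" "y \<in> paths Psi" "path_comp x y = Some z"
  then show "z \<in> paths Psi"
    by (cases x; cases y) (auto simp: walk_append split: if_splits)
next
  show "finite {(v, [] :: arrow list, v) | v. v \<in> verts Psi}"
    unfolding trivial_paths by simp
qed auto

lemma RPsi_eq: "RPsi = path.A"
  by (simp add: path_algebra_def)

lemma RPsi_algebra: "assoc_algebra Z2 RPsi"
  unfolding RPsi_eq
proof (rule path.assoc_algebra_A)
  fix x y z :: "(vertex, arrow) path"
  show "Option.bind (path_comp x y) (\<lambda>p. path_comp p z) = Option.bind (path_comp y z) (path_comp x)"
    by (cases x; cases y; cases z) auto
next
  fix x :: "(vertex, arrow) path"
  obtain u p v where x: "x = (u, p, v)" by (cases x)
  show "\<exists>e\<in>{(v, [], v) | v. v \<in> verts Psi}. \<forall>e'\<in>{(v, [], v) | v. v \<in> verts Psi}.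
      path_comp e' x = (if e' = e then Some x else None)"
    by (rule bexI[of _ "(u, [], u)"]) (auto simp: x Psi_def)
  show "\<exists>e\<in>{(v, [], v) | v. v \<in> verts Psi}. \<forall>e'\<in>{(v, [], v) | v. v \<in> verts Psi}.
      path_comp x e' = (if e' = e then Some x else None)"
    by (rule bexI[of _ "(v, [], v)"]) (auto simp: x Psi_def)
qed

interpretation RPsi: assoc_algebra Z2 path.A
  using RPsi_algebra by (simp only: RPsi_eq)

lemma arrw_eq: "arrw a = basis_elt Z2 (source a, [a], target a)"
  by (simp add: arrow_elt_def Psi_def)

fun vimg :: "vertex \<Rightarrow> arr" where
  "vimg E3 = e3" | "vimg E4 = e4" | "vimg E5 = e5"

fun aimg :: "arrow \<Rightarrow> arr" where
  "aimg T1 = tau1" | "aimg T2 = tau2" | "aimg T3 = tau3" | "aimg T4 = tau4" | "aimg T7 = tau7"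

text \<open>Every product ends with the idempotent of the last vertex, which the last arrow absorbs
  by \<open>vimg_aimg\<close>; trivial paths are thus treated uniformly.\<close>

fun pimg :: "(vertex, arrow) path \<Rightarrow> arr" where
  "pimg (u, [], v) = vimg u"
| "pimg (u, a # p, v) = aimg a * pimg (target a, p, v)"

lemmas gens_def = e3_def e4_def e5_def tau1_def tau2_def tau3_def tau4_def tau7_def

lemma vimg_vimg: "vimg u * vimg v = (if u = v then vimg u else 0)"
  unfolding arr_eq_iff forall_3
  by (cases u; cases v) (simp_all add: gens_def arr_mult_entry sum_3 axis_def)

lemma vimg_aimg: "vimg (source a) * aimg a = aimg a" "aimg a * vimg (target a) = aimg a"
  unfolding arr_eq_iff forall_3
  by (cases a; simp add: gens_def arr_mult_entry sum_3 axis_def)+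

lemma pimg_unit: "walk u p v \<Longrightarrow> vimg u * pimg (u, p, v) = pimg (u, p, v)"
  by (cases p) (auto simp: vimg_vimg vimg_aimg mult.assoc[symmetric])

lemma pimg_append:
  "walk u p v \<Longrightarrow> walk v q w \<Longrightarrow> pimg (u, p, v) * pimg (v, q, w) = pimg (u, p @ q, w)"
  by (induction p arbitrary: u) (auto simp: pimg_unit mult.assoc)

text \<open>The idempotents at the end of \<open>x\<close> and at the start of \<open>y\<close> can
  be inserted between the factors. They are orthogonal when the paths do not compose.\<close>

lemma pimg_mult:
  assumes "x \<in> paths Psi" "y \<in> paths Psi"
  shows "pimg x * pimg y = (case path_comp x y of None \<Rightarrow> 0 | Some z \<Rightarrow> pimg z)"
proof -
  obtain u p v u' q w where xy: "x = (u, p, v)" "y = (u', q, w)" by (cases x; cases y)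
  have w: "walk u p v" "walk u' q w" using assms xy by auto
  have "pimg x = pimg x * vimg v"
    using pimg_append[of u p v "[]" v] w by (simp add: xy)
  moreover have "pimg y = vimg u' * pimg y"
    using pimg_unit[OF w(2)] by (simp add: xy)
  ultimately have "pimg x * pimg y = pimg x * (vimg v * vimg u') * pimg y"
    by (metis mult.assoc)
  moreover have "pimg x * pimg y = pimg (u, p @ q, w)" if "v = u'"
    using that w by (simp add: xy pimg_append)
  ultimately show ?thesis by (auto simp: xy vimg_vimg)
qed

lemma submodule_arr_sum:
  assumes S: "submodule_arr S u" and f: "\<And>i. i \<in> I \<Longrightarrow> f i \<in> S"
  shows "sum f I \<in> S"
proof -
  have "arr_smult 0 u \<in> S" using S unfolding submodule_arr_def by (metis Z2_numeral(1))
  then have "0 \<in> S" by simp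
  then show ?thesis
    using f S by (induction I rule: infinite_finite_induct) (auto simp: submodule_arr_def)
qed

lemma gens_corner: "vimg u \<in> corner" "aimg a \<in> corner"
proof -
  \<comment> \<open>The last membership serves \<open>tau7\<close>, where
    \<open>2 * w - 2 * z1 - z2 = - 8\<close>.\<close>
  have "4 \<in> Z2mult 4" "2 \<in> Z2mult 2" "- 8 \<in> Z2mult 8"
    by (auto simp: Z2mult_def intro: image_eqI[of _ _ 1] image_eqI[of _ _ "- 1"])
  note m = this
  have "vimg u \<in> Lambda_carrier"
    using m by (cases u; simp add: mem_Lambda gens_def axis_def)
  moreover have "aimg a \<in> Lambda_carrier"
    using m by (cases a; simp add: mem_Lambda gens_def axis_def)
  moreover have "eps * vimg u = vimg u" "vimg u * eps = vimg u"
    unfolding arr_eq_iff forall_3 by (cases u; simp add: gens_def arr_mult_entry sum_3 axis_def)+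
  moreover have "eps * aimg a = aimg a" "aimg a * eps = aimg a"
    unfolding arr_eq_iff forall_3 by (cases a; simp add: gens_def arr_mult_entry sum_3 axis_def)+
  ultimately show "vimg u \<in> corner" "aimg a \<in> corner" by (simp_all add: corner_def)
qed

lemma pimg_corner: "pimg p \<in> corner"
  by (induction p rule: pimg.induct) (use gens_corner submodule_corner in \<open>auto simp: submodule_arr_def\<close>)

definition theta :: "((vertex, arrow) path \<Rightarrow> rat) \<Rightarrow> arr" where
  "theta = lin arr_smult pimg"

lemma theta_corner: "f \<in> carrier path.A \<Longrightarrow> theta f \<in> corner"
  unfolding theta_def lin_def
  by (rule submodule_arr_sum[OF submodule_corner])
     (use submodule_corner pimg_corner in \<open>auto simp: submodule_arr_def path.mem_carrier\<close>)

lemma theta_add: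
  "f \<in> carrier path.A \<Longrightarrow> g \<in> carrier path.A \<Longrightarrow> theta (f \<oplus>\<^bsub>path.A\<^esub> g) = theta f + theta g"
  by (simp add: theta_def path.A_simps lin_add[OF arr.module_axioms] path.mem_carrier)

lemma theta_smult: "f \<in> carrier path.A \<Longrightarrow> theta (r \<odot>\<^bsub>path.A\<^esub> f) = arr_smult r (theta f)"
  by (simp add: theta_def path.A_simps lin_smult[OF arr.module_axioms] path.mem_carrier)

lemma theta_mult:
  "f \<in> carrier path.A \<Longrightarrow> g \<in> carrier path.A \<Longrightarrow> theta (f \<otimes>\<^bsub>path.A\<^esub> g) = theta f * theta g"
  unfolding theta_def by (rule path.lin_arr_mult) (auto simp: pimg_mult)

lemma theta_basis [simp]: "theta (basis_elt Z2 p) = pimg p"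
  by (simp add: theta_def lin_basis_elt[OF arr.module_axioms])

lemma theta_one: "theta \<one>\<^bsub>path.A\<^esub> = eps"
proof -
  let ?E = "{(E3, [] :: arrow list, E3), (E4, [], E4), (E5, [], E5)}"
  have one: "\<one>\<^bsub>path.A\<^esub> = (\<lambda>b. if b \<in> ?E then 1 else 0)"
    unfolding path.A_simps(4) unfolding trivial_paths ..
  have "theta \<one>\<^bsub>path.A\<^esub> = (\<Sum>b\<in>?E. arr_smult (\<one>\<^bsub>path.A\<^esub> b) (pimg b))"
    unfolding theta_def by (rule lin_superset[OF arr.module_axioms]) (auto simp: one split: if_splits)
  also have "\<dots> = e3 + (e4 + e5)" by (simp add: one)
  finally show ?thesis by (simp add: eps_def add.assoc)
qed

text \<open>Modulo the ideal, every path is a combination of the following ten.\<close>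

definition nf :: "(vertex, arrow) path list" where
  "nf = [(E3, [], E3), (E4, [], E4), (E5, [], E5), (E5, [T1], E3), (E3, [T2], E5), (E5, [T3], E4),
     (E4, [T4], E5), (E5, [T7], E5), (E5, [T1, T2], E5), (E5, [T3, T4], E5)]"

text \<open>The combination of the images of \<open>nf\<close> with coefficients \<open>c\<close>.
  The entries in position (4,4) come from \<open>tau7 = 2 + 4 \<eta>\<close>,
  \<open>tau1 * tau2 = 8 \<eta>\<close> and
  \<open>tau3 * tau4 = 4 (\<xi> - 12 \<eta>)\<close>.\<close>

definition nf_arr :: "(nat \<Rightarrow> rat) \<Rightarrow> arr" where
  "nf_arr c = Arr (axis 3 (axis 3 (c 0))) (axis 3 (2 * c 4)) (c 1) (2 * c 6) (c 2) (axis 3 (4 * c 3))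
     (2 * c 5) (Loc (c 2 + 2 * c 7) (4 * c 7 + 8 * c 8 - 48 * c 9) (4 * c 9))"

lemma theta_nf:
  assumes "{p. g p \<noteq> 0} \<subseteq> set nf"
  shows "theta g = nf_arr (\<lambda>i. g (nf ! i))"
proof -
  have "theta g = (\<Sum>p\<in>set nf. arr_smult (g p) (pimg p))"
    unfolding theta_def by (rule lin_superset[OF arr.module_axioms _ assms]) simp
  also have "\<dots> = nf_arr (\<lambda>i. g (nf ! i))"
    unfolding arr_eq_iff forall_3
    by (simp add: nf_def nf_arr_def gens_def arr_mult_entry sum_3 axis_def)
  finally show ?thesis .
qed

lemma corner_nf:
  assumes x: "x \<in> corner"
  shows "\<exists>c. (\<forall>i. c i \<in> carrier Z2) \<and> x = nf_arr c"
proof -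
  have "x = eps * x * eps" using x by (simp add: corner_def)
  then have zero: "a11 x $ 1 $ 1 = 0" "a11 x $ 1 $ 2 = 0" "a11 x $ 1 $ 3 = 0" "a11 x $ 2 $ 1 = 0"
      "a11 x $ 2 $ 2 = 0" "a11 x $ 2 $ 3 = 0" "a11 x $ 3 $ 1 = 0" "a11 x $ 3 $ 2 = 0"
      "a14 x $ 1 = 0" "a14 x $ 2 = 0" "a41 x $ 1 = 0" "a41 x $ 2 = 0"
    unfolding arr_eq_iff forall_3 by (simp_all add: arr_mult_entry sum_3 axis_def)
  have L: "x \<in> Lambda_carrier" using x by (simp add: corner_def)
  note L = L[unfolded mem_Lambda]
  obtain t v q y m d k where *: "a14 x $ 3 = 2 * t" "t \<in> carrier Z2" "a24 x = 2 * v" "v \<in> carrier Z2"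
      "a41 x $ 3 = 4 * q" "q \<in> carrier Z2" "a42 x = 2 * y" "y \<in> carrier Z2"
      "eta (a44 x) = 4 * m" "m \<in> carrier Z2" "xi (a44 x) = 4 * d" "d \<in> carrier Z2"
      "2 * a33 x - 2 * cst (a44 x) - eta (a44 x) = 8 * k" "k \<in> carrier Z2"
    using L by (meson Z2multE)
  \<comment> \<open>\<open>c 9\<close> is the coefficient of \<open>\<xi>\<close> divided by 4. As
    \<open>z1 = w + 2 * c 7\<close>, the congruence modulo 8 gives \<open>c 7 = - 2 * k - m\<close>,
    and the coefficient of \<open>\<eta>\<close> then gives \<open>c 8\<close>. With
    \<open>min i 10\<close> all further coefficients are 0.\<close>
  define c where "c i = [a11 x $ 3 $ 3, a22 x, a33 x, q, t, y, v, - 2 * k - m, m + k + 6 * d, d, 0] ! min i 10"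
    for i
  have "c i \<in> carrier Z2" for i
  proof -
    have "c i \<in> set [a11 x $ 3 $ 3, a22 x, a33 x, q, t, y, v, - 2 * k - m, m + k + 6 * d, d, 0]"
      unfolding c_def by (rule nth_mem) simp
    then show ?thesis using L * by auto
  qed
  moreover have "x = nf_arr c"
    unfolding arr_eq_iff forall_3
    using zero * by (simp add: nf_arr_def c_def axis_def) 
  ultimately show ?thesis by blast
qed

lemma theta_surj:
  assumes "x \<in> corner"
  shows "\<exists>f\<in>carrier path.A. theta f = x"
proof -
  obtain c where c: "\<And>i. c i \<in> carrier Z2" "x = nf_arr c"
    using corner_nf[OF assms] by blast
  have inj: "inj_on ((!) nf) {..<10}"
    by (rule inj_on_nth) (simp_all add: nf_def)
  define g where "g p = (if p \<in> set nf then c (inv_into {..<10} ((!) nf) p) else 0)" for p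
  have supp: "{p. g p \<noteq> 0} \<subseteq> set nf"
    by (rule subsetI) (simp add: g_def split: if_splits)
  have "finite {p. g p \<noteq> 0}" using supp by (rule finite_subset) simp
  moreover have "{p. g p \<noteq> 0} \<subseteq> paths Psi"
    using supp by (rule subset_trans) (simp add: nf_def)
  moreover have "g p \<in> carrier Z2" for p
    using c(1) by (simp add: g_def)
  ultimately have g: "g \<in> carrier path.A"
    by (simp only: path.mem_carrier) simp
  have "g (nf ! i) = c i" if "i < 10" for i
  proof -
    have "nf ! i \<in> set nf" using that by (intro nth_mem) (simp add: nf_def)
    then show ?thesis using that inv_into_f_f[OF inj] by (simp add: g_def)
  qed
  then have "nf_arr (\<lambda>i. g (nf ! i)) = nf_arr c"
    by (simp add: nf_arr_def)
  then have "theta g = x"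
    unfolding theta_nf[OF supp] c(2) .
  then show ?thesis using g by (rule bexI)
qed

section \<open>The kernel of the map from the path algebra\<close>

definition ker :: "((vertex, arrow) path \<Rightarrow> rat) set" where
  "ker = {f \<in> carrier path.A. theta f = 0}"

lemma ideal_ker: "ideal ker path.A"
proof -
  interpret L: assoc_algebra Z2 Lambda' by (rule Lambda'_algebra)
  have "ring_hom_ring path.A Lambda' theta"
    by (rule ring_hom_ringI[OF RPsi.ring_axioms L.ring_axioms])
       (simp_all add: theta_corner theta_mult theta_add theta_one)
  then show ?thesis
    using ring_hom_ring.kernel_is_ideal by (fastforce simp: ker_def a_kernel_def')
qed

lemma basis_path [simp]: "walk u p v \<Longrightarrow> basis_elt Z2 (u, p, v) \<in> carrier path.A"
  by (rule path.basis_closed) simp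

lemma basis_path_mult:
  "walk u p v \<Longrightarrow> walk v q w \<Longrightarrow>
    basis_elt Z2 (u, p, v) \<otimes>\<^bsub>path.A\<^esub> basis_elt Z2 (v, q, w) = basis_elt Z2 (u, p @ q, w)"
  by (simp add: path.basis_mult)

lemma relations_closed: "Psi_relations \<subseteq> carrier path.A"
  unfolding Psi_relations_def RPsi_eq arrw_eq by (auto simp: RPsi.smult_closed)

lemma ideal_I: "ideal Psi_ideal path.A"
  unfolding Psi_ideal_def RPsi_eq by (rule RPsi.genideal_ideal[OF relations_closed])

lemma relations_I: "Psi_relations \<subseteq> Psi_ideal"
  unfolding Psi_ideal_def RPsi_eq by (rule RPsi.genideal_self[OF relations_closed])

lemma I_subset_ker: "Psi_ideal \<subseteq> ker"
proof -
  have "x \<ominus>\<^bsub>path.A\<^esub> y \<in> ker"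
    if "x \<in> carrier path.A" "y \<in> carrier path.A" "theta x = theta y" for x y
  proof -
    have "theta x = theta (x \<ominus>\<^bsub>path.A\<^esub> y) + theta y"
      using that by (simp add: theta_add[symmetric] a_minus_def RPsi.a_assoc RPsi.l_neg)
    then show ?thesis using that by (simp add: ker_def)
  qed
  note diff = this
  \<comment> \<open>The last identity is
    \<open>(2 + 4 \<eta>)^2 - 2 (2 + 4 \<eta>) = 8 \<eta>\<close>.\<close>
  have prods: "tau2 * tau1 = 0" "tau2 * tau3 = 0" "tau2 * tau7 = arr_smult 2 tau2" "tau4 * tau1 = 0"
      "tau4 * tau3 = 0" "tau4 * tau7 = arr_smult 2 tau4" "tau7 * tau1 = arr_smult 2 tau1"
      "tau7 * tau3 = arr_smult 2 tau3" "tau7 * tau7 - arr_smult 2 tau7 = tau1 * tau2"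
    unfolding arr_eq_iff forall_3 by (simp_all add: gens_def arr_mult_entry sum_3 axis_def)
  have th: "theta (x \<ominus>\<^bsub>path.A\<^esub> y) = theta x - theta y"
    if "x \<in> carrier path.A" "y \<in> carrier path.A" for x y
  proof -
    have "theta x = theta (x \<ominus>\<^bsub>path.A\<^esub> y) + theta y"
      using that by (simp add: theta_add[symmetric] a_minus_def RPsi.a_assoc RPsi.l_neg)
    then show ?thesis by simp
  qed
  have a: "basis_elt Z2 (source a, [a], target a) \<in> carrier path.A"
    "theta (basis_elt Z2 (source a, [a], target a)) = aimg a" for a
    using vimg_aimg(2)[of a] by simp_all
  have "Psi_relations \<subseteq> ker"
    unfolding Psi_relations_def RPsi_eq arrw_eq ker_def
    by (simp add: th theta_mult theta_smult a RPsi.smult_closed prods del: pimg.simps theta_basis walk.simps source.simps target.simps basis_path)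
  then show ?thesis
    unfolding Psi_ideal_def RPsi_eq by (rule RPsi.genideal_minimal[OF ideal_ker])
qed

lemmas I_l_closed = ideal.I_l_closed[OF ideal_I]
  and I_r_closed = ideal.I_r_closed[OF ideal_I]
  and I_carr = ideal.Icarr[OF ideal_I]
  and I_add = additive_subgroup.a_closed[OF ideal.axioms(1)[OF ideal_I]]
  and I_zero = additive_subgroup.zero_closed[OF ideal.axioms(1)[OF ideal_I]]

text \<open>A ring ideal is also a submodule, because \<open>r f\<close> is the product of
  \<open>r 1\<close> with \<open>f\<close>.\<close>

lemma I_smult: "r \<in> carrier Z2 \<Longrightarrow> f \<in> Psi_ideal \<Longrightarrow> r \<odot>\<^bsub>path.A\<^esub> f \<in> Psi_ideal"
  using I_l_closed[of f "r \<odot>\<^bsub>path.A\<^esub> \<one>\<^bsub>path.A\<^esub>"] I_carr[of f]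
  by (simp add: RPsi.smult_mult_left RPsi.smult_closed)

lemma stable_I: "path.stable Psi_ideal"
  unfolding path.stable_def using I_carr I_zero I_add I_smult by blast

abbreviation red where "red \<equiv> path.reducible Psi_ideal (set nf)"

lemmas red_null = path.reducible_null[OF stable_I, where N = "set nf"]
  and red_mod = path.reducible_mod[OF stable_I, where N = "set nf"]
  and red_add = path.reducible_add[OF stable_I, where N = "set nf"]
  and red_smult = path.reducible_smult[OF stable_I, where N = "set nf"]

lemma red_nf: "p \<in> set nf \<Longrightarrow> red (basis_elt Z2 p)"
  by (rule path.reducible_basis[OF stable_I]) (auto simp: nf_def)

text \<open>A normal form followed by an arrow is again a normal form, or the leading path of a
  relation, or such a leading path with \<open>T1\<close> or \<open>T3\<close> in front. In the last
  case the relation is multiplied on the left.\<close>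

lemma red_step:
  assumes p: "(u, p, v) \<in> set nf" and a: "source a = v"
  shows "red (basis_elt Z2 (u, p @ [a], target a))"
proof -
  note mult = path.basis_mult
  let ?b = "\<lambda>u p v. basis_elt Z2 (u, p, v) :: (vertex, arrow) path \<Rightarrow> rat"
  have rel: "x \<in> Psi_ideal" if "x \<in> Psi_relations" for x using relations_I that by blast
  note rels = Psi_relations_def[unfolded RPsi_eq arrw_eq]
  have mono: "?b E3 [T2, T1] E3 \<in> Psi_ideal" "?b E3 [T2, T3] E4 \<in> Psi_ideal" "?b E4 [T4, T1] E3 \<in> Psi_ideal" "?b E4 [T4, T3] E4 \<in> Psi_ideal"
    using rel unfolding rels by (simp_all add: basis_path_mult)
  have bin: "?b E3 [T2, T7] E5 \<ominus>\<^bsub>path.A\<^esub> 2 \<odot>\<^bsub>path.A\<^esub> ?b E3 [T2] E5 \<in> Psi_ideal"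
      "?b E4 [T4, T7] E5 \<ominus>\<^bsub>path.A\<^esub> 2 \<odot>\<^bsub>path.A\<^esub> ?b E4 [T4] E5 \<in> Psi_ideal"
      "?b E5 [T7, T1] E3 \<ominus>\<^bsub>path.A\<^esub> 2 \<odot>\<^bsub>path.A\<^esub> ?b E5 [T1] E3 \<in> Psi_ideal"
      "?b E5 [T7, T3] E4 \<ominus>\<^bsub>path.A\<^esub> 2 \<odot>\<^bsub>path.A\<^esub> ?b E5 [T3] E4 \<in> Psi_ideal"
      "?b E5 [T7, T7] E5 \<ominus>\<^bsub>path.A\<^esub> 2 \<odot>\<^bsub>path.A\<^esub> ?b E5 [T7] E5 \<ominus>\<^bsub>path.A\<^esub> ?b E5 [T1, T2] E5 \<in> Psi_ideal"
    using rel unfolding rels by (simp_all add: basis_path_mult)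
  \<comment> \<open>These and \<open>bin2\<close> serve the two normal forms of length two,
    \<open>T1 T2\<close> and \<open>T3 T4\<close>.\<close>
  have mono2: "?b E5 [T1, T2, T1] E3 \<in> Psi_ideal" "?b E5 [T1, T2, T3] E4 \<in> Psi_ideal"
      "?b E5 [T3, T4, T1] E3 \<in> Psi_ideal" "?b E5 [T3, T4, T3] E4 \<in> Psi_ideal"
    using I_l_closed[OF mono(1) basis_path[of E5 "[T1]" E3]] I_l_closed[OF mono(2) basis_path[of E5 "[T1]" E3]]
      I_l_closed[OF mono(3) basis_path[of E5 "[T3]" E4]] I_l_closed[OF mono(4) basis_path[of E5 "[T3]" E4]]
    by (simp_all add: basis_path_mult)
  have bin2: "?b E5 [T1, T2, T7] E5 \<ominus>\<^bsub>path.A\<^esub> 2 \<odot>\<^bsub>path.A\<^esub> ?b E5 [T1, T2] E5 \<in> Psi_ideal"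
      "?b E5 [T3, T4, T7] E5 \<ominus>\<^bsub>path.A\<^esub> 2 \<odot>\<^bsub>path.A\<^esub> ?b E5 [T3, T4] E5 \<in> Psi_ideal"
    using I_l_closed[OF bin(1) basis_path[of E5 "[T1]" E3]] I_l_closed[OF bin(2) basis_path[of E5 "[T3]" E4]]
    by (simp_all add: basis_path_mult RPsi.minus_eq RPsi.r_distr RPsi.r_minus RPsi.smult_mult_right RPsi.smult_closed)
  have two: "red x" if "x \<ominus>\<^bsub>path.A\<^esub> 2 \<odot>\<^bsub>path.A\<^esub> basis_elt Z2 y \<in> Psi_ideal" "x \<in> carrier path.A" "y \<in> set nf" for x y
    using that by (intro red_mod[of x "2 \<odot>\<^bsub>path.A\<^esub> basis_elt Z2 y"] red_smult red_nf) simp_all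
  \<comment> \<open>The only relation with two lower terms; they are regrouped into one sum to which
    the square is congruent.\<close>
  have square: "red (?b E5 [T7, T7] E5)"
  proof (rule red_mod)
    show "red (2 \<odot>\<^bsub>path.A\<^esub> ?b E5 [T7] E5 \<oplus>\<^bsub>path.A\<^esub> ?b E5 [T1, T2] E5)"
      by (intro red_add red_smult red_nf) (simp_all add: nf_def)
    have "?b E5 [T7, T7] E5 \<ominus>\<^bsub>path.A\<^esub> (2 \<odot>\<^bsub>path.A\<^esub> ?b E5 [T7] E5 \<oplus>\<^bsub>path.A\<^esub> ?b E5 [T1, T2] E5) =
        ?b E5 [T7, T7] E5 \<ominus>\<^bsub>path.A\<^esub> 2 \<odot>\<^bsub>path.A\<^esub> ?b E5 [T7] E5 \<ominus>\<^bsub>path.A\<^esub> ?b E5 [T1, T2] E5"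
      by (simp add: RPsi.minus_eq RPsi.minus_add RPsi.a_assoc RPsi.smult_closed)
    then show "?b E5 [T7, T7] E5 \<ominus>\<^bsub>path.A\<^esub> (2 \<odot>\<^bsub>path.A\<^esub> ?b E5 [T7] E5 \<oplus>\<^bsub>path.A\<^esub> ?b E5 [T1, T2] E5) \<in> Psi_ideal"
      using bin(5) by simp
  qed simp
  have nfs: "red (?b E3 [T2] E5)" "red (?b E4 [T4] E5)" "red (?b E5 [T1] E3)"
      "red (?b E5 [T3] E4)" "red (?b E5 [T7] E5)" "red (?b E5 [T1, T2] E5)"
      "red (?b E5 [T3, T4] E5)"
    by (rule red_nf; simp add: nf_def)+
  have twos: "red (?b E3 [T2, T7] E5)" "red (?b E4 [T4, T7] E5)" "red (?b E5 [T7, T1] E3)"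
      "red (?b E5 [T7, T3] E4)" "red (?b E5 [T1, T2, T7] E5)" "red (?b E5 [T3, T4, T7] E5)"
    using two[OF bin(1)] two[OF bin(2)] two[OF bin(3)] two[OF bin(4)] two[OF bin2(1)] two[OF bin2(2)]
    by (simp_all add: nf_def)
  show ?thesis
    using p a nfs twos square mono[THEN red_null] mono2[THEN red_null]
    by (cases a) (auto simp: nf_def)
qed

text \<open>The ideal is closed under right multiplication, so \<open>f\<close> may be replaced by
  its normal form, whose terms are handled by \<open>red_step\<close> or do not compose with the
  arrow.\<close>

lemma red_arrow:
  assumes f: "red f"
  shows "red (f \<otimes>\<^bsub>path.A\<^esub> basis_elt Z2 (source a, [a], target a))"
proof -
  let ?a = "basis_elt Z2 (source a, [a], target a) :: (vertex, arrow) path \<Rightarrow> rat"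
  obtain g where g: "g \<in> carrier path.A" "{p. g p \<noteq> 0} \<subseteq> set nf" "f \<ominus>\<^bsub>path.A\<^esub> g \<in> Psi_ideal"
    and fc: "f \<in> carrier path.A"
    using f by (auto simp: path.reducible_def)
  have a: "?a \<in> carrier path.A" by simp
  have "red (g \<otimes>\<^bsub>path.A\<^esub> ?a)"
    using g(1,2)
  proof (induction rule: path.span_induct)
    case zero
    have "(\<lambda>b. 0) \<otimes>\<^bsub>path.A\<^esub> ?a = \<zero>\<^bsub>path.A\<^esub>"
      using RPsi.l_null[OF a] by (simp add: path.A_simps)
    then show ?case using red_null I_zero by simp
  next
    case (add f g)
    then show ?case by (simp add: RPsi.l_distr a red_add)
  next
    case (smult r b)
    obtain u p v where b: "b = (u, p, v)" by (cases b)
    have "red (basis_elt Z2 b \<otimes>\<^bsub>path.A\<^esub> ?a)"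
    proof (cases "v = source a")
      case True
      have "walk u p (source a)" using smult(2) unfolding b True by simp
      then have "basis_elt Z2 b \<otimes>\<^bsub>path.A\<^esub> ?a = basis_elt Z2 (u, p @ [a], target a)"
        unfolding b True by (rule basis_path_mult) simp
      then show ?thesis
        using red_step[of u p v a] smult(3) unfolding b True by simp
    next
      case False
      have "?a \<in> carrier path.A \<and> (source a, [a], target a) \<in> paths Psi" by simp
      then have "basis_elt Z2 b \<otimes>\<^bsub>path.A\<^esub> ?a = \<zero>\<^bsub>path.A\<^esub>"
        using path.basis_mult[OF smult(2), of "(source a, [a], target a)"] False
        unfolding b by simp
      then show ?thesis using red_null[OF I_zero] by (simp only:)
    qed
    then show ?case
      using smult by (simp add: RPsi.smult_mult_left a path.basis_closed red_smult)
  qed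
  moreover have "f \<otimes>\<^bsub>path.A\<^esub> ?a \<ominus>\<^bsub>path.A\<^esub> g \<otimes>\<^bsub>path.A\<^esub> ?a \<in> Psi_ideal"
    using I_r_closed[OF g(3) a] fc g(1) a by (simp add: RPsi.minus_eq RPsi.l_distr RPsi.l_minus)
  ultimately show ?thesis
    using red_mod fc a by blast
qed

lemma red_path: "walk u p v \<Longrightarrow> red (basis_elt Z2 (u, p, v))"
proof (induction p arbitrary: v rule: rev_induct)
  case Nil
  then have "(u, [], v) \<in> set nf" by (cases u) (auto simp: nf_def)
  then show ?case by (rule red_nf)
next
  case (snoc a p)
  then have "walk u p (source a)" "v = target a" by (auto simp: walk_append)
  then show ?case
    using red_arrow[OF snoc.IH[of "source a"], of a] by (simp add: basis_path_mult)
qed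

lemma ker_eq_I: "ker = Psi_ideal"
  unfolding ker_def theta_def
proof (rule path.kernel_eq[OF stable_I, of "set nf"])
  show "red (basis_elt Z2 b)" if "b \<in> paths Psi" for b
    using that red_path by (cases b) simp
  show "lin arr_smult pimg f = 0" if "f \<in> Psi_ideal" for f
    using I_subset_ker that unfolding ker_def theta_def by blast
  fix g p
  assume g: "{p. g p \<noteq> 0} \<subseteq> set nf" "lin arr_smult pimg g = 0" and p: "p \<in> set nf"
  then have "nf_arr (\<lambda>i. g (nf ! i)) = 0"
    using theta_nf[OF g(1)] by (simp add: theta_def)
  \<comment> \<open>The entries of \<open>nf_arr\<close> determine the coefficients: in position
    (4,4), \<open>c 2\<close> being known from \<open>w\<close>, the constant term gives
    \<open>c 7\<close>, then \<open>\<xi>\<close> gives \<open>c 9\<close> and \<open>\<eta>\<close>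
    gives \<open>c 8\<close>.\<close>
  then show "g p = 0"
    unfolding arr_eq_iff forall_3 using p by (auto simp: nf_arr_def nf_def axis_def)
qed

lemma Lambda'_iso_path_quotient:
  "\<exists>h. algebra_iso Z2 Lambda' (quot_algebra RPsi Psi_ideal) h \<and>
     (\<forall>x\<in>carrier RPsi. h (theta x) = Psi_ideal +>\<^bsub>RPsi\<^esub> x)"
proof -
  have "Psi_ideal = {x \<in> carrier path.A. theta x = \<zero>\<^bsub>Lambda'\<^esub>}"
    unfolding ker_eq_I[symmetric] ker_def Lambda'_simps ..
  note I = this
  show ?thesis
  proof (rule quot_algebra_iso[OF path.abelian_group_A Lambda'_algebra, of theta Psi_ideal])
    fix h
    assume "algebra_iso Z2 Lambda' (quot_algebra path.A Psi_ideal) h"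
      "\<And>x. x \<in> carrier path.A \<Longrightarrow> h (theta x) = Psi_ideal +>\<^bsub>path.A\<^esub> x"
    then show ?thesis unfolding RPsi_eq by blast
  qed (unfold Lambda'_simps,
      (fact I[unfolded Lambda'_simps] RPsi.m_closed RPsi.one_closed RPsi.smult_closed theta_corner theta_surj theta_add
        theta_mult theta_one | rule theta_smult, assumption)+)
qed

section \<open>Finite bisets\<close>

lemma sum_const_arr: "(\<Sum>i\<in>I. x) = arr_smult (of_nat (card I)) x"
  using arr.scale_sum_left[of "\<lambda>_. 1" I x] by (simp only: arr.scale_one sum_constant mult_1_right)

text \<open>Elements of \<open>Bij E\<close> are extensional, so an action by functions on the whole
  type must be restricted to \<open>E\<close> before the orbit-stabilizer theorem applies.\<close>

lemma (in group) group_action_restrict: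
  assumes closed: "\<And>g x. g \<in> carrier G \<Longrightarrow> x \<in> E \<Longrightarrow> act g x \<in> E"
    and one: "\<And>x. x \<in> E \<Longrightarrow> act \<one> x = x"
    and mult: "\<And>g h x. g \<in> carrier G \<Longrightarrow> h \<in> carrier G \<Longrightarrow> x \<in> E \<Longrightarrow> act (g \<otimes> h) x = act g (act h x)"
  shows "group_action G E (\<lambda>g. restrict (act g) E)"
proof -
  have bij: "restrict (act g) E \<in> Bij E" if g: "g \<in> carrier G" for g
  proof -
    have "bij_betw (restrict (act g) E) E E"
    proof (rule bij_betw_byWitness[where f' = "act (inv g)"])
      show "\<forall>x\<in>E. act (inv g) (restrict (act g) E x) = x"
        using g one by (simp add: mult[symmetric])
      show "\<forall>x\<in>E. restrict (act g) E (act (inv g) x) = x"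
        using g one closed[of "inv g"] by (simp add: mult[symmetric])
    qed (use g closed in auto)
    then show ?thesis by (simp add: Bij_def)
  qed
  have "restrict (act (g \<otimes> h)) E = compose E (restrict (act g) E) (restrict (act h) E)"
    if "g \<in> carrier G" "h \<in> carrier G" for g h
    using that mult closed by (auto simp: compose_def restrict_def fun_eq_iff)
  then have "group_hom G (BijGroup E) (\<lambda>g. restrict (act g) E)"
    using bij by (intro group_hom.intro group_BijGroup group_axioms)
      (simp add: group_hom_axioms_def hom_def BijGroup_def)
  then show ?thesis by (simp add: group_action_def)
qed

lemma orbit_restrict: "x \<in> E \<Longrightarrow> orbit G (\<lambda>g. restrict (act g) E) x = orbit G act x"
  by (simp add: orbit_def)

section \<open>Stabilizers of the points of a biset\<close>

context group
begin

text \<open>The stabilizer of \<open>x\<close> for the action of \<open>G \<times> G\<close> in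
  which \<open>(a, b)\<close> sends \<open>x\<close> to \<open>a x b^-1\<close>. Written as a
  relation, it can be composed with another stabilizer.\<close>

definition stab :: "('a, 'm) biset \<Rightarrow> 'm \<Rightarrow> ('a \<times> 'a) set" where
  "stab M x = {(a, b). a \<in> carrier G \<and> b \<in> carrier G \<and> lact M a x = ract M x b}"

definition conjugate :: "'a \<Rightarrow> 'a \<Rightarrow> ('a \<times> 'a) set \<Rightarrow> ('a \<times> 'a) set" where
  "conjugate a b S = {(c, d). c \<in> carrier G \<and> d \<in> carrier G \<and> (inv a \<otimes> c \<otimes> a, inv b \<otimes> d \<otimes> b) \<in> S}"

lemma subgroup_stab:
  assumes M: "finite_biset G M" and x: "x \<in> pts M"
  shows "subgroup (stab M x) (G \<times>\<times> G)"
proof -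
  interpret M: finite_biset G M by (rule M)
  interpret GG: group "G \<times>\<times> G" by (rule DirProd_group) (rule group_axioms)+
  show ?thesis
  proof (rule GG.subgroupI)
    show "stab M x \<subseteq> carrier (G \<times>\<times> G)" by (auto simp: stab_def)
    have "(\<one>, \<one>) \<in> stab M x" using x by (simp add: stab_def M.lact_one M.ract_one)
    then show "stab M x \<noteq> {}" by blast
    fix p assume "p \<in> stab M x"
    then obtain a b where p: "p = (a, b)" and ab: "a \<in> carrier G" "b \<in> carrier G" "lact M a x = ract M x b"
      by (auto simp: stab_def)
    have "ract M x (inv b) = lact M (inv a) x"
    proof -
      have "lact M (inv a) (lact M a x) = x"
        using ab(1) x by (simp add: M.lact_mult[symmetric] M.lact_one)
      then have "ract M x (inv b) = ract M (lact M (inv a) (lact M a x)) (inv b)" by simp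
      also have "\<dots> = lact M (inv a) (ract M (ract M x b) (inv b))"
        unfolding ab(3) using ab(1,2) x by (simp add: M.actions_commute M.ract_closed)
      also have "\<dots> = lact M (inv a) x"
        using ab x by (simp add: M.ract_mult[symmetric] M.ract_one)
      finally show ?thesis .
    qed
    then show "inv\<^bsub>G \<times>\<times> G\<^esub> p \<in> stab M x"
      using ab by (simp add: p stab_def inv_DirProd group_axioms)
    fix q assume "q \<in> stab M x"
    then obtain c d where q: "q = (c, d)" and cd: "c \<in> carrier G" "d \<in> carrier G" "lact M c x = ract M x d"
      by (auto simp: stab_def)
    have "lact M (a \<otimes> c) x = ract M x (b \<otimes> d)"
      using ab cd x by (simp add: M.lact_mult M.ract_mult M.actions_commute[symmetric])
    then show "p \<otimes>\<^bsub>G \<times>\<times> G\<^esub> q \<in> stab M x"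
      using ab cd by (simp add: p q stab_def)
  qed
qed

lemma stab_translate:
  assumes M: "finite_biset G M" and x: "x \<in> pts M" and a: "a \<in> carrier G" and b: "b \<in> carrier G"
  shows "stab M (lact M a (ract M x (inv b))) = conjugate a b (stab M x)"
proof -
  interpret M: finite_biset G M by (rule M)
  have "lact M c (lact M a (ract M x (inv b))) = ract M (lact M a (ract M x (inv b))) d \<longleftrightarrow>
      lact M (inv a \<otimes> c \<otimes> a) x = ract M x (inv b \<otimes> d \<otimes> b)"
    if c: "c \<in> carrier G" and d: "d \<in> carrier G" for c d
  proof -
    \<comment> \<open>\<open>?t\<close> is the inverse translation; applied to both sides it turns
      the condition at \<open>a x b^-1\<close> into one at \<open>x\<close>.\<close>
    let ?t = "\<lambda>y. lact M (inv a) (ract M y b)"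
    let ?l = "lact M (c \<otimes> a) (ract M x (inv b))" and ?r = "lact M a (ract M x (inv b \<otimes> d))"
    have l: "lact M c (lact M a (ract M x (inv b))) = ?l"
      using a b c x by (simp add: M.lact_mult M.ract_closed)
    have r: "ract M (lact M a (ract M x (inv b))) d = ?r"
      using a b d x by (simp add: M.actions_commute M.ract_mult M.ract_closed)
    have tl: "?t ?l = lact M (inv a \<otimes> c \<otimes> a) x"
    proof -
      have "ract M ?l b = lact M (c \<otimes> a) (ract M x (inv b \<otimes> b))"
        using a b c x by (simp add: M.actions_commute M.ract_mult[symmetric] M.ract_closed)
      then show ?thesis
        using a b c x by (simp add: M.lact_mult[symmetric] M.ract_one m_assoc)
    qed
    have tr: "?t ?r = ract M x (inv b \<otimes> d \<otimes> b)"
    proof -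
      have "ract M ?r b = lact M a (ract M x (inv b \<otimes> d \<otimes> b))"
        using a b d x by (simp add: M.actions_commute M.ract_mult[symmetric] M.ract_closed)
      then show ?thesis
        using a b d x by (simp add: M.lact_mult[symmetric] M.lact_one M.ract_closed)
    qed
    have untwist: "y = lact M a (ract M (?t y) (inv b))" if "y \<in> pts M" for y
    proof -
      have "ract M (?t y) (inv b) = lact M (inv a) (ract M y (b \<otimes> inv b))"
        using a b that by (simp add: M.actions_commute M.ract_mult[symmetric] M.ract_closed)
      then show ?thesis
        using a b that by (simp add: M.lact_mult[symmetric] M.lact_one M.ract_one)
    qed
    have "?l \<in> pts M" "?r \<in> pts M"
      using a b c d x by (simp_all add: M.lact_closed M.ract_closed)
    then have "?l = ?r \<longleftrightarrow> ?t ?l = ?t ?r" using untwist by metis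
    then show ?thesis unfolding l r tl tr .
  qed
  then show ?thesis by (auto simp: stab_def conjugate_def a b)
qed

subsection \<open>Isomorphisms and classes\<close>

lemma biset_isomorphic_refl: "biset_isomorphic G M M"
  unfolding biset_isomorphic_def by (rule exI[of _ id]) auto

lemma biset_isomorphic_sym:
  assumes M: "finite_biset G M" and MN: "biset_isomorphic G M N"
  shows "biset_isomorphic G N M"
proof -
  interpret M: finite_biset G M by (rule M)
  obtain f where f: "bij_betw f (pts M) (pts N)"
    and eq: "\<And>g x. g \<in> carrier G \<Longrightarrow> x \<in> pts M \<Longrightarrow>
      f (lact M g x) = lact N g (f x) \<and> f (ract M x g) = ract N (f x) g"
    using MN by (auto simp: biset_isomorphic_def)
  let ?f = "inv_into (pts M) f"
  have fy: "f (?f y) = y" "?f y \<in> pts M" if "y \<in> pts N" for y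
    using that f by (auto simp: bij_betw_inv_into_right intro: bij_betwE[OF bij_betw_inv_into[OF f], rule_format])
  have ff: "?f (f x) = x" if "x \<in> pts M" for x
    using that f by (simp add: bij_betw_inv_into_left)
  have "?f (lact N g y) = lact M g (?f y) \<and> ?f (ract N y g) = ract M (?f y) g"
    if g: "g \<in> carrier G" and y: "y \<in> pts N" for g y
    using eq[OF g fy(2)[OF y]] fy[OF y] ff[OF M.lact_closed[OF g fy(2)[OF y]]]
      ff[OF M.ract_closed[OF g fy(2)[OF y]]] by simp
  then show ?thesis
    unfolding biset_isomorphic_def using bij_betw_inv_into[OF f] by blast
qed

lemma biset_isomorphic_trans:
  assumes "biset_isomorphic G M N" "biset_isomorphic G N P"
  shows "biset_isomorphic G M P"
proof -
  obtain f g where f: "bij_betw f (pts M) (pts N)"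
    "\<forall>a\<in>carrier G. \<forall>x\<in>pts M. f (lact M a x) = lact N a (f x) \<and> f (ract M x a) = ract N (f x) a"
    and g: "bij_betw g (pts N) (pts P)"
    "\<forall>a\<in>carrier G. \<forall>x\<in>pts N. g (lact N a x) = lact P a (g x) \<and> g (ract N x a) = ract P (g x) a"
    using assms by (auto simp: biset_isomorphic_def)
  have "f x \<in> pts N" if "x \<in> pts M" for x using f(1) that by (meson bij_betwE)
  then show ?thesis
    unfolding biset_isomorphic_def using f g
    by (intro exI[of _ "g \<circ> f"]) (auto intro: bij_betw_trans)
qed

lemma biset_class_eq:
  assumes M: "finite_biset G M" and MN: "biset_isomorphic G M N"
  shows "biset_class G M = biset_class G N"
  using biset_isomorphic_trans[OF MN] biset_isomorphic_trans[OF biset_isomorphic_sym[OF M MN]]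
  by (auto simp: biset_class_def)

lemma nat_copy:
  assumes M: "finite_biset G M"
  obtains N :: "('a, nat) biset" where "finite_biset G N" "biset_isomorphic G M N"
proof -
  interpret M: finite_biset G M by (rule M)
  obtain f :: "_ \<Rightarrow> nat" and n where f: "bij_betw f (pts M) {..<n}"
    using M.finite_pts by (metis ex_bij_betw_finite_nat atLeast0LessThan)
  define f' where "f' = inv_into (pts M) f"
  have ff: "f' (f x) = x" if "x \<in> pts M" for x
    using that f by (simp add: f'_def bij_betw_inv_into_left)
  define N where "N = \<lparr>pts = f ` pts M, lact = (\<lambda>g y. f (lact M g (f' y))), ract = (\<lambda>y g. f (ract M (f' y) g))\<rparr>"
  have "finite_biset G N"
    by unfold_locales
       (auto simp: N_def ff M.finite_pts M.lact_closed M.ract_closed M.lact_one M.ract_one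
         M.lact_mult M.ract_mult M.actions_commute)
  moreover have "bij_betw f (pts M) (pts N)"
    using f by (auto simp: N_def bij_betw_def)
  then have "biset_isomorphic G M N"
    unfolding biset_isomorphic_def by (intro exI[of _ f]) (auto simp: N_def ff)
  ultimately show ?thesis by (rule that)
qed

lemma biset_class_in_classes: "finite_biset G M \<Longrightarrow> biset_class G M \<in> biset_classes G"
  using nat_copy[of M] biset_class_eq[of M] by (metis (mono_tags, lifting) biset_classes_def mem_Collect_eq)

lemma biset_class_self: "finite_biset G M \<Longrightarrow> M \<in> biset_class G M"
  by (simp add: biset_class_def biset_isomorphic_refl)

subsection \<open>Invariants of bisets\<close>

definition inva :: "(('a \<times> 'a) set \<Rightarrow> arr) \<Rightarrow> ('a, 'm) biset \<Rightarrow> arr" where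
  "inva \<phi> M = (\<Sum>x\<in>pts M. \<phi> (stab M x))"

lemma stab_iso:
  assumes M: "finite_biset G M" and x: "x \<in> pts M" and inj: "inj_on f (pts M)"
    and eq: "\<And>g. g \<in> carrier G \<Longrightarrow> f (lact M g x) = lact N g (f x) \<and> f (ract M x g) = ract N (f x) g"
  shows "stab N (f x) = stab M x"
proof -
  interpret M: finite_biset G M by (rule M)
  have "lact N a (f x) = ract N (f x) b \<longleftrightarrow> lact M a x = ract M x b"
    if "a \<in> carrier G" "b \<in> carrier G" for a b
    using that eq[of a] eq[of b] inj x M.lact_closed[of a x] M.ract_closed[of b x]
    by (metis inj_on_eq_iff)
  then show ?thesis by (auto simp: stab_def)
qed

lemma inva_iso:
  assumes M: "finite_biset G M" and MN: "biset_isomorphic G M N"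
  shows "inva \<phi> M = inva \<phi> N"
proof -
  obtain f where f: "bij_betw f (pts M) (pts N)"
    and eq: "\<And>g x. g \<in> carrier G \<Longrightarrow> x \<in> pts M \<Longrightarrow>
      f (lact M g x) = lact N g (f x) \<and> f (ract M x g) = ract N (f x) g"
    using MN by (auto simp: biset_isomorphic_def)
  have "inva \<phi> N = (\<Sum>x\<in>pts M. \<phi> (stab N (f x)))"
    unfolding inva_def by (rule sum.reindex_bij_betw[OF f, symmetric])
  also have "\<dots> = inva \<phi> M"
    unfolding inva_def
    by (intro sum.cong refl arg_cong[of _ _ \<phi>] stab_iso[OF M])
       (use f eq in \<open>auto simp: bij_betw_def\<close>)
  finally show ?thesis by simp
qed

text \<open>The choice of the representative is immaterial by \<open>inva_iso\<close>.\<close>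

definition class_inva :: "(('a \<times> 'a) set \<Rightarrow> arr) \<Rightarrow> ('a, nat) biset set \<Rightarrow> arr" where
  "class_inva \<phi> C = inva \<phi> (SOME M. M \<in> C)"

lemma class_inva:
  assumes M: "finite_biset G M"
  shows "class_inva \<phi> (biset_class G M) = inva \<phi> M"
proof -
  have "\<exists>N. N \<in> biset_class G M"
    using nat_copy[OF M] by (metis (mono_tags, lifting) biset_class_def mem_Collect_eq)
  then have "(SOME N. N \<in> biset_class G M) \<in> biset_class G M" by (rule someI_ex)
  then show ?thesis
    unfolding class_inva_def
    by (intro inva_iso[OF M, symmetric]) (simp add: biset_class_def)
qed

lemma finite_biset_disjoint_union:
  assumes M: "finite_biset G M" and N: "finite_biset G N"
  shows "finite_biset G (disjoint_union M N)"
proof -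
  interpret M: finite_biset G M by (rule M)
  interpret N: finite_biset G N by (rule N)
  show ?thesis
    by unfold_locales
       (auto simp: disjoint_union_def M.finite_pts N.finite_pts M.lact_closed M.ract_closed
         M.lact_one M.ract_one M.lact_mult M.ract_mult M.actions_commute N.lact_closed N.ract_closed
         N.lact_one N.ract_one N.lact_mult N.ract_mult N.actions_commute)
qed

lemma inva_disjoint_union:
  assumes M: "finite_biset G M" and N: "finite_biset G N"
  shows "inva \<phi> (disjoint_union M N) = inva \<phi> M + inva \<phi> N"
proof -
  interpret M: finite_biset G M by (rule M)
  interpret N: finite_biset G N by (rule N)
  have "stab (disjoint_union M N) (Inl x) = stab M x" "stab (disjoint_union M N) (Inr y) = stab N y" for x y
    by (auto simp: stab_def disjoint_union_def)
  then show ?thesis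
    by (simp add: inva_def disjoint_union_def[of M N, THEN arg_cong[of _ _ pts], simplified]
        sum.Plus M.finite_pts N.finite_pts o_def)
qed

subsection \<open>Tensor products\<close>

abbreviation tact :: "('a, 'm) biset \<Rightarrow> ('a, 'n) biset \<Rightarrow> 'a \<Rightarrow> 'm \<times> 'n \<Rightarrow> 'm \<times> 'n" where
  "tact M N \<equiv> \<lambda>g (m, n). (ract M m (inv g), lact N g n)"

lemma tensor_action:
  assumes M: "finite_biset G M" and N: "finite_biset G N"
  shows "group_action G (pts M \<times> pts N) (\<lambda>g. restrict (tact M N g) (pts M \<times> pts N))"
proof -
  interpret M: finite_biset G M by (rule M)
  interpret N: finite_biset G N by (rule N)
  show ?thesis
    by (rule group_action_restrict)
       (auto simp: M.ract_closed N.lact_closed M.ract_one N.lact_one N.lact_mult M.ract_mult[symmetric]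
         inv_mult_group)
qed

lemma orbit_tact_eq:
  assumes M: "finite_biset G M" and N: "finite_biset G N" and x: "x \<in> pts M" "y \<in> pts N"
    and x': "x' \<in> pts M" "y' \<in> pts N"
  shows "orbit G (tact M N) (x', y') = orbit G (tact M N) (x, y) \<longleftrightarrow>
    (\<exists>g\<in>carrier G. x' = ract M x (inv g) \<and> y' = lact N g y)"
proof -
  let ?P = "pts M \<times> pts N"
  interpret group_action G ?P "\<lambda>g. restrict (tact M N g) ?P"
    by (rule tensor_action[OF M N])
  let ?o = "orbit G (tact M N)"
  note o = orbit_restrict[of _ ?P G "tact M N"]
  have self: "p \<in> ?o p" if "p \<in> ?P" for p using orbit_refl[OF that] o[OF that] by simp
  have mem: "(x', y') \<in> ?o (x, y) \<longleftrightarrow> (\<exists>g\<in>carrier G. x' = ract M x (inv g) \<and> y' = lact N g y)"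
    by (auto simp: orbit_def)
  have "?o (x', y') = ?o (x, y)" if "(x', y') \<in> ?o (x, y)"
  proof -
    have P: "(x, y) \<in> ?P" "(x', y') \<in> ?P" using x x' by auto
    have 1: "(x', y') \<in> orbit G (\<lambda>g. restrict (tact M N g) ?P) (x, y)" using that o P by simp
    have 2: "(x, y) \<in> orbit G (\<lambda>g. restrict (tact M N g) ?P) (x', y')" by (rule orbit_sym[OF P 1])
    have sub: "orbit G (\<lambda>g. restrict (tact M N g) ?P) p \<subseteq> ?P" if "p \<in> ?P" for p
      using that element_image by (auto simp: orbit_def)
    show ?thesis
      unfolding o[OF P(1), symmetric] o[OF P(2), symmetric]
      using orbit_trans[OF P(1) P(2) _ 1] orbit_trans[OF P(2) P(1) _ 2] sub[OF P(1)] sub[OF P(2)]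
      by blast
  qed
  then show ?thesis using mem self[of "(x', y')"] x' by blast
qed

lemma tensor_simps:
  assumes M: "finite_biset G M" and N: "finite_biset G N"
  shows "pts (tensor_biset G M N) = (\<lambda>p. orbit G (tact M N) p) ` (pts M \<times> pts N)"
    and "\<lbrakk>x \<in> pts M; y \<in> pts N; h \<in> carrier G\<rbrakk> \<Longrightarrow>
      lact (tensor_biset G M N) h (orbit G (tact M N) (x, y)) = orbit G (tact M N) (lact M h x, y)"
    and "\<lbrakk>x \<in> pts M; y \<in> pts N; h \<in> carrier G\<rbrakk> \<Longrightarrow>
      ract (tensor_biset G M N) (orbit G (tact M N) (x, y)) h = orbit G (tact M N) (x, ract N y h)"
proof -
  interpret M: finite_biset G M by (rule M)
  interpret N: finite_biset G N by (rule N)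
  show "pts (tensor_biset G M N) = (\<lambda>p. orbit G (tact M N) p) ` (pts M \<times> pts N)"
    by (auto simp: tensor_biset_def orbits_def)
  have im: "f ` {act g p | g. g \<in> carrier G} = {f (act g p) | g. g \<in> carrier G}"
    for f act and p :: "'m \<times> 'n" by blast
  show "lact (tensor_biset G M N) h (orbit G (tact M N) (x, y)) = orbit G (tact M N) (lact M h x, y)"
    if "x \<in> pts M" "y \<in> pts N" "h \<in> carrier G" for x y h
    unfolding orbit_def using that
    by (simp add: tensor_biset_def setcompr_eq_image image_image M.actions_commute cong: image_cong_simp)
  show "ract (tensor_biset G M N) (orbit G (tact M N) (x, y)) h = orbit G (tact M N) (x, ract N y h)"
    if "x \<in> pts M" "y \<in> pts N" "h \<in> carrier G" for x y h
    unfolding orbit_def using that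
    by (simp add: tensor_biset_def setcompr_eq_image image_image N.actions_commute cong: image_cong_simp)
qed

lemma finite_biset_tensor:
  assumes M: "finite_biset G M" and N: "finite_biset G N"
  shows "finite_biset G (tensor_biset G M N)"
proof -
  interpret M: finite_biset G M by (rule M)
  interpret N: finite_biset G N by (rule N)
  note s = tensor_simps[OF M N]
  show ?thesis
    by unfold_locales
       (auto simp: s M.finite_pts N.finite_pts M.lact_closed N.ract_closed M.lact_one N.ract_one
         M.lact_mult N.ract_mult)
qed

text \<open>\<open>[a x, y] = [x, y c]\<close> means that some \<open>g\<close> carries one pair to
  the other. With \<open>b = g^-1\<close> this reads \<open>a x = x b\<close> and
  \<open>b y = y c\<close>.\<close>

lemma stab_tensor:
  assumes M: "finite_biset G M" and N: "finite_biset G N" and x: "x \<in> pts M" and y: "y \<in> pts N"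
  shows "stab (tensor_biset G M N) (orbit G (tact M N) (x, y)) = stab M x O stab N y"
proof -
  interpret M: finite_biset G M by (rule M)
  interpret N: finite_biset G N by (rule N)
  have "(\<exists>g\<in>carrier G. lact M a x = ract M x (inv g) \<and> y = lact N g (ract N y c)) \<longleftrightarrow>
      (\<exists>b\<in>carrier G. lact M a x = ract M x b \<and> lact N b y = ract N y c)"
    if "a \<in> carrier G" "c \<in> carrier G" for a c
  proof safe
    fix g assume g: "g \<in> carrier G" and e: "lact M a x = ract M x (inv g)" "y = lact N g (ract N y c)"
    have "lact N (inv g) y = lact N (inv g) (lact N g (ract N y c))" using e(2) by simp
    also have "\<dots> = ract N y c"
      using g y that by (simp add: N.lact_mult[symmetric] N.ract_closed N.lact_one)
    finally show "\<exists>b\<in>carrier G. lact M a x = ract M x b \<and> lact N b y = ract N y c"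
      using e(1) g by blast
  next
    fix b assume b: "b \<in> carrier G" and e: "lact M a x = ract M x b" "lact N b y = ract N y c"
    have "lact N (inv b) (ract N y c) = y"
      unfolding e(2)[symmetric] using b y by (simp add: N.lact_mult[symmetric] N.lact_one)
    then show "\<exists>g\<in>carrier G. lact M a x = ract M x (inv g) \<and> y = lact N g (ract N y c)"
      using e(1) b by (intro bexI[of _ "inv b"]) auto
  qed
  note eq = this
  let ?T = "tensor_biset G M N" and ?O = "orbit G (tact M N) (x, y)"
  have "lact ?T a ?O = ract ?T ?O c \<longleftrightarrow>
      (\<exists>b\<in>carrier G. lact M a x = ract M x b \<and> lact N b y = ract N y c)"
    if ac: "a \<in> carrier G" "c \<in> carrier G" for a c
    unfolding tensor_simps(2)[OF M N x y ac(1)] tensor_simps(3)[OF M N x y ac(2)]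
      orbit_tact_eq[OF M N x N.ract_closed[OF ac(2) y] M.lact_closed[OF ac(1) x] y]
    by (rule eq[OF ac])
  then show ?thesis by (auto simp: stab_def)
qed

text \<open>For the stabilizers of \<open>x\<close> and \<open>y\<close> this is the order of the
  stabilizer of the pair \<open>(x, y)\<close> under the action whose orbits are the points of the
  tensor product.\<close>

definition weight :: "('a \<times> 'a) set \<Rightarrow> ('a \<times> 'a) set \<Rightarrow> nat" where
  "weight S T = card {b \<in> carrier G. (\<one>, b) \<in> S \<and> (b, \<one>) \<in> T}"

text \<open>The orbit of \<open>(x, y)\<close> has |G| / weight points, so a sum over all pairs with
  the reciprocal factor counts each orbit once.\<close>

lemma inva_tensor:
  assumes fin: "finite (carrier G)" and M: "finite_biset G M" and N: "finite_biset G N"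
  shows "inva \<phi> (tensor_biset G M N) = (\<Sum>x\<in>pts M. \<Sum>y\<in>pts N.
    arr_smult (of_nat (weight (stab M x) (stab N y)) / of_nat (order G)) (\<phi> (stab M x O stab N y)))"
proof -
  interpret M: finite_biset G M by (rule M)
  interpret N: finite_biset G N by (rule N)
  let ?P = "pts M \<times> pts N" and ?o = "orbit G (tact M N)"
  let ?\<alpha> = "\<lambda>g. restrict (tact M N g) ?P"
  interpret A: group_action G ?P ?\<alpha> by (rule tensor_action[OF M N])
  let ?F = "\<lambda>p. arr_smult (of_nat (weight (stab M (fst p)) (stab N (snd p))) / of_nat (order G))
    (\<phi> (stab M (fst p) O stab N (snd p)))"
  have order: "order G > 0" using fin by (simp add: order_gt_0_iff_finite)
  have inner: "(\<Sum>p | p \<in> ?P \<and> ?o p = B. ?F p) = \<phi> (stab (tensor_biset G M N) B)"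
    if B: "B \<in> ?o ` ?P" for B
  proof -
    obtain q where q: "q \<in> ?P" "B = ?o q" using B by blast
    \<comment> \<open>By the orbit-stabilizer theorem every pair in the orbit \<open>B\<close>
      contributes the same share, the reciprocal of the size of \<open>B\<close>.\<close>
    have eq: "?F p = arr_smult (1 / of_nat (card B)) (\<phi> (stab (tensor_biset G M N) B))"
      if p: "p \<in> ?P" "?o p = B" for p
    proof -
      obtain x y where xy: "p = (x, y)" "x \<in> pts M" "y \<in> pts N" using p by auto
      have "stabilizer G ?\<alpha> p = {g \<in> carrier G. ract M x (inv g) = x \<and> lact N g y = y}"
        using xy by (auto simp: stabilizer_def)
      also have "\<dots> = {b \<in> carrier G. (\<one>, b) \<in> stab M x \<and> (b, \<one>) \<in> stab N y}"
      proof -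
        have "ract M x (inv g) = x \<longleftrightarrow> lact M \<one> x = ract M x g" if g: "g \<in> carrier G" for g
        proof -
          have "ract M (ract M x (inv g)) g = x" "ract M (ract M x g) (inv g) = x"
            using g xy by (simp_all add: M.ract_mult[symmetric] M.ract_one)
          then show ?thesis using xy by (metis M.lact_one)
        qed
        then show ?thesis using xy by (auto simp: stab_def N.ract_one)
      qed
      finally have "card (stabilizer G ?\<alpha> p) = weight (stab M x) (stab N y)"
        by (simp add: weight_def)
      then have "card B * weight (stab M x) (stab N y) = order G"
        using A.orbit_stabilizer_theorem[OF p(1)] p orbit_restrict[OF p(1), of G "tact M N"] by simp
      then have prod: "(of_nat (card B) :: rat) * of_nat (weight (stab M x) (stab N y)) = of_nat (order G)"
        by (metis of_nat_mult)
      have n: "(of_nat (order G) :: rat) \<noteq> 0" using order by simp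
      have "(of_nat (card B) :: rat) \<noteq> 0"
      proof
        assume "(of_nat (card B) :: rat) = 0"
        then have "(of_nat (order G) :: rat) = 0" using prod by (metis mult_zero_left)
        then show False using n by simp
      qed
      then have "of_nat (weight (stab M x) (stab N y)) / of_nat (order G) = (1 / of_nat (card B) :: rat)"
        using prod n by (simp add: field_simps)
      then show ?thesis
        using stab_tensor[OF M N xy(2,3)] p(2) xy(1) by simp
    qed
    have "{p. p \<in> ?P \<and> ?o p = B} = B"
    proof -
      have "?o p = ?o q \<longleftrightarrow> p \<in> ?o q" if "p \<in> ?P" for p
      proof -
        obtain x y x' y' where xy: "q = (x, y)" "p = (x', y')" by (cases q; cases p)
        have "p \<in> ?o q \<longleftrightarrow> (\<exists>g\<in>carrier G. x' = ract M x (inv g) \<and> y' = lact N g y)"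
          unfolding xy by (auto simp: orbit_def)
        then show ?thesis
          using orbit_tact_eq[OF M N, of x y x' y'] q that unfolding xy by simp
      qed
      moreover have "?o q \<subseteq> ?P"
        using q by (auto simp: orbit_def M.ract_closed N.lact_closed)
      ultimately show ?thesis using q(2) by blast
    qed
    note B_eq = this
    have "finite B" by (subst B_eq[symmetric]) (simp add: M.finite_pts N.finite_pts)
    moreover have "q \<in> B" by (subst B_eq[symmetric]) (simp add: q(1) q(2)[symmetric] del: mem_Times_iff)
    ultimately have "(of_nat (card B) :: rat) \<noteq> 0" by auto
    have "(\<Sum>p | p \<in> ?P \<and> ?o p = B. ?F p) =
        (\<Sum>p | p \<in> ?P \<and> ?o p = B. arr_smult (1 / of_nat (card B)) (\<phi> (stab (tensor_biset G M N) B)))"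
      by (intro sum.cong refl eq) auto
    also have "\<dots> = arr_smult (\<Sum>p\<in>B. 1 / of_nat (card B)) (\<phi> (stab (tensor_biset G M N) B))"
      unfolding B_eq by (rule arr.scale_sum_left[symmetric])
    also have "(\<Sum>p\<in>B. 1 / of_nat (card B) :: rat) = 1"
      using \<open>(of_nat (card B) :: rat) \<noteq> 0\<close> by simp
    finally show ?thesis by simp
  qed
  have "inva \<phi> (tensor_biset G M N) = (\<Sum>B\<in>?o ` ?P. \<Sum>p | p \<in> ?P \<and> ?o p = B. ?F p)"
    unfolding inva_def tensor_simps(1)[OF M N] by (intro sum.cong refl inner[symmetric])
  also have "\<dots> = (\<Sum>p\<in>?P. ?F p)"
    by (rule sum.image_gen[symmetric]) (simp add: M.finite_pts N.finite_pts)
  finally show ?thesis by (simp add: sum.cartesian_product split_beta)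
qed

text \<open>The point \<open>x\<close> may be replaced by \<open>x g\<^sup>-\<^sup>1\<close>; averaging over \<open>g\<close> leaves an identity that only
  involves the subgroups.\<close>

definition multiplicative :: "(('a \<times> 'a) set \<Rightarrow> arr) \<Rightarrow> bool" where
  "multiplicative \<phi> \<longleftrightarrow> (\<forall>S T. subgroup S (G \<times>\<times> G) \<longrightarrow> subgroup T (G \<times>\<times> G) \<longrightarrow>
     (\<Sum>g\<in>carrier G. arr_smult (of_nat (weight (conjugate \<one> g S) T)) (\<phi> (conjugate \<one> g S O T))) =
     arr_smult (of_nat (order G) ^ 2) (\<phi> S * \<phi> T))"

lemma inva_tensor_multiplicative:
  assumes fin: "finite (carrier G)" and M: "finite_biset G M" and N: "finite_biset G N"
    and \<phi>: "multiplicative \<phi>"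
  shows "inva \<phi> (tensor_biset G M N) = inva \<phi> M * inva \<phi> N"
proof -
  interpret M: finite_biset G M by (rule M)
  interpret N: finite_biset G N by (rule N)
  let ?n = "of_nat (order G) :: rat"
  have n: "?n \<noteq> 0" using fin by (simp add: order_gt_0_iff_finite)
  let ?K = "\<lambda>S y. arr_smult (of_nat (weight S (stab N y)) / ?n) (\<phi> (S O stab N y))"
  let ?J = "\<Sum>x\<in>pts M. \<Sum>y\<in>pts N. ?K (stab M x) y"
  \<comment> \<open>The map \<open>x \<mapsto> x g^-1\<close> permutes the points of
    \<open>M\<close> and conjugates their stabilizers by \<open>(1, g)\<close>.\<close>
  have shift: "?J = (\<Sum>x\<in>pts M. \<Sum>y\<in>pts N. ?K (conjugate \<one> g (stab M x)) y)" if g: "g \<in> carrier G" for g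
  proof -
    have bij: "bij_betw (\<lambda>x. ract M x (inv g)) (pts M) (pts M)"
      by (rule bij_betw_byWitness[where f' = "\<lambda>x. ract M x g"])
         (use g in \<open>auto simp: M.ract_closed M.ract_mult[symmetric] M.ract_one\<close>)
    have "stab M (ract M x (inv g)) = conjugate \<one> g (stab M x)" if "x \<in> pts M" for x
      using stab_translate[OF M that one_closed g] g that by (simp add: M.lact_one M.ract_closed)
    then show ?thesis
      by (subst sum.reindex_bij_betw[OF bij, symmetric]) simp
  qed
  have "arr_smult ?n ?J = (\<Sum>g\<in>carrier G. ?J)"
    unfolding order_def by (rule sum_const_arr[symmetric])
  also have "\<dots> = (\<Sum>g\<in>carrier G. \<Sum>x\<in>pts M. \<Sum>y\<in>pts N. ?K (conjugate \<one> g (stab M x)) y)"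
    by (intro sum.cong refl shift)
  also have "\<dots> = (\<Sum>x\<in>pts M. \<Sum>y\<in>pts N. \<Sum>g\<in>carrier G. ?K (conjugate \<one> g (stab M x)) y)"
    by (subst sum.swap, intro sum.cong refl sum.swap)
  also have "\<dots> = (\<Sum>x\<in>pts M. \<Sum>y\<in>pts N. arr_smult ?n (\<phi> (stab M x) * \<phi> (stab N y)))"
  proof (intro sum.cong refl)
    fix x y assume x: "x \<in> pts M" and y: "y \<in> pts N"
    have "(\<Sum>g\<in>carrier G. ?K (conjugate \<one> g (stab M x)) y) = arr_smult (1 / ?n)
        (\<Sum>g\<in>carrier G. arr_smult (of_nat (weight (conjugate \<one> g (stab M x)) (stab N y)))
          (\<phi> (conjugate \<one> g (stab M x) O stab N y)))"
      by (simp add: arr.scale_sum_right)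
    also have "\<dots> = arr_smult (1 / ?n) (arr_smult (?n ^ 2) (\<phi> (stab M x) * \<phi> (stab N y)))"
      using \<phi> subgroup_stab[OF M x] subgroup_stab[OF N y] unfolding multiplicative_def by simp
    also have "\<dots> = arr_smult ?n (\<phi> (stab M x) * \<phi> (stab N y))"
      using n by (simp add: power2_eq_square)
    finally show "(\<Sum>g\<in>carrier G. ?K (conjugate \<one> g (stab M x)) y) =
      arr_smult ?n (\<phi> (stab M x) * \<phi> (stab N y))" .
  qed
  also have "\<dots> = arr_smult ?n (inva \<phi> M * inva \<phi> N)"
    by (simp add: inva_def sum_product arr.scale_sum_right)
  finally have "arr_smult (1 / ?n) (arr_smult ?n ?J) = arr_smult (1 / ?n) (arr_smult ?n (inva \<phi> M * inva \<phi> N))"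
    by simp
  then show ?thesis using n unfolding inva_tensor[OF fin M N] by simp
qed

lemma tensor_iso:
  assumes M: "finite_biset G M" and N: "finite_biset G N"
    and M': "finite_biset G M'" and N': "finite_biset G N'"
    and MM: "biset_isomorphic G M M'" and NN: "biset_isomorphic G N N'"
  shows "biset_isomorphic G (tensor_biset G M N) (tensor_biset G M' N')"
proof -
  interpret M: finite_biset G M by (rule M)
  interpret N: finite_biset G N by (rule N)
  obtain f where f: "bij_betw f (pts M) (pts M')"
    and feq: "\<And>g x. g \<in> carrier G \<Longrightarrow> x \<in> pts M \<Longrightarrow>
      f (lact M g x) = lact M' g (f x) \<and> f (ract M x g) = ract M' (f x) g"
    using MM by (auto simp: biset_isomorphic_def)
  obtain k where k: "bij_betw k (pts N) (pts N')"
    and keq: "\<And>g x. g \<in> carrier G \<Longrightarrow> x \<in> pts N \<Longrightarrow>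
      k (lact N g x) = lact N' g (k x) \<and> k (ract N x g) = ract N' (k x) g"
    using NN by (auto simp: biset_isomorphic_def)
  let ?F = "\<lambda>B. map_prod f k ` B" and ?o = "orbit G (tact M N)" and ?o' = "orbit G (tact M' N')"
  have F: "?F (?o (x, y)) = ?o' (f x, k y)" if "x \<in> pts M" "y \<in> pts N" for x y
    unfolding orbit_def using that feq keq by (simp add: setcompr_eq_image image_image cong: image_cong_simp)
  have fk: "f x \<in> pts M'" "k y \<in> pts N'" if "x \<in> pts M" "y \<in> pts N" for x y
    using that f k by (meson bij_betwE)+
  have onto: "\<exists>x\<in>pts M. x' = f x" if "x' \<in> pts M'" for x'
    using that f by (auto simp: bij_betw_def)
  have onto': "\<exists>x\<in>pts N. x' = k x" if "x' \<in> pts N'" for x'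
    using that k by (auto simp: bij_betw_def)
  have im: "?F ` (?o ` (pts M \<times> pts N)) = ?o' ` (pts M' \<times> pts N')"
  proof (intro equalityI subsetI)
    fix B assume "B \<in> ?F ` (?o ` (pts M \<times> pts N))"
    then show "B \<in> ?o' ` (pts M' \<times> pts N')" using F fk by auto
  next
    fix B assume "B \<in> ?o' ` (pts M' \<times> pts N')"
    then obtain x y where "x \<in> pts M" "y \<in> pts N" "B = ?o' (f x, k y)" using onto onto' by blast
    then show "B \<in> ?F ` (?o ` (pts M \<times> pts N))" using F by (intro image_eqI[of _ _ "?o (x, y)"]) auto
  qed
  have "inj_on (map_prod f k) (pts M \<times> pts N)"
    using f k by (auto simp: bij_betw_def inj_on_def)
  moreover have "\<Union>(?o ` (pts M \<times> pts N)) \<subseteq> pts M \<times> pts N"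
    by (auto simp: orbit_def M.ract_closed N.lact_closed)
  ultimately have "inj_on (map_prod f k) (\<Union>(?o ` (pts M \<times> pts N)))"
    by (rule inj_on_subset)
  then have "inj_on ?F (?o ` (pts M \<times> pts N))"
    by (rule inj_on_image)
  then have "bij_betw ?F (pts (tensor_biset G M N)) (pts (tensor_biset G M' N'))"
    using im by (simp add: bij_betw_def tensor_simps[OF M N] tensor_simps[OF M' N'])
  then show ?thesis
    unfolding biset_isomorphic_def
    by (intro exI[of _ ?F])
       (auto simp: tensor_simps[OF M N] tensor_simps[OF M' N'] F fk feq keq M.lact_closed N.ract_closed)
qed

lemma tensor_class_eq:
  fixes M N :: "('a, nat) biset"
  assumes M: "finite_biset G M" and N: "finite_biset G N"
  shows "tensor_class G (biset_class G M) (biset_class G N) = biset_class G (tensor_biset G M N)"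
proof -
  have "biset_class G (tensor_biset G M' N') = biset_class G (tensor_biset G M N)"
    if "M' \<in> biset_class G M" "N' \<in> biset_class G N" for M' N'
  proof -
    have "finite_biset G M'" "finite_biset G N'" "biset_isomorphic G M M'" "biset_isomorphic G N N'"
      using that by (auto simp: biset_class_def)
    then show ?thesis
      by (rule biset_class_eq[OF finite_biset_tensor[OF M N] tensor_iso[OF M N], symmetric])
  qed
  then show ?thesis
    using biset_class_self[OF M] biset_class_self[OF N] unfolding tensor_class_def by blast
qed

lemma finite_biset_regular: "finite (carrier G) \<Longrightarrow> finite_biset G (regular_biset G)"
  by unfold_locales (auto simp: regular_biset_def m_assoc)

end

section \<open>Transitive bisets\<close>

context group
begin

definition transitive_at :: "('a, 'm) biset \<Rightarrow> 'm \<Rightarrow> bool" where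
  "transitive_at M x \<longleftrightarrow> x \<in> pts M \<and>
     (\<forall>y\<in>pts M. \<exists>a\<in>carrier G. \<exists>b\<in>carrier G. y = lact M a (ract M x b))"

text \<open>Cancel \<open>a'\<close> on the left and \<open>b\<close> on the right.\<close>

lemma translate_eq_iff:
  assumes M: "finite_biset G M" and x: "x \<in> pts M"
    and ab: "a \<in> carrier G" "b \<in> carrier G" "a' \<in> carrier G" "b' \<in> carrier G"
  shows "lact M a (ract M x b) = lact M a' (ract M x b') \<longleftrightarrow> (inv a' \<otimes> a, b' \<otimes> inv b) \<in> stab M x"
proof -
  interpret M: finite_biset G M by (rule M)
  let ?t = "\<lambda>y. lact M (inv a') (ract M y (inv b))" and ?u = "\<lambda>y. lact M a' (ract M y b)"
  have t1: "?t (lact M a (ract M x b)) = lact M (inv a' \<otimes> a) x"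
  proof -
    have "ract M (lact M a (ract M x b)) (inv b) = lact M a (ract M x (b \<otimes> inv b))"
      using ab x by (simp add: M.actions_commute M.ract_mult[symmetric] M.ract_closed del: r_inv)
    then show ?thesis using ab x by (simp add: M.lact_mult M.ract_one)
  qed
  have t2: "?t (lact M a' (ract M x b')) = ract M x (b' \<otimes> inv b)"
  proof -
    have "ract M (lact M a' (ract M x b')) (inv b) = lact M a' (ract M x (b' \<otimes> inv b))"
      using ab x by (simp add: M.actions_commute M.ract_mult[symmetric] M.ract_closed)
    then show ?thesis using ab x by (simp add: M.lact_mult[symmetric] M.lact_one M.ract_closed)
  qed
  have u: "?u (?t y) = y" if "y \<in> pts M" for y
  proof -
    have "ract M (?t y) b = lact M (inv a') (ract M y (inv b \<otimes> b))"
      using ab that by (simp add: M.actions_commute M.ract_mult[symmetric] M.ract_closed del: l_inv)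
    then show ?thesis using ab that by (simp add: M.lact_mult[symmetric] M.lact_one M.ract_one)
  qed
  have "lact M a (ract M x b) \<in> pts M" "lact M a' (ract M x b') \<in> pts M"
    using ab x by (simp_all add: M.lact_closed M.ract_closed)
  then have "lact M a (ract M x b) = lact M a' (ract M x b') \<longleftrightarrow>
      ?t (lact M a (ract M x b)) = ?t (lact M a' (ract M x b'))"
    using u by metis
  then show ?thesis
    unfolding t1 t2 using ab by (simp add: stab_def)
qed

text \<open>By \<open>translate_eq_iff\<close> the stabilizer alone decides when two translates of
  the base point coincide, so sending \<open>a x b\<close> to \<open>a y b\<close> is well defined
  and injective.\<close>

lemma transitive_iso:
  assumes M: "finite_biset G M" and N: "finite_biset G N"
    and x: "transitive_at M x" and y: "transitive_at N y" and stab: "stab M x = stab N y"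
  shows "biset_isomorphic G M N"
proof -
  interpret M: finite_biset G M by (rule M)
  interpret N: finite_biset G N by (rule N)
  have xM: "x \<in> pts M" and yN: "y \<in> pts N" using x y by (auto simp: transitive_at_def)
  have same: "lact M a (ract M x b) = lact M a' (ract M x b') \<longleftrightarrow>
      lact N a (ract N y b) = lact N a' (ract N y b')"
    if "a \<in> carrier G" "b \<in> carrier G" "a' \<in> carrier G" "b' \<in> carrier G" for a b a' b'
    unfolding translate_eq_iff[OF M xM that] translate_eq_iff[OF N yN that] stab ..
  define f where "f z = (SOME w. \<exists>a\<in>carrier G. \<exists>b\<in>carrier G.
    z = lact M a (ract M x b) \<and> w = lact N a (ract N y b))" for z
  have f: "f (lact M a (ract M x b)) = lact N a (ract N y b)"
    if ab: "a \<in> carrier G" "b \<in> carrier G" for a b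
  proof -
    have "\<exists>a'\<in>carrier G. \<exists>b'\<in>carrier G. lact M a (ract M x b) = lact M a' (ract M x b') \<and>
        f (lact M a (ract M x b)) = lact N a' (ract N y b')"
      unfolding f_def by (rule someI_ex) (use ab in blast)
    then show ?thesis using same ab by metis
  qed
  have pM: "\<exists>a\<in>carrier G. \<exists>b\<in>carrier G. z = lact M a (ract M x b)" if "z \<in> pts M" for z
    using x that by (auto simp: transitive_at_def)
  have pN: "\<exists>a\<in>carrier G. \<exists>b\<in>carrier G. z = lact N a (ract N y b)" if "z \<in> pts N" for z
    using y that by (auto simp: transitive_at_def)
  have "inj_on f (pts M)"
  proof (rule inj_onI)
    fix z z' assume z: "z \<in> pts M" "z' \<in> pts M" "f z = f z'"
    obtain a b a' b' where ab: "a \<in> carrier G" "b \<in> carrier G" "a' \<in> carrier G" "b' \<in> carrier G"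
      and eq: "z = lact M a (ract M x b)" "z' = lact M a' (ract M x b')"
      using pM[OF z(1)] pM[OF z(2)] by blast
    show "z = z'" using z(3) unfolding eq f[OF ab(1,2)] f[OF ab(3,4)] same[OF ab] .
  qed
  moreover have "f ` pts M = pts N"
  proof (intro equalityI subsetI)
    fix w assume "w \<in> f ` pts M"
    then obtain z where z: "z \<in> pts M" "w = f z" by blast
    obtain a b where ab: "a \<in> carrier G" "b \<in> carrier G" "z = lact M a (ract M x b)"
      using pM[OF z(1)] by blast
    show "w \<in> pts N" unfolding z(2) ab(3) f[OF ab(1,2)] using ab yN by (simp add: N.lact_closed N.ract_closed)
  next
    fix w assume "w \<in> pts N"
    then obtain a b where ab: "a \<in> carrier G" "b \<in> carrier G" "w = lact N a (ract N y b)"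
      using pN by blast
    then have "w = f (lact M a (ract M x b))" "lact M a (ract M x b) \<in> pts M"
      using f xM by (simp_all add: M.lact_closed M.ract_closed)
    then show "w \<in> f ` pts M" by (rule image_eqI)
  qed
  ultimately have "bij_betw f (pts M) (pts N)" by (simp add: bij_betw_def)
  moreover have "f (lact M g z) = lact N g (f z) \<and> f (ract M z g) = ract N (f z) g"
    if g: "g \<in> carrier G" and z: "z \<in> pts M" for g z
  proof -
    obtain a b where ab: "a \<in> carrier G" "b \<in> carrier G" and eq: "z = lact M a (ract M x b)"
      using pM[OF z] by blast
    have 1: "lact M g z = lact M (g \<otimes> a) (ract M x b)" "ract M z g = lact M a (ract M x (b \<otimes> g))"
      unfolding eq using ab g xM by (simp_all add: M.lact_mult M.ract_mult M.actions_commute M.ract_closed)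
    have 2: "lact N g (f z) = lact N (g \<otimes> a) (ract N y b)" "ract N (f z) g = lact N a (ract N y (b \<otimes> g))"
      unfolding eq f[OF ab] using ab g yN by (simp_all add: N.lact_mult N.ract_mult N.actions_commute N.ract_closed)
    show ?thesis unfolding 1 2 using f ab g by simp
  qed
  ultimately show ?thesis unfolding biset_isomorphic_def by blast
qed

text \<open>Right multiplication is a right action of \<open>G \<times> G\<close> on the right
  cosets of \<open>S\<close>; the inverse in the first component makes the first factor act from the
  left.\<close>

definition coset_biset :: "('a \<times> 'a) set \<Rightarrow> ('a, ('a \<times> 'a) set) biset" where
  "coset_biset S = \<lparr>pts = rcosets\<^bsub>G \<times>\<times> G\<^esub> S, lact = (\<lambda>a C. C #>\<^bsub>G \<times>\<times> G\<^esub> (inv a, \<one>)),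
     ract = (\<lambda>C b. C #>\<^bsub>G \<times>\<times> G\<^esub> (\<one>, b))\<rparr>"

lemma coset_biset:
  assumes fin: "finite (carrier G)" and S: "subgroup S (G \<times>\<times> G)"
  shows "finite_biset G (coset_biset S)" "transitive_at (coset_biset S) S"
    "stab (coset_biset S) S = S" "card (pts (coset_biset S)) * card S = order G ^ 2"
proof -
  interpret GG: group "G \<times>\<times> G" by (rule DirProd_group) (rule group_axioms)+
  have sub: "S \<subseteq> carrier (G \<times>\<times> G)" using S by (rule subgroup.subset)
  have C: "C \<subseteq> carrier (G \<times>\<times> G)" if "C \<in> rcosets\<^bsub>G \<times>\<times> G\<^esub> S" for C
    using that GG.rcosets_part_G[OF S] by blast
  have closed: "C #>\<^bsub>G \<times>\<times> G\<^esub> g \<in> rcosets\<^bsub>G \<times>\<times> G\<^esub> S"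
    if CS: "C \<in> rcosets\<^bsub>G \<times>\<times> G\<^esub> S" and g: "g \<in> carrier (G \<times>\<times> G)" for C g
  proof -
    obtain h where h: "h \<in> carrier (G \<times>\<times> G)" "C = S #>\<^bsub>G \<times>\<times> G\<^esub> h"
      using CS unfolding RCOSETS_def by (elim UN_E singletonE)
    show ?thesis
      unfolding h(2) GG.coset_mult_assoc[OF sub h(1) g]
      by (rule GG.rcosetsI[OF sub GG.m_closed[OF h(1) g]])
  qed
  have assoc: "C #>\<^bsub>G \<times>\<times> G\<^esub> (a, b) #>\<^bsub>G \<times>\<times> G\<^esub> (c, d) = C #>\<^bsub>G \<times>\<times> G\<^esub> (a \<otimes> c, b \<otimes> d)"
    if "C \<in> rcosets\<^bsub>G \<times>\<times> G\<^esub> S" "a \<in> carrier G" "b \<in> carrier G" "c \<in> carrier G" "d \<in> carrier G" for C a b c d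
    using GG.coset_mult_assoc[OF C[OF that(1)], of "(a, b)" "(c, d)"] that by simp
  have one: "C #>\<^bsub>G \<times>\<times> G\<^esub> (\<one>, \<one>) = C" if "C \<in> rcosets\<^bsub>G \<times>\<times> G\<^esub> S" for C
    using GG.coset_mult_one[OF C[OF that]] by simp
  have finc: "finite (rcosets\<^bsub>G \<times>\<times> G\<^esub> S)"
  proof (rule finite_subset)
    show "rcosets\<^bsub>G \<times>\<times> G\<^esub> S \<subseteq> Pow (carrier (G \<times>\<times> G))" using C by blast
    show "finite (Pow (carrier (G \<times>\<times> G)))" using fin by simp
  qed
  show "finite_biset G (coset_biset S)"
    by unfold_locales
       (simp_all add: coset_biset_def finc closed assoc one inv_mult_group)
  have self: "S \<in> rcosets\<^bsub>G \<times>\<times> G\<^esub> S"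
    using GG.rcosetsI[OF sub GG.one_closed] GG.coset_mult_one[OF sub] by simp
  show "transitive_at (coset_biset S) S"
    unfolding transitive_at_def
  proof (intro conjI ballI)
    show "S \<in> pts (coset_biset S)" using self by (simp add: coset_biset_def)
    fix C assume "C \<in> pts (coset_biset S)"
    then have "C \<in> rcosets\<^bsub>G \<times>\<times> G\<^esub> S" by (simp add: coset_biset_def)
    then obtain p where p: "p \<in> carrier (G \<times>\<times> G)" "C = S #>\<^bsub>G \<times>\<times> G\<^esub> p"
      unfolding RCOSETS_def by (elim UN_E singletonE)
    obtain a b where "p = (a, b)" by (cases p)
    with p have ab: "a \<in> carrier G" "b \<in> carrier G" "C = S #>\<^bsub>G \<times>\<times> G\<^esub> (a, b)"
      by simp_all
    then have "C = lact (coset_biset S) (inv a) (ract (coset_biset S) S b)"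
      using assoc[OF self, of \<one> b a \<one>] by (simp add: coset_biset_def)
    then show "\<exists>a\<in>carrier G. \<exists>b\<in>carrier G. C = lact (coset_biset S) a (ract (coset_biset S) S b)"
      using ab by blast
  qed
  have "S #>\<^bsub>G \<times>\<times> G\<^esub> (inv a, \<one>) = S #>\<^bsub>G \<times>\<times> G\<^esub> (\<one>, b) \<longleftrightarrow> (a, b) \<in> S"
    if ab: "a \<in> carrier G" "b \<in> carrier G" for a b
  proof -
    have i: "inv\<^bsub>G \<times>\<times> G\<^esub> (a, b) = (inv a, inv b)"
      using ab by (simp add: inv_DirProd group_axioms)
    have "(a, b) \<in> S \<longleftrightarrow> (inv a, inv b) \<in> S"
      using subgroup.m_inv_closed[OF S, of "(a, b)"] subgroup.m_inv_closed[OF S, of "(inv a, inv b)"] ab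
      by (auto simp: inv_DirProd group_axioms)
    also have "\<dots> \<longleftrightarrow> S #>\<^bsub>G \<times>\<times> G\<^esub> (inv a, inv b) = S"
      using GG.coset_join1[OF _ _ S, of "(inv a, inv b)"] GG.coset_join2[OF _ S, of "(inv a, inv b)"] ab by auto
    also have "\<dots> \<longleftrightarrow> S #>\<^bsub>G \<times>\<times> G\<^esub> (inv a, \<one>) = S #>\<^bsub>G \<times>\<times> G\<^esub> (\<one>, b)"
    proof
      assume "S #>\<^bsub>G \<times>\<times> G\<^esub> (inv a, inv b) = S"
      then show "S #>\<^bsub>G \<times>\<times> G\<^esub> (inv a, \<one>) = S #>\<^bsub>G \<times>\<times> G\<^esub> (\<one>, b)"
        using assoc[OF self, of "inv a" "inv b" \<one> b] ab by simp
    next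
      assume "S #>\<^bsub>G \<times>\<times> G\<^esub> (inv a, \<one>) = S #>\<^bsub>G \<times>\<times> G\<^esub> (\<one>, b)"
      then show "S #>\<^bsub>G \<times>\<times> G\<^esub> (inv a, inv b) = S"
        using assoc[OF self, of "inv a" \<one> \<one> "inv b"] assoc[OF self, of \<one> b \<one> "inv b"] one[OF self] ab by simp
    qed
    finally show ?thesis by blast
  qed
  then have "stab (coset_biset S) S = {(a, b). a \<in> carrier G \<and> b \<in> carrier G \<and> (a, b) \<in> S}"
    by (auto simp: stab_def coset_biset_def)
  also have "\<dots> = S" using sub by auto
  finally show "stab (coset_biset S) S = S" .
  show "card (pts (coset_biset S)) * card S = order G ^ 2"
    using GG.lagrange[OF S] by (simp add: coset_biset_def order_def power2_eq_square card_cartesian_product)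
qed

definition conj_invariant :: "(('a \<times> 'a) set \<Rightarrow> arr) \<Rightarrow> bool" where
  "conj_invariant \<phi> \<longleftrightarrow> (\<forall>S a b. subgroup S (G \<times>\<times> G) \<longrightarrow> a \<in> carrier G \<longrightarrow> b \<in> carrier G \<longrightarrow>
     \<phi> (conjugate a b S) = \<phi> S)"

text \<open>The stabilizers of all points are conjugate, so the summands agree.\<close>

lemma inva_transitive:
  assumes \<phi>: "conj_invariant \<phi>" and M: "finite_biset G M" and x: "transitive_at M x"
  shows "inva \<phi> M = arr_smult (of_nat (card (pts M))) (\<phi> (stab M x))"
proof -
  interpret M: finite_biset G M by (rule M)
  have xM: "x \<in> pts M" using x by (simp add: transitive_at_def)
  have "\<phi> (stab M y) = \<phi> (stab M x)" if y: "y \<in> pts M" for y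
  proof -
    obtain a b where ab: "a \<in> carrier G" "b \<in> carrier G" "y = lact M a (ract M x b)"
      using x y by (auto simp: transitive_at_def)
    have "stab M y = conjugate a (inv b) (stab M x)"
      using stab_translate[OF M xM ab(1) inv_closed[OF ab(2)]] ab by simp
    then show ?thesis
      using \<phi> subgroup_stab[OF M xM] ab unfolding conj_invariant_def by simp
  qed
  then have "inva \<phi> M = (\<Sum>y\<in>pts M. \<phi> (stab M x))"
    unfolding inva_def by (intro sum.cong refl)
  then show ?thesis by (simp only: sum_const_arr)
qed

text \<open>Split off the set of all translates of \<open>x\<close>; it and its complement are
  closed under both actions. The strict decrease of the number of points drives the induction in
  \<open>reducible_class\<close>.\<close>

lemma decompose:
  fixes M :: "('a, 'm) biset"
  assumes M: "finite_biset G M" and x: "x \<in> pts M"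
  obtains O' R :: "('a, 'm) biset" where "finite_biset G O'" "finite_biset G R" "transitive_at O' x"
    "stab O' x = stab M x" "card (pts R) < card (pts M)" "biset_isomorphic G (disjoint_union O' R) M"
proof -
  interpret M: finite_biset G M by (rule M)
  define P where "P = {lact M a (ract M x b) | a b. a \<in> carrier G \<and> b \<in> carrier G}"
  have xP: "x \<in> P"
    unfolding P_def by (intro CollectI exI[of _ \<one>]) (simp add: M.lact_one M.ract_one x)
  have PM: "P \<subseteq> pts M" using x by (auto simp: P_def M.lact_closed M.ract_closed)
  have move: "lact M g (lact M a (ract M x b)) = lact M (g \<otimes> a) (ract M x b)"
      "ract M (lact M a (ract M x b)) g = lact M a (ract M x (b \<otimes> g))"
    if "a \<in> carrier G" "b \<in> carrier G" "g \<in> carrier G" for a b g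
    using that x by (simp_all add: M.lact_mult M.ract_mult M.actions_commute M.ract_closed)
  have Pc: "lact M g y \<in> P" "ract M y g \<in> P" if "g \<in> carrier G" "y \<in> P" for g y
  proof -
    obtain a b where ab: "a \<in> carrier G" "b \<in> carrier G" "y = lact M a (ract M x b)"
      using \<open>y \<in> P\<close> by (auto simp: P_def)
    show "lact M g y \<in> P" "ract M y g \<in> P"
      unfolding ab(3) move[OF ab(1,2) that(1)] using ab that by (auto simp: P_def)
  qed
  have inv: "lact M (inv g) (lact M g y) = y" "ract M (ract M y g) (inv g) = y"
    if "g \<in> carrier G" "y \<in> pts M" for g y
    using that by (simp_all add: M.lact_mult[symmetric] M.ract_mult[symmetric] M.lact_one M.ract_one)
  have Rc: "lact M g y \<in> pts M - P" "ract M y g \<in> pts M - P" if "g \<in> carrier G" "y \<in> pts M - P" for g y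
    using that inv[of g y] Pc(1)[of "inv g" "lact M g y"] Pc(2)[of "inv g" "ract M y g"]
    by (auto simp: M.lact_closed M.ract_closed)
  let ?O = "M\<lparr>pts := P\<rparr>" and ?R = "M\<lparr>pts := pts M - P\<rparr>"
  have O: "finite_biset G ?O"
    by unfold_locales
       (use PM in \<open>auto simp: finite_subset[OF PM M.finite_pts] Pc M.lact_one M.ract_one M.lact_mult M.ract_mult
         M.actions_commute subset_iff\<close>)
  have R: "finite_biset G ?R"
    by unfold_locales
       (use Rc in \<open>auto simp: M.finite_pts M.lact_one M.ract_one M.lact_mult M.ract_mult M.actions_commute\<close>)
  have t: "transitive_at ?O x"
    unfolding transitive_at_def using xP by (auto simp: P_def)
  have c: "card (pts ?R) < card (pts M)"
  proof -
    have "pts M - P \<subset> pts M" using xP x by blast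
    then show ?thesis using psubset_card_mono[OF M.finite_pts] by simp
  qed
  let ?f = "case_sum id id"
  have "bij_betw ?f (P <+> (pts M - P)) (pts M)"
  proof -
    have "?f ` (P <+> (pts M - P)) = pts M"
      using PM by (simp add: Plus_def image_Un image_image Un_absorb1)
    moreover have "inj_on ?f (P <+> (pts M - P))"
      by (auto simp: inj_on_def Plus_def)
    ultimately show ?thesis by (simp add: bij_betw_def)
  qed
  then have "biset_isomorphic G (disjoint_union ?O ?R) M"
    unfolding biset_isomorphic_def
    by (intro exI[of _ ?f]) (auto simp: disjoint_union_def)
  then show ?thesis using that[OF O R t _ c] by (simp add: stab_def)
qed

end

section \<open>The double Burnside algebra\<close>

locale finite_group = group + assumes finite_carrier: "finite (carrier G)"
begin

lemma Z2_basis_bisets: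
  "Z2_basis (biset_classes G) (\<lambda>C D. Some (tensor_class G C D)) {biset_class G (regular_biset G)}"
proof
  fix C D E assume "C \<in> biset_classes G" "D \<in> biset_classes G" and E: "Some (tensor_class G C D) = Some E"
  then obtain M N :: "('a, nat) biset" where MN: "finite_biset G M" "finite_biset G N"
      "C = biset_class G M" "D = biset_class G N"
    by (auto simp: biset_classes_def)
  then have "E = biset_class G (tensor_biset G M N)"
    using E tensor_class_eq by simp
  then show "E \<in> biset_classes G"
    using biset_class_in_classes[OF finite_biset_tensor[OF MN(1,2)]] by simp
qed (auto intro!: biset_class_in_classes finite_biset_regular finite_carrier)

sublocale bur: Z2_basis "biset_classes G" "\<lambda>C D. Some (tensor_class G C D)"
    "{biset_class G (regular_biset G)}"
  by (rule Z2_basis_bisets)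

lemma biset_algebra_eq: "biset_algebra Z2 G = bur.A"
  by (simp add: biset_algebra_def)

definition rel_span where
  "rel_span = (\<lambda>H. submodule H Z2 bur.A) hull burnside_relators Z2 G"

lemma class_mem: "finite_biset G M \<Longrightarrow> basis_elt Z2 (biset_class G M) \<in> carrier bur.A"
  by (intro bur.basis_closed biset_class_in_classes)

lemma stable_iff: "submodule H Z2 bur.A \<longleftrightarrow> bur.stable H"
proof
  assume "submodule H Z2 bur.A"
  then interpret submodule H Z2 bur.A .
  show "bur.stable H"
    unfolding bur.stable_def
    using subset one_closed m_closed smult_closed by simp
next
  assume H: "bur.stable H"
  show "submodule H Z2 bur.A"
  proof (rule Module.module.submoduleI[OF bur.module_A])
    fix f assume "f \<in> H"
    then have f: "f \<in> carrier bur.A" "(- 1) \<odot>\<^bsub>bur.A\<^esub> f \<in> H"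
      using H by (auto simp: bur.stable_def)
    have "\<ominus>\<^bsub>bur.A\<^esub> f = (- 1) \<odot>\<^bsub>bur.A\<^esub> f"
      using bur.minus_A[OF bur.zero_closed f(1)] abelian_group.r_neg[OF bur.abelian_group_A f(1)]
        abelian_group.a_inv_closed[OF bur.abelian_group_A f(1)]
        abelian_monoid.l_zero[OF abelian_group.axioms(1)[OF bur.abelian_group_A]]
      by (simp add: a_minus_def bur.A_simps)
    then show "\<ominus>\<^bsub>bur.A\<^esub> f \<in> H" using f by simp
  qed (use H in \<open>auto simp: bur.stable_def\<close>)
qed

text \<open>An intersection of submodules is a submodule once it lies in the carrier, and it does
  because the carrier is itself a submodule containing the relators.\<close>

lemma stable_rel_span: "bur.stable rel_span"
proof -
  have "bur.stable (carrier bur.A)"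
    unfolding bur.stable_def bur.A_simps using bur.zero_closed bur.add_closed bur.smult_closed by blast
  moreover have "burnside_relators Z2 G \<subseteq> carrier bur.A"
  proof -
    interpret abelian_group bur.A by (rule bur.abelian_group_A)
    show ?thesis
      by (auto simp: burnside_relators_def biset_algebra_eq class_mem finite_biset_disjoint_union)
  qed
  ultimately have "rel_span \<subseteq> carrier bur.A"
    unfolding rel_span_def stable_iff by (rule hull_minimal[rotated])
  then show ?thesis
    unfolding rel_span_def stable_iff hull_def bur.stable_def by blast
qed

lemma relator:
  fixes M N :: "('a, nat) biset"
  assumes "finite_biset G M" "finite_biset G N"
  shows "basis_elt Z2 (biset_class G (disjoint_union M N)) \<ominus>\<^bsub>bur.A\<^esub>
    (basis_elt Z2 (biset_class G M) \<oplus>\<^bsub>bur.A\<^esub> basis_elt Z2 (biset_class G N)) \<in> rel_span"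
proof -
  have "basis_elt Z2 (biset_class G (disjoint_union M N)) \<ominus>\<^bsub>bur.A\<^esub>
    (basis_elt Z2 (biset_class G M) \<oplus>\<^bsub>bur.A\<^esub> basis_elt Z2 (biset_class G N)) \<in> burnside_relators Z2 G"
    unfolding burnside_relators_def biset_algebra_eq using assms by blast
  then show ?thesis unfolding rel_span_def by (rule hull_inc)
qed

text \<open>A finite family of subgroups of \<open>G \<times> G\<close> containing representatives of all conjugacy classes.\<close>

context
  fixes reps :: "('a \<times> 'a) set set" and \<phi> :: "('a \<times> 'a) set \<Rightarrow> arr"
  assumes reps: "\<And>S. S \<in> reps \<Longrightarrow> subgroup S (G \<times>\<times> G)"
    and conj_reps: "\<And>S. subgroup S (G \<times>\<times> G) \<Longrightarrow>
      \<exists>a\<in>carrier G. \<exists>b\<in>carrier G. conjugate a b S \<in> reps"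
    and invariant: "conj_invariant \<phi>" and mult: "multiplicative \<phi>"
begin

definition rep_class where "rep_class S = biset_class G (coset_biset S)"

text \<open>Induction on the number of points. Splitting off one orbit writes \<open>[M]\<close>
  modulo the relators as the class of that orbit plus the class of a smaller biset, and the orbit is
  isomorphic to the coset biset of a representative.\<close>

lemma reducible_class:
  fixes M :: "('a, nat) biset"
  shows "finite_biset G M \<Longrightarrow> bur.reducible rel_span (rep_class ` reps) (basis_elt Z2 (biset_class G M))"
proof (induction "card (pts M)" arbitrary: M rule: less_induct)
  case less
  note M = less.prems
  interpret M: finite_biset G M by (rule M)
  note red = bur.reducible_null[OF stable_rel_span] bur.reducible_mod[OF stable_rel_span]
    bur.reducible_add[OF stable_rel_span] bur.reducible_smult[OF stable_rel_span]
  show ?case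
  proof (cases "pts M = {}")
    case True
    \<comment> \<open>The empty biset is its own double, so its relator is the negative of its
      class, which is therefore congruent to zero. Any function serves as the isomorphism, the set
      of points being empty.\<close>
    have "biset_isomorphic G (disjoint_union M M) M"
      unfolding biset_isomorphic_def by (rule exI[of _ undefined]) (simp add: disjoint_union_def True Plus_def bij_betw_def)
    then have "biset_class G (disjoint_union M M) = biset_class G M"
      by (rule biset_class_eq[OF finite_biset_disjoint_union[OF M M]])
    then have rel: "basis_elt Z2 (biset_class G M) \<ominus>\<^bsub>bur.A\<^esub>
        (basis_elt Z2 (biset_class G M) \<oplus>\<^bsub>bur.A\<^esub> basis_elt Z2 (biset_class G M)) \<in> rel_span"
      using relator[OF M M] by simp
    have "(- 1) \<odot>\<^bsub>bur.A\<^esub> (basis_elt Z2 (biset_class G M) \<ominus>\<^bsub>bur.A\<^esub>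
        (basis_elt Z2 (biset_class G M) \<oplus>\<^bsub>bur.A\<^esub> basis_elt Z2 (biset_class G M))) \<in> rel_span"
      using rel stable_rel_span unfolding bur.stable_def by (meson Z2_numeral(4))
    also have "(- 1) \<odot>\<^bsub>bur.A\<^esub> (basis_elt Z2 (biset_class G M) \<ominus>\<^bsub>bur.A\<^esub>
        (basis_elt Z2 (biset_class G M) \<oplus>\<^bsub>bur.A\<^esub> basis_elt Z2 (biset_class G M))) = basis_elt Z2 (biset_class G M)"
      using bur.add_closed[OF class_mem[OF M] class_mem[OF M]]
      by (simp add: bur.A_simps bur.minus_A class_mem[OF M])
    finally show ?thesis by (rule red(1))
  next
    case False
    then obtain x where x: "x \<in> pts M" by blast
    obtain O' R :: "('a, nat) biset" where OR: "finite_biset G O'" "finite_biset G R" "transitive_at O' x"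
        "stab O' x = stab M x" "card (pts R) < card (pts M)" "biset_isomorphic G (disjoint_union O' R) M"
      using decompose[OF M x] .
    interpret O': finite_biset G O' by (rule OR(1))
    have xO: "x \<in> pts O'" using OR(3) by (simp add: transitive_at_def)
    obtain a b where ab: "a \<in> carrier G" "b \<in> carrier G" "conjugate a b (stab O' x) \<in> reps"
      using conj_reps[OF subgroup_stab[OF OR(1) xO]] by blast
    let ?S = "conjugate a b (stab O' x)"
    \<comment> \<open>The base point is moved so that its stabilizer is the representative itself
      and not merely conjugate to it.\<close>
    define y where "y = lact O' a (ract O' x (inv b))"
    have yO: "y \<in> pts O'" using ab xO by (simp add: y_def O'.lact_closed O'.ract_closed)
    have sy: "stab O' y = ?S" unfolding y_def by (rule stab_translate[OF OR(1) xO ab(1,2)])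
    have "transitive_at O' y"
      unfolding transitive_at_def
    proof (intro conjI ballI yO)
      fix z assume "z \<in> pts O'"
      then obtain c d where cd: "c \<in> carrier G" "d \<in> carrier G" "z = lact O' c (ract O' x d)"
        using OR(3) by (auto simp: transitive_at_def)
      have "ract O' y (b \<otimes> d) = lact O' a (ract O' x d)"
        using ab cd xO by (simp add: y_def O'.actions_commute O'.ract_closed O'.ract_mult[symmetric] m_assoc[symmetric])
      then have "z = lact O' (c \<otimes> inv a) (ract O' y (b \<otimes> d))"
        using ab cd xO by (simp add: O'.lact_mult[symmetric] O'.ract_closed m_assoc)
      then show "\<exists>a\<in>carrier G. \<exists>b\<in>carrier G. z = lact O' a (ract O' y b)"
        using m_closed[OF cd(1) inv_closed[OF ab(1)]] m_closed[OF ab(2) cd(2)] by blast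
    qed
    then have "biset_isomorphic G O' (coset_biset ?S)"
      using coset_biset[OF finite_carrier reps[OF ab(3)]] sy by (intro transitive_iso[OF OR(1), of _ y ?S]) simp_all
    then have "biset_class G O' = rep_class ?S"
      unfolding rep_class_def by (rule biset_class_eq[OF OR(1)])
    then have rO: "bur.reducible rel_span (rep_class ` reps) (basis_elt Z2 (biset_class G O'))"
      using ab(3) biset_class_in_classes[OF OR(1)] by (intro bur.reducible_basis[OF stable_rel_span]) auto
    have "basis_elt Z2 (biset_class G (disjoint_union O' R)) = basis_elt Z2 (biset_class G M)"
      using biset_class_eq[OF finite_biset_disjoint_union[OF OR(1,2)] OR(6)] by simp
    then have "basis_elt Z2 (biset_class G M) \<ominus>\<^bsub>bur.A\<^esub>
        (basis_elt Z2 (biset_class G O') \<oplus>\<^bsub>bur.A\<^esub> basis_elt Z2 (biset_class G R)) \<in> rel_span"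
      using relator[OF OR(1,2)] by simp
    then show ?thesis
      by (rule red(2)[OF class_mem[OF M] red(3)[OF rO less.hyps[OF OR(5,2)]]])
  qed
qed

definition psi where "psi = lin arr_smult (class_inva \<phi>)"

lemma class_inva_mult:
  assumes "C \<in> biset_classes G" "D \<in> biset_classes G"
  shows "class_inva \<phi> C * class_inva \<phi> D = class_inva \<phi> (tensor_class G C D)"
proof -
  obtain M N :: "('a, nat) biset" where MN: "finite_biset G M" "finite_biset G N"
      "C = biset_class G M" "D = biset_class G N"
    using assms by (auto simp: biset_classes_def)
  show ?thesis
    unfolding MN(3,4) tensor_class_eq[OF MN(1,2)] class_inva[OF MN(1)] class_inva[OF MN(2)]
      class_inva[OF finite_biset_tensor[OF MN(1,2)]]
    by (rule inva_tensor_multiplicative[OF finite_carrier MN(1,2) mult, symmetric])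
qed

lemma psi_add:
  "f \<in> carrier bur.A \<Longrightarrow> g \<in> carrier bur.A \<Longrightarrow> psi (f \<oplus>\<^bsub>bur.A\<^esub> g) = psi f + psi g"
  by (simp add: psi_def bur.A_simps lin_add[OF arr.module_axioms] bur.mem_carrier)

lemma psi_smult: "f \<in> carrier bur.A \<Longrightarrow> psi (r \<odot>\<^bsub>bur.A\<^esub> f) = arr_smult r (psi f)"
  by (simp add: psi_def bur.A_simps lin_smult[OF arr.module_axioms] bur.mem_carrier)

lemma psi_mult:
  "f \<in> carrier bur.A \<Longrightarrow> g \<in> carrier bur.A \<Longrightarrow> psi (f \<otimes>\<^bsub>bur.A\<^esub> g) = psi f * psi g"
  unfolding psi_def by (rule bur.lin_arr_mult) (simp_all add: class_inva_mult)

lemma psi_basis: "finite_biset G M \<Longrightarrow> psi (basis_elt Z2 (biset_class G M)) = inva \<phi> M"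
  by (simp add: psi_def lin_basis_elt[OF arr.module_axioms] class_inva)

text \<open>The kernel of \<open>psi\<close> is a submodule, and it contains the relators because
  the invariant is additive on disjoint unions; so it contains their span.\<close>

lemma psi_rel_span:
  assumes "f \<in> rel_span"
  shows "psi f = 0"
proof -
  let ?K = "{f \<in> carrier bur.A. psi f = 0}"
  have "bur.stable ?K"
    unfolding bur.stable_def
  proof (intro conjI ballI)
    show "\<zero>\<^bsub>bur.A\<^esub> \<in> ?K" using bur.zero_closed by (simp add: psi_def lin_def bur.A_simps)
    show "f \<oplus>\<^bsub>bur.A\<^esub> g \<in> ?K" if "f \<in> ?K" "g \<in> ?K" for f g
      using that bur.add_closed[of f g] by (simp add: psi_add) (simp add: bur.A_simps)
    show "r \<odot>\<^bsub>bur.A\<^esub> f \<in> ?K" if "r \<in> carrier Z2" "f \<in> ?K" for r f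
      using that bur.smult_closed[of r f] by (simp add: psi_smult) (simp add: bur.A_simps)
  qed auto
  moreover have "burnside_relators Z2 G \<subseteq> ?K"
  proof
    fix f assume "f \<in> burnside_relators Z2 G"
    then obtain M N :: "('a, nat) biset" where MN: "finite_biset G M" "finite_biset G N"
      and f: "f = basis_elt Z2 (biset_class G (disjoint_union M N)) \<ominus>\<^bsub>bur.A\<^esub>
        (basis_elt Z2 (biset_class G M) \<oplus>\<^bsub>bur.A\<^esub> basis_elt Z2 (biset_class G N))"
      unfolding burnside_relators_def biset_algebra_eq by blast
    let ?u = "basis_elt Z2 (biset_class G (disjoint_union M N)) :: ('a, nat) biset set \<Rightarrow> rat"
      and ?v = "basis_elt Z2 (biset_class G M) \<oplus>\<^bsub>bur.A\<^esub> basis_elt Z2 (biset_class G N)"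
    interpret abelian_group bur.A by (rule bur.abelian_group_A)
    have u: "?u \<in> carrier bur.A" by (intro class_mem finite_biset_disjoint_union MN)
    have v: "?v \<in> carrier bur.A" by (intro add.m_closed class_mem MN)
    have fc: "f \<in> carrier bur.A" unfolding f using u v by (rule minus_closed)
    have "?u = f \<oplus>\<^bsub>bur.A\<^esub> ?v" unfolding f using u v by (simp add: a_minus_def a_assoc l_neg)
    then have "psi ?u = psi f + psi ?v" using psi_add[OF fc v] by simp
    then have "psi f = 0"
      using MN by (simp add: psi_add class_mem psi_basis finite_biset_disjoint_union inva_disjoint_union)
    then show "f \<in> ?K" using fc by simp
  qed
  ultimately have "rel_span \<subseteq> ?K"
    unfolding rel_span_def stable_iff by (rule hull_minimal[rotated])
  then show ?thesis using assms by blast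
qed

text \<open>The coset biset has |G|^2 / |S| points, and all their stabilizers are conjugate to
  \<open>S\<close>.\<close>

lemma psi_rep:
  assumes S: "S \<in> reps"
  shows "class_inva \<phi> (rep_class S) = arr_smult (of_nat (order G) ^ 2 / of_nat (card S)) (\<phi> S)"
proof -
  note c = coset_biset[OF finite_carrier reps[OF S]]
  have "order G > 0" using finite_carrier by (simp add: order_gt_0_iff_finite)
  then have "card S > 0" using c(4) by (cases "card S = 0") auto
  moreover have "(of_nat (card (pts (coset_biset S))) * of_nat (card S) :: rat) = of_nat (order G) ^ 2"
    using c(4) by (metis of_nat_mult of_nat_power)
  ultimately have "(of_nat (card (pts (coset_biset S))) :: rat) = of_nat (order G) ^ 2 / of_nat (card S)"
    by (simp add: field_simps)
  then show ?thesis
    unfolding rep_class_def class_inva[OF c(1)] inva_transitive[OF invariant c(1,2)] c(3) by simp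
qed

text \<open>An instance of \<open>kernel_eq\<close> with the classes of the coset bisets as normal
  forms. The hypotheses \<open>indep\<close> and \<open>span\<close> say that their images form a
  basis of \<open>L\<close>.\<close>

lemma double_burnside_iso:
  fixes L :: "(rat, arr) module"
  assumes L: "assoc_algebra Z2 L"
    and ops: "\<And>x y. x \<otimes>\<^bsub>L\<^esub> y = x * y" "\<And>x y. x \<oplus>\<^bsub>L\<^esub> y = x + y" "\<And>r x. r \<odot>\<^bsub>L\<^esub> x = arr_smult r x"
      "\<zero>\<^bsub>L\<^esub> = 0"
    and one: "inva \<phi> (regular_biset G) = \<one>\<^bsub>L\<^esub>"
    and fin: "finite reps"
    and inL: "\<And>S. S \<in> reps \<Longrightarrow> class_inva \<phi> (rep_class S) \<in> carrier L"
    and indep: "\<And>c S. \<lbrakk>(\<Sum>S\<in>reps. arr_smult (c S) (class_inva \<phi> (rep_class S))) = 0; S \<in> reps\<rbrakk> \<Longrightarrow> c S = 0"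
    and span: "\<And>x. x \<in> carrier L \<Longrightarrow> \<exists>c. (\<forall>S\<in>reps. c S \<in> carrier Z2) \<and>
      x = (\<Sum>S\<in>reps. arr_smult (c S) (class_inva \<phi> (rep_class S)))"
  shows "\<exists>h. algebra_iso Z2 L (double_burnside Z2 G) h"
proof -
  interpret L: assoc_algebra Z2 L by (rule L)
  have inj: "inj_on rep_class reps"
  proof (rule inj_onI, rule ccontr)
    fix S T assume ST: "S \<in> reps" "T \<in> reps" "rep_class S = rep_class T" "S \<noteq> T"
    \<comment> \<open>Two representatives with the same class would satisfy the nontrivial relation
      with coefficients 1 and -1.\<close>
    let ?c = "\<lambda>U. if U = S then 1 else if U = T then - 1 else 0 :: rat"
    have "(\<Sum>U\<in>reps. arr_smult (?c U) (class_inva \<phi> (rep_class U))) =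
        (\<Sum>U\<in>reps. (if U = S then class_inva \<phi> (rep_class S) else 0) -
          (if U = T then class_inva \<phi> (rep_class T) else 0))"
      using ST by (intro sum.cong refl) auto
    also have "\<dots> = 0" using ST fin by (simp add: sum_subtractf)
    finally have "?c S = 0" by (rule indep[of ?c, OF _ ST(1)])
    then show False by simp
  qed
  have comb: "psi g = (\<Sum>S\<in>reps. arr_smult (g (rep_class S)) (class_inva \<phi> (rep_class S)))"
    if "{p. g p \<noteq> 0} \<subseteq> rep_class ` reps" for g
    unfolding psi_def
    by (subst lin_superset[OF arr.module_axioms _ that])
       (simp_all add: fin sum.reindex[OF inj])
  have classes: "rep_class ` reps \<subseteq> biset_classes G"
    unfolding rep_class_def using coset_biset(1)[OF finite_carrier reps] biset_class_in_classes by blast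
  have red: "bur.reducible rel_span (rep_class ` reps) (basis_elt Z2 b)" if "b \<in> biset_classes G" for b
    using that reducible_class by (auto simp: biset_classes_def)
  have ker: "{f \<in> carrier bur.A. psi f = 0} = rel_span"
    unfolding psi_def
  proof (rule bur.kernel_eq[OF stable_rel_span red])
    show "lin arr_smult (class_inva \<phi>) f = 0" if "f \<in> rel_span" for f
      using psi_rel_span[OF that] by (simp add: psi_def)
    fix g p
    assume g: "{p. g p \<noteq> 0} \<subseteq> rep_class ` reps" "lin arr_smult (class_inva \<phi>) g = 0"
      and p: "p \<in> rep_class ` reps"
    have "(\<Sum>S\<in>reps. arr_smult (g (rep_class S)) (class_inva \<phi> (rep_class S))) = 0"
      using comb[OF g(1)] g(2) by (simp add: psi_def)
    then show "g p = 0" using p indep[of "\<lambda>S. g (rep_class S)"] by blast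
  qed
  have closed: "psi f \<in> carrier L" if f: "f \<in> carrier bur.A" for f
  proof -
    obtain g where g: "g \<in> carrier bur.A" "{p. g p \<noteq> 0} \<subseteq> rep_class ` reps" "f \<ominus>\<^bsub>bur.A\<^esub> g \<in> rel_span"
      using bur.reducible_all[OF stable_rel_span red f] by (auto simp: bur.reducible_def)
    interpret abelian_group bur.A by (rule bur.abelian_group_A)
    have "f = (f \<ominus>\<^bsub>bur.A\<^esub> g) \<oplus>\<^bsub>bur.A\<^esub> g" using f g(1) by (simp add: a_minus_def a_assoc l_neg)
    then have "psi f = psi (f \<ominus>\<^bsub>bur.A\<^esub> g) + psi g"
      using psi_add[OF minus_closed[OF f g(1)] g(1)] by simp
    then have eq: "psi f = psi g" using psi_rel_span[OF g(3)] by simp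
    have "(\<Sum>S\<in>F. arr_smult (g (rep_class S)) (class_inva \<phi> (rep_class S))) \<in> carrier L"
      if "finite F" "F \<subseteq> reps" for F
      using that
    proof (induction F)
      case empty
      then show ?case using L.zero_closed by (simp add: ops)
    next
      case (insert S F)
      have "arr_smult (g (rep_class S)) (class_inva \<phi> (rep_class S)) \<in> carrier L"
        using L.smult_closed[of "g (rep_class S)" "class_inva \<phi> (rep_class S)"] inL insert.prems g(1)
        by (simp add: ops bur.mem_carrier)
      then show ?case
        using insert L.a_closed by (simp add: ops)
    qed
    from this[OF fin] show ?thesis unfolding eq comb[OF g(2)] by simp
  qed
  have surj: "\<exists>f\<in>carrier bur.A. psi f = x" if x: "x \<in> carrier L" for x
  proof -
    obtain c where c: "\<And>S. S \<in> reps \<Longrightarrow> c S \<in> carrier Z2"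
        "x = (\<Sum>S\<in>reps. arr_smult (c S) (class_inva \<phi> (rep_class S)))"
      using span[OF x] by blast
    define g where "g p = (if p \<in> rep_class ` reps then c (inv_into reps rep_class p) else 0)" for p
    have supp: "{p. g p \<noteq> 0} \<subseteq> rep_class ` reps"
      by (rule subsetI) (simp add: g_def split: if_splits)
    have "finite {p. g p \<noteq> 0}" using supp fin by (meson finite_imageI finite_subset)
    moreover have "{p. g p \<noteq> 0} \<subseteq> biset_classes G" using supp classes by (rule subset_trans)
    moreover have "g p \<in> carrier Z2" for p
      using c(1) by (auto simp: g_def inj inv_into_f_f)
    ultimately have g: "g \<in> carrier bur.A" by (simp only: bur.mem_carrier) simp
    have "psi g = x"
      unfolding comb[OF supp] c(2)
      by (intro sum.cong refl) (simp add: g_def inv_into_f_f[OF inj])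
    then show ?thesis using g by (rule bexI)
  qed
  have psi_one: "psi \<one>\<^bsub>bur.A\<^esub> = \<one>\<^bsub>L\<^esub>"
  proof -
    have "\<one>\<^bsub>bur.A\<^esub> = basis_elt Z2 (biset_class G (regular_biset G))"
      by (auto simp: bur.A_simps basis_elt_Z2)
    then show ?thesis
      using psi_basis[OF finite_biset_regular[OF finite_carrier]] one by simp
  qed
  have I: "rel_span = {f \<in> carrier bur.A. psi f = \<zero>\<^bsub>L\<^esub>}"
    unfolding ops ker ..
  have sc: "r \<odot>\<^bsub>bur.A\<^esub> x \<in> carrier bur.A" if "r \<in> carrier Z2" "x \<in> carrier bur.A" for r x
    unfolding bur.A_simps using bur.smult_closed that .
  have "double_burnside Z2 G = quot_algebra bur.A rel_span"
    by (simp add: double_burnside_def biset_algebra_eq rel_span_def)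
  then show ?thesis
  proof (rule ssubst)
    show "\<exists>h. algebra_iso Z2 L (quot_algebra bur.A rel_span) h"
    proof (rule quot_algebra_iso[OF bur.abelian_group_A L, of psi rel_span])
      fix h assume "algebra_iso Z2 L (quot_algebra bur.A rel_span) h"
      then show ?thesis by blast
    qed (unfold ops,
        (fact bur.mult_closed bur.one_closed sc closed surj psi_add psi_mult psi_one I[unfolded ops]
          | rule psi_smult, assumption)+)
  qed
qed

end

end

section \<open>Computations with pairs of permutations\<close>

text \<open>A copy of the symmetric group on which everything can be evaluated: \<open>A\<close>
  marks transpositions and \<open>C\<close> three-cycles. Products are composed from right to left,
  see \<open>pm_mul3\<close>.\<close>

datatype perm3 = Id | A23 | A12 | C123 | C132 | A13

fun mul3 :: "perm3 \<Rightarrow> perm3 \<Rightarrow> perm3" where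
  "mul3 Id y = y"
| "mul3 x Id = x"
| "mul3 A23 A23 = Id"
| "mul3 A23 A12 = C132"
| "mul3 A23 C123 = A13"
| "mul3 A23 C132 = A12"
| "mul3 A23 A13 = C123"
| "mul3 A12 A23 = C123"
| "mul3 A12 A12 = Id"
| "mul3 A12 C123 = A23"
| "mul3 A12 C132 = A13"
| "mul3 A12 A13 = C132"
| "mul3 C123 A23 = A12"
| "mul3 C123 A12 = A13"
| "mul3 C123 C123 = C132"
| "mul3 C123 C132 = Id"
| "mul3 C123 A13 = A23"
| "mul3 C132 A23 = A13"
| "mul3 C132 A12 = A23"
| "mul3 C132 C123 = Id"
| "mul3 C132 C132 = C123"
| "mul3 C132 A13 = A12"
| "mul3 A13 A23 = C132"
| "mul3 A13 A12 = C123"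
| "mul3 A13 C123 = A12"
| "mul3 A13 C132 = A23"
| "mul3 A13 A13 = Id"

fun inv3 :: "perm3 \<Rightarrow> perm3" where
  "inv3 C123 = C132" | "inv3 C132 = C123" | "inv3 x = x"

definition elems3 :: "perm3 list" where "elems3 = [Id, A23, A12, C123, C132, A13]"

lemma set_elems3: "set elems3 = UNIV"
proof -
  have "x \<in> set elems3" for x by (cases x) (simp_all add: elems3_def)
  then show ?thesis by blast
qed

instance perm3 :: finite
  by standard (metis set_elems3 List.finite_set)

lemma ex_perm3: "(\<exists>x. P x) \<longleftrightarrow> P Id \<or> P A23 \<or> P A12 \<or> P C123 \<or> P C132 \<or> P A13"
  by (metis perm3.exhaust)

lemma mul3_assoc: "mul3 (mul3 x y) z = mul3 x (mul3 y z)"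
  by (cases x; cases y; cases z; simp)

lemma mul3_unit [simp]: "mul3 x Id = x" "mul3 Id x = x"
  by (cases x; simp)+

lemma mul3_inv [simp]: "mul3 x (inv3 x) = Id" "mul3 (inv3 x) x = Id"
  by (cases x; simp)+

lemma mul3_inv_assoc [simp]: "mul3 x (mul3 (inv3 x) y) = y" "mul3 (inv3 x) (mul3 x y) = y"
  by (simp_all add: mul3_assoc[symmetric])

lemma inv3_mul3: "inv3 (mul3 x y) = mul3 (inv3 y) (inv3 x)"
  by (cases x; cases y; simp)

definition icj :: "perm3 \<Rightarrow> perm3 \<Rightarrow> perm3" where
  "icj g x = mul3 (inv3 g) (mul3 x g)"

lemma icj_icj: "icj b (icj g x) = icj (mul3 g b) x"
  by (simp add: icj_def mul3_assoc inv3_mul3)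

lemma icj_Id [simp]: "icj Id x = x" "icj g Id = Id"
  by (simp_all add: icj_def)

lemma icj_inverse [simp]: "icj (inv3 g) (icj g x) = x" "icj g (icj (inv3 g) x) = x"
  by (simp_all add: icj_icj)

lemma inj_icj: "inj (icj g)"
  by (metis icj_inverse(1) injI)

definition conj3 :: "perm3 \<Rightarrow> perm3 \<Rightarrow> (perm3 \<times> perm3) set \<Rightarrow> (perm3 \<times> perm3) set" where
  "conj3 a b Q = {(x, y). (icj a x, icj b y) \<in> Q}"

lemma conj3_image: "conj3 a b Q = map_prod (icj (inv3 a)) (icj (inv3 b)) ` Q"
  by (force simp: conj3_def)

definition weight3 :: "(perm3 \<times> perm3) set \<Rightarrow> (perm3 \<times> perm3) set \<Rightarrow> nat" where
  "weight3 Q R = card {y. (Id, y) \<in> Q \<and> (y, Id) \<in> R}"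

subsection \<open>Integral arrays\<close>

text \<open>The entries are listed in the order \<open>s\<close> (by rows), \<open>t\<close>, \<open>u\<close>, \<open>v\<close>, \<open>w\<close>, \<open>x\<close>, \<open>y\<close>, \<open>z\<close>.\<close>

datatype iarr = IArr int int int int int int int int int int int int int int int int int int int int int int

fun iarr_add :: "iarr \<Rightarrow> iarr \<Rightarrow> iarr" where
  "iarr_add (IArr s11 s12 s13 s21 s22 s23 s31 s32 s33 t1 t2 t3 u v w x1 x2 x3 y z1 z2 z3)
     (IArr s11' s12' s13' s21' s22' s23' s31' s32' s33' t1' t2' t3' u' v' w' x1' x2' x3' y' z1' z2' z3') = IArr
     (s11 + s11') (s12 + s12') (s13 + s13') (s21 + s21') (s22 + s22') (s23 + s23') (s31 + s31') (s32 + s32') (s33 + s33') (t1 + t1') (t2 + t2') (t3 + t3') (u + u') (v + v') (w + w') (x1 + x1') (x2 + x2') (x3 + x3') (y + y') (z1 + z1') (z2 + z2') (z3 + z3')"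

fun iarr_smult :: "int \<Rightarrow> iarr \<Rightarrow> iarr" where
  "iarr_smult c (IArr s11 s12 s13 s21 s22 s23 s31 s32 s33 t1 t2 t3 u v w x1 x2 x3 y z1 z2 z3) = IArr
     (c * s11) (c * s12) (c * s13) (c * s21) (c * s22) (c * s23) (c * s31) (c * s32) (c * s33) (c * t1) (c * t2) (c * t3) (c * u) (c * v) (c * w) (c * x1) (c * x2) (c * x3) (c * y) (c * z1) (c * z2) (c * z3)"

text \<open>The product of \<open>A\<close> written out on the entries. The images of the transitive
  bisets have integral entries, so their products are evaluated without fractions.\<close>

fun iarr_mult :: "iarr \<Rightarrow> iarr \<Rightarrow> iarr" where
  "iarr_mult (IArr s11 s12 s13 s21 s22 s23 s31 s32 s33 t1 t2 t3 u v w x1 x2 x3 y z1 z2 z3)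
     (IArr s11' s12' s13' s21' s22' s23' s31' s32' s33' t1' t2' t3' u' v' w' x1' x2' x3' y' z1' z2' z3') = IArr
    (s11 * s11' + s12 * s21' + s13 * s31')
    (s11 * s12' + s12 * s22' + s13 * s32')
    (s11 * s13' + s12 * s23' + s13 * s33')
    (s21 * s11' + s22 * s21' + s23 * s31')
    (s21 * s12' + s22 * s22' + s23 * s32')
    (s21 * s13' + s22 * s23' + s23 * s33')
    (s31 * s11' + s32 * s21' + s33 * s31')
    (s31 * s12' + s32 * s22' + s33 * s32')
    (s31 * s13' + s32 * s23' + s33 * s33')
    (s11 * t1' + s12 * t2' + s13 * t3' + t1 * z1')
    (s21 * t1' + s22 * t2' + s23 * t3' + t2 * z1')
    (s31 * t1' + s32 * t2' + s33 * t3' + t3 * z1')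
    (u * u')
    (u * v' + v * z1')
    (w * w')
    (x1 * s11' + x2 * s21' + x3 * s31' + z1 * x1')
    (x1 * s12' + x2 * s22' + x3 * s32' + z1 * x2')
    (x1 * s13' + x2 * s23' + x3 * s33' + z1 * x3')
    (y * u' + z1 * y')
    (z1 * z1')
    (x1 * t1' + x2 * t2' + x3 * t3' - 12 * (y * v') + z1 * z2' + z2 * z1')
    (y * v' + z1 * z3' + z3 * z1')"

definition iarr_zero :: iarr where
  "iarr_zero = IArr 0 0 0 0 0 0 0 0 0 0 0 0 0 0 0 0 0 0 0 0 0 0"

fun arr_of :: "iarr \<Rightarrow> arr" where
  "arr_of (IArr s11 s12 s13 s21 s22 s23 s31 s32 s33 t1 t2 t3 u v w x1 x2 x3 y z1 z2 z3) =
    Arr (vector [vector [of_int s11, of_int s12, of_int s13], vector [of_int s21, of_int s22, of_int s23],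
        vector [of_int s31, of_int s32, of_int s33]])
      (vector [of_int t1, of_int t2, of_int t3]) (of_int u) (of_int v) (of_int w)
      (vector [of_int x1, of_int x2, of_int x3]) (of_int y) (Loc (of_int z1) (of_int z2) (of_int z3))"

lemma arr_of_zero: "arr_of iarr_zero = 0"
  unfolding arr_eq_iff forall_3 by (simp add: iarr_zero_def)

lemma arr_of_add: "arr_of (iarr_add a b) = arr_of a + arr_of b"
  unfolding arr_eq_iff forall_3 by (cases a; cases b) simp

lemma arr_of_smult: "arr_of (iarr_smult c a) = arr_smult (of_int c) (arr_of a)"
  unfolding arr_eq_iff forall_3 by (cases a) simp

lemma arr_of_mult: "arr_of (iarr_mult a b) = arr_of a * arr_of b"
  unfolding arr_eq_iff forall_3 by (cases a; cases b) (simp add: arr_mult_entry sum_3)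

text \<open>The images in \<open>A\<close> of the transitive bisets \<open>(S\<^sub>3 \<times> S\<^sub>3) / Q\<close>. They depend only on the orders \<open>p\<close>, \<open>q\<close>
  of the two projections of \<open>Q\<close> and the order \<open>k\<close> of \<open>Q\<close>, and were found by lifting a decomposition of
  the unit into primitive orthogonal idempotents to the double Burnside ring.\<close>

definition beta1 :: "int \<Rightarrow> int \<Rightarrow> iarr" where
  "beta1 q k =
    (if q = 1 then IArr 4 2 2 2 1 1 2 1 1 4 2 2 0 0 0 8 4 4 0 0 8 0 else
    (if q = 2 then IArr 2 0 2 1 0 1 1 0 1 0 0 0 0 0 0 4 0 4 0 0 0 0 else
    (if q = 3 then IArr 0 2 2 0 1 1 0 1 1 0 0 0 0 0 0 0 4 4 0 0 0 0 else
      IArr 0 0 2 0 0 1 0 0 1 0 0 0 0 0 0 0 0 4 0 0 0 0)))"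
definition beta2 :: "int \<Rightarrow> int \<Rightarrow> iarr" where
  "beta2 q k =
    (if q = 1 then IArr 2 1 1 0 0 0 2 1 1 2 0 2 0 0 0 0 0 0 0 0 0 0 else
    (if q = 2 then if k = 4 then IArr 1 0 1 0 0 0 1 0 1 0 0 0 0 0 0 0 0 0 0 0 0 0 else IArr 2 1 1 1 1 0 1 0 1 2 2 0 1 (-2) 0 4 4 0 (-2) 0 (-40) 4 else
    (if q = 3 then IArr 0 1 1 0 0 0 0 1 1 0 0 0 0 0 0 0 0 0 0 0 0 0 else
      if k = 12 then IArr 0 0 1 0 0 0 0 0 1 0 0 0 0 0 0 0 0 0 0 0 0 0 else IArr 0 1 1 0 1 0 0 0 1 0 0 0 1 0 0 0 4 0 (-2) 0 0 0)))"
definition beta3 :: "int \<Rightarrow> int \<Rightarrow> iarr" where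
  "beta3 q k =
    (if q = 1 then IArr 0 0 0 2 1 1 2 1 1 0 2 2 0 0 0 0 0 0 0 0 0 0 else
    (if q = 2 then IArr 0 0 0 1 0 1 1 0 1 0 0 0 0 0 0 0 0 0 0 0 0 0 else
    (if q = 3 then if k = 9 then IArr 0 0 0 0 1 1 0 1 1 0 0 0 0 0 0 0 0 0 0 0 0 0 else IArr 2 0 0 0 1 1 0 1 1 2 0 0 0 0 2 4 0 0 0 0 4 0 else
      IArr 0 0 0 0 0 1 0 0 1 0 0 0 0 0 0 0 0 0 0 0 0 0)))"
definition beta6 :: "int \<Rightarrow> int \<Rightarrow> iarr" where
  "beta6 q k =
    (if q = 1 then IArr 0 0 0 0 0 0 2 1 1 0 0 2 0 0 0 0 0 0 0 0 0 0 else
    (if q = 2 then if k = 12 then IArr 0 0 0 0 0 0 1 0 1 0 0 0 0 0 0 0 0 0 0 0 0 0 else IArr 0 0 0 1 1 0 1 0 1 0 2 0 1 (-2) 0 0 0 0 0 0 0 0 else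
    (if q = 3 then IArr 0 0 0 0 0 0 0 1 1 0 0 0 0 0 0 0 0 0 0 0 0 0 else
      if k = 36 then IArr 0 0 0 0 0 0 0 0 1 0 0 0 0 0 0 0 0 0 0 0 0 0 else if k = 18 then IArr 0 0 0 0 1 0 0 0 1 0 0 0 1 0 0 0 0 0 0 0 0 0 else IArr 1 0 0 0 1 0 0 0 1 0 0 0 1 0 1 0 0 0 0 1 0 0)))"
definition beta :: "int \<Rightarrow> int \<Rightarrow> int \<Rightarrow> iarr" where
  "beta p q k = (if p = 1 then beta1 q k else if p = 2 then beta2 q k else if p = 3 then beta3 q k else beta6 q k)"

text \<open>The factor is the reciprocal of the number of points of the transitive biset with
  stabilizer \<open>Q\<close>, so that the sum over all points is the array given by
  \<open>beta\<close>.\<close>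

definition phi3 :: "(perm3 \<times> perm3) set \<Rightarrow> arr" where
  "phi3 Q = arr_smult (of_nat (card Q) / 36)
     (arr_of (beta (int (card (Domain Q))) (int (card (Range Q))) (int (card Q))))"

lemma phi3_conj3: "phi3 (conj3 a b Q) = phi3 Q"
proof -
  have inj: "inj (map_prod (icj (inv3 a)) (icj (inv3 b)))"
    by (intro prod.inj_map inj_icj)
  have "Domain (conj3 a b Q) = icj (inv3 a) ` Domain Q" "Range (conj3 a b Q) = icj (inv3 b) ` Range Q"
    unfolding conj3_image by force+
  then have "card (Domain (conj3 a b Q)) = card (Domain Q)" "card (Range (conj3 a b Q)) = card (Range Q)"
    by (simp_all add: card_image inj_on_subset[OF inj_icj])
  moreover have "card (conj3 a b Q) = card Q"
    unfolding conj3_image using inj by (metis card_image inj_on_subset subset_UNIV)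
  ultimately show ?thesis by (simp add: phi3_def)
qed

text \<open>The condition of \<open>multiplicative\<close> for a single pair, with
  \<open>36 = 6 ^ 2\<close>.\<close>

definition mult3 :: "(perm3 \<times> perm3) set \<Rightarrow> (perm3 \<times> perm3) set \<Rightarrow> bool" where
  "mult3 Q R \<longleftrightarrow> (\<Sum>g\<in>UNIV. arr_smult (of_nat (weight3 (conj3 Id g Q) R)) (phi3 (conj3 Id g Q O R))) =
     arr_smult 36 (phi3 Q * phi3 R)"

text \<open>Reindex the sum by \<open>g \<mapsto> c^-1 g b\<close>. The summands then differ only by
  a conjugation of the middle variable, which preserves the weight, and a conjugation of the
  composite by \<open>(a, d)\<close>, which \<open>phi3\<close> ignores.\<close>

lemma mult3_conj3:
  assumes "mult3 Q R"
  shows "mult3 (conj3 a b Q) (conj3 c d R)"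
proof -
  let ?t = "\<lambda>g. arr_smult (of_nat (weight3 (conj3 Id g Q) R)) (phi3 (conj3 Id g Q O R))"
  let ?u = "\<lambda>g. arr_smult (of_nat (weight3 (conj3 Id g (conj3 a b Q)) (conj3 c d R)))
    (phi3 (conj3 Id g (conj3 a b Q) O conj3 c d R))"
  have "?u g = ?t (mul3 (inv3 c) (mul3 g b))" for g
  proof -
    let ?h = "mul3 (inv3 c) (mul3 g b)"
    have h: "icj b (icj g y) = icj ?h (icj c y)" for y
      by (simp add: icj_icj)
    have comp: "conj3 Id g (conj3 a b Q) O conj3 c d R = conj3 a d (conj3 Id ?h Q O R)"
    proof (intro equalityI subsetI)
      fix p assume "p \<in> conj3 Id g (conj3 a b Q) O conj3 c d R"
      then show "p \<in> conj3 a d (conj3 Id ?h Q O R)"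
        unfolding conj3_def relcomp_unfold by (auto simp: h)
    next
      fix p assume "p \<in> conj3 a d (conj3 Id ?h Q O R)"
      then obtain x z y where p: "p = (x, z)" "(icj a x, icj ?h y) \<in> Q" "(y, icj d z) \<in> R"
        unfolding conj3_def relcomp_unfold by auto
      then have "(icj a x, icj b (icj g (icj (inv3 c) y))) \<in> Q" "(icj c (icj (inv3 c) y), icj d z) \<in> R"
        by (simp_all add: h del: icj_icj)
      then show "p \<in> conj3 Id g (conj3 a b Q) O conj3 c d R"
        unfolding p(1) conj3_def relcomp_unfold by auto
    qed
    have "{y. (Id, y) \<in> conj3 Id ?h Q \<and> (y, Id) \<in> R} =
        icj c ` {y. (Id, y) \<in> conj3 Id g (conj3 a b Q) \<and> (y, Id) \<in> conj3 c d R}"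
    proof (intro equalityI subsetI)
      fix y assume "y \<in> {y. (Id, y) \<in> conj3 Id ?h Q \<and> (y, Id) \<in> R}"
      then have "icj (inv3 c) y \<in> {y. (Id, y) \<in> conj3 Id g (conj3 a b Q) \<and> (y, Id) \<in> conj3 c d R}"
        by (simp add: conj3_def h)
      then show "y \<in> icj c ` {y. (Id, y) \<in> conj3 Id g (conj3 a b Q) \<and> (y, Id) \<in> conj3 c d R}"
        by (rule image_eqI[rotated]) simp
    qed (auto simp: conj3_def h)
    then have "weight3 (conj3 Id g (conj3 a b Q)) (conj3 c d R) = weight3 (conj3 Id ?h Q) R"
      unfolding weight3_def by (simp add: card_image inj_on_subset[OF inj_icj])
    then show ?thesis by (simp add: comp phi3_conj3)
  qed
  moreover have "bij (\<lambda>g. mul3 (inv3 c) (mul3 g b))"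
    by (rule o_bij[of "\<lambda>g. mul3 c (mul3 g (inv3 b))"]) (auto simp: fun_eq_iff mul3_assoc)
  ultimately have "(\<Sum>g\<in>UNIV. ?u g) = (\<Sum>g\<in>UNIV. ?t g)"
    using sum.reindex_bij_betw[of "\<lambda>g. mul3 (inv3 c) (mul3 g b)" UNIV UNIV ?t] by simp
  then show ?thesis
    using assms unfolding mult3_def phi3_conj3 by simp
qed

subsection \<open>Relations as Boolean matrices\<close>

definition mat3 :: "(perm3 \<times> perm3) set \<Rightarrow> bool list list" where
  "mat3 Q = map (\<lambda>a. map (\<lambda>b. (a, b) \<in> Q) elems3) elems3"

fun sel :: "perm3 \<Rightarrow> 'a list \<Rightarrow> 'a" where
  "sel Id [x0, x1, x2, x3, x4, x5] = x0"
| "sel A23 [x0, x1, x2, x3, x4, x5] = x1"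
| "sel A12 [x0, x1, x2, x3, x4, x5] = x2"
| "sel C123 [x0, x1, x2, x3, x4, x5] = x3"
| "sel C132 [x0, x1, x2, x3, x4, x5] = x4"
| "sel A13 [x0, x1, x2, x3, x4, x5] = x5"
| "sel g xs = hd xs"

text \<open>In the order of \<open>elems3\<close>, entry \<open>b\<close> of the result is entry
  \<open>g^-1 b g\<close> of the list. The permutations are spelled out for fast evaluation.\<close>

fun conj_list :: "perm3 \<Rightarrow> 'a list \<Rightarrow> 'a list" where
  "conj_list Id [x0, x1, x2, x3, x4, x5] = [x0, x1, x2, x3, x4, x5]"
| "conj_list A23 [x0, x1, x2, x3, x4, x5] = [x0, x1, x5, x4, x3, x2]"
| "conj_list A12 [x0, x1, x2, x3, x4, x5] = [x0, x5, x2, x4, x3, x1]"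
| "conj_list C123 [x0, x1, x2, x3, x4, x5] = [x0, x2, x5, x3, x4, x1]"
| "conj_list C132 [x0, x1, x2, x3, x4, x5] = [x0, x5, x1, x3, x4, x2]"
| "conj_list A13 [x0, x1, x2, x3, x4, x5] = [x0, x2, x1, x4, x3, x5]"
| "conj_list g xs = xs"


text \<open>Right translation: entry \<open>b\<close> of the result is entry \<open>b g^-1\<close>
  of the list.\<close>

fun shift_list :: "perm3 \<Rightarrow> 'a list \<Rightarrow> 'a list" where
  "shift_list Id [x0, x1, x2, x3, x4, x5] = [x0, x1, x2, x3, x4, x5]"
| "shift_list A23 [x0, x1, x2, x3, x4, x5] = [x1, x0, x3, x2, x5, x4]"
| "shift_list A12 [x0, x1, x2, x3, x4, x5] = [x2, x4, x0, x5, x1, x3]"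
| "shift_list C123 [x0, x1, x2, x3, x4, x5] = [x4, x2, x5, x0, x3, x1]"
| "shift_list C132 [x0, x1, x2, x3, x4, x5] = [x3, x5, x1, x4, x0, x2]"
| "shift_list A13 [x0, x1, x2, x3, x4, x5] = [x5, x3, x4, x1, x2, x0]"
| "shift_list g xs = xs"

text \<open>The Boolean product of a row vector with a matrix of six columns, that is, the union of
  the selected rows.\<close>

fun row_comb :: "bool list \<Rightarrow> bool list list \<Rightarrow> bool list" where
  "row_comb (x # xs) (r # rs) = (if x then map2 (\<or>) r (row_comb xs rs) else row_comb xs rs)"
| "row_comb _ _ = [False, False, False, False, False, False]"

definition mat_comp :: "bool list list \<Rightarrow> bool list list \<Rightarrow> bool list list" where
  "mat_comp A B = map (\<lambda>r. row_comb r B) A"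

fun count_true :: "bool list \<Rightarrow> int" where
  "count_true [] = 0"
| "count_true (x # xs) = (if x then 1 + count_true xs else count_true xs)"

definition mat_size :: "bool list list \<Rightarrow> int" where
  "mat_size A = count_true (concat A)"

definition mat_beta :: "bool list list \<Rightarrow> iarr" where
  "mat_beta A = beta (count_true (map (list_ex id) A))
      (count_true (row_comb [True, True, True, True, True, True] A)) (mat_size A)"

definition mat_weight :: "bool list list \<Rightarrow> bool list list \<Rightarrow> int" where
  "mat_weight A B = count_true (map2 (\<and>) (hd A) (map hd B))"

definition mat_conj :: "perm3 \<Rightarrow> perm3 \<Rightarrow> bool list list \<Rightarrow> bool list list" where
  "mat_conj a b A = conj_list a (map (conj_list b) A)"

definition mat_shift :: "perm3 \<times> perm3 \<Rightarrow> bool list list \<Rightarrow> bool list list" where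
  "mat_shift p A = shift_list (fst p) (map (shift_list (snd p)) A)"

definition mat_or :: "bool list list \<Rightarrow> bool list list \<Rightarrow> bool list list" where
  "mat_or A B = map2 (map2 (\<or>)) A B"

definition mat_at :: "bool list list \<Rightarrow> perm3 \<times> perm3 \<Rightarrow> bool" where
  "mat_at A p \<longleftrightarrow> sel (snd p) (sel (fst p) A)"

lemma conj_list_map: "conj_list g (map f elems3) = map (\<lambda>b. f (icj g b)) elems3"
  by (cases g) (simp_all add: elems3_def icj_def)

lemma shift_list_map: "shift_list g (map f elems3) = map (\<lambda>b. f (mul3 b (inv3 g))) elems3"
  by (cases g) (simp_all add: elems3_def)

lemma sel_map: "sel g (map f elems3) = f g"
  by (cases g) (simp_all add: elems3_def)

lemma mat_conj: "mat_conj a b (mat3 Q) = mat3 (conj3 a b Q)"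
  by (simp add: mat_conj_def mat3_def conj_list_map conj3_def comp_def)

lemma mat_shift: "mat_shift (a, b) (mat3 Q) = mat3 {(x, y). (mul3 x (inv3 a), mul3 y (inv3 b)) \<in> Q}"
  by (simp add: mat_shift_def mat3_def shift_list_map comp_def)

lemma mat_or: "mat_or (mat3 Q) (mat3 R) = mat3 (Q \<union> R)"
  by (simp add: mat_or_def mat3_def elems3_def)

lemma mat_at: "mat_at (mat3 Q) p \<longleftrightarrow> p \<in> Q"
  by (simp add: mat_at_def mat3_def sel_map)

lemma mat3_inj: "mat3 Q = mat3 R \<longleftrightarrow> Q = R"
  by (metis mat_at subsetI subset_antisym)

lemma row_comb_map:
  "row_comb (map P elems3) (map (\<lambda>b. map (T b) elems3) elems3) = map (\<lambda>c. \<exists>b. P b \<and> T b c) elems3"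
  unfolding ex_perm3 by (simp add: elems3_def)

lemma mat_comp: "mat_comp (mat3 Q) (mat3 R) = mat3 (Q O R)"
  by (simp add: mat_comp_def mat3_def row_comb_map relcomp_unfold comp_def)

lemma count_true_map: "distinct xs \<Longrightarrow> count_true (map P xs) = int (card {x \<in> set xs. P x})"
proof (induction xs)
  case (Cons x xs)
  have "{y \<in> set (x # xs). P y} = (if P x then insert x {y \<in> set xs. P y} else {y \<in> set xs. P y})"
    by auto
  then show ?case using Cons by simp
qed simp

lemma distinct_elems3: "distinct elems3"
  by (simp add: elems3_def)

lemma count_elems3: "count_true (map P elems3) = int (card {x. P x})"
  using count_true_map[OF distinct_elems3, of P] by (simp add: set_elems3)

lemma mat_size: "mat_size (mat3 Q) = int (card Q)"
proof -
  have "mat_size (mat3 Q) = count_true (map (\<lambda>p. p \<in> Q) (List.product elems3 elems3))"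
    by (simp add: mat_size_def mat3_def product_concat_map map_concat comp_def)
  also have "\<dots> = int (card {p \<in> set (List.product elems3 elems3). p \<in> Q})"
    by (intro count_true_map distinct_product distinct_elems3)
  finally show ?thesis by (simp add: set_elems3)
qed

lemma mat_beta: "mat_beta (mat3 Q) = beta (int (card (Domain Q))) (int (card (Range Q))) (int (card Q))"
proof -
  have "list_ex id (map P elems3) \<longleftrightarrow> (\<exists>b. P b)" for P
    by (simp add: list_ex_iff set_elems3)
  then have "map (list_ex id) (mat3 Q) = map (\<lambda>a. a \<in> Domain Q) elems3"
    by (simp add: mat3_def comp_def Domain_iff)
  moreover have "row_comb [True, True, True, True, True, True] (mat3 Q) = map (\<lambda>b. b \<in> Range Q) elems3"
    using row_comb_map[of "\<lambda>_. True" "\<lambda>a b. (a, b) \<in> Q"] by (simp add: mat3_def Range_iff elems3_def)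
  ultimately show ?thesis by (simp add: mat_beta_def count_elems3 mat_size)
qed

lemma mat_weight: "mat_weight (mat3 Q) (mat3 R) = int (card {y. (Id, y) \<in> Q \<and> (y, Id) \<in> R})"
proof -
  have "map2 (\<and>) (hd (mat3 Q)) (map hd (mat3 R)) = map (\<lambda>y. (Id, y) \<in> Q \<and> (y, Id) \<in> R) elems3"
    by (simp add: mat3_def elems3_def)
  then show ?thesis by (simp add: mat_weight_def count_elems3)
qed

text \<open>The identity \<open>mult3\<close> multiplied by 36, which clears the denominators of
  \<open>phi3\<close>.\<close>

definition check :: "bool list list \<Rightarrow> bool list list \<Rightarrow> bool" where
  "check A B \<longleftrightarrow> foldr (\<lambda>g. iarr_add (let A' = map (conj_list g) A; C = mat_comp A' B
        in iarr_smult (mat_weight A' B * mat_size C) (mat_beta C))) elems3 iarr_zero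
     = iarr_smult (mat_size A * mat_size B) (iarr_mult (mat_beta A) (mat_beta B))"

lemma check_mult3:
  assumes "check (mat3 Q) (mat3 R)"
  shows "mult3 Q R"
proof -
  let ?b = "\<lambda>Q. arr_of (mat_beta (mat3 Q))" and ?C = "\<lambda>g. conj3 Id g Q O R"
  have phi: "phi3 Q = arr_smult (of_nat (card Q) / 36) (?b Q)" for Q
    by (simp add: phi3_def mat_beta)
  have conj: "map (conj_list g) (mat3 Q) = mat3 (conj3 Id g Q)" for g
    using mat_conj[of Id g Q] conj_list_map[of Id "\<lambda>a. conj_list g (map (\<lambda>b. (a, b) \<in> Q) elems3)"]
    by (simp add: mat_conj_def mat3_def comp_def)
  have fold: "arr_of (foldr (\<lambda>g. iarr_add (f g)) xs iarr_zero) = sum_list (map (\<lambda>g. arr_of (f g)) xs)" for f and xs :: "perm3 list"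
    by (induction xs) (simp_all add: arr_of_zero arr_of_add)
  have "arr_of (foldr (\<lambda>g. iarr_add (iarr_smult (int (weight3 (conj3 Id g Q) R) * int (card (?C g)))
      (mat_beta (mat3 (?C g))))) elems3 iarr_zero) =
    arr_of (iarr_smult (int (card Q) * int (card R)) (iarr_mult (mat_beta (mat3 Q)) (mat_beta (mat3 R))))"
    using assms unfolding check_def Let_def conj mat_comp mat_weight mat_size weight3_def by simp
  then have "(\<Sum>g\<in>UNIV. arr_smult (of_nat (weight3 (conj3 Id g Q) R) * of_nat (card (?C g))) (?b (?C g))) =
      arr_smult (of_nat (card Q) * of_nat (card R)) (?b Q * ?b R)"
    unfolding fold arr_of_smult arr_of_mult
    by (simp add: sum_list_distinct_conv_sum_set distinct_elems3 set_elems3)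
  then have "arr_smult (1 / 36) (\<Sum>g\<in>UNIV. arr_smult (of_nat (weight3 (conj3 Id g Q) R) * of_nat (card (?C g))) (?b (?C g))) =
      arr_smult (1 / 36) (arr_smult (of_nat (card Q) * of_nat (card R)) (?b Q * ?b R))"
    by (simp only:)
  then show ?thesis
    unfolding mult3_def phi arr.scale_sum_right by simp
qed

subsection \<open>The subgroups up to conjugacy\<close>

definition mat_one :: "bool list list" where
  "mat_one = map (\<lambda>a. map (\<lambda>b. a = Id \<and> b = Id) elems3) elems3"

definition grow :: "(perm3 \<times> perm3) list \<Rightarrow> bool list list \<Rightarrow> bool list list" where
  "grow hs A = foldl (\<lambda>A h. mat_or A (mat_shift h A)) A hs"

text \<open>The first list only counts the rounds, six for \<open>elems3\<close>. That the generated
  subgroup is reached is not presupposed: the search relies only on everything added being in each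
  closed set that contains the generators, and the representatives are tested by
  \<open>wellformed\<close>.\<close>

fun saturate :: "'c list \<Rightarrow> (perm3 \<times> perm3) list \<Rightarrow> bool list list \<Rightarrow> bool list list" where
  "saturate [] hs A = A"
| "saturate (_ # ks) hs A = saturate ks hs (grow hs A)"

definition closed3 :: "(perm3 \<times> perm3) set \<Rightarrow> bool" where
  "closed3 Q \<longleftrightarrow> (Id, Id) \<in> Q \<and> (\<forall>a b c d. (a, b) \<in> Q \<longrightarrow> (c, d) \<in> Q \<longrightarrow> (mul3 a c, mul3 b d) \<in> Q)"

text \<open>A search through all subgroups: the matrix \<open>A\<close> holds the elements known to belong to the subgroup,
  \<open>hs\<close> generators of these, \<open>N\<close> the elements known not to belong, and the last list the undecided
  elements.\<close>

fun subgroups_from ::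
  "bool list list \<Rightarrow> (perm3 \<times> perm3) list \<Rightarrow> (perm3 \<times> perm3) list \<Rightarrow> (perm3 \<times> perm3) list \<Rightarrow> bool list list list"
where
  "subgroups_from A hs N [] = [A]"
| "subgroups_from A hs N (g # gs) =
    (if mat_at A g then subgroups_from A hs N gs
     else (let B = saturate elems3 (g # hs) (mat_or A (mat_shift g A))
           in if list_ex (mat_at B) N then [] else subgroups_from B (g # hs) N gs) @
       subgroups_from A hs (g # N) gs)"

lemma grow_sound:
  assumes Q: "closed3 Q" and "P \<subseteq> Q" "set hs \<subseteq> Q"
  shows "\<exists>P'. grow hs (mat3 P) = mat3 P' \<and> P \<subseteq> P' \<and> P' \<subseteq> Q"
  using assms(2,3)
proof (induction hs arbitrary: P)
  case Nil
  then show ?case by (auto simp: grow_def)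
next
  case (Cons h hs)
  obtain a b where h: "h = (a, b)" by (cases h)
  let ?S = "{(x, y). (mul3 x (inv3 a), mul3 y (inv3 b)) \<in> P}"
  have "?S \<subseteq> Q"
  proof
    fix p assume "p \<in> ?S"
    then obtain x y where p: "p = (x, y)" "(mul3 x (inv3 a), mul3 y (inv3 b)) \<in> Q"
      using Cons.prems by auto
    moreover have "(a, b) \<in> Q" using Cons.prems by (simp add: h)
    ultimately have "(mul3 (mul3 x (inv3 a)) a, mul3 (mul3 y (inv3 b)) b) \<in> Q"
      using Q unfolding closed3_def by blast
    then show "p \<in> Q" by (simp add: p mul3_assoc)
  qed
  then have "\<exists>P'. grow hs (mat3 (P \<union> ?S)) = mat3 P' \<and> P \<union> ?S \<subseteq> P' \<and> P' \<subseteq> Q"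
    using Cons.prems by (intro Cons.IH) auto
  moreover have "grow (h # hs) (mat3 P) = grow hs (mat3 (P \<union> ?S))"
    by (simp add: grow_def h mat_shift mat_or)
  ultimately show ?case by auto
qed

lemma saturate_sound:
  assumes Q: "closed3 Q" and "P \<subseteq> Q" and hs: "set hs \<subseteq> Q"
  shows "\<exists>P'. saturate ks hs (mat3 P) = mat3 P' \<and> P \<subseteq> P' \<and> P' \<subseteq> Q"
  using assms(2)
proof (induction ks arbitrary: P)
  case (Cons k ks)
  obtain P' where P': "grow hs (mat3 P) = mat3 P'" "P \<subseteq> P'" "P' \<subseteq> Q"
    using grow_sound[OF Q Cons.prems hs] by blast
  then show ?case using Cons.IH[OF P'(3)] by auto
qed auto

text \<open>Follow the branch on which every decision agrees with \<open>Q\<close>. Accepted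
  elements stay inside \<open>Q\<close> and rejected ones outside, so this branch is never pruned,
  and when nothing is undecided \<open>P\<close> equals \<open>Q\<close>.\<close>

lemma subgroups_from_complete:
  assumes Q: "closed3 Q"
  shows "\<lbrakk>(Id, Id) \<in> P; P \<subseteq> Q; set hs \<subseteq> Q; Q \<inter> set N = {}; Q \<subseteq> P \<union> set N \<union> set gs\<rbrakk>
    \<Longrightarrow> mat3 Q \<in> set (subgroups_from (mat3 P) hs N gs)"
proof (induction gs arbitrary: P hs N)
  case Nil
  then have "Q = P" by auto
  then show ?case by simp
next
  case (Cons g gs)
  show ?case
  proof (cases "g \<in> P")
    case True
    then have "mat3 Q \<in> set (subgroups_from (mat3 P) hs N gs)"
      using Cons.prems by (intro Cons.IH) auto
    then show ?thesis using True by (simp add: mat_at)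
  next
    case False
    obtain a b where g: "g = (a, b)" by (cases g)
    let ?S = "{(x, y). (mul3 x (inv3 a), mul3 y (inv3 b)) \<in> P}"
    let ?B = "saturate elems3 (g # hs) (mat_or (mat3 P) (mat_shift g (mat3 P)))"
    show ?thesis
    proof (cases "g \<in> Q")
      case True
      have "?S \<subseteq> Q"
      proof
        fix p assume "p \<in> ?S"
        then obtain x y where p: "p = (x, y)" "(mul3 x (inv3 a), mul3 y (inv3 b)) \<in> Q"
          using Cons.prems by auto
        then have "(mul3 (mul3 x (inv3 a)) a, mul3 (mul3 y (inv3 b)) b) \<in> Q"
          using Q True unfolding closed3_def g by blast
        then show "p \<in> Q" by (simp add: p mul3_assoc)
      qed
      then obtain P' where P': "?B = mat3 P'" "P \<union> ?S \<subseteq> P'" "P' \<subseteq> Q"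
        using saturate_sound[OF Q, of "P \<union> ?S" "g # hs" elems3] Cons.prems True
        by (auto simp: g mat_shift mat_or)
      have "g \<in> ?S" using Cons.prems(1) by (simp add: g)
      then have "g \<in> P'" using P'(2) by blast
      then have "mat3 Q \<in> set (subgroups_from (mat3 P') (g # hs) N gs)"
        using Cons.prems True P' by (intro Cons.IH) auto
      moreover have "\<not> list_ex (mat_at (mat3 P')) N"
        using Cons.prems(4) P'(3) by (auto simp: list_ex_iff mat_at)
      ultimately show ?thesis using False by (simp add: mat_at P'(1) Let_def)
    next
      case notin: False
      have "mat3 Q \<in> set (subgroups_from (mat3 P) hs (g # N) gs)"
        using Cons.prems notin by (intro Cons.IH) auto
      then show ?thesis using False by (simp add: mat_at Let_def)
    qed
  qed
qed

text \<open>Generators for one subgroup from each conjugacy class; the order is that of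
  \<open>betas\<close>.\<close>

definition reps3 :: "bool list list list" where
  "reps3 = map (\<lambda>hs. saturate elems3 hs mat_one)
    [[],
     [(Id, A23)],
     [(Id, C123)],
     [(Id, A23), (Id, A12)],
     [(A23, Id)],
     [(A23, A23)],
     [(Id, A23), (A23, Id)],
     [(A23, C123)],
     [(Id, C123), (A23, A23)],
     [(Id, A23), (A23, A12)],
     [(C123, Id)],
     [(C123, A23)],
     [(C123, C123)],
     [(Id, C123), (C123, Id)],
     [(Id, A23), (C123, A12)],
     [(A23, Id), (A12, Id)],
     [(A23, A23), (A12, A23)],
     [(A23, Id), (A12, A23)],
     [(A23, Id), (A12, C123)],
     [(A23, A23), (A12, A12)],
     [(Id, C123), (A23, A23), (A12, A23)],
     [(A23, A23), (A12, C123)]]"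

text \<open>Explicit values, so that independence and spanning can be read off without evaluating
  relations; \<open>betas_reps3\<close> ties them to the representatives.\<close>

definition betas :: "iarr list" where
  "betas =
   [IArr 4 2 2 2 1 1 2 1 1 4 2 2 0 0 0 8 4 4 0 0 8 0,
    IArr 2 0 2 1 0 1 1 0 1 0 0 0 0 0 0 4 0 4 0 0 0 0,
    IArr 0 2 2 0 1 1 0 1 1 0 0 0 0 0 0 0 4 4 0 0 0 0,
    IArr 0 0 2 0 0 1 0 0 1 0 0 0 0 0 0 0 0 4 0 0 0 0,
    IArr 2 1 1 0 0 0 2 1 1 2 0 2 0 0 0 0 0 0 0 0 0 0,
    IArr 2 1 1 1 1 0 1 0 1 2 2 0 1 (-2) 0 4 4 0 (-2) 0 (-40) 4,
    IArr 1 0 1 0 0 0 1 0 1 0 0 0 0 0 0 0 0 0 0 0 0 0,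
    IArr 0 1 1 0 0 0 0 1 1 0 0 0 0 0 0 0 0 0 0 0 0 0,
    IArr 0 1 1 0 1 0 0 0 1 0 0 0 1 0 0 0 4 0 (-2) 0 0 0,
    IArr 0 0 1 0 0 0 0 0 1 0 0 0 0 0 0 0 0 0 0 0 0 0,
    IArr 0 0 0 2 1 1 2 1 1 0 2 2 0 0 0 0 0 0 0 0 0 0,
    IArr 0 0 0 1 0 1 1 0 1 0 0 0 0 0 0 0 0 0 0 0 0 0,
    IArr 2 0 0 0 1 1 0 1 1 2 0 0 0 0 2 4 0 0 0 0 4 0,
    IArr 0 0 0 0 1 1 0 1 1 0 0 0 0 0 0 0 0 0 0 0 0 0,
    IArr 0 0 0 0 0 1 0 0 1 0 0 0 0 0 0 0 0 0 0 0 0 0,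
    IArr 0 0 0 0 0 0 2 1 1 0 0 2 0 0 0 0 0 0 0 0 0 0,
    IArr 0 0 0 1 1 0 1 0 1 0 2 0 1 (-2) 0 0 0 0 0 0 0 0,
    IArr 0 0 0 0 0 0 1 0 1 0 0 0 0 0 0 0 0 0 0 0 0 0,
    IArr 0 0 0 0 0 0 0 1 1 0 0 0 0 0 0 0 0 0 0 0 0 0,
    IArr 1 0 0 0 1 0 0 0 1 0 0 0 1 0 1 0 0 0 0 1 0 0,
    IArr 0 0 0 0 1 0 0 0 1 0 0 0 1 0 0 0 0 0 0 0 0 0,
    IArr 0 0 0 0 0 0 0 0 1 0 0 0 0 0 0 0 0 0 0 0 0 0]"

definition classify :: "bool list list list \<Rightarrow> bool" where
  "classify rs \<longleftrightarrow> list_all (\<lambda>A. list_ex (\<lambda>a. list_ex (\<lambda>b. List.member rs (mat_conj a b A)) elems3) elems3)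
     (subgroups_from mat_one [] [] (List.product elems3 elems3))"

text \<open>Besides the shape of the matrix: it contains the identity and is unchanged by right
  translation with each of its elements, which makes it a subgroup.\<close>

definition wellformed :: "bool list list \<Rightarrow> bool" where
  "wellformed A \<longleftrightarrow> length A = 6 \<and> list_all (\<lambda>r. length r = 6) A \<and> mat_at A (Id, Id) \<and>
     list_all (\<lambda>p. mat_at A p \<longrightarrow> mat_shift p A = A) (List.product elems3 elems3)"

definition check_all :: "bool list list list \<Rightarrow> bool list list list \<Rightarrow> bool" where
  "check_all rs rs' \<longleftrightarrow> list_all (\<lambda>A. list_all (check A) rs') rs"

section \<open>Verification by evaluation\<close>

lemma classify_reps3: "classify reps3"
  by code_simp

lemma wellformed_reps3: "list_all wellformed reps3"
  by code_simp

lemma betas_reps3: "map mat_beta reps3 = betas"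
  by code_simp

lemma distinct_betas: "distinct betas"
  by code_simp

text \<open>All 484 ordered pairs, in blocks of 6, 6, 5 and 5 left factors.\<close>

lemma check_reps3: "check_all (take 6 reps3) reps3" "check_all (take 6 (drop 6 reps3)) reps3"
    "check_all (take 5 (drop 12 reps3)) reps3" "check_all (drop 17 reps3) reps3"
  by code_simp+

section \<open>The double Burnside algebra of the symmetric group\<close>

fun images3 :: "perm3 \<Rightarrow> nat \<times> nat \<times> nat" where
  "images3 Id = (1, 2, 3)" | "images3 A23 = (1, 3, 2)" | "images3 A12 = (2, 1, 3)"
| "images3 C123 = (2, 3, 1)" | "images3 C132 = (3, 1, 2)" | "images3 A13 = (3, 2, 1)"

definition pm :: "perm3 \<Rightarrow> nat \<Rightarrow> nat" where
  "pm x = (case images3 x of (a, b, c) \<Rightarrow> id(1 := a, 2 := b, 3 := c))"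

abbreviation S3 :: "(nat \<Rightarrow> nat) monoid" where "S3 \<equiv> sym_group 3"

lemma pm_mul3: "pm (mul3 x y) = pm x \<circ> pm y"
  by (cases x; cases y; simp add: pm_def fun_eq_iff)

lemma pm_Id: "pm Id = id"
  by (simp add: pm_def fun_eq_iff)

lemma pm_inverse: "pm x (pm (inv3 x) n) = n" "pm (inv3 x) (pm x n) = n"
  using pm_mul3[of x "inv3 x"] pm_mul3[of "inv3 x" x] by (simp_all add: pm_Id fun_eq_iff)

lemma inj_pm: "inj pm"
proof (rule injI)
  fix x y assume "pm x = pm y"
  then have "pm x 1 = pm y 1" "pm x 2 = pm y 2" by simp_all
  then show "x = y" by (cases x; cases y; simp add: pm_def)
qed

lemma pm_permutes: "pm x permutes {1..3}"
  unfolding permutes_def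
proof (intro conjI allI impI)
  fix n :: nat assume "n \<notin> {1..3}"
  then have "n \<noteq> 1" "n \<noteq> 2" "n \<noteq> 3" by auto
  then show "pm x n = n" by (simp add: pm_def split: prod.split)
next
  fix n
  show "\<exists>!m. pm x m = n"
    by (rule ex1I[of _ "pm (inv3 x) n"]) (auto simp: pm_inverse)
qed

lemma ex_pm:
  assumes p: "p permutes {1..3}"
  shows "\<exists>x. p = pm x"
proof -
  have eq: "p = id(1 := p 1, 2 := p 2, 3 := p 3)"
  proof
    fix n
    have "p n = n" if "n \<noteq> 1" "n \<noteq> 2" "n \<noteq> 3"
      using that by (intro permutes_not_in[OF p]) auto
    then show "p n = (id(1 := p 1, 2 := p 2, 3 := p 3)) n" by simp
  qed
  have range: "p n \<in> {1, 2, 3}" if "n \<in> {1..3}" for n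
    using permutes_in_image[OF p, of n] that by auto
  have r: "p 1 \<in> {1, 2, 3}" "p 2 \<in> {1, 2, 3}" "p 3 \<in> {1, 2, 3}"
    by (rule range; simp)+
  have inj: "inj p" using p by (rule permutes_inj)
  then have d: "p 1 \<noteq> p 2" "p 1 \<noteq> p 3" "p 2 \<noteq> p 3"
    by (simp_all add: inj_eq)
  have "\<exists>x. images3 x = (i, j, k)"
    if "i \<in> {1, 2, 3}" "j \<in> {1, 2, 3}" "k \<in> {1, 2, 3}" "i \<noteq> j" "i \<noteq> k" "j \<noteq> k" for i j k
    using that unfolding ex_perm3 by (elim insertE emptyE) simp_all
  from this[OF r d] have "\<exists>x. images3 x = (p 1, p 2, p 3)" .
  then obtain x where "images3 x = (p 1, p 2, p 3)" by blast
  then have "pm x = p" using eq by (simp add: pm_def)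
  then show ?thesis by blast
qed

lemma carrier_S3: "carrier S3 = range pm"
  by (rule Set.set_eqI) (metis ex_pm pm_permutes rangeE rangeI sym_group_carrier)

interpretation S3: finite_group S3
proof -
  interpret group S3 by (rule sym_group_is_group)
  show "finite_group S3" by unfold_locales (simp add: carrier_S3)
qed

lemma pm_carrier [simp]: "pm x \<in> carrier S3"
  by (simp add: carrier_S3)

lemma pm_mult [simp]: "pm x \<otimes>\<^bsub>S3\<^esub> pm y = pm (mul3 x y)"
  by (simp add: sym_group_mult pm_mul3)

lemma pm_one [simp]: "\<one>\<^bsub>S3\<^esub> = pm Id"
  by (simp add: sym_group_one pm_Id)

lemma pm_inv [simp]: "inv\<^bsub>S3\<^esub> (pm x) = pm (inv3 x)"
  by (rule S3.inv_equality) simp_all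

lemma pm_eq [simp]: "pm x = pm y \<longleftrightarrow> x = y"
  using inj_pm by (simp add: inj_eq)

lemma order_S3: "order S3 = 6"
proof -
  have "card (UNIV :: perm3 set) = 6"
    unfolding set_elems3[symmetric] distinct_card[OF distinct_elems3] by (simp add: elems3_def)
  then show ?thesis by (simp add: order_def carrier_S3 card_image inj_pm)
qed

definition pull :: "((nat \<Rightarrow> nat) \<times> (nat \<Rightarrow> nat)) set \<Rightarrow> (perm3 \<times> perm3) set" where
  "pull S = {(x, y). (pm x, pm y) \<in> S}"

definition push :: "(perm3 \<times> perm3) set \<Rightarrow> ((nat \<Rightarrow> nat) \<times> (nat \<Rightarrow> nat)) set" where
  "push Q = map_prod pm pm ` Q"

lemma mem_push [simp]: "(pm x, pm y) \<in> push Q \<longleftrightarrow> (x, y) \<in> Q"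
  by (auto simp: push_def)

lemma pull_push: "pull (push Q) = Q"
  by (simp add: pull_def)

lemma push_pull:
  assumes "S \<subseteq> carrier (S3 \<times>\<times> S3)"
  shows "push (pull S) = S"
proof (intro equalityI subsetI)
  fix p assume p: "p \<in> S"
  then have "p \<in> range pm \<times> range pm" using assms by (auto simp: carrier_S3)
  then obtain x y where "p = (pm x, pm y)" by blast
  then show "p \<in> push (pull S)" using p by (simp add: pull_def)
qed (auto simp: pull_def push_def)

lemma push_carrier: "push Q \<subseteq> carrier (S3 \<times>\<times> S3)"
  by (auto simp: push_def)

lemma card_push: "card (push Q) = card Q"
  unfolding push_def by (rule card_image) (auto simp: inj_on_def)

lemma pull_conjugate: "pull (S3.conjugate (pm a) (pm b) S) = conj3 a b (pull S)"
  by (auto simp: pull_def S3.conjugate_def conj3_def icj_def mul3_assoc)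

lemma pull_relcomp:
  assumes "S \<subseteq> carrier (S3 \<times>\<times> S3)"
  shows "pull (S O T) = pull S O pull T"
proof (intro equalityI subsetI)
  fix p assume "p \<in> pull (S O T)"
  then obtain x z y where p: "p = (x, z)" "(pm x, y) \<in> S" "(y, pm z) \<in> T"
    by (auto simp: pull_def)
  then obtain y' where "y = pm y'" using assms by (auto simp: carrier_S3)
  then show "p \<in> pull S O pull T" using p by (auto simp: pull_def)
qed (auto simp: pull_def)

lemma weight_pull: "S3.weight S T = weight3 (pull S) (pull T)"
proof -
  have "{b \<in> carrier S3. (\<one>\<^bsub>S3\<^esub>, b) \<in> S \<and> (b, \<one>\<^bsub>S3\<^esub>) \<in> T} =
      pm ` {y. (Id, y) \<in> pull S \<and> (y, Id) \<in> pull T}"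
    by (auto simp: carrier_S3 pull_def)
  then show ?thesis
    by (simp add: S3.weight_def weight3_def card_image inj_on_subset[OF inj_pm])
qed

lemma closed3_pull:
  assumes "subgroup S (S3 \<times>\<times> S3)"
  shows "closed3 (pull S)"
  using subgroup.one_closed[OF assms] subgroup.m_closed[OF assms]
  by (fastforce simp: closed3_def pull_def)

definition phi :: "((nat \<Rightarrow> nat) \<times> (nat \<Rightarrow> nat)) set \<Rightarrow> arr" where
  "phi S = phi3 (pull S)"

lemma conj_invariant_phi: "S3.conj_invariant phi"
  unfolding S3.conj_invariant_def
proof (intro allI impI)
  fix S a b assume "a \<in> carrier S3" "b \<in> carrier S3"
  then obtain a' b' where "a = pm a'" "b = pm b'" by (auto simp: carrier_S3)
  then show "phi (S3.conjugate a b S) = phi S"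
    by (simp add: phi_def pull_conjugate phi3_conj3)
qed

lemma conj_reps3:
  assumes "closed3 Q"
  shows "\<exists>a b. mat3 (conj3 a b Q) \<in> set reps3"
proof -
  have one: "mat_one = mat3 {(Id, Id)}" by (simp add: mat_one_def mat3_def)
  have "mat3 Q \<in> set (subgroups_from mat_one [] [] (List.product elems3 elems3))"
    unfolding one using assms
    by (intro subgroups_from_complete) (auto simp: set_elems3 closed3_def)
  then obtain a b where "List.member reps3 (mat_conj a b (mat3 Q))"
    using classify_reps3 unfolding classify_def list_all_iff list_ex_iff by blast
  then show ?thesis by (auto simp: mat_conj List.member_iff)
qed

lemma mult3_reps3:
  assumes "A \<in> set reps3" "B \<in> set reps3"
  shows "check A B"
proof -
  have split: "set xs = set (take n xs) \<union> set (drop n xs)" for n and xs :: "'c list"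
    by (metis append_take_drop_id set_append)
  have "set reps3 = set (take 6 reps3) \<union> set (take 6 (drop 6 reps3)) \<union> set (take 5 (drop 12 reps3)) \<union>
      set (drop 17 reps3)"
    using split[of reps3 6] split[of "drop 6 reps3" 6] split[of "drop 12 reps3" 5] by (simp add: Un_assoc)
  then show ?thesis
    using assms check_reps3 by (auto simp: check_all_def list_all_iff)
qed

lemma mult3_closed:
  assumes "closed3 Q" "closed3 R"
  shows "mult3 Q R"
proof -
  obtain a b c d where "mat3 (conj3 a b Q) \<in> set reps3" "mat3 (conj3 c d R) \<in> set reps3"
    using conj_reps3 assms by blast
  then have "mult3 (conj3 a b Q) (conj3 c d R)"
    by (intro check_mult3 mult3_reps3)
  \<comment> \<open>Conjugation by the inverses leads back from the representatives to the given
    subgroups.\<close>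
  then have "mult3 (conj3 (inv3 a) (inv3 b) (conj3 a b Q)) (conj3 (inv3 c) (inv3 d) (conj3 c d R))"
    by (rule mult3_conj3)
  then show ?thesis by (simp add: conj3_def)
qed

lemma multiplicative_phi: "S3.multiplicative phi"
  unfolding S3.multiplicative_def
proof (intro allI impI)
  fix S T assume S: "subgroup S (S3 \<times>\<times> S3)" and T: "subgroup T (S3 \<times>\<times> S3)"
  have sub: "S3.conjugate a b S \<subseteq> carrier (S3 \<times>\<times> S3)" for a b
    by (auto simp: S3.conjugate_def)
  have "(\<Sum>g\<in>carrier S3. arr_smult (of_nat (S3.weight (S3.conjugate \<one>\<^bsub>S3\<^esub> g S) T))
      (phi (S3.conjugate \<one>\<^bsub>S3\<^esub> g S O T))) =
    (\<Sum>g\<in>UNIV. arr_smult (of_nat (S3.weight (S3.conjugate \<one>\<^bsub>S3\<^esub> (pm g) S) T))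
      (phi (S3.conjugate \<one>\<^bsub>S3\<^esub> (pm g) S O T)))"
    unfolding carrier_S3 by (subst sum.reindex[OF inj_pm]) simp
  also have "\<dots> = arr_smult 36 (phi3 (pull S) * phi3 (pull T))"
    using mult3_closed[OF closed3_pull[OF S] closed3_pull[OF T]]
    by (simp only: mult3_def weight_pull phi_def pull_relcomp[OF sub] pm_one pull_conjugate)
  finally show "(\<Sum>g\<in>carrier S3. arr_smult (of_nat (S3.weight (S3.conjugate \<one>\<^bsub>S3\<^esub> g S) T))
      (phi (S3.conjugate \<one>\<^bsub>S3\<^esub> g S O T))) = arr_smult (of_nat (order S3) ^ 2) (phi S * phi T)"
    by (simp add: order_S3 phi_def)
qed

definition relm :: "bool list list \<Rightarrow> (perm3 \<times> perm3) set" where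
  "relm A = {p. mat_at A p}"

lemma relm_mat3 [simp]: "relm (mat3 Q) = Q"
  by (auto simp: relm_def mat_at)

lemma mat3_relm:
  assumes "A \<in> set reps3"
  shows "mat3 (relm A) = A"
proof -
  have "map (\<lambda>a. sel a xs) elems3 = xs" if "length xs = 6" for xs :: "'c list"
  proof -
    obtain x0 x1 x2 x3 x4 x5 where "xs = [x0, x1, x2, x3, x4, x5]"
      using \<open>length xs = 6\<close> by (auto simp: numeral_eq_Suc length_Suc_conv)
    then show ?thesis by (simp add: elems3_def)
  qed
  note sel = this
  have "length A = 6" "\<And>r. r \<in> set A \<Longrightarrow> length r = 6"
    using wellformed_reps3 assms by (auto simp: list_all_iff wellformed_def)
  then have "map (\<lambda>a. map (\<lambda>b. sel b (sel a A)) elems3) elems3 = A"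
  proof -
    have "map (\<lambda>a. map (\<lambda>b. sel b (sel a A)) elems3) elems3 = map (\<lambda>r. map (\<lambda>b. sel b r) elems3) (map (\<lambda>a. sel a A) elems3)"
      by simp
    also have "\<dots> = map (\<lambda>r. map (\<lambda>b. sel b r) elems3) A"
      by (simp only: sel[OF \<open>length A = 6\<close>])
    also have "\<dots> = A"
      by (rule map_idI) (simp add: sel \<open>\<And>r. r \<in> set A \<Longrightarrow> length r = 6\<close>)
    finally show ?thesis .
  qed
  then show ?thesis by (simp add: mat3_def relm_def mat_at_def)
qed

lemma subgroup_push_relm:
  assumes A: "A \<in> set reps3"
  shows "subgroup (push (relm A)) (S3 \<times>\<times> S3)"
proof -
  interpret GG: group "S3 \<times>\<times> S3" by (rule DirProd_group) (rule S3.group_axioms)+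
  let ?Q = "relm A"
  have A_eq: "A = mat3 ?Q" using mat3_relm[OF A] by simp
  have w: "wellformed A" using wellformed_reps3 A by (simp add: list_all_iff)
  have one: "(Id, Id) \<in> ?Q" using w by (simp add: wellformed_def relm_def)
  have shift: "(mul3 x (inv3 c), mul3 y (inv3 d)) \<in> ?Q \<longleftrightarrow> (x, y) \<in> ?Q" if "(c, d) \<in> ?Q" for x y c d
  proof -
    have "mat_shift (c, d) A = A"
      using w that by (simp add: wellformed_def relm_def list_all_iff set_elems3)
    then have "{(x, y). (mul3 x (inv3 c), mul3 y (inv3 d)) \<in> ?Q} = ?Q"
      by (metis A_eq mat3_inj mat_shift)
    then show ?thesis by blast
  qed
  \<comment> \<open>Translating \<open>(a c, b d)\<close> back by \<open>(c, d)\<close> gives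
    \<open>(a, b)\<close>. Inverses follow in the same way from the translate of the
    identity.\<close>
  have mult: "(mul3 a c, mul3 b d) \<in> ?Q" if "(a, b) \<in> ?Q" "(c, d) \<in> ?Q" for a b c d
    using shift[OF that(2), of "mul3 a c" "mul3 b d"] that(1) by (simp add: mul3_assoc)
  have inv: "(inv3 c, inv3 d) \<in> ?Q" if "(c, d) \<in> ?Q" for c d
    using shift[OF that, of Id Id] one by simp
  show ?thesis
  proof (rule GG.subgroupI[OF push_carrier])
    show "push ?Q \<noteq> {}" using one by (auto simp: push_def)
    fix p assume "p \<in> push ?Q"
    then obtain a b where p: "p = (pm a, pm b)" "(a, b) \<in> ?Q" by (auto simp: push_def)
    have "inv\<^bsub>S3 \<times>\<times> S3\<^esub> p = (pm (inv3 a), pm (inv3 b))"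
      by (simp add: p inv_DirProd S3.group_axioms)
    then show "inv\<^bsub>S3 \<times>\<times> S3\<^esub> p \<in> push ?Q"
      using inv[OF p(2)] by (force simp: push_def)
    fix q assume "q \<in> push ?Q"
    then obtain c d where q: "q = (pm c, pm d)" "(c, d) \<in> ?Q" by (auto simp: push_def)
    have "p \<otimes>\<^bsub>S3 \<times>\<times> S3\<^esub> q = (pm (mul3 a c), pm (mul3 b d))"
      by (simp add: p q)
    then show "p \<otimes>\<^bsub>S3 \<times>\<times> S3\<^esub> q \<in> push ?Q"
      using mult[OF p(2) q(2)] by (force simp: push_def)
  qed
qed

definition reps :: "((nat \<Rightarrow> nat) \<times> (nat \<Rightarrow> nat)) set set" where
  "reps = (\<lambda>A. push (relm A)) ` set reps3"

lemma subgroup_reps: "S \<in> reps \<Longrightarrow> subgroup S (S3 \<times>\<times> S3)"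
  by (auto simp: reps_def subgroup_push_relm)

lemma conj_reps:
  assumes S: "subgroup S (S3 \<times>\<times> S3)"
  shows "\<exists>a\<in>carrier S3. \<exists>b\<in>carrier S3. S3.conjugate a b S \<in> reps"
proof -
  obtain a b where ab: "mat3 (conj3 a b (pull S)) \<in> set reps3"
    using conj_reps3[OF closed3_pull[OF S]] by blast
  have "S3.conjugate (pm a) (pm b) S = push (conj3 a b (pull S))"
    unfolding pull_conjugate[symmetric]
    by (rule push_pull[symmetric]) (auto simp: S3.conjugate_def)
  also have "\<dots> = push (relm (mat3 (conj3 a b (pull S))))" by simp
  finally have "S3.conjugate (pm a) (pm b) S \<in> reps"
    unfolding reps_def using ab by (rule image_eqI)
  then show ?thesis using pm_carrier by blast
qed

section \<open>The 22 images as a basis of the order\<close>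

abbreviation rep_inva where
  "rep_inva S \<equiv> S3.class_inva phi (S3.rep_class S)"

text \<open>The number of points, 36 / |Q|, cancels the factor in \<open>phi3\<close>.\<close>

lemma rep_inva_reps3:
  assumes A: "A \<in> set reps3"
  shows "rep_inva (push (relm A)) = arr_of (mat_beta A)"
proof -
  have S: "push (relm A) \<in> reps" using A by (simp add: reps_def)
  have "relm A \<noteq> {}"
    using wellformed_reps3 A by (force simp: list_all_iff wellformed_def relm_def)
  then have "(of_nat (card (relm A)) :: rat) \<noteq> 0" by simp
  moreover have "mat_beta A = beta (int (card (Domain (relm A)))) (int (card (Range (relm A)))) (int (card (relm A)))"
    using mat_beta[of "relm A"] mat3_relm[OF A] by simp
  ultimately show ?thesis
    using S3.psi_rep[OF subgroup_reps conj_reps conj_invariant_phi multiplicative_phi S]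
    by (simp add: order_S3 card_push phi_def pull_push phi3_def)
qed

lemma length_reps3: "length reps3 = 22"
  by (simp add: reps3_def)

lemma sum_reps:
  "(\<Sum>S\<in>reps. arr_smult (c S) (rep_inva S)) =
    (\<Sum>i<22. arr_smult (c (push (relm (reps3 ! i)))) (arr_of (betas ! i)))"
proof -
  have inj: "inj_on (\<lambda>A. push (relm A)) (set reps3)"
    by (rule inj_onI) (metis mat3_relm pull_push)
  have "(\<Sum>S\<in>reps. arr_smult (c S) (rep_inva S)) =
      (\<Sum>A\<in>set reps3. arr_smult (c (push (relm A))) (arr_of (mat_beta A)))"
    unfolding reps_def by (subst sum.reindex[OF inj]) (simp add: rep_inva_reps3)
  also have "\<dots> = (\<Sum>A\<leftarrow>reps3. arr_smult (c (push (relm A))) (arr_of (mat_beta A)))"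
    using distinct_betas unfolding betas_reps3[symmetric]
    by (intro sum.distinct_set_conv_list) (simp add: distinct_map)
  also have "\<dots> = (\<Sum>i<22. arr_smult (c (push (relm (reps3 ! i)))) (arr_of (mat_beta (reps3 ! i))))"
    by (simp add: sum_list_sum_nth length_reps3 atLeast0LessThan)
  also have "\<dots> = (\<Sum>i<22. arr_smult (c (push (relm (reps3 ! i)))) (arr_of (betas ! i)))"
    by (intro sum.cong refl) (simp add: betas_reps3[symmetric] length_reps3)
  finally show ?thesis .
qed

lemma sum_22:
  "(\<Sum>i<22. f i) = f 0 + f 1 + f 2 + f 3 + f 4 + f 5 + f 6 + f 7 + f 8 + f 9 + f 10 + f 11 +
    f 12 + f 13 + f 14 + f 15 + f 16 + f 17 + f 18 + f 19 + f 20 + (f (21 :: nat) :: arr)"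
  by (simp add: eval_nat_numeral)

lemma all_22:
  "(\<forall>i<22. P i) \<longleftrightarrow> P 0 \<and> P 1 \<and> P 2 \<and> P 3 \<and> P 4 \<and> P 5 \<and> P 6 \<and> P 7 \<and> P 8 \<and> P 9 \<and> P 10 \<and> P 11 \<and>
    P 12 \<and> P 13 \<and> P 14 \<and> P 15 \<and> P 16 \<and> P 17 \<and> P 18 \<and> P 19 \<and> P 20 \<and> P (21 :: nat)"
  by (simp add: eval_nat_numeral All_less_Suc conj_ac)

lemma betas_independent:
  assumes "(\<Sum>i<22. arr_smult (c i) (arr_of (betas ! i))) = 0" and "i < 22"
  shows "c i = 0"
proof -
  note sels = arr_sel loc_sel arr_of.simps arr.sel loc.sel vector_add_component vector_smult_component
    vector_3 zero_index
  have zero: "arr_smult (c 0) (arr_of (IArr 4 2 2 2 1 1 2 1 1 4 2 2 0 0 0 8 4 4 0 0 8 0)) +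
      arr_smult (c 1) (arr_of (IArr 2 0 2 1 0 1 1 0 1 0 0 0 0 0 0 4 0 4 0 0 0 0)) +
      arr_smult (c 2) (arr_of (IArr 0 2 2 0 1 1 0 1 1 0 0 0 0 0 0 0 4 4 0 0 0 0)) +
      arr_smult (c 3) (arr_of (IArr 0 0 2 0 0 1 0 0 1 0 0 0 0 0 0 0 0 4 0 0 0 0)) +
      arr_smult (c 4) (arr_of (IArr 2 1 1 0 0 0 2 1 1 2 0 2 0 0 0 0 0 0 0 0 0 0)) +
      arr_smult (c 5) (arr_of (IArr 2 1 1 1 1 0 1 0 1 2 2 0 1 (-2) 0 4 4 0 (-2) 0 (-40) 4)) +
      arr_smult (c 6) (arr_of (IArr 1 0 1 0 0 0 1 0 1 0 0 0 0 0 0 0 0 0 0 0 0 0)) +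
      arr_smult (c 7) (arr_of (IArr 0 1 1 0 0 0 0 1 1 0 0 0 0 0 0 0 0 0 0 0 0 0)) +
      arr_smult (c 8) (arr_of (IArr 0 1 1 0 1 0 0 0 1 0 0 0 1 0 0 0 4 0 (-2) 0 0 0)) +
      arr_smult (c 9) (arr_of (IArr 0 0 1 0 0 0 0 0 1 0 0 0 0 0 0 0 0 0 0 0 0 0)) +
      arr_smult (c 10) (arr_of (IArr 0 0 0 2 1 1 2 1 1 0 2 2 0 0 0 0 0 0 0 0 0 0)) +
      arr_smult (c 11) (arr_of (IArr 0 0 0 1 0 1 1 0 1 0 0 0 0 0 0 0 0 0 0 0 0 0)) +
      arr_smult (c 12) (arr_of (IArr 2 0 0 0 1 1 0 1 1 2 0 0 0 0 2 4 0 0 0 0 4 0)) +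
      arr_smult (c 13) (arr_of (IArr 0 0 0 0 1 1 0 1 1 0 0 0 0 0 0 0 0 0 0 0 0 0)) +
      arr_smult (c 14) (arr_of (IArr 0 0 0 0 0 1 0 0 1 0 0 0 0 0 0 0 0 0 0 0 0 0)) +
      arr_smult (c 15) (arr_of (IArr 0 0 0 0 0 0 2 1 1 0 0 2 0 0 0 0 0 0 0 0 0 0)) +
      arr_smult (c 16) (arr_of (IArr 0 0 0 1 1 0 1 0 1 0 2 0 1 (-2) 0 0 0 0 0 0 0 0)) +
      arr_smult (c 17) (arr_of (IArr 0 0 0 0 0 0 1 0 1 0 0 0 0 0 0 0 0 0 0 0 0 0)) +
      arr_smult (c 18) (arr_of (IArr 0 0 0 0 0 0 0 1 1 0 0 0 0 0 0 0 0 0 0 0 0 0)) +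
      arr_smult (c 19) (arr_of (IArr 1 0 0 0 1 0 0 0 1 0 0 0 1 0 1 0 0 0 0 1 0 0)) +
      arr_smult (c 20) (arr_of (IArr 0 0 0 0 1 0 0 0 1 0 0 0 1 0 0 0 0 0 0 0 0 0)) +
      arr_smult (c 21) (arr_of (IArr 0 0 0 0 0 0 0 0 1 0 0 0 0 0 0 0 0 0 0 0 0 0)) = 0"
    using assms(1) unfolding sum_22 by (simp add: betas_def del: arr_of.simps)
  have e0: "4 * c 0 + 2 * c 1 + 2 * c 4 + 2 * c 5 + c 6 + 2 * c 12 + c 19 = 0"
    using arg_cong[OF zero, of "\<lambda>x. a11 x $ 1 $ 1"]
    by (simp only: sels; linarith)
  have e1: "2 * c 0 + 2 * c 2 + c 4 + c 5 + c 7 + c 8 = 0"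
    using arg_cong[OF zero, of "\<lambda>x. a11 x $ 1 $ 2"]
    by (simp only: sels; linarith)
  have e2: "2 * c 0 + 2 * c 1 + 2 * c 2 + 2 * c 3 + c 4 + c 5 + c 6 + c 7 + c 8 + c 9 = 0"
    using arg_cong[OF zero, of "\<lambda>x. a11 x $ 1 $ 3"]
    by (simp only: sels; linarith)
  have e3: "2 * c 0 + c 1 + c 5 + 2 * c 10 + c 11 + c 16 = 0"
    using arg_cong[OF zero, of "\<lambda>x. a11 x $ 2 $ 1"]
    by (simp only: sels; linarith)
  have e4: "c 0 + c 2 + c 5 + c 8 + c 10 + c 12 + c 13 + c 16 + c 19 + c 20 = 0"
    using arg_cong[OF zero, of "\<lambda>x. a11 x $ 2 $ 2"]
    by (simp only: sels; linarith)
  have e5: "c 0 + c 1 + c 2 + c 3 + c 10 + c 11 + c 12 + c 13 + c 14 = 0"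
    using arg_cong[OF zero, of "\<lambda>x. a11 x $ 2 $ 3"]
    by (simp only: sels; linarith)
  have e6: "2 * c 0 + c 1 + 2 * c 4 + c 5 + c 6 + 2 * c 10 + c 11 + 2 * c 15 + c 16 + c 17 = 0"
    using arg_cong[OF zero, of "\<lambda>x. a11 x $ 3 $ 1"]
    by (simp only: sels; linarith)
  have e7: "c 0 + c 2 + c 4 + c 7 + c 10 + c 12 + c 13 + c 15 + c 18 = 0"
    using arg_cong[OF zero, of "\<lambda>x. a11 x $ 3 $ 2"]
    by (simp only: sels; linarith)
  have e8: "c 0 + c 1 + c 2 + c 3 + c 4 + c 5 + c 6 + c 7 + c 8 + c 9 + c 10 + c 11 + c 12 + c 13 + c 14 + c 15 + c 16 + c 17 + c 18 + c 19 + c 20 + c 21 = 0"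
    using arg_cong[OF zero, of "\<lambda>x. a11 x $ 3 $ 3"]
    by (simp only: sels; linarith)
  have e9: "4 * c 0 + 2 * c 4 + 2 * c 5 + 2 * c 12 = 0"
    using arg_cong[OF zero, of "\<lambda>x. a14 x $ 1"]
    by (simp only: sels; linarith)
  have e10: "2 * c 0 + 2 * c 5 + 2 * c 10 + 2 * c 16 = 0"
    using arg_cong[OF zero, of "\<lambda>x. a14 x $ 2"]
    by (simp only: sels; linarith)
  have e11: "2 * c 0 + 2 * c 4 + 2 * c 10 + 2 * c 15 = 0"
    using arg_cong[OF zero, of "\<lambda>x. a14 x $ 3"]
    by (simp only: sels; linarith)
  have e12: "c 5 + c 8 + c 16 + c 19 + c 20 = 0"
    using arg_cong[OF zero, of "\<lambda>x. a22 x"]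
    by (simp only: sels; linarith)
  have e13: "- 2 * c 5 - 2 * c 16 = 0"
    using arg_cong[OF zero, of "\<lambda>x. a24 x"]
    by (simp only: sels; linarith)
  have e14: "2 * c 12 + c 19 = 0"
    using arg_cong[OF zero, of "\<lambda>x. a33 x"]
    by (simp only: sels; linarith)
  have e15: "8 * c 0 + 4 * c 1 + 4 * c 5 + 4 * c 12 = 0"
    using arg_cong[OF zero, of "\<lambda>x. a41 x $ 1"]
    by (simp only: sels; linarith)
  have e16: "4 * c 0 + 4 * c 2 + 4 * c 5 + 4 * c 8 = 0"
    using arg_cong[OF zero, of "\<lambda>x. a41 x $ 2"]
    by (simp only: sels; linarith)
  have e17: "4 * c 0 + 4 * c 1 + 4 * c 2 + 4 * c 3 = 0"
    using arg_cong[OF zero, of "\<lambda>x. a41 x $ 3"]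
    by (simp only: sels; linarith)
  have e18: "- 2 * c 5 - 2 * c 8 = 0"
    using arg_cong[OF zero, of "\<lambda>x. a42 x"]
    by (simp only: sels; linarith)
  have e19: "c 19 = 0"
    using arg_cong[OF zero, of "\<lambda>x. cst (a44 x)"]
    by (simp only: sels; linarith)
  have e20: "8 * c 0 - 40 * c 5 + 4 * c 12 = 0"
    using arg_cong[OF zero, of "\<lambda>x. eta (a44 x)"]
    by (simp only: sels; linarith)
  have e21: "4 * c 5 = 0"
    using arg_cong[OF zero, of "\<lambda>x. xi (a44 x)"]
    by (simp only: sels; linarith)
  \<comment> \<open>The system is triangular in the order chosen here: each unknown is found from
    one equation and the unknowns already known to vanish.\<close>
  have z19: "c 19 = 0"
    using e19  by linarith
  have z12: "c 12 = 0"
    using e14 z19 by linarith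
  have z5: "c 5 = 0"
    using e21  by linarith
  have z16: "c 16 = 0"
    using e13 z5 by linarith
  have z8: "c 8 = 0"
    using e18 z5 by linarith
  have z20: "c 20 = 0"
    using e12 z19 z5 z16 z8 by linarith
  have z0: "c 0 = 0"
    using e20 z12 z5 by linarith
  have z4: "c 4 = 0"
    using e9 z12 z5 z0 by linarith
  have z10: "c 10 = 0"
    using e10 z5 z16 z0 by linarith
  have z15: "c 15 = 0"
    using e11 z0 z4 z10 by linarith
  have z1: "c 1 = 0"
    using e15 z12 z5 z0 by linarith
  have z6: "c 6 = 0"
    using e0 z19 z12 z5 z0 z4 z1 by linarith
  have z11: "c 11 = 0"
    using e3 z5 z16 z0 z10 z1 by linarith
  have z17: "c 17 = 0"
    using e6 z5 z16 z0 z4 z10 z15 z1 z6 z11 by linarith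
  have z2: "c 2 = 0"
    using e16 z5 z8 z0 by linarith
  have z7: "c 7 = 0"
    using e1 z5 z8 z0 z4 z2 by linarith
  have z13: "c 13 = 0"
    using e4 z19 z12 z5 z16 z8 z20 z0 z10 z2 by linarith
  have z18: "c 18 = 0"
    using e7 z12 z0 z4 z10 z15 z2 z7 z13 by linarith
  have z3: "c 3 = 0"
    using e17 z0 z1 z2 by linarith
  have z9: "c 9 = 0"
    using e2 z5 z8 z0 z4 z1 z6 z2 z7 z3 by linarith
  have z14: "c 14 = 0"
    using e5 z12 z0 z10 z1 z11 z2 z13 z3 by linarith
  have z21: "c 21 = 0"
    using e8 z19 z12 z5 z16 z8 z20 z0 z4 z10 z15 z1 z6 z11 z17 z2 z7 z13 z18 z3 z9 z14 by linarith
  have "\<forall>i<22. c i = 0"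
    unfolding all_22 using z0 z1 z2 z3 z4 z5 z6 z7 z8 z9 z10 z11 z12 z13 z14 z15 z16 z17 z18 z19 z20 z21 by blast
  then show ?thesis using assms(2) by blast
qed

lemma betas_Lambda: "b \<in> set betas \<Longrightarrow> arr_of b \<in> Lambda_carrier"
proof -
  have "of_int (n * k) \<in> Z2mult (of_int n)" for n k
    by (auto simp: Z2mult_def)
  from this[of 2] this[of 4] this[of 8]
  have m: "2 \<in> Z2mult 2" "- 2 \<in> Z2mult 2" "4 \<in> Z2mult 2" "4 \<in> Z2mult 4" "8 \<in> Z2mult 4" "- 40 \<in> Z2mult 4"
      "8 \<in> Z2mult 8" "- 8 \<in> Z2mult 8" "40 \<in> Z2mult 8"
    using \<open>\<And>k. of_int (2 * k) \<in> Z2mult (of_int 2)\<close>[of 1] \<open>\<And>k. of_int (2 * k) \<in> Z2mult (of_int 2)\<close>[of "- 1"]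
      \<open>\<And>k. of_int (2 * k) \<in> Z2mult (of_int 2)\<close>[of 2] \<open>\<And>k. of_int (4 * k) \<in> Z2mult (of_int 4)\<close>[of 1]
      \<open>\<And>k. of_int (4 * k) \<in> Z2mult (of_int 4)\<close>[of 2] \<open>\<And>k. of_int (4 * k) \<in> Z2mult (of_int 4)\<close>[of "- 10"]
      \<open>\<And>k. of_int (8 * k) \<in> Z2mult (of_int 8)\<close>[of 1] \<open>\<And>k. of_int (8 * k) \<in> Z2mult (of_int 8)\<close>[of "- 1"]
      \<open>\<And>k. of_int (8 * k) \<in> Z2mult (of_int 8)\<close>[of 5]
    by simp_all
  have "\<forall>b\<in>set betas. arr_of b \<in> Lambda_carrier"
    unfolding betas_def mem_Lambda forall_3 by (simp add: m)
  then show "b \<in> set betas \<Longrightarrow> arr_of b \<in> Lambda_carrier" by blast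
qed

lemma betas_span:
  assumes x: "x \<in> Lambda_carrier"
  shows "\<exists>c. (\<forall>i<22. c i \<in> carrier Z2) \<and> x = (\<Sum>i<22. arr_smult (c i) (arr_of (betas ! i)))"
proof -
  note L = x[unfolded mem_Lambda]
  obtain t1 t2 t3 v x1 x2 x3 y m d k where *: "a14 x $ 1 = 2 * t1" "t1 \<in> carrier Z2"
      "a14 x $ 2 = 2 * t2" "t2 \<in> carrier Z2" "a14 x $ 3 = 2 * t3" "t3 \<in> carrier Z2"
      "a24 x = 2 * v" "v \<in> carrier Z2" "a41 x $ 1 = 4 * x1" "x1 \<in> carrier Z2"
      "a41 x $ 2 = 4 * x2" "x2 \<in> carrier Z2" "a41 x $ 3 = 4 * x3" "x3 \<in> carrier Z2"
      "a42 x = 2 * y" "y \<in> carrier Z2" "eta (a44 x) = 4 * m" "m \<in> carrier Z2"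
      "xi (a44 x) = 4 * d" "d \<in> carrier Z2"
      "2 * a33 x - 2 * cst (a44 x) - eta (a44 x) = 8 * k" "k \<in> carrier Z2"
    using L by (meson Z2multE)
  define s11 s12 s13 s21 s22 s23 s31 s32 s33 u w where s: "s11 = a11 x $ 1 $ 1" "s12 = a11 x $ 1 $ 2"
    "s13 = a11 x $ 1 $ 3" "s21 = a11 x $ 2 $ 1" "s22 = a11 x $ 2 $ 2" "s23 = a11 x $ 2 $ 3"
    "s31 = a11 x $ 3 $ 1" "s32 = a11 x $ 3 $ 2" "s33 = a11 x $ 3 $ 3" "u = a22 x" "w = a33 x"
  have Z: "s11 \<in> carrier Z2" "s12 \<in> carrier Z2" "s13 \<in> carrier Z2" "s21 \<in> carrier Z2"
      "s22 \<in> carrier Z2" "s23 \<in> carrier Z2" "s31 \<in> carrier Z2" "s32 \<in> carrier Z2" "s33 \<in> carrier Z2"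
      "u \<in> carrier Z2" "w \<in> carrier Z2"
    using L by (simp_all add: s)
  have z1: "cst (a44 x) = w - 2 * m - 4 * k"
    using *(17,21) by (simp add: s)
  \<comment> \<open>The triangular system of \<open>betas_independent\<close> with right-hand side
    \<open>x\<close>. In terms of the quotients by 2, 4 and 8 introduced above, all coefficients are
    integral. The congruence modulo 8 is what makes \<open>c 0\<close> integral:
    \<open>8 * c 0 - 40 * c 5 + 4 * c 12 = 4 * m\<close> with \<open>c 5 = d\<close> and
    \<open>c 12 = m + 2 * k\<close>.\<close>
  define c where "c i = [
    - k + 5 * d,
    x1 - m - 11 * d,
    x2 + y + k - 5 * d,
    - x1 - x2 + x3 - y + m + 11 * d,
    t1 - m - 11 * d,
    d,
    s11 - 2 * t1 - w - 2 * x1 + 4 * m + 4 * k + 22 * d,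
    s12 - t1 - 2 * x2 - y + m + 11 * d,
    - y - d,
    - s11 - s12 + s13 + 2 * t1 + w + 2 * x1 + 2 * x2 - 2 * x3 + 2 * y - 4 * m - 4 * k - 22 * d,
    t2 + v + k - 5 * d,
    s21 - 2 * t2 - v - x1 + m + 11 * d,
    m + 2 * k,
    s22 - t2 - u - v - x2 - y - m - 3 * k + 5 * d,
    - s21 - s22 + s23 + 2 * t2 + u + v + x1 + x2 - x3 + y - m - 11 * d,
    - t1 - t2 + t3 - v + m + 11 * d,
    - v - d,
    - s11 - s21 + s31 + 2 * t1 + 2 * t2 - 2 * t3 + 2 * v + w + 2 * x1 - 4 * m - 4 * k - 22 * d,
    - s12 - s22 + s32 + t1 + t2 - t3 + u + v + 2 * x2 + y - m - 11 * d,
    w - 2 * m - 4 * k,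
    u + v - w + y + 2 * m + 4 * k + d,
    s11 + s12 - s13 + s21 + s22 - s23 - s31 - s32 + s33 - 2 * t1 - 2 * t2 + 2 * t3 - 2 * u - 2 * v - w - 2 * x1 - 2 * x2 + 2 * x3 - 2 * y + 4 * m + 4 * k + 22 * d] ! i" for i
  have "\<forall>i<22. c i \<in> carrier Z2"
    unfolding all_22 c_def using * Z by simp
  moreover have "x = (\<Sum>i<22. arr_smult (c i) (arr_of (betas ! i)))"
    unfolding sum_22 arr_eq_iff forall_3
    by (simp add: betas_def c_def * s[symmetric] z1)
  ultimately show ?thesis by blast
qed

text \<open>The regular biset is transitive, and the stabilizer of the identity is the diagonal. Its
  order and the orders of its projections are 6, and \<open>beta 6 6 6\<close> is the unit
  array.\<close>

lemma inva_regular: "S3.inva phi (regular_biset S3) = 1"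
proof -
  let ?D = "{(x, x) | x :: perm3. True}"
  have t: "S3.transitive_at (regular_biset S3) \<one>\<^bsub>S3\<^esub>"
    unfolding S3.transitive_at_def
  proof (intro conjI ballI)
    show "\<one>\<^bsub>S3\<^esub> \<in> pts (regular_biset S3)" by (simp add: regular_biset_def del: pm_one)
    fix y assume y: "y \<in> pts (regular_biset S3)"
    show "\<exists>a\<in>carrier S3. \<exists>b\<in>carrier S3.
        y = lact (regular_biset S3) a (ract (regular_biset S3) \<one>\<^bsub>S3\<^esub> b)"
      by (rule bexI[of _ y], rule bexI[of _ "\<one>\<^bsub>S3\<^esub>"])
         (use y in \<open>simp_all add: regular_biset_def del: pm_one\<close>)
  qed
  have "pull (S3.stab (regular_biset S3) \<one>\<^bsub>S3\<^esub>) = ?D"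
    by (auto simp: S3.stab_def pull_def regular_biset_def)
  moreover have "card ?D = 6" "Domain ?D = UNIV" "Range ?D = UNIV"
  proof -
    have "?D = (\<lambda>x. (x, x)) ` UNIV" by auto
    then show "card ?D = 6"
      using order_S3 by (simp add: card_image inj_on_def order_def carrier_S3 inj_pm)
  qed auto
  moreover have "card (UNIV :: perm3 set) = 6"
    using order_S3 by (simp add: order_def carrier_S3 card_image inj_pm)
  moreover have "card (pts (regular_biset S3)) = 6"
    using order_S3 by (simp add: regular_biset_def order_def)
  moreover have "arr_of (beta 6 6 6) = 1"
    unfolding arr_eq_iff forall_3 by (simp add: beta_def beta6_def mat_def)
  ultimately show ?thesis
    using S3.inva_transitive[OF conj_invariant_phi S3.finite_biset_regular[OF S3.finite_carrier] t]
    by (simp add: phi_def phi3_def)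
qed

theorem double_burnside_S3_iso: "\<exists>h. algebra_iso Z2 Lambda (double_burnside Z2 S3) h"
proof (rule S3.double_burnside_iso[OF subgroup_reps conj_reps conj_invariant_phi multiplicative_phi
      Lambda_algebra])
  show "finite reps" by (simp add: reps_def)
  show "rep_inva S \<in> carrier Lambda" if "S \<in> reps" for S
  proof -
    obtain A where A: "A \<in> set reps3" "S = push (relm A)" using \<open>S \<in> reps\<close> by (auto simp: reps_def)
    then have "mat_beta A \<in> set betas" unfolding betas_reps3[symmetric] by simp
    then show ?thesis using A by (simp add: rep_inva_reps3 betas_Lambda)
  qed
  show "c S = 0" if "(\<Sum>S\<in>reps. arr_smult (c S) (rep_inva S)) = 0" "S \<in> reps" for c S
  proof -
    obtain A where "A \<in> set reps3" "S = push (relm A)" using \<open>S \<in> reps\<close> by (auto simp: reps_def)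
    then obtain i where "i < 22" "S = push (relm (reps3 ! i))"
      by (metis in_set_conv_nth length_reps3)
    then show ?thesis
      using that(1) betas_independent[of "\<lambda>i. c (push (relm (reps3 ! i)))" i] unfolding sum_reps by simp
  qed
  fix x assume "x \<in> carrier Lambda"
  then have "x \<in> Lambda_carrier" by simp
  then obtain c where c: "\<forall>i<22. c i \<in> carrier Z2" "x = (\<Sum>i<22. arr_smult (c i) (arr_of (betas ! i)))"
    using betas_span by blast
  \<comment> \<open>Distinct indices give distinct subgroups, so coefficients indexed by numbers can
    be turned into coefficients indexed by subgroups.\<close>
  have inj: "inj_on (\<lambda>i. push (relm (reps3 ! i))) {..<22}"
  proof (rule inj_onI)
    fix i j assume ij: "i \<in> {..<22}" "j \<in> {..<22}" "push (relm (reps3 ! i)) = push (relm (reps3 ! j))"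
    then have "relm (reps3 ! i) = relm (reps3 ! j)" by (metis pull_push)
    then have eq: "mat3 (relm (reps3 ! i)) = mat3 (relm (reps3 ! j))" by (rule arg_cong)
    have "reps3 ! i \<in> set reps3" "reps3 ! j \<in> set reps3"
      using ij by (auto intro!: nth_mem simp: length_reps3)
    then have "reps3 ! i = reps3 ! j"
      using eq by (simp only: mat3_relm)
    moreover have "distinct reps3"
      using distinct_betas unfolding betas_reps3[symmetric] by (simp add: distinct_map)
    ultimately show "i = j" using ij by (simp add: nth_eq_iff_index_eq length_reps3)
  qed
  define c' where "c' S = c (inv_into {..<22} (\<lambda>i. push (relm (reps3 ! i))) S)" for S
  have c': "c' (push (relm (reps3 ! i))) = c i" if "i < 22" for i
    using inv_into_f_f[OF inj, of i] that by (simp add: c'_def)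
  have "c' S \<in> carrier Z2" if "S \<in> reps" for S
  proof -
    obtain A where "A \<in> set reps3" "S = push (relm A)" using \<open>S \<in> reps\<close> by (auto simp: reps_def)
    then obtain i where "i < 22" "S = push (relm (reps3 ! i))"
      by (metis in_set_conv_nth length_reps3)
    then show ?thesis using c(1) c' by simp
  qed
  moreover have "x = (\<Sum>S\<in>reps. arr_smult (c' S) (rep_inva S))"
    unfolding sum_reps c(2) by (intro sum.cong refl) (simp add: c')
  ultimately show "\<exists>c. (\<forall>S\<in>reps. c S \<in> carrier Z2) \<and> x = (\<Sum>S\<in>reps. arr_smult (c S) (rep_inva S))"
    by blast
qed (simp_all add: inva_regular)

section \<open>Morita equivalence with a corner\<close>

text \<open>An infinite type is equinumerous with its square; iterating such a pairing codes tuples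
  of any fixed length.\<close>

lemma ex_tuple_code: "\<exists>enc :: 'u::infinite list \<Rightarrow> 'u. inj_on enc {xs. length xs = n}"
proof -
  have "\<exists>p :: 'u \<times> 'u \<Rightarrow> 'u. bij_betw p (UNIV \<times> UNIV) UNIV"
    unfolding card_of_ordIso by (rule card_of_Times_same_infinite[OF infinite_UNIV])
  then obtain p :: "'u \<times> 'u \<Rightarrow> 'u" where "bij_betw p (UNIV \<times> UNIV) UNIV" ..
  then have "inj p" by (simp add: bij_betw_def)
  then have p: "p a = p b \<Longrightarrow> a = b" for a b by (rule injD)
  show ?thesis
  proof (induction n)
    case 0
    \<comment> \<open>There is only one list of length 0, so every function is injective
      here.\<close>
    show ?case by (rule exI[of _ undefined]) (auto simp: inj_on_def)
  next
    case (Suc n)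
    then obtain enc :: "'u list \<Rightarrow> 'u" where enc: "inj_on enc {xs. length xs = n}" by blast
    have "inj_on (\<lambda>xs. p (hd xs, enc (tl xs))) {xs. length xs = Suc n}"
    proof (rule inj_onI)
      fix xs ys :: "'u list"
      assume "xs \<in> {xs. length xs = Suc n}" "ys \<in> {xs. length xs = Suc n}"
        and eq: "p (hd xs, enc (tl xs)) = p (hd ys, enc (tl ys))"
      then obtain a as b bs where l: "xs = a # as" "ys = b # bs" "length as = n" "length bs = n"
        by (auto simp: length_Suc_conv)
      have "a = b" "enc as = enc bs" using p[OF eq] by (simp_all add: l)
      then show "xs = ys" using inj_onD[OF enc, of as bs] l by simp
    qed
    then show ?case by blast
  qed
qed

lemma hom_finsum:
  assumes X: "abelian_monoid P" and Y: "abelian_monoid Q"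
    and closed: "\<And>x. x \<in> carrier P \<Longrightarrow> h x \<in> carrier Q"
    and add: "\<And>x y. x \<in> carrier P \<Longrightarrow> y \<in> carrier P \<Longrightarrow> h (x \<oplus>\<^bsub>P\<^esub> y) = h x \<oplus>\<^bsub>Q\<^esub> h y"
    and zero: "h \<zero>\<^bsub>P\<^esub> = \<zero>\<^bsub>Q\<^esub>"
    and fin: "finite I" and g: "\<And>i. i \<in> I \<Longrightarrow> g i \<in> carrier P"
  shows "h (finsum P g I) = finsum Q (\<lambda>i. h (g i)) I"
  using fin g
proof (induction I)
  case empty
  then show ?case by (simp add: abelian_monoid.finsum_empty[OF X] abelian_monoid.finsum_empty[OF Y] zero)
next
  case (insert i I)
  have "finsum P g I \<in> carrier P"
    using insert by (intro abelian_monoid.finsum_closed[OF X]) auto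
  then show ?case
    using insert closed
    by (simp add: abelian_monoid.finsum_insert[OF X] abelian_monoid.finsum_insert[OF Y] add Pi_def)
qed

lemma left_module_transport:
  fixes M :: "('a, 'm, 'd) module_scheme" and Q :: "('a, 'n, 'e) module_scheme"
  assumes M: "left_module A M"
    and car: "carrier Q = h ` carrier M"
    and add: "\<And>x y. x \<in> carrier M \<Longrightarrow> y \<in> carrier M \<Longrightarrow> h (x \<oplus>\<^bsub>M\<^esub> y) = h x \<oplus>\<^bsub>Q\<^esub> h y"
    and act: "\<And>a x. a \<in> carrier A \<Longrightarrow> x \<in> carrier M \<Longrightarrow> h (a \<odot>\<^bsub>M\<^esub> x) = a \<odot>\<^bsub>Q\<^esub> h x"
    and zero: "h \<zero>\<^bsub>M\<^esub> = \<zero>\<^bsub>Q\<^esub>"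
  shows "left_module A Q"
proof -
  interpret M: left_module A M by (rule M)
  note hom = add[symmetric] act[symmetric] zero[symmetric]
  have grp: "abelian_group Q"
  proof (rule abelian_groupI)
    fix x assume "x \<in> carrier Q"
    then obtain a where a: "a \<in> carrier M" "x = h a" by (auto simp: car)
    show "\<exists>y\<in>carrier Q. y \<oplus>\<^bsub>Q\<^esub> x = \<zero>\<^bsub>Q\<^esub>"
      by (rule bexI[of _ "h (\<ominus>\<^bsub>M\<^esub> a)"]) (use a in \<open>simp_all add: car hom M.M.l_neg\<close>)
  qed (auto simp: car hom M.M.a_assoc M.M.a_comm M.M.a_lcomm)
  show ?thesis
    unfolding left_module_def left_module_axioms_def
    using grp M.A.ring_axioms
    by (auto simp: car hom M.act_closed M.act_add_left M.act_add_right M.act_mult M.act_one)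
qed

lemma (in left_module) act_zero: "a \<in> carrier A \<Longrightarrow> a \<odot>\<^bsub>M\<^esub> \<zero>\<^bsub>M\<^esub> = \<zero>\<^bsub>M\<^esub>"
  using act_add_right[of a "\<zero>\<^bsub>M\<^esub>" "\<zero>\<^bsub>M\<^esub>"] act_closed[of a "\<zero>\<^bsub>M\<^esub>"]
  by (simp add: M.add.l_cancel_one')

lemma (in left_module) zero_act: "x \<in> carrier M \<Longrightarrow> \<zero>\<^bsub>A\<^esub> \<odot>\<^bsub>M\<^esub> x = \<zero>\<^bsub>M\<^esub>"
  using act_add_left[of "\<zero>\<^bsub>A\<^esub>" "\<zero>\<^bsub>A\<^esub>" x] act_closed[of "\<zero>\<^bsub>A\<^esub>" x]
  by (simp add: M.add.l_cancel_one')

lemma (in left_module) act_neg: "a \<in> carrier A \<Longrightarrow> x \<in> carrier M \<Longrightarrow> a \<odot>\<^bsub>M\<^esub> (\<ominus>\<^bsub>M\<^esub> x) = \<ominus>\<^bsub>M\<^esub> (a \<odot>\<^bsub>M\<^esub> x)"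
proof -
  assume a: "a \<in> carrier A" and x: "x \<in> carrier M"
  have "a \<odot>\<^bsub>M\<^esub> (\<ominus>\<^bsub>M\<^esub> x) \<oplus>\<^bsub>M\<^esub> a \<odot>\<^bsub>M\<^esub> x = \<zero>\<^bsub>M\<^esub>"
    using a x by (simp add: act_add_right[symmetric] M.l_neg act_zero)
  then show ?thesis using a x by (intro M.minus_equality[symmetric]) (simp_all add: act_closed)
qed

text \<open>The map \<open>\<phi>\<close> identifies \<open>B\<close> with \<open>e A e\<close>.
  Fullness, that is \<open>A e A = A\<close>, is given by an explicit decomposition of the unit,
  because its right factors \<open>e y\<close> become generators of \<open>e A\<close> over
  \<open>B\<close>.\<close>

locale full_corner =
  fixes R :: "('r, 'c) ring_scheme" and A :: "('r, 'a, 'd) module_scheme"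
    and B :: "('r, 'b, 'e) module_scheme" and \<phi> :: "'b \<Rightarrow> 'a" and e :: 'a
    and xs ys :: "nat \<Rightarrow> 'a" and n :: nat
  assumes A: "assoc_algebra R A" and B: "assoc_algebra R B"
    and phi_add: "\<And>b c. b \<in> carrier B \<Longrightarrow> c \<in> carrier B \<Longrightarrow> \<phi> (b \<oplus>\<^bsub>B\<^esub> c) = \<phi> b \<oplus>\<^bsub>A\<^esub> \<phi> c"
    and phi_mult: "\<And>b c. b \<in> carrier B \<Longrightarrow> c \<in> carrier B \<Longrightarrow> \<phi> (b \<otimes>\<^bsub>B\<^esub> c) = \<phi> b \<otimes>\<^bsub>A\<^esub> \<phi> c"
    and phi_smult: "\<And>r b. r \<in> carrier R \<Longrightarrow> b \<in> carrier B \<Longrightarrow> \<phi> (r \<odot>\<^bsub>B\<^esub> b) = r \<odot>\<^bsub>A\<^esub> \<phi> b"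
    and phi_one: "\<phi> \<one>\<^bsub>B\<^esub> = e"
    and inj_phi: "inj_on \<phi> (carrier B)"
    and image_phi: "\<phi> ` carrier B = {e \<otimes>\<^bsub>A\<^esub> a \<otimes>\<^bsub>A\<^esub> e | a. a \<in> carrier A}"
    and e_carrier: "e \<in> carrier A"
    and xs: "\<And>i. i < n \<Longrightarrow> xs i \<in> carrier A" and ys: "\<And>i. i < n \<Longrightarrow> ys i \<in> carrier A"
    and full: "(\<Oplus>\<^bsub>A\<^esub>i\<in>{..<n}. xs i \<otimes>\<^bsub>A\<^esub> e \<otimes>\<^bsub>A\<^esub> ys i) = \<one>\<^bsub>A\<^esub>"
begin

interpretation A: assoc_algebra R A by (rule A)
interpretation B: assoc_algebra R B by (rule B)

lemma e_idem: "e \<otimes>\<^bsub>A\<^esub> e = e"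
  using phi_mult[OF B.one_closed B.one_closed] by (simp add: phi_one)

lemma phi_closed [simp]: "b \<in> carrier B \<Longrightarrow> \<phi> b \<in> carrier A"
proof -
  assume "b \<in> carrier B"
  then have "\<phi> b \<in> {e \<otimes>\<^bsub>A\<^esub> a \<otimes>\<^bsub>A\<^esub> e | a. a \<in> carrier A}" using image_phi by blast
  then show ?thesis using e_carrier by auto
qed

lemma e_phi: "b \<in> carrier B \<Longrightarrow> e \<otimes>\<^bsub>A\<^esub> \<phi> b = \<phi> b" "b \<in> carrier B \<Longrightarrow> \<phi> b \<otimes>\<^bsub>A\<^esub> e = \<phi> b"
  using phi_mult[OF B.one_closed, of b] phi_mult[OF _ B.one_closed, of b] by (simp_all add: phi_one)

definition psi' where "psi' = inv_into (carrier B) \<phi>"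

definition eA where "eA = {z \<in> carrier A. e \<otimes>\<^bsub>A\<^esub> z = z}"

lemma eA_carrier: "z \<in> eA \<Longrightarrow> z \<in> carrier A"
  by (simp add: eA_def)

lemma e_eA: "z \<in> eA \<Longrightarrow> e \<otimes>\<^bsub>A\<^esub> z = z"
  by (simp add: eA_def)

lemma eA_closed:
  "a \<in> carrier A \<Longrightarrow> e \<otimes>\<^bsub>A\<^esub> a \<in> eA" "e \<in> eA"
  "z \<in> eA \<Longrightarrow> a \<in> carrier A \<Longrightarrow> z \<otimes>\<^bsub>A\<^esub> a \<in> eA"
  "z \<in> eA \<Longrightarrow> w \<in> eA \<Longrightarrow> z \<oplus>\<^bsub>A\<^esub> w \<in> eA" "\<zero>\<^bsub>A\<^esub> \<in> eA"
  "b \<in> carrier B \<Longrightarrow> z \<in> eA \<Longrightarrow> \<phi> b \<otimes>\<^bsub>A\<^esub> z \<in> eA"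
  using e_carrier
  by (simp_all add: eA_def e_idem A.r_distr A.m_assoc[symmetric] e_phi)

lemma psi'_closed: "z \<in> eA \<Longrightarrow> psi' (z \<otimes>\<^bsub>A\<^esub> e) \<in> carrier B"
  and phi_psi': "z \<in> eA \<Longrightarrow> \<phi> (psi' (z \<otimes>\<^bsub>A\<^esub> e)) = z \<otimes>\<^bsub>A\<^esub> e"
proof -
  assume z: "z \<in> eA"
  have "z \<otimes>\<^bsub>A\<^esub> e = e \<otimes>\<^bsub>A\<^esub> z \<otimes>\<^bsub>A\<^esub> e" using e_eA[OF z] by simp
  then have "z \<otimes>\<^bsub>A\<^esub> e \<in> \<phi> ` carrier B" unfolding image_phi using eA_carrier[OF z] by blast
  then show "psi' (z \<otimes>\<^bsub>A\<^esub> e) \<in> carrier B" "\<phi> (psi' (z \<otimes>\<^bsub>A\<^esub> e)) = z \<otimes>\<^bsub>A\<^esub> e"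
    unfolding psi'_def by (rule inv_into_into, rule f_inv_into_f)
qed

lemma psi'_eqI: "z \<in> eA \<Longrightarrow> b \<in> carrier B \<Longrightarrow> \<phi> b = z \<otimes>\<^bsub>A\<^esub> e \<Longrightarrow> psi' (z \<otimes>\<^bsub>A\<^esub> e) = b"
  using inj_onD[OF inj_phi _ psi'_closed] phi_psi' by metis

text \<open>Multiply the decomposition of the unit by \<open>z\<close>. The elements
  \<open>e ys i\<close> thus generate \<open>e A\<close>, with coefficients \<open>z xs i e\<close>
  in \<open>e A e\<close>.\<close>

lemma expand:
  assumes z: "z \<in> eA"
  shows "z = (\<Oplus>\<^bsub>A\<^esub>i\<in>{..<n}. (z \<otimes>\<^bsub>A\<^esub> xs i \<otimes>\<^bsub>A\<^esub> e) \<otimes>\<^bsub>A\<^esub> (e \<otimes>\<^bsub>A\<^esub> ys i))"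
proof -
  note zA = eA_carrier[OF z]
  have "z = z \<otimes>\<^bsub>A\<^esub> (\<Oplus>\<^bsub>A\<^esub>i\<in>{..<n}. xs i \<otimes>\<^bsub>A\<^esub> e \<otimes>\<^bsub>A\<^esub> ys i)"
    using zA by (simp add: full)
  also have "\<dots> = (\<Oplus>\<^bsub>A\<^esub>i\<in>{..<n}. z \<otimes>\<^bsub>A\<^esub> (xs i \<otimes>\<^bsub>A\<^esub> e \<otimes>\<^bsub>A\<^esub> ys i))"
    by (rule A.finsum_rdistr) (use zA xs ys e_carrier in auto)
  also have "\<dots> = (\<Oplus>\<^bsub>A\<^esub>i\<in>{..<n}. (z \<otimes>\<^bsub>A\<^esub> xs i \<otimes>\<^bsub>A\<^esub> e) \<otimes>\<^bsub>A\<^esub> (e \<otimes>\<^bsub>A\<^esub> ys i))"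
  proof (rule A.finsum_cong')
    fix i assume "i \<in> {..<n}"
    then have i: "xs i \<in> carrier A" "ys i \<in> carrier A" using xs ys by auto
    have "e \<otimes>\<^bsub>A\<^esub> (e \<otimes>\<^bsub>A\<^esub> ys i) = e \<otimes>\<^bsub>A\<^esub> ys i"
      using i e_carrier by (simp add: A.m_assoc[symmetric] e_idem)
    then show "z \<otimes>\<^bsub>A\<^esub> (xs i \<otimes>\<^bsub>A\<^esub> e \<otimes>\<^bsub>A\<^esub> ys i) = (z \<otimes>\<^bsub>A\<^esub> xs i \<otimes>\<^bsub>A\<^esub> e) \<otimes>\<^bsub>A\<^esub> (e \<otimes>\<^bsub>A\<^esub> ys i)"
      using i zA e_carrier by (simp add: A.m_assoc)
  qed (use zA xs ys e_carrier in auto)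
  finally show ?thesis .
qed

subsection \<open>The functor \<open>M \<mapsto> e M\<close>\<close>

definition Fo :: "('a, 'u) module \<Rightarrow> ('b, 'u) module" where
  "Fo M = \<lparr>carrier = {m \<in> carrier M. e \<odot>\<^bsub>M\<^esub> m = m}, monoid.mult = undefined, one = undefined,
     ring.zero = \<zero>\<^bsub>M\<^esub>, ring.add = (\<lambda>x y. x \<oplus>\<^bsub>M\<^esub> y), smult = (\<lambda>b m. \<phi> b \<odot>\<^bsub>M\<^esub> m)\<rparr>"

definition Fm :: "('a, 'u) module \<Rightarrow> ('a, 'u) module \<Rightarrow> ('u \<Rightarrow> 'u) \<Rightarrow> 'u \<Rightarrow> 'u" where
  "Fm M N f = restrict f (carrier (Fo M))"

lemma Fo_simps [simp]:
  "m \<in> carrier (Fo M) \<longleftrightarrow> m \<in> carrier M \<and> e \<odot>\<^bsub>M\<^esub> m = m"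
  "\<zero>\<^bsub>Fo M\<^esub> = \<zero>\<^bsub>M\<^esub>" "x \<oplus>\<^bsub>Fo M\<^esub> y = x \<oplus>\<^bsub>M\<^esub> y" "b \<odot>\<^bsub>Fo M\<^esub> m = \<phi> b \<odot>\<^bsub>M\<^esub> m"
  by (simp_all add: Fo_def)

lemma left_module_Fo:
  assumes M: "left_module A M"
  shows "left_module B (Fo M)"
proof -
  interpret M: left_module A M by (rule M)
  have grp: "abelian_group (Fo M)"
  proof (rule abelian_groupI)
    fix x assume x: "x \<in> carrier (Fo M)"
    then show "\<exists>y\<in>carrier (Fo M). y \<oplus>\<^bsub>Fo M\<^esub> x = \<zero>\<^bsub>Fo M\<^esub>"
      by (intro bexI[of _ "\<ominus>\<^bsub>M\<^esub> x"]) (simp_all add: M.act_neg e_carrier M.M.l_neg)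
  qed (simp_all add: M.act_add_right e_carrier M.act_zero M.M.a_ac)
  show ?thesis
    unfolding left_module_def left_module_axioms_def
  proof (intro conjI allI impI B.ring_axioms grp)
    fix a x assume a: "a \<in> carrier B" and x: "x \<in> carrier (Fo M)"
    show "a \<odot>\<^bsub>Fo M\<^esub> x \<in> carrier (Fo M)"
      using a x e_carrier by (simp add: M.act_closed M.act_mult[symmetric] e_phi)
  qed (simp_all add: phi_add phi_mult phi_one M.act_add_left M.act_add_right M.act_mult)
qed

lemma module_homD:
  assumes "f \<in> module_hom C M N"
  shows "x \<in> carrier M \<Longrightarrow> f x \<in> carrier N"
    "x \<in> carrier M \<Longrightarrow> y \<in> carrier M \<Longrightarrow> f (x \<oplus>\<^bsub>M\<^esub> y) = f x \<oplus>\<^bsub>N\<^esub> f y"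
    "a \<in> carrier C \<Longrightarrow> x \<in> carrier M \<Longrightarrow> f (a \<odot>\<^bsub>M\<^esub> x) = a \<odot>\<^bsub>N\<^esub> f x"
    "f \<in> extensional (carrier M)"
  using assms by (auto simp: module_hom_def PiE_def)

text \<open>A scalar acting on \<open>e A\<close> through \<open>A\<close> from the right acts as it
  does through \<open>B\<close> from the left; this yields linearity of the Hom functor.\<close>

lemma smult_one_A: "r \<in> carrier R \<Longrightarrow> z \<in> eA \<Longrightarrow> z \<otimes>\<^bsub>A\<^esub> (r \<odot>\<^bsub>A\<^esub> \<one>\<^bsub>A\<^esub>) = \<phi> (r \<odot>\<^bsub>B\<^esub> \<one>\<^bsub>B\<^esub>) \<otimes>\<^bsub>A\<^esub> z"
  using e_carrier e_eA[of z] eA_carrier[of z]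
  by (simp add: A.smult_mult_right phi_smult phi_one A.smult_mult_left)

lemma linear_functor_F: "linear_functor R A B (Fo :: ('a, 'u) module \<Rightarrow> _) Fm"
proof (rule linear_functor.intro)
  fix M N :: "('a, 'u) module" and f
  assume M: "left_module A M" and N: "left_module A N" and f: "f \<in> module_hom A M N"
  interpret M: left_module A M by (rule M)
  interpret N: left_module A N by (rule N)
  note fD = module_homD[OF f]
  have fe: "e \<odot>\<^bsub>N\<^esub> f m = f m" if "m \<in> carrier M" "e \<odot>\<^bsub>M\<^esub> m = m" for m
    using fD(3)[OF e_carrier that(1)] that(2) by simp
  show "Fm M N f \<in> module_hom B (Fo M) (Fo N)"
    unfolding module_hom_def Fm_def
    using fD fe e_carrier
    by (auto simp: M.act_closed M.act_add_right M.act_mult[symmetric] e_phi)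
next
  fix M N P :: "('a, 'u) module" and f g
  assume M: "left_module A M" and N: "left_module A N" and f: "f \<in> module_hom A M N"
  note fD = module_homD[OF f]
  have fe: "e \<odot>\<^bsub>N\<^esub> f m = f m" if "m \<in> carrier M" "e \<odot>\<^bsub>M\<^esub> m = m" for m
    using fD(3)[OF e_carrier that(1)] that(2) by simp
  show "Fm M P (compose (carrier M) g f) = compose (carrier (Fo M)) (Fm N P g) (Fm M N f)"
    by (rule ext) (use fD(1) fe in \<open>auto simp: Fm_def compose_def restrict_def\<close>)
next
  fix M N :: "('a, 'u) module" and f g r
  assume M: "left_module A M" and N: "left_module A N"
    and f: "f \<in> module_hom A M N" and g: "g \<in> module_hom A M N" and r: "r \<in> carrier R"
  interpret M: left_module A M by (rule M)
  interpret N: left_module A N by (rule N)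
  note fD = module_homD[OF f]
  have "(r \<odot>\<^bsub>A\<^esub> \<one>\<^bsub>A\<^esub>) \<odot>\<^bsub>N\<^esub> f m = \<phi> (r \<odot>\<^bsub>B\<^esub> \<one>\<^bsub>B\<^esub>) \<odot>\<^bsub>N\<^esub> f m" if m: "m \<in> carrier M" "e \<odot>\<^bsub>M\<^esub> m = m" for m
  proof -
    \<comment> \<open>On vectors fixed by \<open>e\<close>, the scalar \<open>r 1\<close> of
      \<open>A\<close> acts as \<open>r e\<close>, which is the image of \<open>r 1\<close> of
      \<open>B\<close>.\<close>
    have fe: "e \<odot>\<^bsub>N\<^esub> f m = f m" using fD(3)[OF e_carrier m(1)] m(2) by simp
    have "(r \<odot>\<^bsub>A\<^esub> \<one>\<^bsub>A\<^esub>) \<odot>\<^bsub>N\<^esub> f m = ((r \<odot>\<^bsub>A\<^esub> \<one>\<^bsub>A\<^esub>) \<otimes>\<^bsub>A\<^esub> e) \<odot>\<^bsub>N\<^esub> f m"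
      using r e_carrier fD(1)[OF m(1)] fe by (simp add: N.act_mult A.smult_closed)
    also have "(r \<odot>\<^bsub>A\<^esub> \<one>\<^bsub>A\<^esub>) \<otimes>\<^bsub>A\<^esub> e = \<phi> (r \<odot>\<^bsub>B\<^esub> \<one>\<^bsub>B\<^esub>)"
      using r e_carrier by (simp add: A.smult_mult_left phi_smult phi_one)
    finally show ?thesis .
  qed
  then show "Fm M N (hom_axpy A M N r f g) = hom_axpy B (Fo M) (Fo N) r (Fm M N f) (Fm M N g)"
    by (intro ext) (auto simp: Fm_def hom_axpy_def restrict_def)
qed (rule left_module_Fo, assumption, auto simp: Fm_def restrict_def fun_eq_iff)

subsection \<open>The functor \<open>N \<mapsto> Hom(e A, N)\<close>\<close>

definition Hm :: "('b, 'u) module \<Rightarrow> ('a \<Rightarrow> 'u) set" where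
  "Hm N = {f \<in> eA \<rightarrow>\<^sub>E carrier N. (\<forall>z\<in>eA. \<forall>w\<in>eA. f (z \<oplus>\<^bsub>A\<^esub> w) = f z \<oplus>\<^bsub>N\<^esub> f w) \<and>
     (\<forall>b\<in>carrier B. \<forall>z\<in>eA. f (\<phi> b \<otimes>\<^bsub>A\<^esub> z) = b \<odot>\<^bsub>N\<^esub> f z)}"

text \<open>\<open>e A\<close> is a bimodule; its right action of \<open>A\<close> becomes the left
  action \<open>(a f)(z) = f (z a)\<close> on \<open>B\<close>-linear maps.\<close>

definition H :: "('b, 'u) module \<Rightarrow> ('a, 'a \<Rightarrow> 'u) module" where
  "H N = \<lparr>carrier = Hm N, monoid.mult = undefined, one = undefined,
     ring.zero = (\<lambda>z\<in>eA. \<zero>\<^bsub>N\<^esub>), ring.add = (\<lambda>f g. \<lambda>z\<in>eA. f z \<oplus>\<^bsub>N\<^esub> g z),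
     smult = (\<lambda>a f. \<lambda>z\<in>eA. f (z \<otimes>\<^bsub>A\<^esub> a))\<rparr>"

lemma H_simps [simp]:
  "carrier (H N) = Hm N" "\<zero>\<^bsub>H N\<^esub> = (\<lambda>z\<in>eA. \<zero>\<^bsub>N\<^esub>)" "f \<oplus>\<^bsub>H N\<^esub> g = (\<lambda>z\<in>eA. f z \<oplus>\<^bsub>N\<^esub> g z)"
  "a \<odot>\<^bsub>H N\<^esub> f = (\<lambda>z\<in>eA. f (z \<otimes>\<^bsub>A\<^esub> a))"
  by (simp_all add: H_def)

lemma HmD:
  assumes "f \<in> Hm N"
  shows "z \<in> eA \<Longrightarrow> f z \<in> carrier N" "z \<in> eA \<Longrightarrow> w \<in> eA \<Longrightarrow> f (z \<oplus>\<^bsub>A\<^esub> w) = f z \<oplus>\<^bsub>N\<^esub> f w"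
    "b \<in> carrier B \<Longrightarrow> z \<in> eA \<Longrightarrow> f (\<phi> b \<otimes>\<^bsub>A\<^esub> z) = b \<odot>\<^bsub>N\<^esub> f z" "f \<in> extensional eA"
  using assms by (auto simp: Hm_def PiE_def)

lemma HmI:
  assumes "f \<in> extensional eA" "\<And>z. z \<in> eA \<Longrightarrow> f z \<in> carrier N"
    "\<And>z w. z \<in> eA \<Longrightarrow> w \<in> eA \<Longrightarrow> f (z \<oplus>\<^bsub>A\<^esub> w) = f z \<oplus>\<^bsub>N\<^esub> f w"
    "\<And>b z. b \<in> carrier B \<Longrightarrow> z \<in> eA \<Longrightarrow> f (\<phi> b \<otimes>\<^bsub>A\<^esub> z) = b \<odot>\<^bsub>N\<^esub> f z"
  shows "f \<in> Hm N"
  using assms by (auto simp: Hm_def PiE_def)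

lemma Hm_eqI: "f \<in> Hm N \<Longrightarrow> g \<in> Hm N \<Longrightarrow> (\<And>z. z \<in> eA \<Longrightarrow> f z = g z) \<Longrightarrow> f = g"
  by (rule extensionalityI[OF HmD(4) HmD(4)])

context
  fixes N :: "('b, 'u) module"
  assumes N: "left_module B N"
begin

interpretation N: left_module B N by (rule N)

lemma Hm_add: "f \<in> Hm N \<Longrightarrow> g \<in> Hm N \<Longrightarrow> (\<lambda>z\<in>eA. f z \<oplus>\<^bsub>N\<^esub> g z) \<in> Hm N"
  by (rule HmI) (simp_all add: HmD eA_closed N.act_add_right N.M.a_ac)

lemma Hm_zero: "(\<lambda>z\<in>eA. \<zero>\<^bsub>N\<^esub>) \<in> Hm N"
  by (rule HmI) (simp_all add: eA_closed N.act_zero)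

lemma Hm_neg: "f \<in> Hm N \<Longrightarrow> (\<lambda>z\<in>eA. \<ominus>\<^bsub>N\<^esub> f z) \<in> Hm N"
  by (rule HmI) (simp_all add: HmD eA_closed N.act_neg N.M.minus_add)

lemma Hm_act: "f \<in> Hm N \<Longrightarrow> a \<in> carrier A \<Longrightarrow> (\<lambda>z\<in>eA. f (z \<otimes>\<^bsub>A\<^esub> a)) \<in> Hm N"
  by (rule HmI) (simp_all add: HmD eA_closed eA_carrier A.l_distr A.m_assoc)

lemma left_module_H: "left_module A (H N)"
proof -
  have grp: "abelian_group (H N)"
  proof (rule abelian_groupI)
    fix f assume f: "f \<in> carrier (H N)"
    show "\<exists>g\<in>carrier (H N). g \<oplus>\<^bsub>H N\<^esub> f = \<zero>\<^bsub>H N\<^esub>"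
      by (rule bexI[of _ "\<lambda>z\<in>eA. \<ominus>\<^bsub>N\<^esub> f z"])
         (use f in \<open>auto simp: Hm_neg HmD N.M.l_neg intro!: restrict_ext\<close>)
    have "f \<in> extensional eA" using f HmD(4) by simp
    then show "\<zero>\<^bsub>H N\<^esub> \<oplus>\<^bsub>H N\<^esub> f = f"
      by (rule extensionalityI[of _ eA, rotated]) (use f in \<open>simp_all add: HmD\<close>)
  qed (auto simp: Hm_add Hm_zero HmD N.M.a_ac intro!: restrict_ext)
  show ?thesis
    unfolding left_module_def left_module_axioms_def
  proof (intro conjI allI impI A.ring_axioms grp)
    fix f assume f: "f \<in> carrier (H N)"
    show "\<one>\<^bsub>A\<^esub> \<odot>\<^bsub>H N\<^esub> f = f"
      by (rule Hm_eqI[of _ N]) (use f Hm_act[of f "\<one>\<^bsub>A\<^esub>"] in \<open>simp_all add: eA_carrier\<close>)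
  qed (auto simp: Hm_act HmD eA_closed eA_carrier A.r_distr A.m_assoc intro!: restrict_ext)
qed

lemma Hm_zero_val: "f \<in> Hm N \<Longrightarrow> f \<zero>\<^bsub>A\<^esub> = \<zero>\<^bsub>N\<^esub>"
  using HmD(2)[of f N "\<zero>\<^bsub>A\<^esub>" "\<zero>\<^bsub>A\<^esub>"] HmD(1)[of f N "\<zero>\<^bsub>A\<^esub>"]
  by (simp add: eA_closed N.M.add.l_cancel_one')

text \<open>Apply \<open>f\<close> to \<open>expand\<close> and move the coefficients in
  \<open>e A e\<close> out by \<open>B\<close>-linearity; so \<open>f\<close> is determined by
  finitely many values.\<close>

lemma Hm_expand:
  assumes f: "f \<in> Hm N" and z: "z \<in> eA"
  shows "f z = (\<Oplus>\<^bsub>N\<^esub>i\<in>{..<n}. psi' (z \<otimes>\<^bsub>A\<^esub> xs i \<otimes>\<^bsub>A\<^esub> e) \<odot>\<^bsub>N\<^esub> f (e \<otimes>\<^bsub>A\<^esub> ys i))"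
proof -
  \<comment> \<open>\<open>f\<close> is additive on \<open>e A\<close> only, so the sum is first
    taken in \<open>e A\<close> as a monoid of its own.\<close>
  let ?P = "A\<lparr>carrier := eA\<rparr>"
  have P: "abelian_monoid ?P"
    by (rule abelian_monoidI) (simp_all add: eA_closed eA_carrier A.a_ac)
  let ?t = "\<lambda>i. (z \<otimes>\<^bsub>A\<^esub> xs i \<otimes>\<^bsub>A\<^esub> e) \<otimes>\<^bsub>A\<^esub> (e \<otimes>\<^bsub>A\<^esub> ys i)"
  have t: "?t i \<in> eA" if "i < n" for i
    using z xs[OF that] ys[OF that] e_carrier by (simp add: eA_closed)
  have "finsum A ?t I = finsum ?P ?t I" if "finite I" "I \<subseteq> {..<n}" for I
    using that
  proof (induction I)
    case empty
    then show ?case by (simp add: abelian_monoid.finsum_empty[OF P])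
  next
    case (insert i I)
    then have "?t i \<in> eA" "\<And>j. j \<in> I \<Longrightarrow> ?t j \<in> eA" using t by auto
    then show ?case
      using insert by (simp add: abelian_monoid.finsum_insert[OF P] A.finsum_insert Pi_def eA_carrier)
  qed
  then have "z = finsum ?P ?t {..<n}" using expand[OF z] by simp
  also have "f \<dots> = finsum N (\<lambda>i. f (?t i)) {..<n}"
    by (rule hom_finsum[OF P N.M.abelian_monoid_axioms])
       (simp_all add: HmD[OF f] Hm_zero_val[OF f] t)
  also have "\<dots> = (\<Oplus>\<^bsub>N\<^esub>i\<in>{..<n}. psi' (z \<otimes>\<^bsub>A\<^esub> xs i \<otimes>\<^bsub>A\<^esub> e) \<odot>\<^bsub>N\<^esub> f (e \<otimes>\<^bsub>A\<^esub> ys i))"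
  proof (rule N.M.finsum_cong'[OF refl Pi_I])
    fix i assume "i \<in> {..<n}"
    then have i: "xs i \<in> carrier A" "ys i \<in> carrier A" using xs ys by auto
    have zx: "z \<otimes>\<^bsub>A\<^esub> xs i \<in> eA" using z i by (simp add: eA_closed)
    show "f (?t i) = psi' (z \<otimes>\<^bsub>A\<^esub> xs i \<otimes>\<^bsub>A\<^esub> e) \<odot>\<^bsub>N\<^esub> f (e \<otimes>\<^bsub>A\<^esub> ys i)"
      using HmD(3)[OF f psi'_closed[OF zx] eA_closed(1)[OF i(2)]] phi_psi'[OF zx] by simp
    show "psi' (z \<otimes>\<^bsub>A\<^esub> xs i \<otimes>\<^bsub>A\<^esub> e) \<odot>\<^bsub>N\<^esub> f (e \<otimes>\<^bsub>A\<^esub> ys i) \<in> carrier N"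
      using psi'_closed[OF zx] HmD(1)[OF f eA_closed(1)[OF i(2)]] by (rule N.act_closed)
  qed
  finally show ?thesis .
qed

end

text \<open>Homomorphisms are determined by their values at the generators \<open>e y\<^sub>i\<close>, so \<open>Hom(e A, N)\<close> fits
  into the universe.\<close>

definition cd :: "('b, 'u::infinite) module \<Rightarrow> ('a \<Rightarrow> 'u) \<Rightarrow> 'u" where
  "cd N f = (SOME enc :: 'u list \<Rightarrow> 'u. inj_on enc {xs. length xs = n}) (map (\<lambda>i. f (e \<otimes>\<^bsub>A\<^esub> ys i)) [0..<n])"

lemma inj_cd:
  fixes N :: "('b, 'u::infinite) module"
  assumes N: "left_module B N"
  shows "inj_on (cd N) (Hm N)"
proof (rule inj_onI)
  fix f g assume f: "f \<in> Hm N" and g: "g \<in> Hm N" and eq: "cd N f = cd N g"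
  interpret N: left_module B N by (rule N)
  have "inj_on (SOME enc :: 'u list \<Rightarrow> 'u. inj_on enc {xs. length xs = n}) {xs. length xs = n}"
    by (rule someI_ex[OF ex_tuple_code])
  from inj_onD[OF this eq[unfolded cd_def]]
  have "map (\<lambda>i. f (e \<otimes>\<^bsub>A\<^esub> ys i)) [0..<n] = map (\<lambda>i. g (e \<otimes>\<^bsub>A\<^esub> ys i)) [0..<n]" by simp
  then have vals: "f (e \<otimes>\<^bsub>A\<^esub> ys i) = g (e \<otimes>\<^bsub>A\<^esub> ys i)" if "i < n" for i
    using that by simp
  show "f = g"
  proof (rule Hm_eqI[OF f g])
    fix z assume z: "z \<in> eA"
    have "psi' (z \<otimes>\<^bsub>A\<^esub> xs i \<otimes>\<^bsub>A\<^esub> e) \<odot>\<^bsub>N\<^esub> g (e \<otimes>\<^bsub>A\<^esub> ys i) \<in> carrier N" if "i < n" for i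
      using psi'_closed[OF eA_closed(3)[OF z xs[OF that]]] HmD(1)[OF g eA_closed(1)[OF ys[OF that]]]
      by (rule N.act_closed)
    then show "f z = g z"
      unfolding Hm_expand[OF N f z] Hm_expand[OF N g z]
      by (intro N.M.finsum_cong') (simp_all add: vals)
  qed
qed

definition dc :: "('b, 'u::infinite) module \<Rightarrow> 'u \<Rightarrow> 'a \<Rightarrow> 'u" where
  "dc N = inv_into (Hm N) (cd N)"

lemma dc_cd: "left_module B N \<Longrightarrow> f \<in> Hm N \<Longrightarrow> dc N (cd N f) = f"
  unfolding dc_def by (rule inv_into_f_f[OF inj_cd])

text \<open>The module \<open>H N\<close> carried into the universe along the injection
  \<open>cd N\<close>; \<open>dc N\<close> decodes.\<close>

definition Go :: "('b, 'u::infinite) module \<Rightarrow> ('a, 'u) module" where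
  "Go N = \<lparr>carrier = cd N ` Hm N, monoid.mult = undefined, one = undefined,
     ring.zero = cd N \<zero>\<^bsub>H N\<^esub>, ring.add = (\<lambda>u v. cd N (dc N u \<oplus>\<^bsub>H N\<^esub> dc N v)),
     smult = (\<lambda>a u. cd N (a \<odot>\<^bsub>H N\<^esub> dc N u))\<rparr>"

definition Gm :: "('b, 'u::infinite) module \<Rightarrow> ('b, 'u) module \<Rightarrow> ('u \<Rightarrow> 'u) \<Rightarrow> 'u \<Rightarrow> 'u" where
  "Gm N P g = (\<lambda>u\<in>carrier (Go N). cd P (\<lambda>z\<in>eA. g (dc N u z)))"

lemma Go_carrier: "carrier (Go N) = cd N ` Hm N"
  by (simp add: Go_def)

lemma Go_ops:
  assumes N: "left_module B N" and f: "f \<in> Hm N"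
  shows "g \<in> Hm N \<Longrightarrow> cd N f \<oplus>\<^bsub>Go N\<^esub> cd N g = cd N (\<lambda>z\<in>eA. f z \<oplus>\<^bsub>N\<^esub> g z)"
    "a \<odot>\<^bsub>Go N\<^esub> cd N f = cd N (\<lambda>z\<in>eA. f (z \<otimes>\<^bsub>A\<^esub> a))"
  using f by (simp_all add: Go_def dc_cd[OF N])

lemma Gm_cd: "left_module B N \<Longrightarrow> f \<in> Hm N \<Longrightarrow> Gm N P g (cd N f) = cd P (\<lambda>z\<in>eA. g (f z))"
  by (simp add: Gm_def Go_carrier dc_cd)

lemma left_module_Go: "left_module B N \<Longrightarrow> left_module A (Go N)"
  by (rule left_module_transport[OF left_module_H, of _ _ "cd N"]) (simp_all add: Go_def dc_cd)

lemma Hm_comp: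
  assumes f: "f \<in> Hm N" and g: "g \<in> module_hom B N P"
  shows "(\<lambda>z\<in>eA. g (f z)) \<in> Hm P"
  by (rule HmI) (simp_all add: HmD[OF f] module_homD[OF g] eA_closed)

lemma linear_functor_G: "linear_functor R B A (Go :: ('b, 'u::infinite) module \<Rightarrow> _) Gm"
proof (rule linear_functor.intro)
  fix N P :: "('b, 'u::infinite) module" and g
  assume N: "left_module B N" and P: "left_module B P" and g: "g \<in> module_hom B N P"
  interpret N: left_module B N by (rule N)
  note gD = module_homD[OF g] and comp = Hm_comp[OF _ g]
  show "Gm N P g \<in> module_hom A (Go N) (Go P)"
    unfolding module_hom_def
  proof (intro CollectI conjI ballI)
    show "Gm N P g \<in> carrier (Go N) \<rightarrow>\<^sub>E carrier (Go P)"
      using comp by (auto simp: Gm_def Go_carrier dc_cd[OF N])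
    fix u assume "u \<in> carrier (Go N)"
    then obtain f where f: "f \<in> Hm N" "u = cd N f" by (auto simp: Go_carrier)
    { fix v assume "v \<in> carrier (Go N)"
      then obtain k where k: "k \<in> Hm N" "v = cd N k" by (auto simp: Go_carrier)
      have "(\<lambda>z\<in>eA. g ((\<lambda>z\<in>eA. f z \<oplus>\<^bsub>N\<^esub> k z) z)) =
          (\<lambda>z\<in>eA. (\<lambda>z\<in>eA. g (f z)) z \<oplus>\<^bsub>P\<^esub> (\<lambda>z\<in>eA. g (k z)) z)"
        by (rule restrict_ext) (simp add: gD HmD[OF f(1)] HmD[OF k(1)])
      then show "Gm N P g (u \<oplus>\<^bsub>Go N\<^esub> v) = Gm N P g u \<oplus>\<^bsub>Go P\<^esub> Gm N P g v"
        unfolding f(2) k(2) Go_ops(1)[OF N f(1) k(1)] Gm_cd[OF N f(1)] Gm_cd[OF N k(1)]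
          Gm_cd[OF N Hm_add[OF N f(1) k(1)]] Go_ops(1)[OF P comp[OF f(1)] comp[OF k(1)]]
        by simp }
    fix a assume a: "a \<in> carrier A"
    have "(\<lambda>z\<in>eA. g ((\<lambda>z\<in>eA. f (z \<otimes>\<^bsub>A\<^esub> a)) z)) = (\<lambda>z\<in>eA. (\<lambda>z\<in>eA. g (f z)) (z \<otimes>\<^bsub>A\<^esub> a))"
      by (rule restrict_ext) (simp add: eA_closed a)
    then show "Gm N P g (a \<odot>\<^bsub>Go N\<^esub> u) = a \<odot>\<^bsub>Go P\<^esub> Gm N P g u"
      unfolding f(2) Go_ops(2)[OF N f(1)] Gm_cd[OF N f(1)] Gm_cd[OF N Hm_act[OF N f(1) a]]
        Go_ops(2)[OF P comp[OF f(1)]]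
      by simp
  qed
next
  fix N :: "('b, 'u::infinite) module"
  assume N: "left_module B N"
  show "left_module A (Go N)" by (rule left_module_Go[OF N])
  show "Gm N N (\<lambda>x\<in>carrier N. x) = (\<lambda>x\<in>carrier (Go N). x)"
  proof (unfold Gm_def, rule restrict_ext)
    fix u assume "u \<in> carrier (Go N)"
    then obtain f where f: "f \<in> Hm N" "u = cd N f" by (auto simp: Go_carrier)
    have "(\<lambda>z\<in>eA. (\<lambda>x\<in>carrier N. x) (f z)) = f"
      by (rule extensionalityI[of _ eA]) (simp_all add: HmD[OF f(1)])
    then show "cd N (\<lambda>z\<in>eA. (\<lambda>x\<in>carrier N. x) (dc N u z)) = u"
      unfolding f(2) dc_cd[OF N f(1)] by simp
  qed
next
  fix N P Q :: "('b, 'u::infinite) module" and f g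
  assume N: "left_module B N" and P: "left_module B P" and f: "f \<in> module_hom B N P"
  show "Gm N Q (compose (carrier N) g f) = compose (carrier (Go N)) (Gm P Q g) (Gm N P f)"
  proof (rule extensionalityI[of _ "carrier (Go N)"])
    fix u assume u: "u \<in> carrier (Go N)"
    then obtain k where k: "k \<in> Hm N" "u = cd N k" by (auto simp: Go_carrier)
    have "(\<lambda>z\<in>eA. compose (carrier N) g f (k z)) = (\<lambda>z\<in>eA. g ((\<lambda>z\<in>eA. f (k z)) z))"
      by (rule restrict_ext) (simp add: compose_def HmD[OF k(1)])
    then show "Gm N Q (compose (carrier N) g f) u = compose (carrier (Go N)) (Gm P Q g) (Gm N P f) u"
      using u unfolding k(2) by (simp add: compose_def Gm_cd[OF N k(1)] Gm_cd[OF P Hm_comp[OF k(1) f]])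
  qed (simp_all add: Gm_def)
next
  fix N P :: "('b, 'u::infinite) module" and f g r
  assume N: "left_module B N" and P: "left_module B P"
    and f: "f \<in> module_hom B N P" and g: "g \<in> module_hom B N P" and r: "r \<in> carrier R"
  interpret N: left_module B N by (rule N)
  have rA: "r \<odot>\<^bsub>A\<^esub> \<one>\<^bsub>A\<^esub> \<in> carrier A" and rB: "r \<odot>\<^bsub>B\<^esub> \<one>\<^bsub>B\<^esub> \<in> carrier B"
    using r by (simp_all add: A.smult_closed B.smult_closed)
  show "Gm N P (hom_axpy B N P r f g) = hom_axpy A (Go N) (Go P) r (Gm N P f) (Gm N P g)"
  proof (rule extensionalityI[of _ "carrier (Go N)"])
    fix u assume u: "u \<in> carrier (Go N)"
    then obtain k where k: "k \<in> Hm N" "u = cd N k" by (auto simp: Go_carrier)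
    let ?fk = "\<lambda>z\<in>eA. f (k z)" and ?gk = "\<lambda>z\<in>eA. g (k z)"
    note fk = Hm_comp[OF k(1) f] and gk = Hm_comp[OF k(1) g]
    have "hom_axpy A (Go N) (Go P) r (Gm N P f) (Gm N P g) u =
        (r \<odot>\<^bsub>A\<^esub> \<one>\<^bsub>A\<^esub>) \<odot>\<^bsub>Go P\<^esub> cd P ?fk \<oplus>\<^bsub>Go P\<^esub> cd P ?gk"
      using u by (simp add: hom_axpy_def k(2) Gm_cd[OF N k(1)])
    also have "\<dots> = cd P (\<lambda>z\<in>eA. (\<lambda>z\<in>eA. ?fk (z \<otimes>\<^bsub>A\<^esub> (r \<odot>\<^bsub>A\<^esub> \<one>\<^bsub>A\<^esub>))) z \<oplus>\<^bsub>P\<^esub> ?gk z)"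
      unfolding Go_ops(2)[OF P fk] Go_ops(1)[OF P Hm_act[OF P fk rA] gk] ..
    also have "(\<lambda>z\<in>eA. (\<lambda>z\<in>eA. ?fk (z \<otimes>\<^bsub>A\<^esub> (r \<odot>\<^bsub>A\<^esub> \<one>\<^bsub>A\<^esub>))) z \<oplus>\<^bsub>P\<^esub> ?gk z) =
        (\<lambda>z\<in>eA. hom_axpy B N P r f g (k z))"
    proof (rule restrict_ext)
      fix z assume z: "z \<in> eA"
      have "?fk (z \<otimes>\<^bsub>A\<^esub> (r \<odot>\<^bsub>A\<^esub> \<one>\<^bsub>A\<^esub>)) = ?fk (\<phi> (r \<odot>\<^bsub>B\<^esub> \<one>\<^bsub>B\<^esub>) \<otimes>\<^bsub>A\<^esub> z)"
        unfolding smult_one_A[OF r z] ..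
      also have "\<dots> = (r \<odot>\<^bsub>B\<^esub> \<one>\<^bsub>B\<^esub>) \<odot>\<^bsub>P\<^esub> ?fk z" by (rule HmD(3)[OF fk rB z])
      finally show "(\<lambda>z\<in>eA. ?fk (z \<otimes>\<^bsub>A\<^esub> (r \<odot>\<^bsub>A\<^esub> \<one>\<^bsub>A\<^esub>))) z \<oplus>\<^bsub>P\<^esub> ?gk z = hom_axpy B N P r f g (k z)"
        using z HmD(1)[OF k(1) z] by (simp add: hom_axpy_def)
    qed
    finally show "Gm N P (hom_axpy B N P r f g) u = hom_axpy A (Go N) (Go P) r (Gm N P f) (Gm N P g) u"
      unfolding k(2) Gm_cd[OF N k(1)] by (rule sym)
  qed (simp_all add: Gm_def hom_axpy_def)
qed

subsection \<open>The natural isomorphisms\<close>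

text \<open>The canonical map from \<open>M\<close> to \<open>Hom(e A, e M)\<close>, which sends
  \<open>m\<close> to right multiplication \<open>z \<mapsto> z m\<close>.\<close>

definition unit_A :: "('a, 'u::infinite) module \<Rightarrow> 'u \<Rightarrow> 'u" where
  "unit_A M = (\<lambda>m\<in>carrier M. cd (Fo M) (\<lambda>z\<in>eA. z \<odot>\<^bsub>M\<^esub> m))"

text \<open>The canonical map from \<open>N\<close> to \<open>e Hom(e A, N)\<close>, which sends
  \<open>m\<close> to \<open>z \<mapsto> (z e) m\<close>. Its inverse is evaluation at
  \<open>e\<close>.\<close>

definition unit_B :: "('b, 'u::infinite) module \<Rightarrow> 'u \<Rightarrow> 'u" where
  "unit_B N = (\<lambda>m\<in>carrier N. cd N (\<lambda>z\<in>eA. psi' (z \<otimes>\<^bsub>A\<^esub> e) \<odot>\<^bsub>N\<^esub> m))"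

lemma eval_Hm:
  assumes M: "left_module A M" and m: "m \<in> carrier M"
  shows "(\<lambda>z\<in>eA. z \<odot>\<^bsub>M\<^esub> m) \<in> Hm (Fo M)"
proof -
  interpret M: left_module A M by (rule M)
  show ?thesis
    by (rule HmI)
       (simp_all add: m eA_closed eA_carrier M.act_closed M.act_add_left M.act_mult
         M.act_mult[symmetric, of e] e_carrier e_eA)
qed

lemma natural_A:
  "natural_iso_id A (\<lambda>M :: ('a, 'u::infinite) module. Go (Fo M)) (\<lambda>M N f. Gm (Fo M) (Fo N) (Fm M N f)) unit_A"
  unfolding natural_iso_id_def
proof (intro conjI allI impI)
  fix M :: "('a, 'u::infinite) module"
  assume M: "left_module A M"
  interpret M: left_module A M by (rule M)
  note F = left_module_Fo[OF M] and ev = eval_Hm[OF M]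
  show "unit_A M \<in> module_hom A M (Go (Fo M))"
    unfolding module_hom_def
  proof (intro CollectI conjI ballI)
    show "unit_A M \<in> carrier M \<rightarrow>\<^sub>E carrier (Go (Fo M))"
      using ev by (auto simp: unit_A_def Go_carrier)
    fix m assume m: "m \<in> carrier M"
    { fix k assume k: "k \<in> carrier M"
      have "(\<lambda>z\<in>eA. z \<odot>\<^bsub>M\<^esub> (m \<oplus>\<^bsub>M\<^esub> k)) =
          (\<lambda>z\<in>eA. (\<lambda>z\<in>eA. z \<odot>\<^bsub>M\<^esub> m) z \<oplus>\<^bsub>Fo M\<^esub> (\<lambda>z\<in>eA. z \<odot>\<^bsub>M\<^esub> k) z)"
        by (rule restrict_ext) (simp add: m k eA_carrier M.act_add_right)
      then show "unit_A M (m \<oplus>\<^bsub>M\<^esub> k) = unit_A M m \<oplus>\<^bsub>Go (Fo M)\<^esub> unit_A M k"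
        using Go_ops(1)[OF F ev[OF m] ev[OF k]] m k by (simp add: unit_A_def) }
    fix a assume a: "a \<in> carrier A"
    have "(\<lambda>z\<in>eA. z \<odot>\<^bsub>M\<^esub> (a \<odot>\<^bsub>M\<^esub> m)) = (\<lambda>z\<in>eA. (\<lambda>z\<in>eA. z \<odot>\<^bsub>M\<^esub> m) (z \<otimes>\<^bsub>A\<^esub> a))"
      by (rule restrict_ext) (simp add: m a eA_closed eA_carrier M.act_mult)
    then show "unit_A M (a \<odot>\<^bsub>M\<^esub> m) = a \<odot>\<^bsub>Go (Fo M)\<^esub> unit_A M m"
      using Go_ops(2)[OF F ev[OF m]] m a by (simp add: unit_A_def M.act_closed)
  qed
  show "bij_betw (unit_A M) (carrier M) (carrier (Go (Fo M)))"
    unfolding bij_betw_def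
  proof
    \<comment> \<open>The decomposition of the unit applied to \<open>m\<close>: an element is
      recovered from its multiples by the generators \<open>e ys i\<close>, which gives
      injectivity.\<close>
    have expand_m: "m = (\<Oplus>\<^bsub>M\<^esub>i\<in>{..<n}. xs i \<odot>\<^bsub>M\<^esub> ((e \<otimes>\<^bsub>A\<^esub> ys i) \<odot>\<^bsub>M\<^esub> m))" if m: "m \<in> carrier M" for m
    proof -
      have c: "xs i \<otimes>\<^bsub>A\<^esub> e \<otimes>\<^bsub>A\<^esub> ys i \<in> carrier A" if "i \<in> {..<n}" for i
        using that xs ys e_carrier by auto
      have "m = (\<Oplus>\<^bsub>A\<^esub>i\<in>{..<n}. xs i \<otimes>\<^bsub>A\<^esub> e \<otimes>\<^bsub>A\<^esub> ys i) \<odot>\<^bsub>M\<^esub> m"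
        unfolding full using m by (simp add: M.act_one)
      also have "\<dots> = (\<Oplus>\<^bsub>M\<^esub>i\<in>{..<n}. (xs i \<otimes>\<^bsub>A\<^esub> e \<otimes>\<^bsub>A\<^esub> ys i) \<odot>\<^bsub>M\<^esub> m)"
        by (rule hom_finsum[OF A.abelian_monoid_axioms M.M.abelian_monoid_axioms, where h = "\<lambda>a. a \<odot>\<^bsub>M\<^esub> m"])
           (use m c in \<open>simp_all add: M.act_closed M.act_add_left M.zero_act\<close>)
      also have "\<dots> = (\<Oplus>\<^bsub>M\<^esub>i\<in>{..<n}. xs i \<odot>\<^bsub>M\<^esub> ((e \<otimes>\<^bsub>A\<^esub> ys i) \<odot>\<^bsub>M\<^esub> m))"
        by (rule M.M.finsum_cong')
           (use m xs ys e_carrier in \<open>auto simp: M.act_closed M.act_mult[symmetric] A.m_assoc\<close>)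
      finally show ?thesis .
    qed
    show "inj_on (unit_A M) (carrier M)"
    proof (rule inj_onI)
      fix m k assume m: "m \<in> carrier M" and k: "k \<in> carrier M" and "unit_A M m = unit_A M k"
      then have "cd (Fo M) (\<lambda>z\<in>eA. z \<odot>\<^bsub>M\<^esub> m) = cd (Fo M) (\<lambda>z\<in>eA. z \<odot>\<^bsub>M\<^esub> k)"
        by (simp add: unit_A_def)
      then have "(\<lambda>z\<in>eA. z \<odot>\<^bsub>M\<^esub> m) = (\<lambda>z\<in>eA. z \<odot>\<^bsub>M\<^esub> k)"
        by (rule inj_onD[OF inj_cd[OF F] _ ev[OF m] ev[OF k]])
      then have "z \<odot>\<^bsub>M\<^esub> m = z \<odot>\<^bsub>M\<^esub> k" if "z \<in> eA" for z
        using that by (metis restrict_apply')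
      then have eq: "(e \<otimes>\<^bsub>A\<^esub> ys i) \<odot>\<^bsub>M\<^esub> m = (e \<otimes>\<^bsub>A\<^esub> ys i) \<odot>\<^bsub>M\<^esub> k" if "i < n" for i
        using eA_closed(1)[OF ys[OF that]] by blast
      have "(\<Oplus>\<^bsub>M\<^esub>i\<in>{..<n}. xs i \<odot>\<^bsub>M\<^esub> ((e \<otimes>\<^bsub>A\<^esub> ys i) \<odot>\<^bsub>M\<^esub> m)) =
          (\<Oplus>\<^bsub>M\<^esub>i\<in>{..<n}. xs i \<odot>\<^bsub>M\<^esub> ((e \<otimes>\<^bsub>A\<^esub> ys i) \<odot>\<^bsub>M\<^esub> k))"
        by (rule M.M.finsum_cong') (use k xs ys e_carrier eq in \<open>auto simp: M.act_closed\<close>)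
      then show "m = k" using expand_m[OF m] expand_m[OF k] by simp
    qed
    show "unit_A M ` carrier M = carrier (Go (Fo M))"
    proof (intro equalityI subsetI)
      fix u assume "u \<in> unit_A M ` carrier M"
      then show "u \<in> carrier (Go (Fo M))" using ev by (auto simp: unit_A_def Go_carrier)
    next
      fix u assume "u \<in> carrier (Go (Fo M))"
      then obtain f where f: "f \<in> Hm (Fo M)" "u = cd (Fo M) f" by (auto simp: Go_carrier)
      \<comment> \<open>The preimage is suggested by \<open>expand_m\<close> with \<open>f\<close>
        in place of multiplication: \<open>z m\<close> is the sum of the
        \<open>(z xs i) f(e ys i)\<close>, which is \<open>f z\<close> by
        \<open>Hm_expand\<close>.\<close>
      define m where "m = (\<Oplus>\<^bsub>M\<^esub>i\<in>{..<n}. xs i \<odot>\<^bsub>M\<^esub> f (e \<otimes>\<^bsub>A\<^esub> ys i))"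
      have fc: "f (e \<otimes>\<^bsub>A\<^esub> ys i) \<in> carrier M" "e \<odot>\<^bsub>M\<^esub> f (e \<otimes>\<^bsub>A\<^esub> ys i) = f (e \<otimes>\<^bsub>A\<^esub> ys i)" if "i < n" for i
        using HmD(1)[OF f(1) eA_closed(1)[OF ys[OF that]]] by simp_all
      have xf: "xs i \<odot>\<^bsub>M\<^esub> f (e \<otimes>\<^bsub>A\<^esub> ys i) \<in> carrier M" if "i < n" for i
        using xs[OF that] fc[OF that] by (simp add: M.act_closed)
      have m: "m \<in> carrier M" unfolding m_def by (rule M.M.finsum_closed) (use xf in auto)
      have "z \<odot>\<^bsub>M\<^esub> m = f z" if z: "z \<in> eA" for z
      proof -
        interpret FM: left_module B "Fo M" by (rule F)
        note zA = eA_carrier[OF z]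
        have g: "psi' (z \<otimes>\<^bsub>A\<^esub> xs i \<otimes>\<^bsub>A\<^esub> e) \<odot>\<^bsub>Fo M\<^esub> f (e \<otimes>\<^bsub>A\<^esub> ys i) \<in> carrier (Fo M)" if "i < n" for i
          by (rule FM.act_closed[OF psi'_closed[OF eA_closed(3)[OF z xs[OF that]]]
                HmD(1)[OF f(1) eA_closed(1)[OF ys[OF that]]]])
        have "z \<odot>\<^bsub>M\<^esub> m = (\<Oplus>\<^bsub>M\<^esub>i\<in>{..<n}. z \<odot>\<^bsub>M\<^esub> (xs i \<odot>\<^bsub>M\<^esub> f (e \<otimes>\<^bsub>A\<^esub> ys i)))"
          unfolding m_def
          by (rule hom_finsum[OF M.M.abelian_monoid_axioms M.M.abelian_monoid_axioms])
             (use zA xf in \<open>simp_all add: M.act_closed M.act_add_right M.act_zero\<close>)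
        also have "\<dots> = (\<Oplus>\<^bsub>M\<^esub>i\<in>{..<n}. psi' (z \<otimes>\<^bsub>A\<^esub> xs i \<otimes>\<^bsub>A\<^esub> e) \<odot>\<^bsub>Fo M\<^esub> f (e \<otimes>\<^bsub>A\<^esub> ys i))"
        proof (rule M.M.finsum_cong'[OF refl Pi_I])
          fix i assume "i \<in> {..<n}"
          then have i: "i < n" "xs i \<in> carrier A" using xs by auto
          have zx: "z \<otimes>\<^bsub>A\<^esub> xs i \<in> eA" using z i by (simp add: eA_closed)
          have "psi' (z \<otimes>\<^bsub>A\<^esub> xs i \<otimes>\<^bsub>A\<^esub> e) \<odot>\<^bsub>Fo M\<^esub> f (e \<otimes>\<^bsub>A\<^esub> ys i) =
              (z \<otimes>\<^bsub>A\<^esub> xs i) \<odot>\<^bsub>M\<^esub> f (e \<otimes>\<^bsub>A\<^esub> ys i)"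
            using phi_psi'[OF zx] eA_carrier[OF zx] e_carrier fc[OF i(1)] by (simp add: M.act_mult)
          also have "\<dots> = z \<odot>\<^bsub>M\<^esub> (xs i \<odot>\<^bsub>M\<^esub> f (e \<otimes>\<^bsub>A\<^esub> ys i))"
            using zA i fc by (simp add: M.act_mult)
          finally show "z \<odot>\<^bsub>M\<^esub> (xs i \<odot>\<^bsub>M\<^esub> f (e \<otimes>\<^bsub>A\<^esub> ys i)) =
              psi' (z \<otimes>\<^bsub>A\<^esub> xs i \<otimes>\<^bsub>A\<^esub> e) \<odot>\<^bsub>Fo M\<^esub> f (e \<otimes>\<^bsub>A\<^esub> ys i)" by simp
          show "psi' (z \<otimes>\<^bsub>A\<^esub> xs i \<otimes>\<^bsub>A\<^esub> e) \<odot>\<^bsub>Fo M\<^esub> f (e \<otimes>\<^bsub>A\<^esub> ys i) \<in> carrier M"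
            using psi'_closed[OF zx] fc[OF i(1)] by (simp add: M.act_closed)
        qed
        \<comment> \<open>The sum in \<open>Fo M\<close> agrees with the sum in \<open>M\<close>,
          since the inclusion is additive.\<close>
        also have "\<dots> = f z"
          unfolding Hm_expand[OF F f(1) z]
          by (rule hom_finsum[OF FM.M.abelian_monoid_axioms M.M.abelian_monoid_axioms, where h = "\<lambda>x. x",
                symmetric])
             (simp, simp, simp, simp, rule g, simp)
        finally show ?thesis .
      qed
      then have "(\<lambda>z\<in>eA. z \<odot>\<^bsub>M\<^esub> m) = f"
        by (intro Hm_eqI[OF ev[OF m] f(1)]) simp
      then have "u = unit_A M m" using m f(2) by (simp add: unit_A_def)
      then show "u \<in> unit_A M ` carrier M" using m by (rule image_eqI)
    qed
  qed
next
  fix M N :: "('a, 'u::infinite) module" and f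
  assume "left_module A M \<and> left_module A N \<and> f \<in> module_hom A M N"
  then have M: "left_module A M" and N: "left_module A N" and f: "f \<in> module_hom A M N" by auto
  interpret M: left_module A M by (rule M)
  note fD = module_homD[OF f]
  show "compose (carrier M) (unit_A N) f =
      compose (carrier M) (Gm (Fo M) (Fo N) (Fm M N f)) (unit_A M)"
    unfolding compose_def
  proof (rule restrict_ext)
    fix m assume m: "m \<in> carrier M"
    have "(\<lambda>z\<in>eA. Fm M N f ((\<lambda>z\<in>eA. z \<odot>\<^bsub>M\<^esub> m) z)) = (\<lambda>z\<in>eA. z \<odot>\<^bsub>N\<^esub> f m)"
      by (rule restrict_ext)
         (simp add: Fm_def m eA_carrier M.act_closed M.act_mult[symmetric] e_carrier e_eA fD(3))
    then show "unit_A N (f m) = Gm (Fo M) (Fo N) (Fm M N f) (unit_A M m)"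
      using m fD(1)[OF m] by (simp add: unit_A_def Gm_cd[OF left_module_Fo[OF M] eval_Hm[OF M m]])
  qed
qed

lemma psi'_add: "z \<in> eA \<Longrightarrow> w \<in> eA \<Longrightarrow>
    psi' ((z \<oplus>\<^bsub>A\<^esub> w) \<otimes>\<^bsub>A\<^esub> e) = psi' (z \<otimes>\<^bsub>A\<^esub> e) \<oplus>\<^bsub>B\<^esub> psi' (w \<otimes>\<^bsub>A\<^esub> e)"
  by (rule psi'_eqI)
     (simp_all add: eA_closed psi'_closed phi_add phi_psi' A.l_distr eA_carrier e_carrier)

lemma psi'_mult: "b \<in> carrier B \<Longrightarrow> z \<in> eA \<Longrightarrow>
    psi' ((\<phi> b \<otimes>\<^bsub>A\<^esub> z) \<otimes>\<^bsub>A\<^esub> e) = b \<otimes>\<^bsub>B\<^esub> psi' (z \<otimes>\<^bsub>A\<^esub> e)"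
  by (rule psi'_eqI)
     (simp_all add: eA_closed psi'_closed phi_mult phi_psi' A.m_assoc eA_carrier e_carrier)

lemma act_Hm:
  assumes N: "left_module B N" and m: "m \<in> carrier N"
  shows "(\<lambda>z\<in>eA. psi' (z \<otimes>\<^bsub>A\<^esub> e) \<odot>\<^bsub>N\<^esub> m) \<in> Hm N"
proof -
  interpret N: left_module B N by (rule N)
  show ?thesis
    by (rule HmI)
       (simp_all add: m eA_closed psi'_closed psi'_add psi'_mult N.act_closed N.act_add_left N.act_mult)
qed

text \<open>The element \<open>e\<close> acts on Hom by \<open>(e f)(z) = f (z e)\<close>, and
  coding is injective, so the codes fixed by \<open>e\<close> are the codes of the maps fixed by
  \<open>e\<close>.\<close>

lemma carrier_Fo_Go:
  assumes N: "left_module B N"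
  shows "carrier (Fo (Go N)) = cd N ` {f \<in> Hm N. \<forall>z\<in>eA. f (z \<otimes>\<^bsub>A\<^esub> e) = f z}"
proof (intro equalityI subsetI)
  fix u assume "u \<in> carrier (Fo (Go N))"
  then have u: "u \<in> carrier (Go N)" "e \<odot>\<^bsub>Go N\<^esub> u = u" by auto
  then obtain f where f: "f \<in> Hm N" "u = cd N f" by (auto simp: Go_carrier)
  have "cd N (\<lambda>z\<in>eA. f (z \<otimes>\<^bsub>A\<^esub> e)) = cd N f"
    using u(2) unfolding f(2) Go_ops(2)[OF N f(1)] .
  then have "(\<lambda>z\<in>eA. f (z \<otimes>\<^bsub>A\<^esub> e)) = f"
    by (rule inj_onD[OF inj_cd[OF N] _ Hm_act[OF N f(1) e_carrier] f(1)])
  then have "\<forall>z\<in>eA. f (z \<otimes>\<^bsub>A\<^esub> e) = f z" by (metis restrict_apply')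
  then show "u \<in> cd N ` {f \<in> Hm N. \<forall>z\<in>eA. f (z \<otimes>\<^bsub>A\<^esub> e) = f z}" using f by blast
next
  fix u assume "u \<in> cd N ` {f \<in> Hm N. \<forall>z\<in>eA. f (z \<otimes>\<^bsub>A\<^esub> e) = f z}"
  then obtain f where f: "f \<in> Hm N" "u = cd N f" "\<And>z. z \<in> eA \<Longrightarrow> f (z \<otimes>\<^bsub>A\<^esub> e) = f z" by blast
  have "(\<lambda>z\<in>eA. f (z \<otimes>\<^bsub>A\<^esub> e)) = f"
    by (rule Hm_eqI[OF Hm_act[OF N f(1) e_carrier] f(1)]) (simp add: f(3))
  then show "u \<in> carrier (Fo (Go N))"
    using f(1) by (simp add: f(2) Go_carrier Go_ops(2)[OF N f(1)])
qed

lemma natural_B: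
  "natural_iso_id B (\<lambda>N :: ('b, 'u::infinite) module. Fo (Go N)) (\<lambda>N P g. Fm (Go N) (Go P) (Gm N P g)) unit_B"
  unfolding natural_iso_id_def
proof (intro conjI allI impI)
  fix N :: "('b, 'u::infinite) module"
  assume N: "left_module B N"
  interpret N: left_module B N by (rule N)
  note ac = act_Hm[OF N]
  let ?a = "\<lambda>m. \<lambda>z\<in>eA. psi' (z \<otimes>\<^bsub>A\<^esub> e) \<odot>\<^bsub>N\<^esub> m"
  have fixed: "?a m (z \<otimes>\<^bsub>A\<^esub> e) = ?a m z" if "z \<in> eA" for m z
    using that e_carrier by (simp add: eA_closed A.m_assoc eA_carrier e_idem)
  have in_car: "unit_B N m \<in> carrier (Fo (Go N))" if "m \<in> carrier N" for m
    unfolding carrier_Fo_Go[OF N] unit_B_def using that ac[OF that] fixed by auto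
  show "unit_B N \<in> module_hom B N (Fo (Go N))"
    unfolding module_hom_def
  proof (intro CollectI conjI ballI)
    show "unit_B N \<in> carrier N \<rightarrow>\<^sub>E carrier (Fo (Go N))"
      using in_car by (auto simp: PiE_def unit_B_def simp del: Fo_simps)
    fix m assume m: "m \<in> carrier N"
    { fix k assume k: "k \<in> carrier N"
      have "?a (m \<oplus>\<^bsub>N\<^esub> k) = (\<lambda>z\<in>eA. ?a m z \<oplus>\<^bsub>N\<^esub> ?a k z)"
        by (rule restrict_ext) (simp add: m k psi'_closed N.act_add_right)
      then show "unit_B N (m \<oplus>\<^bsub>N\<^esub> k) = unit_B N m \<oplus>\<^bsub>Fo (Go N)\<^esub> unit_B N k"
        using Go_ops(1)[OF N ac[OF m] ac[OF k]] m k by (simp add: unit_B_def) }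
    fix b assume b: "b \<in> carrier B"
    have "?a (b \<odot>\<^bsub>N\<^esub> m) = (\<lambda>z\<in>eA. ?a m (z \<otimes>\<^bsub>A\<^esub> \<phi> b))"
    proof (rule restrict_ext)
      fix z assume z: "z \<in> eA"
      have "psi' ((z \<otimes>\<^bsub>A\<^esub> \<phi> b) \<otimes>\<^bsub>A\<^esub> e) = psi' (z \<otimes>\<^bsub>A\<^esub> e) \<otimes>\<^bsub>B\<^esub> b"
      proof (rule psi'_eqI)
        have "z \<otimes>\<^bsub>A\<^esub> e \<otimes>\<^bsub>A\<^esub> \<phi> b = z \<otimes>\<^bsub>A\<^esub> \<phi> b \<otimes>\<^bsub>A\<^esub> e"
          using z b e_carrier eA_carrier[OF z] by (simp add: A.m_assoc e_phi)
        then show "\<phi> (psi' (z \<otimes>\<^bsub>A\<^esub> e) \<otimes>\<^bsub>B\<^esub> b) = z \<otimes>\<^bsub>A\<^esub> \<phi> b \<otimes>\<^bsub>A\<^esub> e"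
          using z b by (simp add: phi_mult psi'_closed phi_psi')
      qed (use z b in \<open>simp_all add: eA_closed psi'_closed\<close>)
      then show "psi' (z \<otimes>\<^bsub>A\<^esub> e) \<odot>\<^bsub>N\<^esub> (b \<odot>\<^bsub>N\<^esub> m) = ?a m (z \<otimes>\<^bsub>A\<^esub> \<phi> b)"
        using z b m by (simp add: eA_closed psi'_closed N.act_mult)
    qed
    then show "unit_B N (b \<odot>\<^bsub>N\<^esub> m) = b \<odot>\<^bsub>Fo (Go N)\<^esub> unit_B N m"
      using Go_ops(2)[OF N ac[OF m]] m b by (simp add: unit_B_def N.act_closed)
  qed
  have ee: "psi' (e \<otimes>\<^bsub>A\<^esub> e) = \<one>\<^bsub>B\<^esub>"
    by (rule psi'_eqI) (simp_all add: eA_closed phi_one e_idem)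
  show "bij_betw (unit_B N) (carrier N) (carrier (Fo (Go N)))"
    unfolding bij_betw_def
  proof
    show "inj_on (unit_B N) (carrier N)"
    proof (rule inj_onI)
      fix m k assume m: "m \<in> carrier N" and k: "k \<in> carrier N" and "unit_B N m = unit_B N k"
      then have "cd N (?a m) = cd N (?a k)" by (simp add: unit_B_def)
      then have "?a m = ?a k" by (rule inj_onD[OF inj_cd[OF N] _ ac[OF m] ac[OF k]])
      then have "?a m e = ?a k e" by (rule fun_cong)
      then show "m = k" using m k by (simp add: eA_closed ee N.act_one)
    qed
    show "unit_B N ` carrier N = carrier (Fo (Go N))"
    proof (intro equalityI subsetI)
      fix u assume "u \<in> unit_B N ` carrier N"
      then show "u \<in> carrier (Fo (Go N))" using in_car by blast
    next
      fix u assume "u \<in> carrier (Fo (Go N))"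
      then obtain f where f: "f \<in> Hm N" "u = cd N f" "\<And>z. z \<in> eA \<Longrightarrow> f (z \<otimes>\<^bsub>A\<^esub> e) = f z"
        unfolding carrier_Fo_Go[OF N] by blast
      have fe: "f e \<in> carrier N" by (rule HmD(1)[OF f(1) eA_closed(2)])
      \<comment> \<open>Evaluation at \<open>e\<close> recovers the map:
        \<open>f z = f (z e)\<close>, and \<open>z e\<close> is \<open>e\<close> multiplied from the
        left by an element of \<open>e A e\<close>, which \<open>B\<close>-linearity moves
        out.\<close>
      have "?a (f e) = f"
      proof (rule Hm_eqI[OF ac[OF fe] f(1)])
        fix z assume z: "z \<in> eA"
        have "psi' (z \<otimes>\<^bsub>A\<^esub> e) \<odot>\<^bsub>N\<^esub> f e = f (\<phi> (psi' (z \<otimes>\<^bsub>A\<^esub> e)) \<otimes>\<^bsub>A\<^esub> e)"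
          by (rule HmD(3)[OF f(1) psi'_closed[OF z] eA_closed(2), symmetric])
        also have "\<dots> = f (z \<otimes>\<^bsub>A\<^esub> e)"
          using phi_psi'[OF z] eA_carrier[OF z] e_carrier by (simp add: A.m_assoc e_idem)
        finally show "?a (f e) z = f z" using z f(3) by simp
      qed
      then have "u = unit_B N (f e)" using fe f(2) by (simp add: unit_B_def)
      then show "u \<in> unit_B N ` carrier N" using fe by (rule image_eqI)
    qed
  qed
next
  fix N P :: "('b, 'u::infinite) module" and g
  assume "left_module B N \<and> left_module B P \<and> g \<in> module_hom B N P"
  then have N: "left_module B N" and P: "left_module B P" and g: "g \<in> module_hom B N P" by auto
  interpret N: left_module B N by (rule N)
  note gD = module_homD[OF g]
  show "compose (carrier N) (unit_B P) g =
      compose (carrier N) (Fm (Go N) (Go P) (Gm N P g)) (unit_B N)"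
    unfolding compose_def
  proof (rule restrict_ext)
    fix m assume m: "m \<in> carrier N"
    let ?a = "\<lambda>z\<in>eA. psi' (z \<otimes>\<^bsub>A\<^esub> e) \<odot>\<^bsub>N\<^esub> m"
    have "?a (z \<otimes>\<^bsub>A\<^esub> e) = ?a z" if "z \<in> eA" for z
      using that e_carrier by (simp add: eA_closed A.m_assoc eA_carrier e_idem)
    then have car: "cd N ?a \<in> carrier (Fo (Go N))"
      unfolding carrier_Fo_Go[OF N] using act_Hm[OF N m] by auto
    have "(\<lambda>z\<in>eA. g (?a z)) = (\<lambda>z\<in>eA. psi' (z \<otimes>\<^bsub>A\<^esub> e) \<odot>\<^bsub>P\<^esub> g m)"
      by (rule restrict_ext) (simp add: m psi'_closed gD(3))
    then show "unit_B P (g m) = Fm (Go N) (Go P) (Gm N P g) (unit_B N m)"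
      using m gD(1)[OF m] car
      by (simp add: unit_B_def Fm_def Gm_cd[OF N act_Hm[OF N m]] del: Fo_simps)
  qed
qed

theorem morita_equivalent_corner: "morita_equivalent TYPE('u::infinite) R A B"
  unfolding morita_equivalent_def
  using A B linear_functor_F linear_functor_G natural_A natural_B by blast

end

section \<open>The corner of the order and the final statement\<close>

lemma image_corner:
  assumes mult: "\<And>x y. x \<in> Lambda_carrier \<Longrightarrow> y \<in> Lambda_carrier \<Longrightarrow> h (x * y) = h x \<otimes>\<^bsub>A\<^esub> h y"
    and surj: "h ` Lambda_carrier = carrier A"
  shows "h ` corner = {h eps \<otimes>\<^bsub>A\<^esub> a \<otimes>\<^bsub>A\<^esub> h eps | a. a \<in> carrier A}"
proof (intro equalityI subsetI)
  fix y assume "y \<in> h ` corner"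
  then obtain x where x: "x \<in> Lambda_carrier" "eps * x = x" "x * eps = x" "y = h x"
    by (auto simp: corner_def)
  have "y = h eps \<otimes>\<^bsub>A\<^esub> h x \<otimes>\<^bsub>A\<^esub> h eps"
    using mult[OF eps_Lambda x(1)] mult[OF x(1) eps_Lambda] by (simp add: x)
  moreover have "h x \<in> carrier A" unfolding surj[symmetric] using x(1) by (rule imageI)
  ultimately show "y \<in> {h eps \<otimes>\<^bsub>A\<^esub> a \<otimes>\<^bsub>A\<^esub> h eps | a. a \<in> carrier A}"
    by (intro CollectI exI[of _ "h x"] conjI)
next
  fix y assume "y \<in> {h eps \<otimes>\<^bsub>A\<^esub> a \<otimes>\<^bsub>A\<^esub> h eps | a. a \<in> carrier A}"
  then obtain a where a: "y = h eps \<otimes>\<^bsub>A\<^esub> a \<otimes>\<^bsub>A\<^esub> h eps" "a \<in> h ` Lambda_carrier"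
    unfolding surj by blast
  from a(2) obtain x where "x \<in> Lambda_carrier" "a = h x" by blast
  with a(1) have x: "x \<in> Lambda_carrier" "y = h eps \<otimes>\<^bsub>A\<^esub> h x \<otimes>\<^bsub>A\<^esub> h eps" by simp_all
  have ex: "eps * x \<in> Lambda_carrier" using Lambda_closed(2)[OF eps_Lambda x(1)] .
  have "y = h (eps * x * eps)"
    using mult[OF eps_Lambda x(1)] mult[OF ex eps_Lambda] by (simp add: x)
  moreover have "eps * x * eps \<in> corner"
    using Lambda_closed(2)[OF ex eps_Lambda] eps_idem
    by (simp add: corner_def mult.assoc) (simp add: mult.assoc[symmetric])
  ultimately show "y \<in> h ` corner" by simp
qed

text \<open>Since \<open>eps\<close> contains one of the three diagonal matrix units of the first block, it is full.\<close>

definition row_unit :: "nat \<Rightarrow> arr" where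
  "row_unit i = (if i = 0 then eps else Arr (axis (of_nat i) (axis 3 1)) 0 0 0 0 0 0 (Loc 0 0 0))"

definition col_unit :: "nat \<Rightarrow> arr" where
  "col_unit i = (if i = 0 then eps else Arr (axis 3 (axis (of_nat i) 1)) 0 0 0 0 0 0 (Loc 0 0 0))"

lemma units_Lambda: "row_unit i \<in> Lambda_carrier" "col_unit i \<in> Lambda_carrier"
  using eps_Lambda by (auto simp: row_unit_def col_unit_def mem_Lambda axis_def)

text \<open>With matrix units \<open>E\<close> of the first block,
  \<open>E\<^sub>1\<^sub>3 eps E\<^sub>3\<^sub>1 = E\<^sub>1\<^sub>1\<close> and
  \<open>E\<^sub>2\<^sub>3 eps E\<^sub>3\<^sub>2 = E\<^sub>2\<^sub>2\<close>, which are the parts of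
  1 that \<open>eps\<close> lacks.\<close>

lemma sum_units:
  "row_unit 0 * eps * col_unit 0 + (row_unit 1 * eps * col_unit 1 + row_unit 2 * eps * col_unit 2) = 1"
  unfolding arr_eq_iff forall_3
  by (simp add: row_unit_def col_unit_def arr_mult_entry sum_3 axis_def mat_def)

text \<open>The restriction of \<open>h\<close> identifies the corner with the corner of
  \<open>A\<close> at \<open>h eps\<close>, and the image of \<open>sum_units\<close> under
  \<open>h\<close> witnesses that this idempotent is full.\<close>

lemma morita_equivalent_Lambda':
  assumes h: "algebra_iso Z2 Lambda A h"
  shows "morita_equivalent TYPE('u::infinite) Z2 A Lambda'"
proof -
  have A: "assoc_algebra Z2 A" and iso: "h \<in> ring_iso Lambda A"
    and smult: "\<And>r x. r \<in> carrier Z2 \<Longrightarrow> x \<in> Lambda_carrier \<Longrightarrow> h (arr_smult r x) = r \<odot>\<^bsub>A\<^esub> h x"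
    using h by (simp_all add: algebra_iso_def)
  interpret A: assoc_algebra Z2 A by (rule A)
  have hom: "h \<in> ring_hom Lambda A" and bij: "bij_betw h Lambda_carrier (carrier A)"
    using iso by (simp_all add: ring_iso_def)
  note closed = ring_hom_closed[OF hom, simplified] and add = ring_hom_add[OF hom, simplified]
    and mult = ring_hom_mult[OF hom, simplified] and one = ring_hom_one[OF hom, simplified]
  have sub: "x \<in> Lambda_carrier" if "x \<in> corner" for x using that by (simp add: corner_def)
  have img: "h ` corner = {h eps \<otimes>\<^bsub>A\<^esub> a \<otimes>\<^bsub>A\<^esub> h eps | a. a \<in> carrier A}"
    by (rule image_corner) (use mult bij in \<open>auto simp: bij_betw_def\<close>)
  have inj: "inj_on h corner"
    by (rule inj_on_subset[of h Lambda_carrier]) (use bij sub in \<open>auto simp: bij_betw_def\<close>)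
  note cl = Lambda_closed(1,2) units_Lambda eps_Lambda
  have t: "h (row_unit i) \<otimes>\<^bsub>A\<^esub> h eps \<otimes>\<^bsub>A\<^esub> h (col_unit i) = h (row_unit i * eps * col_unit i)" for i
    by (simp add: mult cl)
  have t_closed: "row_unit i * eps * col_unit i \<in> Lambda_carrier" for i
    by (simp add: cl)
  have set3: "{..<3::nat} = {0, 1, 2}" by auto
  have "(\<Oplus>\<^bsub>A\<^esub>i\<in>{..<3}. h (row_unit i) \<otimes>\<^bsub>A\<^esub> h eps \<otimes>\<^bsub>A\<^esub> h (col_unit i)) =
      h (row_unit 0 * eps * col_unit 0 + (row_unit 1 * eps * col_unit 1 + row_unit 2 * eps * col_unit 2))"
    unfolding t set3 using t_closed by (simp add: A.finsum_insert closed add cl(1))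
  then have full: "(\<Oplus>\<^bsub>A\<^esub>i\<in>{..<3}. h (row_unit i) \<otimes>\<^bsub>A\<^esub> h eps \<otimes>\<^bsub>A\<^esub> h (col_unit i)) = \<one>\<^bsub>A\<^esub>"
    unfolding sum_units one .
  show ?thesis
    by (rule full_corner.morita_equivalent_corner[OF full_corner.intro[OF A Lambda'_algebra, where \<phi> = h
          and e = "h eps" and xs = "\<lambda>i. h (row_unit i)" and ys = "\<lambda>i. h (col_unit i)" and n = 3]])
       (simp_all add: add mult smult sub inj img closed cl full)
qed

theorem proposition11:
  shows "(\<exists>h. algebra_iso Z2 Lambda' (quot_algebra RPsi Psi_ideal) h \<and>
             h e3 = Psi_ideal +>\<^bsub>RPsi\<^esub> vert E3 \<and>
             h e4 = Psi_ideal +>\<^bsub>RPsi\<^esub> vert E4 \<and>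
             h e5 = Psi_ideal +>\<^bsub>RPsi\<^esub> vert E5 \<and>
             h tau1 = Psi_ideal +>\<^bsub>RPsi\<^esub> arrw T1 \<and>
             h tau2 = Psi_ideal +>\<^bsub>RPsi\<^esub> arrw T2 \<and>
             h tau3 = Psi_ideal +>\<^bsub>RPsi\<^esub> arrw T3 \<and>
             h tau4 = Psi_ideal +>\<^bsub>RPsi\<^esub> arrw T4 \<and>
             h tau7 = Psi_ideal +>\<^bsub>RPsi\<^esub> arrw T7) \<and>
         morita_equivalent TYPE('u::infinite) Z2 (double_burnside Z2 (sym_group 3)) Lambda'"
proof
  obtain h where iso: "algebra_iso Z2 Lambda' (quot_algebra RPsi Psi_ideal) h"
    and h: "\<forall>x\<in>carrier RPsi. h (theta x) = Psi_ideal +>\<^bsub>RPsi\<^esub> x"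
    using Lambda'_iso_path_quotient by blast
  have v: "h (vimg v) = Psi_ideal +>\<^bsub>RPsi\<^esub> vert v" for v
  proof -
    have "vert v \<in> carrier RPsi" unfolding vertex_elt_def RPsi_eq by (rule basis_path) simp
    from bspec[OF h this] show ?thesis by (simp add: vertex_elt_def)
  qed
  have a: "h (aimg a) = Psi_ideal +>\<^bsub>RPsi\<^esub> arrw a" for a
  proof -
    have "arrw a \<in> carrier RPsi" unfolding arrw_eq RPsi_eq by (rule basis_path) simp
    \<comment> \<open>The image of a path with one arrow carries the idempotent of its target as a
      last factor, which is absorbed.\<close>
    from bspec[OF h this] show ?thesis by (simp add: arrw_eq vimg_aimg)
  qed
  show "\<exists>h. algebra_iso Z2 Lambda' (quot_algebra RPsi Psi_ideal) h \<and>
             h e3 = Psi_ideal +>\<^bsub>RPsi\<^esub> vert E3 \<and>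
             h e4 = Psi_ideal +>\<^bsub>RPsi\<^esub> vert E4 \<and>
             h e5 = Psi_ideal +>\<^bsub>RPsi\<^esub> vert E5 \<and>
             h tau1 = Psi_ideal +>\<^bsub>RPsi\<^esub> arrw T1 \<and>
             h tau2 = Psi_ideal +>\<^bsub>RPsi\<^esub> arrw T2 \<and>
             h tau3 = Psi_ideal +>\<^bsub>RPsi\<^esub> arrw T3 \<and>
             h tau4 = Psi_ideal +>\<^bsub>RPsi\<^esub> arrw T4 \<and>
             h tau7 = Psi_ideal +>\<^bsub>RPsi\<^esub> arrw T7"
    using iso v[of E3] v[of E4] v[of E5] a[of T1] a[of T2] a[of T3] a[of T4] a[of T7]
    by (intro exI[of _ h]) simp
  show "morita_equivalent TYPE('u::infinite) Z2 (double_burnside Z2 (sym_group 3)) Lambda'"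
    using double_burnside_S3_iso morita_equivalent_Lambda' by blast
qed

end
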